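(* Let $p$ be a prime, let $R$ be a $p$-adic ring, and let $G$ be a finite group having a normal $p$-subgroup $N$ that contains its centralizer, i.e. $\mathrm{C}_G(N)\leq N$. Let $\mathrm{V}(RG)$ denote the group of units of augmentation one in the group ring $RG$. Then each central unit of finite $p$-power order in $\mathrm{V}(RG)$ is a trivial unit, i.e. is contained in the center $\mathrm{Z}(G)$ of $G$.
   Context: A $p$-adic ring is the integral closure of the $p$-adic integers $\mathbb{Z}_p$ in a finite extension field of $\mathbb{Q}_p$. The augmentation is the ring homomorphism $RG\to R$ sending each $g\in G$ to $1$. $G$ is regarded as a subgroup of $\mathrm{V}(RG)$; a unit $u\in \mathrm{V}(RG)$ is called trivial if $u\in G$. *)

theory Defs
  imports Complex_Main "HOL-Computational_Algebra.Primes"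
    "HOL-Algebra.Finite_Extensions" "HOL-Algebra.Multiplicative_Group"
begin

section \<open>The field of p-adic numbers and p-adic rings\<close>

definition padic_abs :: "nat \<Rightarrow> rat \<Rightarrow> real" where
  "padic_abs p x = (if x = 0 then 0 else (case quotient_of x of (a, b) \<Rightarrow>
     real p powi (int (multiplicity (int p) b) - int (multiplicity (int p) a))))"

definition padic_Cauchy :: "nat \<Rightarrow> (nat \<Rightarrow> rat) \<Rightarrow> bool" where
  "padic_Cauchy p s \<longleftrightarrow>
     (\<forall>e>0. \<exists>M. \<forall>m\<ge>M. \<forall>n\<ge>M. padic_abs p (s m - s n) < e)"

definition padic_Cauchy_ring :: "nat \<Rightarrow> (nat \<Rightarrow> rat) ring" where
  "padic_Cauchy_ring p =
     \<lparr>carrier = {s. padic_Cauchy p s},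
      mult = (\<lambda>s t n. s n * t n),
      one = (\<lambda>n. 1),
      zero = (\<lambda>n. 0),
      add = (\<lambda>s t n. s n + t n)\<rparr>"

definition padic_null :: "nat \<Rightarrow> (nat \<Rightarrow> rat) set" where
  "padic_null p = {s. (\<lambda>n. padic_abs p (s n)) \<longlonglongrightarrow> 0}"

text \<open>The field of p-adic numbers, as the completion of the rationals with respect to
  the p-adic absolute value, and its closed unit ball, the ring of p-adic integers.  An element of
  the unit ball is represented by some sequence all of whose terms have absolute value at
  most 1, since the absolute values along a Cauchy sequence that is not null are eventually
  constant.\<close>

definition padic_field :: "nat \<Rightarrow> (nat \<Rightarrow> rat) set ring" where
  "padic_field p = padic_Cauchy_ring p Quot padic_null p"

definition padic_integers :: "nat \<Rightarrow> (nat \<Rightarrow> rat) set set" where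
  "padic_integers p =
     {S \<in> carrier (padic_field p). \<exists>s\<in>S. \<forall>n. padic_abs p (s n) \<le> 1}"

text \<open>The condition \<open>f \<noteq> []\<close> is needed because \<^term>\<open>hd []\<close> is unspecified.\<close>

definition integral_closure :: "('a, 'b) ring_scheme \<Rightarrow> 'a set \<Rightarrow> 'a set" where
  "integral_closure K A =
     {x \<in> carrier K. \<exists>f \<in> carrier (A[X]\<^bsub>K\<^esub>).
        f \<noteq> [] \<and> hd f = \<one>\<^bsub>K\<^esub> \<and> ring.eval K f x = \<zero>\<^bsub>K\<^esub>}"

text \<open>A finite extension field of the p-adic numbers is a field \<open>K\<close> together with a
  (necessarily injective) homomorphism \<open>h\<close> into \<open>K\<close> over whose image \<open>K\<close> has finite dimension.\<close>

definition p_adic_ring :: "nat \<Rightarrow> 'a ring \<Rightarrow> bool" where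
  "p_adic_ring p R \<longleftrightarrow>
     (\<exists>(K :: 'a ring) h.
        field K \<and>
        h \<in> ring_hom (padic_field p) K \<and>
        ring.finite_dimension K (h ` carrier (padic_field p)) (carrier K) \<and>
        R = K\<lparr>carrier := integral_closure K (h ` padic_integers p)\<rparr>)"


section \<open>Group rings of finite groups\<close>

definition group_ring_of ::
    "('r, 'a) ring_scheme \<Rightarrow> ('g, 'b) monoid_scheme \<Rightarrow> 'g \<Rightarrow> 'g \<Rightarrow> 'r" where
  "group_ring_of R G g = (\<lambda>x\<in>carrier G. if x = g then \<one>\<^bsub>R\<^esub> else \<zero>\<^bsub>R\<^esub>)"

text \<open>The elements are all functions from the group to the coefficient ring, so this is the
  group ring only for a finite group.\<close>

definition group_ring ::
    "('r, 'a) ring_scheme \<Rightarrow> ('g, 'b) monoid_scheme \<Rightarrow> ('g \<Rightarrow> 'r) ring" where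
  "group_ring R G =
     \<lparr>carrier = carrier G \<rightarrow>\<^sub>E carrier R,
      mult = (\<lambda>a b. \<lambda>x\<in>carrier G.
        \<Oplus>\<^bsub>R\<^esub>y\<in>carrier G. a y \<otimes>\<^bsub>R\<^esub> b (inv\<^bsub>G\<^esub> y \<otimes>\<^bsub>G\<^esub> x)),
      one = group_ring_of R G \<one>\<^bsub>G\<^esub>,
      zero = (\<lambda>x\<in>carrier G. \<zero>\<^bsub>R\<^esub>),
      add = (\<lambda>a b. \<lambda>x\<in>carrier G. a x \<oplus>\<^bsub>R\<^esub> b x)\<rparr>"

text \<open>The \<open>R\<close>-linear ring homomorphism that sends every group element to \<open>\<one>\<close>.\<close>

definition augmentation ::
    "('r, 'a) ring_scheme \<Rightarrow> ('g, 'b) monoid_scheme \<Rightarrow> ('g \<Rightarrow> 'r) \<Rightarrow> 'r" where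
  "augmentation R G a = (\<Oplus>\<^bsub>R\<^esub>x\<in>carrier G. a x)"

definition normalized_units ::
    "('r, 'a) ring_scheme \<Rightarrow> ('g, 'b) monoid_scheme \<Rightarrow> ('g \<Rightarrow> 'r) monoid" where
  "normalized_units R G =
     (units_of (group_ring R G))
       \<lparr>carrier := {u \<in> Units (group_ring R G). augmentation R G u = \<one>\<^bsub>R\<^esub>}\<rparr>"


section \<open>Centralizers\<close>

definition centralizer :: "('g, 'b) monoid_scheme \<Rightarrow> 'g set \<Rightarrow> 'g set" where
  "centralizer G S = {x \<in> carrier G. \<forall>s\<in>S. x \<otimes>\<^bsub>G\<^esub> s = s \<otimes>\<^bsub>G\<^esub> x}"

definition center :: "('g, 'b) monoid_scheme \<Rightarrow> 'g set" where
  "center G = centralizer G (carrier G)"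

end

theory Submission
  imports Defs "HOL-Library.Function_Algebras"
begin

text \<open>
  The field \<open>K\<close> embeds into a commutative ring in the sense of type classes, and Zorn's lemma provides a
  valuation ring \<open>A\<close> of \<open>K\<close> that contains \<open>R\<close> but not \<open>1/p\<close>. A central unit \<open>u\<close> becomes an \<open>A\<close>-valued
  class function on \<open>G\<close>. By induction on its order, \<open>u\<^sup>p\<close> is an element \<open>n'\<close> of \<open>N\<close>. For a normal
  subgroup \<open>H\<close> of \<open>N\<close>, the function \<open>u \<star> ind H\<close> is the image of \<open>u\<close> modulo left translation by \<open>H\<close>; it is
  shown to be the image of an element of \<open>N\<close>, by descent along a central series from \<open>H = N\<close> to \<open>H = 1\<close>.

  For \<open>H = N\<close> the claim is \<open>u \<star> ind N = ind N\<close>. As \<open>N\<close> contains its centralizer, all \<open>N\<close>-classes outside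
  \<open>N\<close> have cardinality divisible by \<open>p\<close>, so \<open>u \<star> ind N - ind N\<close> is divisible by \<open>p\<close>. Expanding
  the \<open>p\<close>-th power of \<open>ind N\<close> plus this difference shows that it is zero if \<open>p\<close> is odd, and minus twice
  an idempotent class function of \<open>G/N\<close> if \<open>p = 2\<close>; counting square roots excludes a nonzero idempotent.

  For the step from \<open>M = \<langle>H, m\<rangle>\<close> to \<open>H\<close>, let \<open>v\<close> be \<open>u\<close> divided by the element of \<open>N\<close> that represents \<open>u\<close>
  modulo \<open>M\<close>. On the left \<open>H\<close>-invariant functions whose sums over the \<open>M\<close>-cosets vanish, \<open>v\<close> has order
  dividing \<open>p\<close> and decomposes the space into eigenspaces for the powers of \<open>m\<close>. Reducing an
  eigenvector that is fixed by \<open>N\<close> modulo the maximal ideal shows that only one power of \<open>m\<close> occurs, so \<open>v\<close>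
  acts as this power and \<open>u\<close> is an element of \<open>N\<close> modulo \<open>H\<close>.
\<close>

section \<open>Valuation rings containing the p-adic integers\<close>

text \<open>On an eigenvector \<open>x\<close> that \<open>N\<close> fixes modulo the maximal ideal,
  every power of \<open>m\<close> reduces to the identity, so the reduction of
  \<open>v x = m^i x\<close> does not see \<open>i\<close>. The exponent shows one level deeper.
  Writing \<open>x = (m - 1) z\<close> gives \<open>(v - 1) z = (1 + m + ... + m^(i-1)) x\<close>,
  which is congruent to \<open>i x\<close>. A correction \<open>s\<close> makes \<open>z + s\<close>
  invariant under \<open>M\<close> modulo the maximal ideal, where \<open>v\<close> acts trivially;
  hence \<open>i x\<close> is congruent to \<open>- (v - 1) s\<close>, and counting
  \<open>N\<close>-orbits of \<open>M\<close>-cosets turns this into \<open>c x\<close> with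
  \<open>c\<close> independent of \<open>x\<close>. The powers of \<open>m\<close> take the place of
  \<open>p\<close>-th roots of unity, which the coefficients may not contain. The ring
  \<open>A\<close> is chosen because among finitely many of its elements one divides all the others:
  the content of a function can be split off without a uniformizer. At the top of the series the
  linear terms of the expansion carry the factor \<open>0 + 1 + ... + (p - 1)\<close>, a multiple of
  \<open>p\<close> only for odd \<open>p\<close>. This is what singles out
  \<open>p = 2\<close>.\<close>

locale unital_field_set =
  fixes F :: "'k :: comm_ring_1 set" and e :: 'k
  assumes F_zero: "0 \<in> F"
    and F_unit: "e \<in> F" "e \<noteq> 0"
    and F_add: "x \<in> F \<Longrightarrow> y \<in> F \<Longrightarrow> x + y \<in> F"
    and F_mult: "x \<in> F \<Longrightarrow> y \<in> F \<Longrightarrow> x * y \<in> F"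
    and F_uminus: "x \<in> F \<Longrightarrow> - x \<in> F"
    and F_unit_mult: "x \<in> F \<Longrightarrow> e * x = x"
    and F_inverse: "x \<in> F \<Longrightarrow> x \<noteq> 0 \<Longrightarrow> \<exists>y\<in>F. x * y = e"
begin

text \<open>Subrings share the unit \<open>e\<close> of the field and not the \<open>1\<close> of
  the ambient ring: in the application the ambient ring is a product that has the field as one
  factor.\<close>

definition is_subring :: "'k set \<Rightarrow> bool" where
  "is_subring B \<longleftrightarrow> B \<subseteq> F \<and> 0 \<in> B \<and> e \<in> B \<and> (\<forall>x\<in>B. - x \<in> B) \<and>
     (\<forall>x\<in>B. \<forall>y\<in>B. x + y \<in> B \<and> x * y \<in> B)"

lemma is_subringD:
  assumes "is_subring B"
  shows "B \<subseteq> F" "0 \<in> B" "e \<in> B" "\<And>x. x \<in> B \<Longrightarrow> - x \<in> B"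
    "\<And>x y. x \<in> B \<Longrightarrow> y \<in> B \<Longrightarrow> x + y \<in> B" "\<And>x y. x \<in> B \<Longrightarrow> y \<in> B \<Longrightarrow> x * y \<in> B"
  using assms unfolding is_subring_def by blast+

lemma F_diff: "x \<in> F \<Longrightarrow> y \<in> F \<Longrightarrow> x - y \<in> F"
  using F_add[of x "- y"] F_uminus[of y] by simp

lemma F_mult_unit: "x \<in> F \<Longrightarrow> x * e = x"
  using F_unit_mult[of x] by (simp add: mult.commute)

lemma F_no_zero_divisors:
  assumes "x \<in> F" "y \<in> F" "x * y = 0"
  shows "x = 0 \<or> y = 0"
proof (rule disjCI)
  assume "y \<noteq> 0"
  then obtain z where "z \<in> F" "y * z = e" using F_inverse assms(2) by blast
  have "x = x * (y * z)" using \<open>y * z = e\<close> F_mult_unit assms(1) by simp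
  also have "\<dots> = (x * y) * z" by (simp add: mult.assoc)
  finally show "x = 0" using assms(3) by simp
qed

lemma F_mult_cancel:
  assumes "x \<in> F" "y \<in> F" "z \<in> F" "x \<noteq> 0" "x * y = x * z"
  shows "y = z"
proof -
  have "x * (y - z) = 0" using assms(5) by (simp add: right_diff_distrib)
  then show ?thesis using F_no_zero_divisors[of x "y - z"] F_diff assms by auto
qed

end

lemma sum_in_set:
  fixes f :: "'i \<Rightarrow> 'b :: comm_monoid_add"
  assumes "0 \<in> S" "\<And>x y. x \<in> S \<Longrightarrow> y \<in> S \<Longrightarrow> x + y \<in> S" "\<And>i. i \<in> I \<Longrightarrow> f i \<in> S"
  shows "sum f I \<in> S"
  using assms(3) by (induction I rule: infinite_finite_induct) (auto intro: assms(1,2))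

text \<open>\<open>p_nonunit\<close> places \<open>p\<close> in the maximal ideal, so the residue
  field has characteristic \<open>p\<close>; \<open>p_nonzero\<close> makes multiplication by
  \<open>p\<close> injective on \<open>F\<close>. The valuation property is phrased with inverse
  pairs, without a value group.\<close>

locale padic_valuation_ring = unital_field_set F e for F :: "'k :: comm_ring_1 set" and e :: 'k +
  fixes A :: "'k set" and p :: nat
  assumes A_subring: "is_subring A"
    and A_valuation: "x \<in> F \<Longrightarrow> y \<in> F \<Longrightarrow> x * y = e \<Longrightarrow> x \<in> A \<or> y \<in> A"
    and prime_p: "Factorial_Ring.prime p"
    and p_nonunit: "a \<in> A \<Longrightarrow> of_nat p * a \<noteq> e"
    and p_nonzero: "of_nat p * e \<noteq> 0"
begin

lemmas A_F = is_subringD(1)[OF A_subring, THEN subsetD]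
  and A_zero = is_subringD(2)[OF A_subring]
  and A_unit = is_subringD(3)[OF A_subring]
  and A_uminus = is_subringD(4)[OF A_subring]
  and A_add = is_subringD(5)[OF A_subring]
  and A_mult = is_subringD(6)[OF A_subring]

lemma A_diff: "x \<in> A \<Longrightarrow> y \<in> A \<Longrightarrow> x - y \<in> A"
  using A_add[of x "- y"] A_uminus[of y] by simp

lemma A_sum: "(\<And>i. i \<in> I \<Longrightarrow> f i \<in> A) \<Longrightarrow> sum f I \<in> A"
  by (rule sum_in_set[OF A_zero A_add])

lemma F_sum: "(\<And>i. i \<in> I \<Longrightarrow> f i \<in> F) \<Longrightarrow> sum f I \<in> F"
  by (rule sum_in_set[OF F_zero F_add])

lemma A_of_nat_mult: "x \<in> A \<Longrightarrow> of_nat n * x \<in> A"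
  by (induction n) (auto simp: A_zero A_add distrib_right)

lemma F_of_nat_mult: "x \<in> F \<Longrightarrow> of_nat n * x \<in> F"
  by (induction n) (auto simp: F_zero F_add distrib_right)

lemma A_of_int_mult: "x \<in> A \<Longrightarrow> of_int i * x \<in> A"
  by (cases i rule: int_cases2) (auto simp: A_of_nat_mult A_uminus)

lemma p_cancel_zero:
  assumes "x \<in> F" "of_nat p * x = 0"
  shows "x = 0"
proof -
  have "(of_nat p * e) * x = 0" using assms F_unit_mult[of x] by (simp add: mult.assoc)
  then show ?thesis using F_no_zero_divisors[of "of_nat p * e" x] p_nonzero assms(1)
      F_of_nat_mult[OF F_unit(1)] by blast
qed

lemma p_cancel:
  assumes "x \<in> F" "y \<in> F" "of_nat p * x = of_nat p * y"
  shows "x = y"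
  using p_cancel_zero[of "x - y"] F_diff assms by (auto simp: right_diff_distrib)

section \<open>The maximal ideal and the residue characteristic\<close>

definition nonunits :: "'k set" where
  "nonunits = {a \<in> A. \<forall>b\<in>A. a * b \<noteq> e}"

lemma nonunits_A: "a \<in> nonunits \<Longrightarrow> a \<in> A"
  by (simp add: nonunits_def)

lemma nonunits_zero: "0 \<in> nonunits"
  using A_zero F_unit(2) by (auto simp: nonunits_def)

lemma nonunits_mult: "a \<in> nonunits \<Longrightarrow> b \<in> A \<Longrightarrow> a * b \<in> nonunits"
  unfolding nonunits_def using A_mult by (auto simp: mult.assoc)

lemma nonunits_mult2: "a \<in> nonunits \<Longrightarrow> b \<in> A \<Longrightarrow> b * a \<in> nonunits"
  using nonunits_mult by (simp add: mult.commute)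

lemma unit_notin_nonunits: "e \<notin> nonunits"
  using A_unit F_unit_mult[OF F_unit(1)] by (auto simp: nonunits_def)

text \<open>One of the quotients of \<open>x\<close> and \<open>y\<close> lies in \<open>A\<close>,
  so divisibility by elements of \<open>A\<close> is a total preorder on \<open>F\<close>.\<close>

lemma A_comparable:
  assumes "x \<in> F" "y \<in> F"
  shows "(\<exists>a\<in>A. x = y * a) \<or> (\<exists>a\<in>A. y = x * a)"
proof (cases "x = 0 \<or> y = 0")
  case True
  then show ?thesis by (intro disj_forward[OF True] bexI[OF _ A_zero]) simp_all
next
  case False
  then obtain x' y' where i: "x' \<in> F" "x * x' = e" "y' \<in> F" "y * y' = e"
    using F_inverse assms by meson
  have "(x * y') * (y * x') = (x * x') * (y * y')" by (simp add: ac_simps)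
  also have "\<dots> = e" using i F_unit_mult[OF F_unit(1)] by simp
  finally have "x * y' \<in> A \<or> y * x' \<in> A"
    using A_valuation F_mult assms i by blast
  moreover have "x = y * (x * y')"
  proof -
    have "y * (x * y') = (y * y') * x" by (simp add: ac_simps)
    then show ?thesis using i F_unit_mult assms by simp
  qed
  moreover have "y = x * (y * x')"
  proof -
    have "x * (y * x') = (x * x') * y" by (simp add: ac_simps)
    then show ?thesis using i F_unit_mult assms by simp
  qed
  ultimately show ?thesis by blast
qed

text \<open>Of two elements one divides the other, so the sum is a multiple of a nonunit. This shows
  that \<open>A\<close> is local.\<close>

lemma nonunits_add:
  assumes "a \<in> nonunits" "b \<in> nonunits"
  shows "a + b \<in> nonunits"
proof -
  have F: "a \<in> F" "b \<in> F" using assms nonunits_A A_F by blast+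
  consider c where "c \<in> A" "a = b * c" | c where "c \<in> A" "b = a * c"
    using A_comparable[OF F] by blast
  then show ?thesis
  proof cases
    case 1
    then have "a + b = b * (c + e)" using F_mult_unit F by (simp add: distrib_left)
    then show ?thesis using nonunits_mult assms A_add A_unit 1 by simp
  next
    case 2
    then have "a + b = a * (e + c)" using F_mult_unit F by (simp add: distrib_left)
    then show ?thesis using nonunits_mult assms A_add A_unit 2 by simp
  qed
qed

lemma nonunits_uminus: "a \<in> nonunits \<Longrightarrow> - a \<in> nonunits"
  using nonunits_mult[of a "- e"] A_uminus A_unit F_mult_unit nonunits_A A_F by simp

lemma nonunits_diff: "a \<in> nonunits \<Longrightarrow> b \<in> nonunits \<Longrightarrow> a - b \<in> nonunits"
  using nonunits_add[of a "- b"] nonunits_uminus by simp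

lemma nonunits_sum: "(\<And>i. i \<in> I \<Longrightarrow> f i \<in> nonunits) \<Longrightarrow> sum f I \<in> nonunits"
  by (rule sum_in_set[OF nonunits_zero nonunits_add])

lemma p_mult_nonunit: "a \<in> A \<Longrightarrow> of_nat p * a \<in> nonunits"
  using A_of_nat_mult p_nonunit A_mult by (auto simp: nonunits_def mult.assoc)

lemma unit_inverse: "a \<in> A \<Longrightarrow> a \<notin> nonunits \<Longrightarrow> \<exists>b\<in>A. a * b = e"
  by (auto simp: nonunits_def)

lemma nonunits_prime:
  assumes "a * b \<in> nonunits" "a \<in> A" "b \<in> A"
  shows "a \<in> nonunits \<or> b \<in> nonunits"
proof (rule disjCI)
  assume "b \<notin> nonunits"
  then obtain c where c: "c \<in> A" "b * c = e" using unit_inverse assms by blast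
  have "a = a * b * c" using c F_mult_unit A_F assms by (simp add: mult.assoc)
  then show "a \<in> nonunits" using nonunits_mult assms c by metis
qed

text \<open>For \<open>i\<close> prime to \<open>p\<close> a Bezout identity would put
  \<open>e\<close> into the ideal of nonunits. Hence integers can be compared modulo
  \<open>p\<close> in the residue field.\<close>

lemma of_int_unit_nonunit:
  assumes "of_int i * e \<in> nonunits"
  shows "int p dvd i"
proof (rule ccontr)
  assume "\<not> int p dvd i"
  then have "coprime (int p) i"
    using prime_p by (simp add: prime_imp_coprime)
  then obtain x y where "x * int p + y * i = 1"
    by (metis bezout_int coprime_iff_gcd_eq_1)
  then have "e = of_int (x * int p + y * i) * e"
    by (metis of_int_1 mult_1)
  also have "\<dots> = of_nat p * (of_int x * e) + (of_int y * e) * (of_int i * e)"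
  proof -
    have "(of_int y * e) * (of_int i * e) = of_int y * of_int i * (e * e)" by (simp only: ac_simps)
    then show ?thesis using F_unit_mult[OF F_unit(1)] by (simp add: distrib_left distrib_right ac_simps)
  qed
  also have "\<dots> \<in> nonunits"
    by (intro nonunits_add p_mult_nonunit nonunits_mult2 A_of_int_mult A_unit assms)
  finally have "e \<in> nonunits" .
  then show False using unit_notin_nonunits by simp
qed

lemma of_nat_unit_nonunit:
  assumes "of_nat i * e \<in> nonunits"
  shows "p dvd i"
  using of_int_unit_nonunit[of "int i"] assms by simp

text \<open>Total divisibility gives a finite family a member that divides all the others. It serves
  as the content of a function on the finite group.\<close>

lemma primitive_multiple:
  assumes "finite S" "\<And>s. s \<in> S \<Longrightarrow> c s \<in> F" "s1 \<in> S" "c s1 \<noteq> 0"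
  shows "\<exists>s0\<in>S. c s0 \<noteq> 0 \<and> (\<forall>s\<in>S. \<exists>a\<in>A. c s = c s0 * a)"
proof -
  have "T \<subseteq> S \<Longrightarrow> \<exists>s0\<in>T. \<forall>s\<in>T. \<exists>a\<in>A. c s = c s0 * a" if "finite T" "T \<noteq> {}" for T
    using that
  proof (induction T rule: finite_ne_induct)
    case (singleton x)
    then show ?case using A_unit F_mult_unit[of "c x"] assms(2) by (auto intro!: bexI[of _ e])
  next
    case (insert x T)
    then obtain s0 where s0: "s0 \<in> T" "\<forall>s\<in>T. \<exists>a\<in>A. c s = c s0 * a"
      by (metis insert_subset)
    have F: "c x \<in> F" "c s0 \<in> F" using insert s0 assms(2) by auto
    from A_comparable[OF F] show ?case
    proof
      assume "\<exists>a\<in>A. c x = c s0 * a"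
      then show ?case using s0 by blast
    next
      assume "\<exists>a\<in>A. c s0 = c x * a"
      then obtain a where a: "a \<in> A" "c s0 = c x * a" by blast
      have "\<exists>b\<in>A. c s = c x * b" if s_in: "s \<in> insert x T" for s
      proof (cases "s = x")
        case True
        then show ?thesis using A_unit F_mult_unit[OF F(1)] by (auto intro!: bexI[of _ e])
      next
        case False
        then obtain b where "b \<in> A" "c s = c s0 * b" using s0(2) s_in by (metis insertE)
        then have "c s = c x * (a * b)" "a * b \<in> A" using a A_mult by (simp_all only: mult.assoc)
        then show ?thesis by (rule bexI)
      qed
      then show ?case by blast
    qed
  qed
  note * = this[OF assms(1) _ order_refl]
  have "S \<noteq> {}" using assms(3) by auto
  then have "\<exists>s0\<in>S. \<forall>s\<in>S. \<exists>a\<in>A. c s = c s0 * a"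
    by (rule *)
  then obtain s0 where s0: "s0 \<in> S" "\<forall>s\<in>S. \<exists>a\<in>A. c s = c s0 * a" by (rule bexE)
  obtain a where "c s1 = c s0 * a" using bspec[OF s0(2) assms(3)] by (rule bexE)
  then have "c s0 \<noteq> 0" using assms(4) by (metis mult_zero_left)
  then show ?thesis by (intro bexI[OF _ s0(1)] conjI s0(2))
qed

end

section \<open>Sums over orbits of p-groups\<close>

text \<open>The sum over a class is its size times one value, up to differences in \<open>J\<close>.
  With \<open>J\<close> a mere set closed under addition, one statement covers the multiples of
  \<open>p\<close> or \<open>4\<close> and the maximal ideal.\<close>

lemma sum_over_classes:
  fixes \<phi> :: "'x \<Rightarrow> 'a :: comm_ring_1"
  assumes fin: "finite S" and eq: "equiv S r"
    and J0: "0 \<in> J" and Jadd: "\<And>a b. a \<in> J \<Longrightarrow> b \<in> J \<Longrightarrow> a + b \<in> J"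
    and inv: "\<And>x y. (x, y) \<in> r \<Longrightarrow> \<phi> y - \<phi> x \<in> J"
    and mult: "\<And>x. x \<in> S \<Longrightarrow> of_nat (card (Image r {x})) * \<phi> x \<in> J"
  shows "sum \<phi> S \<in> J"
proof -
  have "sum \<phi> S = sum (sum \<phi>) (S // r)"
  proof -
    have "sum \<phi> (\<Union> (S // r)) = (sum \<circ> sum) \<phi> (S // r)"
      using quotient_disj[OF eq] finite_equiv_class[OF fin equiv_type[OF eq]]
      by (intro sum.Union_disjoint) blast+
    then show ?thesis using Union_quotient[OF eq] by simp
  qed
  also have "\<dots> \<in> J"
  proof (rule sum_in_set[OF J0 Jadd])
    fix C assume "C \<in> S // r"
    then obtain x where x: "x \<in> S" "C = Image r {x}" by (auto elim: quotientE)
    have "sum \<phi> C = (\<Sum>y\<in>C. \<phi> y - \<phi> x) + of_nat (card C) * \<phi> x"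
      by (simp add: sum_subtractf)
    also have "\<dots> \<in> J"
      using x mult by (intro Jadd sum_in_set[OF J0 Jadd] inv) auto
    finally show "sum \<phi> C \<in> J" .
  qed
  finally show ?thesis .
qed

text \<open>All fibres of the orbit map are translates of the stabilizer, hence of equal
  size.\<close>

lemma (in group) orbit_card_dvd:
  assumes N: "subgroup N G" "finite N"
    and act_one: "act \<one> x = x"
    and act_mult: "\<And>h k. h \<in> N \<Longrightarrow> k \<in> N \<Longrightarrow> act (h \<otimes> k) x = act h (act k x)"
  shows "card ((\<lambda>h. act h x) ` N) dvd card N"
proof -
  interpret N: subgroup N G by fact
  define stab where "stab = {k \<in> N. act k x = x}"
  have fibre: "card {h \<in> N. act h x = y} = card stab" if y: "y \<in> (\<lambda>h. act h x) ` N" for y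
  proof -
    obtain h0 where h0: "h0 \<in> N" "y = act h0 x" using y by blast
    have "bij_betw (\<lambda>k. h0 \<otimes> k) stab {h \<in> N. act h x = y}"
    proof (rule bij_betwI[where g = "\<lambda>h. inv h0 \<otimes> h"])
      show "(\<lambda>k. h0 \<otimes> k) \<in> stab \<rightarrow> {h \<in> N. act h x = y}"
        using h0 act_mult by (auto simp: stab_def)
      show "(\<lambda>h. inv h0 \<otimes> h) \<in> {h \<in> N. act h x = y} \<rightarrow> stab"
      proof
        fix h assume h: "h \<in> {h \<in> N. act h x = y}"
        have "act (inv h0 \<otimes> h) x = act (inv h0) (act h0 x)"
          using h h0 by (simp add: act_mult)
        also have "\<dots> = act (inv h0 \<otimes> h0) x"
          using h0 act_mult[OF N.m_inv_closed] by metis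
        also have "\<dots> = x" using h0 act_one by simp
        finally show "inv h0 \<otimes> h \<in> stab" using h h0 by (simp add: stab_def)
      qed
    qed (use h0 in \<open>auto simp: stab_def m_assoc[symmetric]\<close>)
    then show ?thesis by (metis bij_betw_same_card)
  qed
  have "card N = (\<Sum>y\<in>(\<lambda>h. act h x) ` N. card {h \<in> N. act h x = y})"
    using sum.image_gen[OF N(2), of "\<lambda>_. 1 :: nat" "\<lambda>h. act h x"] by simp
  also have "\<dots> = card ((\<lambda>h. act h x) ` N) * card stab"
    using fibre by simp
  finally show ?thesis by simp
qed

text \<open>The source of the congruences below: modulo \<open>J\<close> a sum over \<open>S\<close>
  reduces to the sum over the fixed points, since the moved points are a union of orbits to which
  \<open>sum_over_classes\<close> applies.\<close>

lemma (in group) sum_moved_points: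
  fixes \<phi> :: "'x \<Rightarrow> 'r :: comm_ring_1"
  assumes N: "subgroup N G" "finite N"
    and fin: "finite S"
    and act_closed: "\<And>h x. h \<in> N \<Longrightarrow> x \<in> S \<Longrightarrow> act h x \<in> S"
    and act_one: "\<And>x. x \<in> S \<Longrightarrow> act \<one> x = x"
    and act_mult: "\<And>h k x. h \<in> N \<Longrightarrow> k \<in> N \<Longrightarrow> x \<in> S \<Longrightarrow> act (h \<otimes> k) x = act h (act k x)"
    and J0: "0 \<in> J" and Jadd: "\<And>a b. a \<in> J \<Longrightarrow> b \<in> J \<Longrightarrow> a + b \<in> J"
    and act_inv: "\<And>h x. h \<in> N \<Longrightarrow> x \<in> S \<Longrightarrow> \<phi> (act h x) - \<phi> x \<in> J"
    and mult: "\<And>x. x \<in> S \<Longrightarrow> \<exists>h\<in>N. act h x \<noteq> x \<Longrightarrow>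
       of_nat (card ((\<lambda>h. act h x) ` N)) * \<phi> x \<in> J"
  shows "sum \<phi> {x \<in> S. \<exists>h\<in>N. act h x \<noteq> x} \<in> J"
proof -
  interpret N: subgroup N G by fact
  define S' where "S' = {x \<in> S. \<exists>h\<in>N. act h x \<noteq> x}"
  define r where "r = {(x, y). x \<in> S' \<and> (\<exists>h\<in>N. y = act h x)}"
  have act_undo: "act (inv h) (act h x) = x" if "h \<in> N" "x \<in> S" for h x
    using that act_mult[of "inv h" h x] act_one by simp
  have closed: "act h x \<in> S'" if hx: "h \<in> N" "x \<in> S'" for h x
  proof -
    have x: "x \<in> S" using hx by (simp add: S'_def)
    obtain k where k: "k \<in> N" "act k x \<noteq> x" using hx by (auto simp: S'_def)
    \<comment> \<open>If \<open>k\<close> moves \<open>x\<close>, its conjugate by \<open>h\<close>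
      moves \<open>act h x\<close>; so moved points stay among the moved points.\<close>
    have "act (h \<otimes> k \<otimes> inv h) (act h x) = act h (act k x)"
      using hx k x act_undo act_closed by (simp add: act_mult)
    moreover have "act h (act k x) \<noteq> act h x"
      using act_undo hx k x act_closed by metis
    ultimately show ?thesis using hx k x act_closed by (auto simp: S'_def intro!: bexI[of _ "h \<otimes> k \<otimes> inv h"])
  qed
  have S: "x \<in> S" if "x \<in> S'" for x using that by (simp add: S'_def)
  have "equiv S' r"
  proof (rule equivI)
    show "r \<subseteq> S' \<times> S'" using closed unfolding r_def by blast
    show "refl_on S' r" 
    proof (rule refl_onI)
      fix x assume x: "x \<in> S'"
      have "x = act \<one> x" using act_one S x by simp
      then show "(x, x) \<in> r" using x N.one_closed unfolding r_def by blast
    qed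
    show "sym r"
    proof (rule symI)
      fix x y assume "(x, y) \<in> r"
      then obtain h where h: "x \<in> S'" "h \<in> N" "y = act h x" by (auto simp: r_def)
      then have "x = act (inv h) y" using act_undo S by simp
      then show "(y, x) \<in> r" using h closed by (auto simp: r_def)
    qed
    show "trans r"
    proof (rule transI)
      fix x y z assume "(x, y) \<in> r" "(y, z) \<in> r"
      then obtain h k where h: "x \<in> S'" "h \<in> N" "y = act h x" "k \<in> N" "z = act k y"
        by (auto simp: r_def)
      then have "z = act (k \<otimes> h) x" using act_mult S by simp
      then show "(x, z) \<in> r" using h by (auto simp: r_def)
    qed
  qed
  moreover have img: "Image r {x} = (\<lambda>h. act h x) ` N" if "x \<in> S'" for x
    using that unfolding r_def by blast
  moreover have "finite S'" using fin by (simp add: S'_def)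
  moreover have "\<phi> y - \<phi> x \<in> J" if xy: "(x, y) \<in> r" for x y
  proof -
    obtain h where "h \<in> N" "y = act h x" "x \<in> S'" using xy unfolding r_def by blast
    then show ?thesis using act_inv S by simp
  qed
  moreover have "of_nat (card (Image r {x})) * \<phi> x \<in> J" if x: "x \<in> S'" for x
  proof -
    have "\<exists>h\<in>N. act h x \<noteq> x" using x unfolding S'_def by blast
    then show ?thesis using mult[OF S[OF x]] unfolding img[OF x] by blast
  qed
  ultimately have "sum \<phi> S' \<in> J"
    by (intro sum_over_classes[where r = r] J0 Jadd) assumption+
  then show ?thesis by (simp add: S'_def)
qed

lemma prime_dvd_orbit_card:
  fixes p :: nat
  assumes "Factorial_Ring.prime p" "c dvd p ^ a" "c \<noteq> 1"
  shows "p dvd c"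
proof -
  obtain i where "c = p ^ i" using assms divides_primepow_nat by blast
  then show ?thesis using assms(3) by (cases i) auto
qed

section \<open>Existence of valuation rings\<close>

context unital_field_set
begin

text \<open>The values at \<open>x\<close> of polynomials of degree less than \<open>n\<close>; the
  union over all \<open>n\<close> is \<open>B[x]\<close>.\<close>

definition span :: "'k set \<Rightarrow> 'k \<Rightarrow> nat \<Rightarrow> 'k set" where
  "span B x n = {\<Sum>i<n. b i * x ^ i | b. \<forall>i. b i \<in> B}"

definition valuation_ring :: "'k set \<Rightarrow> bool" where
  "valuation_ring A \<longleftrightarrow> is_subring A \<and> (\<forall>x\<in>F. \<forall>y\<in>F. x * y = e \<longrightarrow> x \<in> A \<or> y \<in> A)"

text \<open>A monic equation of degree \<open>n\<close>. The factor \<open>e\<close> keeps the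
  leading term in \<open>F\<close> also for \<open>n = 0\<close>, where \<open>x ^ 0\<close> is the
  ambient \<open>1\<close>.\<close>

definition integral :: "'k set \<Rightarrow> 'k \<Rightarrow> bool" where
  "integral B x \<longleftrightarrow> x \<in> F \<and> (\<exists>n. e * x ^ n \<in> span B x n)"

lemma F_mult_power: "c \<in> F \<Longrightarrow> x \<in> F \<Longrightarrow> c * x ^ i \<in> F"
proof (induction i)
  case (Suc i)
  then have "x * (c * x ^ i) \<in> F" by (simp add: F_mult[of x "c * x ^ i"])
  then show ?case by (simp add: mult.left_commute)
qed simp

context
  fixes B x
  assumes B: "is_subring B" and x: "x \<in> F"
begin

lemma span_zero: "0 \<in> span B x n"
  unfolding span_def using is_subringD(2)[OF B] by (intro CollectI exI[of _ "\<lambda>_. 0"]) simp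

lemma span_add:
  assumes "s \<in> span B x n" "t \<in> span B x n"
  shows "s + t \<in> span B x n"
proof -
  obtain b c where "\<forall>i. b i \<in> B" "s = (\<Sum>i<n. b i * x ^ i)" "\<forall>i. c i \<in> B" "t = (\<Sum>i<n. c i * x ^ i)"
    using assms unfolding span_def by blast
  then show ?thesis
    unfolding span_def using is_subringD(5)[OF B]
    by (intro CollectI exI[of _ "\<lambda>i. b i + c i"]) (simp add: distrib_right sum.distrib)
qed

lemma span_sum: "(\<And>j. j \<in> J \<Longrightarrow> f j \<in> span B x n) \<Longrightarrow> sum f J \<in> span B x n"
  by (rule sum_in_set[OF span_zero span_add])

lemma span_term:
  assumes "b \<in> B" "j < n"
  shows "b * x ^ j \<in> span B x n"
proof -
  have "(\<Sum>i<n. (if i = j then b else 0) * x ^ i) = (\<Sum>i<n. if i = j then b * x ^ i else 0)"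
    by (intro sum.cong) auto
  also have "\<dots> = b * x ^ j" using assms by simp
  finally show ?thesis
    unfolding span_def using assms(1) is_subringD(2)[OF B]
    by (intro CollectI exI[of _ "\<lambda>i. if i = j then b else 0"]) simp
qed

lemma span_uminus:
  assumes "s \<in> span B x n"
  shows "- s \<in> span B x n"
proof -
  obtain b where "\<forall>i. b i \<in> B" "s = (\<Sum>i<n. b i * x ^ i)" using assms unfolding span_def by blast
  then show ?thesis
    unfolding span_def using is_subringD(4)[OF B]
    by (intro CollectI exI[of _ "\<lambda>i. - b i"]) (simp add: sum_negf)
qed

lemma span_mult:
  assumes "s \<in> span B x i" "t \<in> span B x j"
  shows "s * t \<in> span B x (i + j)"
proof -
  obtain b c where b: "\<forall>i. b i \<in> B" "s = (\<Sum>k<i. b k * x ^ k)"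
    and c: "\<forall>i. c i \<in> B" "t = (\<Sum>l<j. c l * x ^ l)"
    using assms unfolding span_def by blast
  have "s * t = (\<Sum>k<i. \<Sum>l<j. (b k * c l) * x ^ (k + l))"
    unfolding b(2) c(2) sum_product by (simp add: power_add ac_simps)
  also have "\<dots> \<in> span B x (i + j)"
    using b(1) c(1) is_subringD(6)[OF B] by (intro span_sum span_term) auto
  finally show ?thesis .
qed

lemma span_mono:
  assumes "s \<in> span B x n" "n \<le> n'"
  shows "s \<in> span B x n'"
proof -
  obtain b where b: "\<forall>i. b i \<in> B" "s = (\<Sum>i<n. b i * x ^ i)" using assms unfolding span_def by blast
  show ?thesis unfolding b(2) using b(1) assms(2) by (intro span_sum span_term) auto
qed

lemma span_1: "b \<in> span B x 1 \<longleftrightarrow> b \<in> B"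
  unfolding span_def by auto

lemma span_subset_F:
  assumes "s \<in> span B x n"
  shows "s \<in> F"
proof -
  obtain b where b: "\<forall>i. b i \<in> B" "s = (\<Sum>i<n. b i * x ^ i)" using assms unfolding span_def by blast
  show ?thesis unfolding b(2) using b(1) x is_subringD(1)[OF B]
    by (intro sum_in_set[OF F_zero F_add] F_mult_power) auto
qed

lemma subring_adjoin: "is_subring (\<Union>n. span B x n)"
  unfolding is_subring_def
proof (intro conjI ballI)
  show "(\<Union>n. span B x n) \<subseteq> F" using span_subset_F by blast
  show "0 \<in> (\<Union>n. span B x n)" using span_zero by blast
  show "e \<in> (\<Union>n. span B x n)" using span_1[of e] is_subringD(3)[OF B] by blast
  show "- s \<in> (\<Union>n. span B x n)" if "s \<in> (\<Union>n. span B x n)" for s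
    using span_uminus that by blast
  fix s t assume "s \<in> (\<Union>n. span B x n)" "t \<in> (\<Union>n. span B x n)"
  then obtain i j where s: "s \<in> span B x i" and t: "t \<in> span B x j" by blast
  show "s * t \<in> (\<Union>n. span B x n)" using span_mult[OF s t] by blast
  have "s + t \<in> span B x (i + j)" by (intro span_add span_mono[OF s] span_mono[OF t]) simp_all
  then show "s + t \<in> (\<Union>n. span B x n)" by blast
qed

lemma subset_adjoin: "B \<subseteq> (\<Union>n. span B x n)"
  using span_1 by blast

lemma in_adjoin: "x \<in> (\<Union>n. span B x n)"
proof -
  have "e * x ^ 1 \<in> span B x 2" by (rule span_term[OF is_subringD(3)[OF B]]) simp
  then show ?thesis using F_unit_mult[OF x] by auto
qed

end

lemma unit_power: "i > 0 \<Longrightarrow> e ^ i = e"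
  by (induction i rule: nat_induct_non_zero) (simp_all add: F_unit_mult[OF F_unit(1)])

text \<open>The powers of \<open>x * y\<close> produce powers of \<open>e\<close>, which the factor
  \<open>c\<close> from \<open>F\<close> absorbs.\<close>

lemma inverse_powers:
  assumes "c \<in> F" "x \<in> F" "y \<in> F" "x * y = e" "i \<le> n"
  shows "c * x ^ n * y ^ i = c * x ^ (n - i)"
proof (cases "i = 0")
  case False
  have "c * x ^ n * y ^ i = c * (x ^ (n - i) * (x * y) ^ i)"
  proof -
    have "x ^ n = x ^ (n - i) * x ^ i" using assms(5) by (simp add: power_add[symmetric])
    then show ?thesis by (simp add: power_mult_distrib ac_simps)
  qed
  also have "\<dots> = (e * c) * x ^ (n - i)"
    using False by (simp add: assms(4) unit_power ac_simps)
  finally show ?thesis using F_unit_mult[OF assms(1)] by simp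
qed simp

text \<open>Chevalley's extension theorem, by Zorn's lemma.\<close>

theorem exists_valuation_ring:
  assumes B: "is_subring B" and t: "t \<in> B" and t': "t' \<in> F" "t * t' = e" "t' \<notin> B"
  obtains A where "valuation_ring A" "B \<subseteq> A" "t' \<notin> A"
proof -
  define \<S> where "\<S> = {C. is_subring C \<and> B \<subseteq> C \<and> t' \<notin> C}"
  have "\<exists>A\<in>\<S>. \<forall>C\<in>\<S>. A \<subseteq> C \<longrightarrow> C = A"
  proof (rule subset_Zorn_nonempty)
    show "\<S> \<noteq> {}" using B t' by (auto simp: \<S>_def)
    fix \<C> assume ne: "\<C> \<noteq> {}" and ch: "subset.chain \<S> \<C>"
    have sub: "is_subring C" "B \<subseteq> C" "t' \<notin> C" if "C \<in> \<C>" for C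
      using ch that unfolding subset.chain_def \<S>_def by blast+
    have two: "\<exists>C\<in>\<C>. x \<in> C \<and> y \<in> C" if xy: "x \<in> \<Union>\<C>" "y \<in> \<Union>\<C>" for x y
    proof -
      obtain C D where "C \<in> \<C>" "x \<in> C" "D \<in> \<C>" "y \<in> D" using xy by blast
      moreover from this have "C \<subseteq> D \<or> D \<subseteq> C" using ch unfolding subset_chain_def by blast
      ultimately show ?thesis by blast
    qed
    obtain C0 where C0: "C0 \<in> \<C>" using ne by blast
    have "is_subring (\<Union>\<C>)"
      unfolding is_subring_def
    proof (intro conjI ballI)
      show "\<Union>\<C> \<subseteq> F" using is_subringD(1)[OF sub(1)] by blast
      show "0 \<in> \<Union>\<C>" using is_subringD(2)[OF sub(1)[OF C0]] C0 by blast
      show "e \<in> \<Union>\<C>" using is_subringD(3)[OF sub(1)[OF C0]] C0 by blast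
      show "- x \<in> \<Union>\<C>" if "x \<in> \<Union>\<C>" for x using is_subringD(4)[OF sub(1)] that by blast
      fix x y assume "x \<in> \<Union>\<C>" "y \<in> \<Union>\<C>"
      then obtain C where C: "C \<in> \<C>" "x \<in> C" "y \<in> C" using two by blast
      show "x + y \<in> \<Union>\<C>" using is_subringD(5)[OF sub(1)[OF C(1)] C(2,3)] C(1) by blast
      show "x * y \<in> \<Union>\<C>" using is_subringD(6)[OF sub(1)[OF C(1)] C(2,3)] C(1) by blast
    qed
    moreover have "B \<subseteq> \<Union>\<C>" using sub(2)[OF C0] C0 by blast
    moreover have "t' \<notin> \<Union>\<C>" using sub(3) by blast
    ultimately show "\<Union>\<C> \<in> \<S>" by (simp add: \<S>_def)
  qed
  then obtain A where "A \<in> \<S>" and maxA: "\<And>C. C \<in> \<S> \<Longrightarrow> A \<subseteq> C \<Longrightarrow> C = A" by blast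
  then have A: "is_subring A" and BA: "B \<subseteq> A" and t'A: "t' \<notin> A" by (auto simp: \<S>_def)
  note AF = is_subringD(1)[OF A, THEN subsetD] and A0 = is_subringD(2)[OF A] and Ae = is_subringD(3)[OF A]
    and Aminus = is_subringD(4)[OF A] and Aadd = is_subringD(5)[OF A] and Amult = is_subringD(6)[OF A]
  have tA: "t \<in> A" and tF: "t \<in> F" using t BA AF by blast+
  \<comment> \<open>The element \<open>t\<close> lies in the Jacobson radical of \<open>A\<close>:
    inverting all \<open>e + t * c\<close> gives a ring \<open>C\<close> that still omits
    \<open>t'\<close>, so \<open>C = A\<close> by maximality.\<close>
  have unit: "\<exists>w\<in>A. w * (e + t * a) = e" if a: "a \<in> A" for a
  proof -
    define C where "C = {x \<in> F. \<exists>b\<in>A. \<exists>c\<in>A. x * (e + t * c) = b}"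
    have denom: "(e + t * c) * (e + t * c') = e + t * (c + c' + t * c * c')" if "c \<in> A" "c' \<in> A" for c c'
    proof -
      have "(e + t * c) * (e + t * c') = e * e + (e * (t * c') + t * (e * c) + t * c * (t * c'))"
        by (simp add: algebra_simps)
      also have "\<dots> = e + (t * c' + t * c + t * c * (t * c'))"
        using F_unit_mult F_unit(1) AF[OF that(1)] AF[OF that(2)] tF F_mult by simp
      finally show ?thesis by (simp add: algebra_simps)
    qed
    have "is_subring C"
      unfolding is_subring_def
    proof (intro conjI ballI)
      show "C \<subseteq> F" by (auto simp: C_def)
      show "0 \<in> C" using F_zero A0 by (auto simp: C_def)
      show "e \<in> C" unfolding C_def using F_unit(1) A0 Ae F_unit_mult[OF F_unit(1)] by force
      show "- x \<in> C" if "x \<in> C" for x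
        using that Aminus F_uminus unfolding C_def by force
      fix x y assume "x \<in> C" "y \<in> C"
      then obtain b c b' c' where x: "x \<in> F" "b \<in> A" "c \<in> A" "x * (e + t * c) = b"
        and y: "y \<in> F" "b' \<in> A" "c' \<in> A" "y * (e + t * c') = b'" unfolding C_def by blast
      define c'' where "c'' = c + c' + t * c * c'"
      have c'': "c'' \<in> A" unfolding c''_def by (intro Aadd Amult tA x y)
      have ec: "e + t * c \<in> A" "e + t * c' \<in> A" by (intro Aadd Amult Ae tA x y)+
      have "(x + y) * (e + t * c'') = x * (e + t * c) * (e + t * c') + y * (e + t * c') * (e + t * c)"
        unfolding c''_def denom[OF x(3) y(3), symmetric] by (simp add: algebra_simps)
      also have "\<dots> \<in> A" unfolding x(4) y(4) by (intro Aadd Amult x(2) y(2) ec)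
      finally show "x + y \<in> C" unfolding C_def using c'' F_add[OF x(1) y(1)] by blast
      have "(x * y) * (e + t * c'') = (x * (e + t * c)) * (y * (e + t * c'))"
        unfolding c''_def denom[OF x(3) y(3), symmetric] by (simp only: ac_simps)
      also have "\<dots> \<in> A" unfolding x(4) y(4) by (intro Amult x(2) y(2))
      finally show "x * y \<in> C" unfolding C_def using c'' F_mult[OF x(1) y(1)] by blast
    qed
    moreover have AC: "A \<subseteq> C"
    proof
      fix x assume x: "x \<in> A"
      have "x * (e + t * 0) = x" using F_mult_unit[OF AF[OF x]] by simp
      then show "x \<in> C" unfolding C_def using x A0 AF by blast
    qed
    moreover have "t' \<notin> C"
    proof
      assume "t' \<in> C"
      then obtain b c where bc: "b \<in> A" "c \<in> A" "t' * (e + t * c) = b" unfolding C_def by blast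
      have "t' * (e + t * c) = t' * e + (t * t') * c" by (simp add: algebra_simps)
      also have "\<dots> = t' + c" using F_mult_unit[OF t'(1)] F_unit_mult[OF AF[OF bc(2)]] t'(2) by simp
      finally have "t' = b + - c" using bc(3) by simp
      then show False using t'A Aadd[OF bc(1) Aminus[OF bc(2)]] by simp
    qed
    ultimately have CA: "C = A" using maxA BA by (auto simp: \<S>_def)
    have eaA: "e + t * a \<in> A" by (intro Aadd Amult Ae tA a)
    have "e + t * a \<noteq> 0"
    proof
      assume "e + t * a = 0"
      then have "t' * (e + t * a) = 0" by simp
      then have "t' * e + (t * t') * a = 0" by (simp add: algebra_simps)
      then have "t' = - a" using F_mult_unit[OF t'(1)] F_unit_mult[OF AF[OF a]] t'(2)
        by (simp add: eq_neg_iff_add_eq_0)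
      then show False using t'A Aminus[OF a] by simp
    qed
    then obtain w where w: "w \<in> F" "(e + t * a) * w = e" using F_inverse AF[OF eaA] by blast
    then have "w \<in> C" unfolding C_def using Ae a by (auto simp: mult.commute)
    then show ?thesis using CA w by (auto simp: mult.commute)
  qed
  \<comment> \<open>Multiplied by \<open>t\<close>, the relation in \<open>y\<close> has a constant
    term that can be moved to the left and made a unit, which writes \<open>e\<close> through
    positive powers of \<open>y\<close>. Multiplying the leading term \<open>b n * x ^ n\<close> by
    this expression lowers its degree.\<close>
  have reduce: "t' \<in> span A x n"
    if xy: "x \<in> F" "y \<in> F" "x * y = e" and f: "t' \<in> span A x (Suc n)" and g: "t' \<in> span A y (Suc m)" and mn: "m \<le> n"
    for x y n m
  proof -
    obtain b where b: "\<forall>i. b i \<in> A" "t' = (\<Sum>i<Suc n. b i * x ^ i)" using f unfolding span_def by blast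
    obtain c where c: "\<forall>i. c i \<in> A" "t' = (\<Sum>i<Suc m. c i * y ^ i)" using g unfolding span_def by blast
    have c0: "t' = c 0 + (\<Sum>i<m. c (Suc i) * y ^ Suc i)" unfolding c(2) by (subst sum.lessThan_Suc_shift) simp
    obtain w where w: "w \<in> A" "w * (e + t * - c 0) = e" using unit Aminus c(1) by blast
    have "e + t * - c 0 = t * t' + t * - c 0" by (simp only: t'(2))
    also have "\<dots> = t * (\<Sum>i<m. c (Suc i) * y ^ Suc i)" by (subst c0) (simp add: algebra_simps)
    finally have "e = w * (t * (\<Sum>i<m. c (Suc i) * y ^ Suc i))" using w(2) by simp
    then have "b n * x ^ n * e = b n * x ^ n * (w * (t * (\<Sum>i<m. c (Suc i) * y ^ Suc i)))" by (rule arg_cong)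
    then have "b n * x ^ n = b n * x ^ n * (w * (t * (\<Sum>i<m. c (Suc i) * y ^ Suc i)))"
      using F_mult_unit F_mult_power[OF AF xy(1), of "b n" n] b(1) by simp
    also have "\<dots> = (\<Sum>i<m. (b n * w * t * c (Suc i)) * x ^ n * y ^ Suc i)"
      by (simp add: sum_distrib_left ac_simps)
    also have "\<dots> = (\<Sum>i<m. (b n * w * t * c (Suc i)) * x ^ (n - Suc i))"
    proof (rule sum.cong[OF refl])
      fix i assume "i \<in> {..<m}"
      moreover have "b n * w * t * c (Suc i) \<in> F" using AF Amult tA w(1) b(1) c(1) by simp
      ultimately show "(b n * w * t * c (Suc i)) * x ^ n * y ^ Suc i = (b n * w * t * c (Suc i)) * x ^ (n - Suc i)"
        using mn by (intro inverse_powers xy) simp_all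
    qed
    also have "\<dots> \<in> span A x n"
    proof (intro span_sum[OF A xy(1)] span_term[OF A xy(1)])
      fix i assume "i \<in> {..<m}"
      then show "n - Suc i < n" using mn by simp
      show "b n * w * t * c (Suc i) \<in> A" using Amult tA w(1) b(1) c(1) by simp
    qed
    finally have top: "b n * x ^ n \<in> span A x n" .
    have "(\<Sum>i<n. b i * x ^ i) \<in> span A x n" using b(1) unfolding span_def by blast
    then show ?thesis unfolding b(2) using span_add[OF A xy(1)] top by simp
  qed
  have "valuation_ring A"
    unfolding valuation_ring_def
  proof (intro conjI A ballI impI)
    fix x y assume xy: "x \<in> F" "y \<in> F" "x * y = e"
    show "x \<in> A \<or> y \<in> A"
    proof (rule ccontr)
      assume neg: "\<not> (x \<in> A \<or> y \<in> A)"
      have adj: "\<exists>n. t' \<in> span A z n" if z: "z \<in> F" "z \<notin> A" for z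
      proof (rule ccontr)
        assume "\<nexists>n. t' \<in> span A z n"
        then have "(\<Union>n. span A z n) \<in> \<S>"
          using subring_adjoin[OF A z(1)] subset_adjoin[OF A z(1)] BA by (auto simp: \<S>_def)
        then have "(\<Union>n. span A z n) = A" using maxA subset_adjoin[OF A z(1)] by blast
        then show False using in_adjoin[OF A z(1)] z(2) by blast
      qed
      \<comment> \<open>Both relations are taken of least degree; whichever is at least as long as
        the other is shortened by \<open>reduce\<close>.\<close>
      define n where "n = (LEAST n. t' \<in> span A x n)"
      define m where "m = (LEAST m. t' \<in> span A y m)"
      have exn: "\<exists>n. t' \<in> span A x n" and exm: "\<exists>m. t' \<in> span A y m"
        using adj[OF xy(1)] adj[OF xy(2)] neg by simp_all
      have n: "t' \<in> span A x n" unfolding n_def by (rule LeastI_ex[OF exn])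
      have m: "t' \<in> span A y m" unfolding m_def by (rule LeastI_ex[OF exm])
      have "t' \<noteq> 0" using t'(2) F_unit(2) by auto
      then have "t' \<notin> span A z 0" for z unfolding span_def by auto
      then have "n \<noteq> 0" "m \<noteq> 0" using n m by metis+
      then obtain n' m' where nm: "n = Suc n'" "m = Suc m'" using not0_implies_Suc by metis
      show False
      proof (cases "m' \<le> n'")
        case True
        then have "t' \<in> span A x n'" using reduce[OF xy] n m nm by blast
        then show False using nm(1) Least_le[of "\<lambda>n. t' \<in> span A x n" n'] by (simp add: n_def)
      next
        case False
        have yx: "y * x = e" using xy(3) by (simp add: mult.commute)
        have "t' \<in> span A y m'" using reduce[OF xy(2,1) yx] n m nm False by simp
        then show False using nm(2) Least_le[of "\<lambda>m. t' \<in> span A y m" m'] by (simp add: m_def)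
      qed
    qed
  qed
  then show ?thesis using that BA t'A by blast
qed

text \<open>Described as an intersection of valuation rings, the integral closure is visibly a ring
  and lies in any chosen \<open>A\<close> above \<open>Z\<close>. For the converse, a non-integral
  \<open>x\<close> with inverse \<open>y\<close> is not in \<open>Z[y]\<close>, and
  \<open>exists_valuation_ring\<close> applied to \<open>Z[y]\<close> and \<open>y\<close> yields a
  valuation ring that omits \<open>x\<close>.\<close>

lemma integral_iff:
  assumes Z: "is_subring Z"
  shows "integral Z x \<longleftrightarrow> x \<in> F \<and> (\<forall>A. valuation_ring A \<longrightarrow> Z \<subseteq> A \<longrightarrow> x \<in> A)"
proof
  assume int: "integral Z x"
  then have x: "x \<in> F" by (simp add: integral_def)
  obtain n where "e * x ^ n \<in> span Z x n" using int unfolding integral_def by blast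
  then obtain b where b: "\<forall>i. b i \<in> Z" "e * x ^ n = (\<Sum>i<n. b i * x ^ i)" unfolding span_def by blast
  have "x \<in> A" if A: "valuation_ring A" "Z \<subseteq> A" for A
  proof (rule ccontr)
    assume xA: "x \<notin> A"
    have Ar: "is_subring A" using A(1) by (simp add: valuation_ring_def)
    have "x \<noteq> 0" using xA is_subringD(2)[OF Ar] by auto
    then obtain y where y: "y \<in> F" "x * y = e" using F_inverse x by blast
    have yA: "y \<in> A" using A(1) x y xA unfolding valuation_ring_def by blast
    have "n \<noteq> 0"
    proof
      assume "n = 0"
      then show False using b(2) F_unit(2) by simp
    qed
    then obtain m where m: "n = Suc m" using not0_implies_Suc by blast
    have bF: "b i \<in> F" for i using b(1) is_subringD(1)[OF Z] by blast
    \<comment> \<open>Multiplying the monic equation of degree \<open>n = m + 1\<close> by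
      \<open>y ^ m\<close> expresses \<open>x\<close> as a polynomial in its inverse
      \<open>y\<close>, which lies in \<open>A\<close>.\<close>
    have "e * x ^ n * y ^ m = e * x ^ (n - m)" using m by (intro inverse_powers F_unit(1) x y) simp
    then have "x = e * x ^ n * y ^ m" using m F_unit_mult[OF x] by simp
    also have "\<dots> = (\<Sum>i<n. b i * x ^ i * y ^ m)" unfolding b(2) by (simp add: sum_distrib_right)
    also have "\<dots> \<in> A"
    proof (rule sum_in_set[OF is_subringD(2)[OF Ar] is_subringD(5)[OF Ar]])
      fix i assume "i \<in> {..<n}"
      then have i: "i \<le> m" using m by simp
      have yx: "y * x = e" using y(2) by (simp add: mult.commute)
      have "b i * y ^ m * x ^ i = b i * y ^ (m - i)" by (rule inverse_powers[OF bF y(1) x yx i])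
      then have "b i * x ^ i * y ^ m = b i * y ^ (m - i)" by (simp add: ac_simps)
      moreover have "b i * y ^ j \<in> A" for j
      proof (induction j)
        case 0
        then show ?case using b(1) A(2) by auto
      next
        case (Suc j)
        then show ?case using is_subringD(6)[OF Ar yA Suc] by (simp add: mult.left_commute)
      qed
      ultimately show "b i * x ^ i * y ^ m \<in> A" by simp
    qed
    finally show False using xA by simp
  qed
  then show "x \<in> F \<and> (\<forall>A. valuation_ring A \<longrightarrow> Z \<subseteq> A \<longrightarrow> x \<in> A)" using x by blast
next
  assume r: "x \<in> F \<and> (\<forall>A. valuation_ring A \<longrightarrow> Z \<subseteq> A \<longrightarrow> x \<in> A)"
  then have x: "x \<in> F" by blast
  show "integral Z x"
  proof (rule ccontr)
    assume nint: "\<not> integral Z x"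
    have "x \<noteq> 0"
    proof
      assume "x = 0"
      then have "e * x ^ 1 \<in> span Z x 1" using span_zero[OF Z x] by simp
      then show False using nint x unfolding integral_def by blast
    qed
    then obtain y where y: "y \<in> F" "x * y = e" using F_inverse x by blast
    have "x \<notin> (\<Union>n. span Z y n)"
    proof
      assume "x \<in> (\<Union>n. span Z y n)"
      then obtain n b where b: "\<forall>i. b i \<in> Z" "x = (\<Sum>i<n. b i * y ^ i)" unfolding span_def by blast
      have bF: "b i \<in> F" for i using b(1) is_subringD(1)[OF Z] by blast
      \<comment> \<open>Multiplying an expression of \<open>x\<close> as a polynomial in
        \<open>y\<close> by \<open>x ^ n\<close> clears all powers of \<open>y\<close> and leaves a
        monic equation of degree \<open>n + 1\<close>.\<close>
      have "e * x ^ Suc n = x * x ^ n" using F_unit_mult[OF x] by (simp add: mult.assoc[symmetric])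
      also have "\<dots> = (\<Sum>i<n. b i * y ^ i * x ^ n)" by (subst b(2)) (simp add: sum_distrib_right)
      also have "\<dots> = (\<Sum>i<n. b i * x ^ (n - i))"
      proof (rule sum.cong[OF refl])
        fix i assume "i \<in> {..<n}"
        then have "b i * x ^ n * y ^ i = b i * x ^ (n - i)" by (intro inverse_powers[OF bF x y]) simp
        then show "b i * y ^ i * x ^ n = b i * x ^ (n - i)" by (simp add: ac_simps)
      qed
      also have "\<dots> \<in> span Z x (Suc n)"
        using b(1) by (intro span_sum[OF Z x] span_term[OF Z x]) auto
      finally show False using nint x unfolding integral_def by blast
    qed
    then obtain A where A: "valuation_ring A" "(\<Union>n. span Z y n) \<subseteq> A" "x \<notin> A"
      using exists_valuation_ring[OF subring_adjoin[OF Z y(1)] in_adjoin[OF Z y(1)] x] y(2)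
      by (metis mult.commute)
    then show False using r subset_adjoin[OF Z y(1)] by blast
  qed
qed

end

section \<open>A type class model of all rings on a type\<close>

lemma cring_units:
  assumes "cring K" "x \<in> carrier K"
  shows "\<zero>\<^bsub>K\<^esub> \<oplus>\<^bsub>K\<^esub> x = x" "\<one>\<^bsub>K\<^esub> \<otimes>\<^bsub>K\<^esub> x = x"
proof -
  interpret cring K by fact
  show "\<zero>\<^bsub>K\<^esub> \<oplus>\<^bsub>K\<^esub> x = x" "\<one>\<^bsub>K\<^esub> \<otimes>\<^bsub>K\<^esub> x = x" using assms(2) by simp_all
qed

text \<open>An element of this type consists of an integer and of an element of every commutative ring with
  carrier in the given type. In this way every field given by a carrier set becomes a subset,
  closed under the operations, of one commutative ring in the sense of type classes. The integer only
  ensures \<open>0 \<noteq> 1\<close>.\<close>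

typedef 'r ring_family = "{(i :: int, f :: 'r ring \<Rightarrow> 'r).
    \<forall>K. if cring K then f K \<in> carrier K else f K = undefined}"
  by (intro exI[of _ "(0, \<lambda>K. if cring K then \<zero>\<^bsub>K\<^esub> else undefined)"])
    (auto simp: cring.cring_simprules)

setup_lifting type_definition_ring_family

instantiation ring_family :: (type) comm_ring_1
begin

lift_definition zero_ring_family :: "'a ring_family" is
  "(0, \<lambda>K. if cring K then \<zero>\<^bsub>K\<^esub> else undefined)"
  by (auto simp: cring.cring_simprules)

lift_definition one_ring_family :: "'a ring_family" is
  "(1, \<lambda>K. if cring K then \<one>\<^bsub>K\<^esub> else undefined)"
  by (auto simp: cring.cring_simprules)

lift_definition plus_ring_family :: "'a ring_family \<Rightarrow> 'a ring_family \<Rightarrow> 'a ring_family" is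
  "\<lambda>(i, f) (j, g). (i + j, \<lambda>K. if cring K then f K \<oplus>\<^bsub>K\<^esub> g K else undefined)"
  by (auto simp: cring.cring_simprules split: if_splits)

lift_definition times_ring_family :: "'a ring_family \<Rightarrow> 'a ring_family \<Rightarrow> 'a ring_family" is
  "\<lambda>(i, f) (j, g). (i * j, \<lambda>K. if cring K then f K \<otimes>\<^bsub>K\<^esub> g K else undefined)"
  by (auto simp: cring.cring_simprules split: if_splits)

lift_definition uminus_ring_family :: "'a ring_family \<Rightarrow> 'a ring_family" is
  "\<lambda>(i, f). (- i, \<lambda>K. if cring K then \<ominus>\<^bsub>K\<^esub> f K else undefined)"
  by (auto simp: cring.cring_simprules split: if_splits)

lift_definition minus_ring_family :: "'a ring_family \<Rightarrow> 'a ring_family \<Rightarrow> 'a ring_family" is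
  "\<lambda>(i, f) (j, g). (i - j, \<lambda>K. if cring K then f K \<ominus>\<^bsub>K\<^esub> g K else undefined)"
  by (auto simp: cring.cring_simprules split: if_splits)

instance
proof
  fix a b c :: "'a ring_family"
  show "a * b * c = a * (b * c)"
    by transfer (auto simp: fun_eq_iff cring.cring_simprules mult.assoc)
  show "a * b = b * a"
    by transfer (auto simp: fun_eq_iff cring.cring_simprules(14) mult.commute)
  show "1 * a = a"
    by transfer (auto simp: fun_eq_iff cring_units; metis)
  show "a + b + c = a + (b + c)"
    by transfer (auto simp: fun_eq_iff cring.cring_simprules add.assoc)
  show "a + b = b + a"
    by transfer (auto simp: fun_eq_iff cring.cring_simprules(10) add.commute)
  show "0 + a = a"
    by transfer (auto simp: fun_eq_iff cring_units; metis)
  show "- a + a = 0"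
    by transfer (auto simp: fun_eq_iff cring.cring_simprules(9) split: if_splits)
  show "a - b = a + - b"
    by transfer (auto simp: fun_eq_iff a_minus_def)
  show "(a + b) * c = a * c + b * c"
    by transfer (auto simp: fun_eq_iff cring.cring_simprules(13) distrib_right)
  show "(0 :: 'a ring_family) \<noteq> 1"
    by transfer auto
qed

end

text \<open>The component at \<open>K\<close> carries the element and all others are zero. Addition
  and multiplication are respected, while the unit of \<open>K\<close> becomes an idempotent
  different from \<open>1\<close>; elements outside the carrier are sent to
  \<open>0\<close>.\<close>

lift_definition embed :: "'r ring \<Rightarrow> 'r \<Rightarrow> 'r ring_family" is
  "\<lambda>K a. (0, \<lambda>L. if cring L then if L = K \<and> a \<in> carrier K then a else \<zero>\<^bsub>L\<^esub> else undefined)"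
  by (auto simp: cring.cring_simprules)

context
  fixes K :: "'r ring"
  assumes K: "cring K"
begin

lemma embed_zero: "embed K \<zero>\<^bsub>K\<^esub> = 0"
  using K by transfer auto

lemma embed_add:
  "a \<in> carrier K \<Longrightarrow> b \<in> carrier K \<Longrightarrow> embed K (a \<oplus>\<^bsub>K\<^esub> b) = embed K a + embed K b"
  using K by transfer (auto simp: fun_eq_iff cring.cring_simprules)

lemma embed_mult:
  "a \<in> carrier K \<Longrightarrow> b \<in> carrier K \<Longrightarrow> embed K (a \<otimes>\<^bsub>K\<^esub> b) = embed K a * embed K b"
  using K by transfer (auto simp: fun_eq_iff cring.cring_simprules)

lemma embed_eq_iff:
  "a \<in> carrier K \<Longrightarrow> b \<in> carrier K \<Longrightarrow> embed K a = embed K b \<longleftrightarrow> a = b"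
  using K by transfer (auto simp: fun_eq_iff)

lemma embed_uminus: "a \<in> carrier K \<Longrightarrow> embed K (\<ominus>\<^bsub>K\<^esub> a) = - embed K a"
  using K by transfer (auto simp: fun_eq_iff cring.cring_simprules)

end

lemma field_embed:
  assumes "field K"
  shows "unital_field_set (embed K ` carrier K) (embed K \<one>\<^bsub>K\<^esub>)"
proof -
  interpret field K by fact
  note K = is_cring
  show ?thesis
  proof
    show "0 \<in> embed K ` carrier K" using embed_zero[OF K] zero_closed by (metis imageI)
    show "embed K \<one>\<^bsub>K\<^esub> \<in> embed K ` carrier K" by simp
    show "embed K \<one>\<^bsub>K\<^esub> \<noteq> 0" using embed_eq_iff[OF K one_closed zero_closed] embed_zero[OF K] by simp
    fix x y assume x: "x \<in> embed K ` carrier K"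
    then obtain a where a: "a \<in> carrier K" "x = embed K a" by blast
    show "- x \<in> embed K ` carrier K" using a embed_uminus[OF K a(1)] by (metis imageI a_inv_closed)
    show "embed K \<one>\<^bsub>K\<^esub> * x = x" using a embed_mult[OF K one_closed a(1)] by simp
    show "\<exists>y\<in>embed K ` carrier K. x * y = embed K \<one>\<^bsub>K\<^esub>" if "x \<noteq> 0"
    proof -
      have "a \<noteq> \<zero>\<^bsub>K\<^esub>" using that a(2) embed_zero[OF K] by auto
      then have "inv\<^bsub>K\<^esub> a \<in> carrier K" "a \<otimes>\<^bsub>K\<^esub> inv\<^bsub>K\<^esub> a = \<one>\<^bsub>K\<^esub>" using a(1) field_Units by auto
      then show ?thesis using a embed_mult[OF K a(1)] by (metis imageI)
    qed
    assume "y \<in> embed K ` carrier K"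
    then obtain b where b: "b \<in> carrier K" "y = embed K b" by blast
    show "x + y \<in> embed K ` carrier K" using a b embed_add[OF K a(1) b(1)] by (metis imageI a_closed)
    show "x * y \<in> embed K ` carrier K" using a b embed_mult[OF K a(1) b(1)] by (metis imageI m_closed)
  qed
qed

text \<open>The bridge from \<open>finsum\<close> over the record with carrier \<open>B\<close>,
  which occurs in the group ring and the augmentation, to sums in a type class.\<close>

lemma embed_sum:
  assumes K: "cring K" and B: "subring B K" and fin: "finite S" and f: "\<And>i. i \<in> S \<Longrightarrow> f i \<in> B"
  shows "finsum (K\<lparr>carrier := B\<rparr>) f S \<in> B \<and> embed K (finsum (K\<lparr>carrier := B\<rparr>) f S) = (\<Sum>i\<in>S. embed K (f i))"
  using fin f
proof (induction S)
  case empty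
  then show ?case using embed_zero[OF K] subringE(2)[OF B] by (simp add: finsum_def finprod_def)
next
  case (insert i S)
  interpret K: cring K by fact
  interpret R: ring "K\<lparr>carrier := B\<rparr>" by (rule K.subring_is_ring[OF B])
  have "finsum (K\<lparr>carrier := B\<rparr>) f (insert i S) = f i \<oplus>\<^bsub>K\<^esub> finsum (K\<lparr>carrier := B\<rparr>) f S"
    using R.finsum_insert[of S i f] insert by auto
  then show ?case
    using insert embed_add[OF K] subringE(1,7)[OF B] by (simp add: subset_iff)
qed

section \<open>The p-adic integers\<close>

definition integral_sequences :: "nat \<Rightarrow> (nat \<Rightarrow> rat) set" where
  "integral_sequences p = {s. padic_Cauchy p s \<and> (\<forall>n. padic_abs p (s n) \<le> 1)}"

context
  fixes p :: nat
  assumes p: "Factorial_Ring.prime p"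
begin

text \<open>The definition uses the reduced fraction; additivity of multiplicities makes the
  exponent the same for every fraction.\<close>

lemma padic_abs_fraction:
  assumes a: "a \<noteq> 0" and b: "b \<noteq> 0"
  shows "padic_abs p (of_int a / of_int b) =
    real p powi (int (multiplicity (int p) b) - int (multiplicity (int p) a))"
proof -
  define x :: rat where "x = of_int a / of_int b"
  obtain c d where cd: "quotient_of x = (c, d)" by fastforce
  have x0: "x \<noteq> 0" using a b by (simp add: x_def)
  have d0: "d > 0" by (rule quotient_of_denom_pos[OF cd])
  have xcd: "x = of_int c / of_int d" by (rule quotient_of_div[OF cd])
  then have c0: "c \<noteq> 0" using x0 by auto
  have "(of_int (c * b) :: rat) = of_int (a * d)"
    using xcd b d0 unfolding x_def by (simp add: field_simps)
  then have "c * b = a * d" by (simp only: of_int_eq_iff)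
  moreover have "prime_elem (int p)" using p by simp
  ultimately have "multiplicity (int p) c + multiplicity (int p) b = multiplicity (int p) a + multiplicity (int p) d"
    using prime_elem_multiplicity_mult_distrib[of "int p"] a b c0 d0 by (metis less_irrefl)
  then have "int (multiplicity (int p) d) - int (multiplicity (int p) c) =
      int (multiplicity (int p) b) - int (multiplicity (int p) a)" by simp
  then show ?thesis using x0 cd by (simp add: padic_abs_def x_def)
qed

lemma rat_fraction: "\<exists>a b. b \<noteq> 0 \<and> x = of_int a / (of_int b :: rat)"
proof -
  obtain c d where cd: "quotient_of x = (c, d)" by fastforce
  show ?thesis using quotient_of_div[OF cd] quotient_of_denom_pos[OF cd] by (metis less_irrefl)
qed

lemma padic_abs_zero: "padic_abs p 0 = 0"
  by (simp add: padic_abs_def)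

lemma p_gt_1: "real p > 1"
  using prime_gt_1_nat[OF p] by simp

lemma padic_abs_pos: "x \<noteq> 0 \<Longrightarrow> padic_abs p x > 0"
  using p_gt_1 by (simp add: padic_abs_def split: prod.split)

lemma padic_abs_nonneg: "padic_abs p x \<ge> 0"
  using padic_abs_pos[of x] padic_abs_zero by (cases "x = 0") simp_all

lemma padic_abs_one: "padic_abs p 1 = 1"
  using padic_abs_fraction[of 1 1] by simp

lemma padic_abs_mult: "padic_abs p (x * y) = padic_abs p x * padic_abs p y"
proof (cases "x = 0 \<or> y = 0")
  case True
  then show ?thesis using padic_abs_zero by auto
next
  case False
  obtain a b where ab: "b \<noteq> 0" "x = of_int a / of_int b" using rat_fraction by blast
  obtain c d where cd: "d \<noteq> 0" "y = of_int c / of_int d" using rat_fraction by blast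
  have a0: "a \<noteq> 0" and c0: "c \<noteq> 0" using False ab cd by auto
  have pe: "prime_elem (int p)" using p by simp
  have xy: "x * y = of_int (a * c) / of_int (b * d)" by (simp add: ab cd)
  have "padic_abs p (x * y) = real p powi (int (multiplicity (int p) (b * d)) - int (multiplicity (int p) (a * c)))"
    unfolding xy using a0 c0 ab cd by (intro padic_abs_fraction) simp_all
  also have "\<dots> = real p powi ((int (multiplicity (int p) b) - int (multiplicity (int p) a)) +
      (int (multiplicity (int p) d) - int (multiplicity (int p) c)))"
    using prime_elem_multiplicity_mult_distrib[OF pe] a0 c0 ab(1) cd(1) by (simp add: algebra_simps)
  also have "\<dots> = padic_abs p x * padic_abs p y"
    unfolding ab(2) cd(2) padic_abs_fraction[OF a0 ab(1)] padic_abs_fraction[OF c0 cd(1)]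
    using p_gt_1 by (intro power_int_add) auto
  finally show ?thesis .
qed

lemma padic_abs_uminus: "padic_abs p (- x) = padic_abs p x"
proof -
  have "padic_abs p (- 1) * padic_abs p (- 1) = 1"
    unfolding padic_abs_mult[symmetric] by (simp add: padic_abs_one)
  then have "padic_abs p (- 1) = 1" using padic_abs_nonneg[of "- 1"] by (auto simp: square_eq_1_iff)
  then show ?thesis using padic_abs_mult[of "- 1" x] by simp
qed

text \<open>Over a common denominator the ultrametric inequality says that a power of
  \<open>p\<close> dividing two numerators divides their sum.\<close>

lemma padic_abs_add: "padic_abs p (x + y) \<le> max (padic_abs p x) (padic_abs p y)"
proof (cases "x = 0 \<or> y = 0 \<or> x + y = 0")
  case True
  then show ?thesis using padic_abs_zero padic_abs_nonneg[of x] by auto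
next
  case False
  obtain a b where ab: "b \<noteq> 0" "x = of_int a / of_int b" using rat_fraction by blast
  obtain c d where cd: "d \<noteq> 0" "y = of_int c / of_int d" using rat_fraction by blast
  define s t q where "s = a * d" and "t = c * b" and "q = b * d"
  have q0: "q \<noteq> 0" using ab cd by (simp add: q_def)
  have xs: "x = of_int s / of_int q" and yt: "y = of_int t / of_int q"
    using ab cd by (simp_all add: s_def t_def q_def)
  have xy: "x + y = of_int (s + t) / of_int q" by (simp add: xs yt add_divide_distrib)
  have s0: "s \<noteq> 0" and t0: "t \<noteq> 0" and st0: "s + t \<noteq> 0" using False xs yt xy by auto
  define k where "k = min (multiplicity (int p) s) (multiplicity (int p) t)"
  have "int p ^ k dvd s" "int p ^ k dvd t" unfolding k_def by (intro multiplicity_dvd'; simp)+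
  then have "int p ^ k dvd s + t" by simp
  moreover have "\<not> is_unit (int p)" using p by (metis not_prime_unit prime_int_nat_transfer nat_int prime_nat_int_transfer)
  ultimately have k: "k \<le> multiplicity (int p) (s + t)" using st0 by (intro multiplicity_geI)
  have "padic_abs p (x + y) = real p powi (int (multiplicity (int p) q) - int (multiplicity (int p) (s + t)))"
    unfolding xy by (rule padic_abs_fraction[OF st0 q0])
  also have "\<dots> \<le> real p powi (int (multiplicity (int p) q) - int k)"
    using k p_gt_1 by (intro power_int_increasing) auto
  finally have "padic_abs p (x + y) \<le> real p powi (int (multiplicity (int p) q) - int k)" .
  moreover have "real p powi (int (multiplicity (int p) q) - int k) = padic_abs p x \<or>
      real p powi (int (multiplicity (int p) q) - int k) = padic_abs p y"
    unfolding xs yt padic_abs_fraction[OF s0 q0] padic_abs_fraction[OF t0 q0] k_def by (auto simp: min_def)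
  ultimately show ?thesis by (auto simp: le_max_iff_disj)
qed

lemma padic_abs_add_le: "padic_abs p x \<le> c \<Longrightarrow> padic_abs p y \<le> c \<Longrightarrow> padic_abs p (x + y) \<le> c"
  using padic_abs_add[of x y] by auto

lemma padic_abs_add_less: "padic_abs p x < c \<Longrightarrow> padic_abs p y < c \<Longrightarrow> padic_abs p (x + y) < c"
  using padic_abs_add[of x y] by auto

lemma padic_abs_p: "padic_abs p (of_nat p) < 1"
proof -
  have "multiplicity (int p) (int p) = 1" using p by (intro multiplicity_self) (auto simp: prime_gt_0_nat not_prime_1 dest: prime_gt_1_nat)
  then have "padic_abs p (of_nat p) = real p powi (- 1)"
    using padic_abs_fraction[of "int p" 1] p by (simp add: prime_gt_0_nat)
  then have "padic_abs p (of_nat p) = inverse (real p)" by (simp add: power_int_minus)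
  then show ?thesis using p_gt_1 by (simp add: inverse_less_1_iff)
qed

section \<open>Cauchy sequences and null sequences of rationals\<close>

lemma padic_Cauchy_const: "padic_Cauchy p (\<lambda>_. c)"
  unfolding padic_Cauchy_def by (simp add: padic_abs_zero)

lemma padic_Cauchy_add:
  assumes "padic_Cauchy p s" "padic_Cauchy p t"
  shows "padic_Cauchy p (\<lambda>n. s n + t n)"
  unfolding padic_Cauchy_def
proof (intro allI impI)
  fix \<epsilon> :: real assume "\<epsilon> > 0"
  then obtain M M' where M: "\<forall>m\<ge>M. \<forall>n\<ge>M. padic_abs p (s m - s n) < \<epsilon>"
    and M': "\<forall>m\<ge>M'. \<forall>n\<ge>M'. padic_abs p (t m - t n) < \<epsilon>" using assms unfolding padic_Cauchy_def by blast
  have "padic_abs p (s m + t m - (s n + t n)) < \<epsilon>" if "m \<ge> max M M'" "n \<ge> max M M'" for m n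
  proof -
    have "s m + t m - (s n + t n) = (s m - s n) + (t m - t n)" by simp
    then show ?thesis using padic_abs_add_less M M' that by (metis max.bounded_iff)
  qed
  then show "\<exists>M. \<forall>m\<ge>M. \<forall>n\<ge>M. padic_abs p (s m + t m - (s n + t n)) < \<epsilon>" by blast
qed

lemma padic_Cauchy_bounded:
  assumes "padic_Cauchy p s"
  shows "\<exists>c>0. \<forall>n. padic_abs p (s n) \<le> c"
proof -
  obtain M where M: "\<forall>m\<ge>M. \<forall>n\<ge>M. padic_abs p (s m - s n) < 1"
    using assms unfolding padic_Cauchy_def by (meson zero_less_one)
  define c where "c = Max (insert 1 ((\<lambda>n. padic_abs p (s n)) ` {..M}))"
  have c: "1 \<le> c" "\<And>n. n \<le> M \<Longrightarrow> padic_abs p (s n) \<le> c"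
    unfolding c_def by (rule Max_ge, simp, simp)+
  have "padic_abs p (s n) \<le> c" for n
  proof (cases "n \<le> M")
    case False
    then have "padic_abs p (s n - s M) \<le> c" using M c(1) by (metis le_trans less_imp_le nat_le_linear order_refl order_trans)
    then have "padic_abs p ((s n - s M) + s M) \<le> c" using c(2)[of M] by (intro padic_abs_add_le) simp_all
    then show ?thesis by simp
  qed (rule c(2))
  then show ?thesis using c(1) by (intro exI[of _ c]) auto
qed

lemma padic_Cauchy_mult:
  assumes s: "padic_Cauchy p s" and t: "padic_Cauchy p t"
  shows "padic_Cauchy p (\<lambda>n. s n * t n)"
  unfolding padic_Cauchy_def
proof (intro allI impI)
  fix \<epsilon> :: real assume e: "\<epsilon> > 0"
  obtain c where c: "c > 0" "\<And>n. padic_abs p (s n) \<le> c" using padic_Cauchy_bounded[OF s] by blast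
  obtain d where d: "d > 0" "\<And>n. padic_abs p (t n) \<le> d" using padic_Cauchy_bounded[OF t] by blast
  have "\<epsilon> / d > 0" "\<epsilon> / c > 0" using e c d by simp_all
  then obtain M M' where M: "\<forall>m\<ge>M. \<forall>n\<ge>M. padic_abs p (s m - s n) < \<epsilon> / d"
    and M': "\<forall>m\<ge>M'. \<forall>n\<ge>M'. padic_abs p (t m - t n) < \<epsilon> / c" using s t unfolding padic_Cauchy_def by blast
  have "padic_abs p (s m * t m - s n * t n) < \<epsilon>" if mn: "m \<ge> max M M'" "n \<ge> max M M'" for m n
  proof -
    have "padic_abs p ((s m - s n) * t m) < \<epsilon>"
    proof -
      have "padic_abs p ((s m - s n) * t m) \<le> padic_abs p (s m - s n) * d"
        unfolding padic_abs_mult using d by (intro mult_left_mono padic_abs_nonneg)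
      also have "\<dots> < \<epsilon> / d * d" using M mn d(1) by (intro mult_strict_right_mono) auto
      finally show ?thesis using d(1) by simp
    qed
    moreover have "padic_abs p (s n * (t m - t n)) < \<epsilon>"
    proof -
      have "padic_abs p (s n * (t m - t n)) \<le> c * padic_abs p (t m - t n)"
        unfolding padic_abs_mult using c by (intro mult_right_mono padic_abs_nonneg)
      also have "\<dots> < c * (\<epsilon> / c)" using M' mn c(1) by (intro mult_strict_left_mono) auto
      finally show ?thesis using c(1) by simp
    qed
    ultimately have "padic_abs p ((s m - s n) * t m + s n * (t m - t n)) < \<epsilon>" by (rule padic_abs_add_less)
    then show ?thesis by (simp add: algebra_simps)
  qed
  then show "\<exists>M. \<forall>m\<ge>M. \<forall>n\<ge>M. padic_abs p (s m * t m - s n * t n) < \<epsilon>" by blast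
qed

lemma padic_Cauchy_uminus: "padic_Cauchy p s \<Longrightarrow> padic_Cauchy p (\<lambda>n. - s n)"
  using padic_Cauchy_mult[OF padic_Cauchy_const[of "- 1"]] by simp

lemma padic_Cauchy_cring: "cring (padic_Cauchy_ring p)"
proof (rule cringI)
  show "abelian_group (padic_Cauchy_ring p)"
  proof (rule abelian_groupI)
    fix s assume "s \<in> carrier (padic_Cauchy_ring p)"
    then show "\<exists>t\<in>carrier (padic_Cauchy_ring p). t \<oplus>\<^bsub>padic_Cauchy_ring p\<^esub> s = \<zero>\<^bsub>padic_Cauchy_ring p\<^esub>"
      using padic_Cauchy_uminus by (intro bexI[of _ "\<lambda>n. - s n"]) (auto simp: padic_Cauchy_ring_def)
  qed (auto simp: padic_Cauchy_ring_def padic_Cauchy_add padic_Cauchy_const fun_eq_iff)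
  show "comm_monoid (padic_Cauchy_ring p)"
    by (rule comm_monoidI) (auto simp: padic_Cauchy_ring_def padic_Cauchy_mult padic_Cauchy_const fun_eq_iff)
qed (auto simp: padic_Cauchy_ring_def fun_eq_iff distrib_right)

lemma padic_null_iff: "s \<in> padic_null p \<longleftrightarrow> (\<forall>\<epsilon>>0. \<exists>M. \<forall>n\<ge>M. padic_abs p (s n) < \<epsilon>)"
  by (simp add: padic_null_def LIMSEQ_iff padic_abs_nonneg)

lemma padic_null_add:
  assumes "s \<in> padic_null p" "t \<in> padic_null p"
  shows "(\<lambda>n. s n + t n) \<in> padic_null p"
  unfolding padic_null_iff
proof (intro allI impI)
  fix \<epsilon> :: real assume "\<epsilon> > 0"
  then obtain M M' where "\<forall>n\<ge>M. padic_abs p (s n) < \<epsilon>" "\<forall>n\<ge>M'. padic_abs p (t n) < \<epsilon>"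
    using assms unfolding padic_null_iff by blast
  then have "\<forall>n\<ge>max M M'. padic_abs p (s n + t n) < \<epsilon>" using padic_abs_add_less by simp
  then show "\<exists>M. \<forall>n\<ge>M. padic_abs p (s n + t n) < \<epsilon>" by blast
qed

lemma padic_null_mult:
  assumes s: "padic_Cauchy p s" and t: "t \<in> padic_null p"
  shows "(\<lambda>n. s n * t n) \<in> padic_null p"
  unfolding padic_null_iff
proof (intro allI impI)
  fix \<epsilon> :: real assume e: "\<epsilon> > 0"
  obtain c where c: "c > 0" "\<And>n. padic_abs p (s n) \<le> c" using padic_Cauchy_bounded[OF s] by blast
  have "\<epsilon> / c > 0" using e c by simp
  then obtain M where M: "\<forall>n\<ge>M. padic_abs p (t n) < \<epsilon> / c" using t unfolding padic_null_iff by blast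
  have "padic_abs p (s n * t n) < \<epsilon>" if "n \<ge> M" for n
  proof -
    have "padic_abs p (s n * t n) \<le> c * padic_abs p (t n)"
      unfolding padic_abs_mult using c by (intro mult_right_mono padic_abs_nonneg)
    also have "\<dots> < c * (\<epsilon> / c)" using M that c(1) by (intro mult_strict_left_mono) auto
    finally show ?thesis using c(1) by simp
  qed
  then show "\<exists>M. \<forall>n\<ge>M. padic_abs p (s n * t n) < \<epsilon>" by blast
qed

lemma padic_null_Cauchy:
  assumes "s \<in> padic_null p"
  shows "padic_Cauchy p s"
  unfolding padic_Cauchy_def
proof (intro allI impI)
  fix \<epsilon> :: real assume "\<epsilon> > 0"
  then obtain M where M: "\<forall>n\<ge>M. padic_abs p (s n) < \<epsilon>" using assms unfolding padic_null_iff by blast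
  have "padic_abs p (s m - s n) < \<epsilon>" if "m \<ge> M" "n \<ge> M" for m n
    using padic_abs_add_less[of "s m" \<epsilon> "- s n"] M that by (simp add: padic_abs_uminus)
  then show "\<exists>M. \<forall>m\<ge>M. \<forall>n\<ge>M. padic_abs p (s m - s n) < \<epsilon>" by blast
qed

lemma padic_null_ideal: "ideal (padic_null p) (padic_Cauchy_ring p)"
proof (rule idealI)
  interpret C: cring "padic_Cauchy_ring p" by (rule padic_Cauchy_cring)
  show "ring (padic_Cauchy_ring p)" by (rule C.ring_axioms)
  have zero: "(\<lambda>n. 0) \<in> padic_null p" by (simp add: padic_null_iff padic_abs_zero)
  show "subgroup (padic_null p) (add_monoid (padic_Cauchy_ring p))"
  proof (rule C.add.subgroupI)
    show "padic_null p \<subseteq> carrier (padic_Cauchy_ring p)"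
      using padic_null_Cauchy by (auto simp: padic_Cauchy_ring_def)
    show "padic_null p \<noteq> {}" using zero by blast
    fix s assume s: "s \<in> padic_null p"
    have "(\<lambda>n. - s n) \<in> padic_null p" using padic_null_mult[OF padic_Cauchy_const[of "- 1"] s] by simp
    moreover have "\<ominus>\<^bsub>padic_Cauchy_ring p\<^esub> s = (\<lambda>n. - s n)"
      using padic_null_Cauchy[OF s] padic_Cauchy_uminus[OF padic_null_Cauchy[OF s]]
      by (intro C.minus_equality) (auto simp: padic_Cauchy_ring_def fun_eq_iff)
    ultimately show "\<ominus>\<^bsub>padic_Cauchy_ring p\<^esub> s \<in> padic_null p" by simp
    fix t assume "t \<in> padic_null p"
    then show "s \<oplus>\<^bsub>padic_Cauchy_ring p\<^esub> t \<in> padic_null p"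
      using padic_null_add[OF s] by (simp add: padic_Cauchy_ring_def)
  qed
  fix t s assume t: "t \<in> padic_null p" and s: "s \<in> carrier (padic_Cauchy_ring p)"
  then have "(\<lambda>n. s n * t n) \<in> padic_null p" using padic_null_mult by (simp add: padic_Cauchy_ring_def)
  then show "s \<otimes>\<^bsub>padic_Cauchy_ring p\<^esub> t \<in> padic_null p" "t \<otimes>\<^bsub>padic_Cauchy_ring p\<^esub> s \<in> padic_null p"
    by (simp_all add: padic_Cauchy_ring_def mult.commute)
qed

text \<open>The homomorphism \<open>h\<close> of the definition of a p-adic ring is best studied on Cauchy sequences.\<close>

lemma padic_integers_lift:
  fixes K :: "'r ring"
  assumes h: "h \<in> ring_hom (padic_field p) K"
  obtains g where "g \<in> ring_hom (padic_Cauchy_ring p) K" "h ` padic_integers p = g ` integral_sequences p"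
proof -
  define C where "C = padic_Cauchy_ring p"
  define I where "I = padic_null p"
  interpret I: ideal I C unfolding I_def C_def by (rule padic_null_ideal)
  define g where "g s = h (I +>\<^bsub>C\<^esub> s)" for s
  have hQ: "h \<in> ring_hom (C Quot I) K" using h by (simp add: padic_field_def C_def I_def)
  have "g = h \<circ> (+>\<^bsub>C\<^esub>) I" by (simp add: g_def fun_eq_iff)
  then have "g \<in> ring_hom C K" using ring_hom_trans[OF I.rcos_ring_hom hQ] by simp
  moreover have "h ` padic_integers p = g ` integral_sequences p"
  proof (intro equalityI subsetI)
    fix z assume "z \<in> h ` padic_integers p"
    then obtain S s where S: "S \<in> carrier (C Quot I)" "s \<in> S" "\<forall>n. padic_abs p (s n) \<le> 1" "z = h S"
      unfolding padic_integers_def padic_field_def C_def I_def by blast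
    obtain t where t: "t \<in> carrier C" "S = I +>\<^bsub>C\<^esub> t" using S(1) by (auto simp: FactRing_def A_RCOSETS_def')
    have "S = I +>\<^bsub>C\<^esub> s" using I.a_repr_independence'[of s t] S(2) t by simp
    moreover have "s \<in> carrier C"
      using S(2) I.a_r_coset_subset_G[OF I.a_subset t(1)] unfolding t(2) by (rule subsetD[rotated])
    ultimately show "z \<in> g ` integral_sequences p"
      using S(3,4) by (auto simp: g_def integral_sequences_def C_def padic_Cauchy_ring_def)
  next
    fix z assume "z \<in> g ` integral_sequences p"
    then obtain s where s: "s \<in> carrier C" "\<forall>n. padic_abs p (s n) \<le> 1" "z = g s"
      by (auto simp: integral_sequences_def C_def padic_Cauchy_ring_def)
    have "s \<in> I +>\<^bsub>C\<^esub> s" by (rule I.a_rcos_self[OF s(1)])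
    moreover have "I +>\<^bsub>C\<^esub> s \<in> carrier (C Quot I)" using s(1) by (auto simp: FactRing_def A_RCOSETS_def')
    ultimately show "z \<in> h ` padic_integers p"
      using s unfolding padic_integers_def padic_field_def g_def C_def I_def by blast
  qed
  ultimately show ?thesis using that by (simp add: C_def)
qed

text \<open>By the ultrametric inequality every term of \<open>1 - p s\<close> has absolute value
  \<open>1\<close>, so termwise inversion preserves distances. This is why \<open>p\<close> has no
  inverse among the p-adic integers.\<close>

lemma one_minus_p_invertible:
  assumes s: "s \<in> integral_sequences p"
  shows "padic_Cauchy p (\<lambda>n. inverse (1 - of_nat p * s n))" "\<And>n. 1 - of_nat p * s n \<noteq> 0"
proof -
  define t where "t n = 1 - of_nat p * s n" for n
  have ps: "padic_abs p (of_nat p * s n) < 1" for n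
  proof -
    have "padic_abs p (of_nat p * s n) \<le> padic_abs p (of_nat p) * 1"
      unfolding padic_abs_mult using s by (intro mult_left_mono padic_abs_nonneg) (simp add: integral_sequences_def)
    then show ?thesis using padic_abs_p by simp
  qed
  have t1: "padic_abs p (t n) = 1" for n
  proof (rule antisym)
    have "padic_abs p (1 + - (of_nat p * s n)) \<le> 1"
      using ps[of n] by (intro padic_abs_add_le) (simp_all add: padic_abs_one padic_abs_uminus)
    then show "padic_abs p (t n) \<le> 1" by (simp add: t_def)
    show "padic_abs p (t n) \<ge> 1"
    proof (rule ccontr)
      assume "\<not> padic_abs p (t n) \<ge> 1"
      then have "padic_abs p (t n + of_nat p * s n) < 1" using ps[of n] by (intro padic_abs_add_less) simp_all
      then show False by (simp add: t_def padic_abs_one)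
    qed
  qed
  then have t0: "t n \<noteq> 0" for n using padic_abs_zero by (metis zero_neq_one)
  then show "\<And>n. 1 - of_nat p * s n \<noteq> 0" by (simp add: t_def)
  have tC: "padic_Cauchy p t"
    unfolding t_def
    using padic_Cauchy_add[OF padic_Cauchy_const[of 1] padic_Cauchy_mult[OF padic_Cauchy_const[of "- of_nat p"], of s]] s
    by (simp add: integral_sequences_def)
  have inv1: "padic_abs p (inverse (t n)) = 1" for n
    using padic_abs_mult[of "t n" "inverse (t n)"] t1[of n] t0[of n] padic_abs_one by simp
  have "padic_abs p (inverse (t m) - inverse (t n)) = padic_abs p (t m - t n)" for m n
  proof -
    have "inverse (t m) - inverse (t n) = inverse (t m) * (- (t m - t n)) * inverse (t n)"
      using t0[of m] t0[of n] by (simp add: field_simps)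
    then show ?thesis by (simp only: padic_abs_mult inv1 padic_abs_uminus mult_1 mult_1_right)
  qed
  then have "padic_Cauchy p (\<lambda>n. inverse (t n))" using tC unfolding padic_Cauchy_def by simp
  then show "padic_Cauchy p (\<lambda>n. inverse (1 - of_nat p * s n))" by (simp add: t_def)
qed

end

section \<open>Group algebras as spaces of functions\<close>

lemma sum_fun_apply: "(\<Sum>i\<in>I. f i) x = (\<Sum>i\<in>I. f i x)"
  by (induction I rule: infinite_finite_induct) simp_all

locale group_functions = padic_valuation_ring F e A p + group G
  for F :: "'k :: comm_ring_1 set" and e A p and G :: "('g, 'm) monoid_scheme" (structure) +
  assumes finite_G: "finite (carrier G)"
begin

text \<open>With \<open>S\<close> one of \<open>F\<close>, \<open>A\<close>, \<open>nonunits\<close>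
  this is the group algebra over \<open>F\<close>, over \<open>A\<close>, and its ideal generated by
  the maximal ideal. The value \<open>0\<close> outside the carrier makes equality of functions on
  the whole type the right equality, so the pointwise operations of the type class can be
  used.\<close>

definition fspace :: "'k set \<Rightarrow> ('g \<Rightarrow> 'k) set" where
  "fspace S = {x. (\<forall>g\<in>carrier G. x g \<in> S) \<and> (\<forall>g. g \<notin> carrier G \<longrightarrow> x g = 0)}"

definition conv :: "('g \<Rightarrow> 'k) \<Rightarrow> ('g \<Rightarrow> 'k) \<Rightarrow> 'g \<Rightarrow> 'k" (infixl \<open>\<star>\<close> 70) where
  "x \<star> y = (\<lambda>g. if g \<in> carrier G then \<Sum>h\<in>carrier G. x h * y (inv h \<otimes> g) else 0)"

text \<open>Left multiplication by the group element \<open>h\<close> in the group algebra, as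
  \<open>ind_singleton_conv\<close> shows.\<close>

definition translate :: "'g \<Rightarrow> ('g \<Rightarrow> 'k) \<Rightarrow> 'g \<Rightarrow> 'k" where
  "translate h x = (\<lambda>g. if g \<in> carrier G then x (inv h \<otimes> g) else 0)"

definition ind :: "'g set \<Rightarrow> 'g \<Rightarrow> 'k" where
  "ind S = (\<lambda>g. if g \<in> S then e else 0)"

definition class_function :: "('g \<Rightarrow> 'k) \<Rightarrow> bool" where
  "class_function u \<longleftrightarrow> (\<forall>h\<in>carrier G. \<forall>g\<in>carrier G. u (h \<otimes> g \<otimes> inv h) = u g)"

lemma class_functionD:
  "class_function u \<Longrightarrow> h \<in> carrier G \<Longrightarrow> g \<in> carrier G \<Longrightarrow> u (h \<otimes> g \<otimes> inv h) = u g"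
  by (simp add: class_function_def)

lemma fspaceI:
  "(\<And>g. g \<in> carrier G \<Longrightarrow> x g \<in> S) \<Longrightarrow> (\<And>g. g \<notin> carrier G \<Longrightarrow> x g = 0) \<Longrightarrow> x \<in> fspace S"
  by (simp add: fspace_def)

lemma fspace_apply: "x \<in> fspace S \<Longrightarrow> g \<in> carrier G \<Longrightarrow> x g \<in> S"
  by (simp add: fspace_def)

lemma fspace_outside: "x \<in> fspace S \<Longrightarrow> g \<notin> carrier G \<Longrightarrow> x g = 0"
  by (simp add: fspace_def)

lemma fspace_eqI:
  assumes "x \<in> fspace S" "y \<in> fspace S'" "\<And>g. g \<in> carrier G \<Longrightarrow> x g = y g"
  shows "x = y"
proof
  fix g show "x g = y g"
    using assms(3) fspace_outside[OF assms(1)] fspace_outside[OF assms(2)]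
    by (cases "g \<in> carrier G") simp_all
qed

lemma fspace_A_F: "x \<in> fspace A \<Longrightarrow> x \<in> fspace F"
  using A_F by (auto simp: fspace_def)

lemma fspace_nonunits_A: "x \<in> fspace nonunits \<Longrightarrow> x \<in> fspace A"
  using nonunits_A by (auto simp: fspace_def)

lemma fspace_zero:
  "0 \<in> fspace F" "0 \<in> fspace A" "0 \<in> fspace nonunits"
  by (auto simp: fspace_def F_zero A_zero nonunits_zero)

lemma fspace_add:
  "x \<in> fspace F \<Longrightarrow> y \<in> fspace F \<Longrightarrow> x + y \<in> fspace F"
  "x \<in> fspace A \<Longrightarrow> y \<in> fspace A \<Longrightarrow> x + y \<in> fspace A"
  "x \<in> fspace nonunits \<Longrightarrow> y \<in> fspace nonunits \<Longrightarrow> x + y \<in> fspace nonunits"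
  by (auto simp: fspace_def F_add A_add nonunits_add)

lemma fspace_uminus:
  "x \<in> fspace F \<Longrightarrow> - x \<in> fspace F"
  "x \<in> fspace A \<Longrightarrow> - x \<in> fspace A"
  "x \<in> fspace nonunits \<Longrightarrow> - x \<in> fspace nonunits"
  by (auto simp: fspace_def F_uminus A_uminus nonunits_uminus fun_Compl_def)

lemma fspace_diff:
  "x \<in> fspace F \<Longrightarrow> y \<in> fspace F \<Longrightarrow> x - y \<in> fspace F"
  "x \<in> fspace A \<Longrightarrow> y \<in> fspace A \<Longrightarrow> x - y \<in> fspace A"
  "x \<in> fspace nonunits \<Longrightarrow> y \<in> fspace nonunits \<Longrightarrow> x - y \<in> fspace nonunits"
  by (auto simp: fspace_def F_diff A_diff nonunits_diff)

lemma fspace_of_nat: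
  "x \<in> fspace F \<Longrightarrow> of_nat n * x \<in> fspace F"
  "x \<in> fspace A \<Longrightarrow> of_nat n * x \<in> fspace A"
  "x \<in> fspace A \<Longrightarrow> of_nat p * x \<in> fspace nonunits"
  by (auto simp: fspace_def F_of_nat_mult A_of_nat_mult p_mult_nonunit)

lemma fspace_scale:
  "a \<in> F \<Longrightarrow> x \<in> fspace F \<Longrightarrow> (\<lambda>_. a) * x \<in> fspace F"
  "a \<in> A \<Longrightarrow> x \<in> fspace A \<Longrightarrow> (\<lambda>_. a) * x \<in> fspace A"
  "a \<in> nonunits \<Longrightarrow> x \<in> fspace A \<Longrightarrow> (\<lambda>_. a) * x \<in> fspace nonunits"
  by (auto simp: fspace_def F_mult A_mult nonunits_mult)

lemma fspace_sum:
  "(\<And>i. i \<in> I \<Longrightarrow> x i \<in> fspace F) \<Longrightarrow> (\<Sum>i\<in>I. x i) \<in> fspace F"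
  "(\<And>i. i \<in> I \<Longrightarrow> x i \<in> fspace A) \<Longrightarrow> (\<Sum>i\<in>I. x i) \<in> fspace A"
  "(\<And>i. i \<in> I \<Longrightarrow> x i \<in> fspace nonunits) \<Longrightarrow> (\<Sum>i\<in>I. x i) \<in> fspace nonunits"
  by (rule sum_in_set[OF fspace_zero(1) fspace_add(1)]
      sum_in_set[OF fspace_zero(2) fspace_add(2)]
      sum_in_set[OF fspace_zero(3) fspace_add(3)]; simp)+

lemma fspace_translate: "h \<in> carrier G \<Longrightarrow> x \<in> fspace S \<Longrightarrow> translate h x \<in> fspace S"
  by (auto simp: fspace_def translate_def)

lemma fspace_ind: "S \<subseteq> carrier G \<Longrightarrow> ind S \<in> fspace A"
  by (auto simp: fspace_def ind_def A_zero A_unit)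

lemma fspace_conv:
  "x \<in> fspace F \<Longrightarrow> y \<in> fspace F \<Longrightarrow> x \<star> y \<in> fspace F"
  "x \<in> fspace A \<Longrightarrow> y \<in> fspace A \<Longrightarrow> x \<star> y \<in> fspace A"
  "x \<in> fspace nonunits \<Longrightarrow> y \<in> fspace A \<Longrightarrow> x \<star> y \<in> fspace nonunits"
  "x \<in> fspace A \<Longrightarrow> y \<in> fspace nonunits \<Longrightarrow> x \<star> y \<in> fspace nonunits"
  subgoal by (auto simp: fspace_def conv_def intro!: F_sum F_mult)
  subgoal by (auto simp: fspace_def conv_def intro!: A_sum A_mult)
  subgoal by (auto simp: fspace_def conv_def intro!: nonunits_sum nonunits_mult)
  subgoal by (auto simp: fspace_def conv_def intro!: nonunits_sum nonunits_mult2)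
  done

lemma p_cancel_fspace:
  assumes "x \<in> fspace F" "y \<in> fspace F" "of_nat p * x = of_nat p * y"
  shows "x = y"
proof (rule fspace_eqI[OF assms(1,2)])
  fix g assume "g \<in> carrier G"
  moreover have "of_nat p * x g = of_nat p * y g"
    using fun_cong[OF assms(3), of g] by simp
  ultimately show "x g = y g" using p_cancel assms fspace_apply by blast
qed

section \<open>Convolution and left translation\<close>

lemma mult_inv_cancel:
  "k \<in> carrier G \<Longrightarrow> y \<in> carrier G \<Longrightarrow> k \<otimes> (inv k \<otimes> y) = y"
  "k \<in> carrier G \<Longrightarrow> y \<in> carrier G \<Longrightarrow> inv k \<otimes> (k \<otimes> y) = y"
  by (simp_all add: m_assoc[symmetric])

lemma bij_left_mult:
  assumes "k \<in> carrier G"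
  shows "bij_betw (\<lambda>h. k \<otimes> h) (carrier G) (carrier G)"
  by (rule bij_betwI[where g = "\<lambda>h. inv k \<otimes> h"]) (use assms in \<open>auto simp: m_assoc[symmetric]\<close>)

lemma bij_conjugation:
  assumes "k \<in> carrier G"
  shows "bij_betw (\<lambda>h. k \<otimes> h \<otimes> inv k) (carrier G) (carrier G)"
  by (rule bij_betwI[where g = "\<lambda>h. inv k \<otimes> h \<otimes> k"])
    (use assms in \<open>auto simp: m_assoc mult_inv_cancel\<close>)

lemma sum_left_mult: "k \<in> carrier G \<Longrightarrow> (\<Sum>h\<in>carrier G. f (k \<otimes> h)) = (\<Sum>h\<in>carrier G. f h)"
  by (rule sum.reindex_bij_betw[OF bij_left_mult])

lemma sum_conjugation:
  "k \<in> carrier G \<Longrightarrow> (\<Sum>h\<in>carrier G. f (k \<otimes> h \<otimes> inv k)) = (\<Sum>h\<in>carrier G. f h)"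
  by (rule sum.reindex_bij_betw[OF bij_conjugation])

lemma conv_outside: "g \<notin> carrier G \<Longrightarrow> (x \<star> y) g = 0"
  by (simp add: conv_def)

lemma translate_outside: "g \<notin> carrier G \<Longrightarrow> translate h x g = 0"
  by (simp add: translate_def)

lemma conv_apply: "g \<in> carrier G \<Longrightarrow> (x \<star> y) g = (\<Sum>h\<in>carrier G. x h * y (inv h \<otimes> g))"
  by (simp add: conv_def)

lemma translate_apply: "g \<in> carrier G \<Longrightarrow> translate h x g = x (inv h \<otimes> g)"
  by (simp add: translate_def)

lemma conv_assoc: "x \<star> y \<star> z = x \<star> (y \<star> z)"
proof
  fix g
  show "(x \<star> y \<star> z) g = (x \<star> (y \<star> z)) g"
  proof (cases "g \<in> carrier G")
    case g: True
    have "(x \<star> y \<star> z) g = (\<Sum>h\<in>carrier G. \<Sum>k\<in>carrier G. x k * y (inv k \<otimes> h) * z (inv h \<otimes> g))"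
      using g by (simp add: conv_apply sum_distrib_right)
    also have "\<dots> = (\<Sum>k\<in>carrier G. \<Sum>h\<in>carrier G. x k * y (inv k \<otimes> h) * z (inv h \<otimes> g))"
      by (rule sum.swap)
    also have "\<dots> = (\<Sum>k\<in>carrier G. x k * (y \<star> z) (inv k \<otimes> g))"
    proof (rule sum.cong[OF refl])
      fix k assume k: "k \<in> carrier G"
      have "(\<Sum>h\<in>carrier G. x k * y (inv k \<otimes> h) * z (inv h \<otimes> g)) =
          (\<Sum>h\<in>carrier G. x k * y (inv k \<otimes> (k \<otimes> h)) * z (inv (k \<otimes> h) \<otimes> g))"
        by (rule sum_left_mult[OF k, symmetric])
      also have "\<dots> = (\<Sum>h\<in>carrier G. x k * (y h * z (inv h \<otimes> (inv k \<otimes> g))))"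
        using k g by (intro sum.cong[OF refl])
          (simp add: m_assoc[symmetric] inv_mult_group mult.assoc)
      finally show "(\<Sum>h\<in>carrier G. x k * y (inv k \<otimes> h) * z (inv h \<otimes> g)) =
          x k * (y \<star> z) (inv k \<otimes> g)"
        using k g by (simp add: conv_apply sum_distrib_left)
    qed
    finally show ?thesis using g by (simp add: conv_apply)
  qed (simp add: conv_outside)
qed

lemma conv_add: "(x + y) \<star> z = x \<star> z + y \<star> z" "z \<star> (x + y) = z \<star> x + z \<star> y"
  by (auto simp: conv_def fun_eq_iff sum.distrib distrib_left distrib_right)

lemma conv_diff: "(x - y) \<star> z = x \<star> z - y \<star> z" "z \<star> (x - y) = z \<star> x - z \<star> y"
  by (auto simp: conv_def fun_eq_iff sum_subtractf left_diff_distrib right_diff_distrib)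

lemma conv_uminus: "(- x) \<star> z = - (x \<star> z)" "z \<star> (- x) = - (z \<star> x)"
  by (auto simp: conv_def fun_eq_iff sum_negf fun_Compl_def)

lemma conv_zero: "0 \<star> z = 0" "z \<star> 0 = 0"
  by (auto simp: conv_def fun_eq_iff)

lemma conv_of_nat: "(of_nat n * x) \<star> z = of_nat n * (x \<star> z)" "z \<star> (of_nat n * x) = of_nat n * (z \<star> x)"
  by (auto simp: conv_def fun_eq_iff sum_distrib_left ac_simps)

lemma conv_scale: "((\<lambda>_. a) * x) \<star> z = (\<lambda>_. a) * (x \<star> z)" "z \<star> ((\<lambda>_. a) * x) = (\<lambda>_. a) * (z \<star> x)"
  by (auto simp: conv_def fun_eq_iff sum_distrib_left ac_simps)

lemma conv_sum: "(\<Sum>i\<in>I. x i) \<star> z = (\<Sum>i\<in>I. x i \<star> z)" "z \<star> (\<Sum>i\<in>I. x i) = (\<Sum>i\<in>I. z \<star> x i)"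
  by (induction I rule: infinite_finite_induct) (simp_all add: conv_add conv_zero)

lemma translate_add: "translate h (x + y) = translate h x + translate h y"
  by (auto simp: translate_def fun_eq_iff)

lemma translate_diff: "translate h (x - y) = translate h x - translate h y"
  by (auto simp: translate_def fun_eq_iff)

lemma translate_uminus: "translate h (- x) = - translate h x"
  by (auto simp: translate_def fun_eq_iff fun_Compl_def)

lemma translate_zero: "translate h 0 = 0"
  by (auto simp: translate_def fun_eq_iff)

lemma translate_of_nat: "translate h (of_nat n * x) = of_nat n * translate h x"
  by (auto simp: translate_def fun_eq_iff)

lemma translate_scale: "translate h ((\<lambda>_. a) * x) = (\<lambda>_. a) * translate h x"
  by (auto simp: translate_def fun_eq_iff)

lemma translate_sum: "translate h (\<Sum>i\<in>I. x i) = (\<Sum>i\<in>I. translate h (x i))"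
  by (induction I rule: infinite_finite_induct)
    (simp_all only: sum.infinite sum.empty sum.insert translate_add translate_zero not_False_eq_True)

lemma translate_translate:
  assumes "h \<in> carrier G" "k \<in> carrier G"
  shows "translate h (translate k x) = translate (h \<otimes> k) x"
  using assms by (auto simp: translate_def fun_eq_iff inv_mult_group m_assoc)

lemma translate_one: "x \<in> fspace S \<Longrightarrow> translate \<one> x = x"
  by (auto simp: translate_def fun_eq_iff fspace_outside)

lemma translate_conv:
  assumes "h \<in> carrier G"
  shows "translate h x \<star> y = translate h (x \<star> y)"
proof
  fix g show "(translate h x \<star> y) g = translate h (x \<star> y) g"
  proof (cases "g \<in> carrier G")
    case g: True
    have "(translate h x \<star> y) g = (\<Sum>k\<in>carrier G. translate h x (h \<otimes> k) * y (inv (h \<otimes> k) \<otimes> g))"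
      unfolding conv_apply[OF g] by (rule sum_left_mult[OF assms, symmetric])
    also have "\<dots> = (\<Sum>k\<in>carrier G. x k * y (inv k \<otimes> (inv h \<otimes> g)))"
      using g assms by (intro sum.cong[OF refl])
        (simp add: translate_apply m_assoc[symmetric] inv_mult_group)
    finally show ?thesis using g assms by (simp add: translate_apply conv_apply)
  qed (simp add: conv_outside translate_outside)
qed

text \<open>Class functions are central in the group algebra; in the sum this is the substitution of
  \<open>h k h^-1\<close> for \<open>k\<close>.\<close>

lemma conv_translate:
  assumes "class_function u" "h \<in> carrier G"
  shows "u \<star> translate h x = translate h (u \<star> x)"
proof
  fix g show "(u \<star> translate h x) g = translate h (u \<star> x) g"
  proof (cases "g \<in> carrier G")
    case g: True
    have "(u \<star> translate h x) g = (\<Sum>k\<in>carrier G. u (h \<otimes> k \<otimes> inv h) *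
        translate h x (inv (h \<otimes> k \<otimes> inv h) \<otimes> g))"
      unfolding conv_apply[OF g] by (rule sum_conjugation[OF assms(2), symmetric])
    also have "\<dots> = (\<Sum>k\<in>carrier G. u k * x (inv k \<otimes> (inv h \<otimes> g)))"
    proof (rule sum.cong[OF refl])
      fix k assume k: "k \<in> carrier G"
      have "inv h \<otimes> (inv (h \<otimes> k \<otimes> inv h) \<otimes> g) = inv k \<otimes> (inv h \<otimes> g)"
        using k g assms(2) by (simp add: inv_mult_group m_assoc[symmetric])
      then show "u (h \<otimes> k \<otimes> inv h) * translate h x (inv (h \<otimes> k \<otimes> inv h) \<otimes> g) =
          u k * x (inv k \<otimes> (inv h \<otimes> g))"
        using k g assms by (simp add: translate_apply class_functionD)
    qed
    finally show ?thesis using g assms by (simp add: translate_apply conv_apply)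
  qed (simp add: conv_outside translate_outside)
qed

lemma ind_conv_apply:
  assumes "S \<subseteq> carrier G" "g \<in> carrier G" "x \<in> fspace F"
  shows "(ind S \<star> x) g = (\<Sum>h\<in>S. x (inv h \<otimes> g))"
proof -
  have "(ind S \<star> x) g = (\<Sum>h\<in>carrier G. if h \<in> S then x (inv h \<otimes> g) else 0)"
    unfolding conv_apply[OF assms(2)]
    using assms F_unit_mult fspace_apply[OF assms(3)] by (intro sum.cong[OF refl]) (simp add: ind_def)
  also have "\<dots> = (\<Sum>h\<in>S. x (inv h \<otimes> g))"
    using assms(1) finite_G by (simp add: sum.If_cases Int_absorb1)
  finally show ?thesis .
qed

lemma ind_singleton_conv:
  assumes "h \<in> carrier G" "x \<in> fspace F"
  shows "ind {h} \<star> x = translate h x"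
proof
  fix g show "(ind {h} \<star> x) g = translate h x g"
    using assms ind_conv_apply[of "{h}" g x]
    by (cases "g \<in> carrier G") (simp_all add: conv_outside translate_def)
qed

lemma conv_ind_one:
  assumes "x \<in> fspace F"
  shows "x \<star> ind {\<one>} = x"
proof
  fix g show "(x \<star> ind {\<one>}) g = x g"
  proof (cases "g \<in> carrier G")
    case g: True
    have "(x \<star> ind {\<one>}) g = (\<Sum>h\<in>carrier G. if h = g then x g else 0)"
      unfolding conv_apply[OF g]
    proof (rule sum.cong[OF refl])
      fix h assume h: "h \<in> carrier G"
      have "inv h \<otimes> g = \<one> \<longleftrightarrow> h = g"
        using h g by (metis inv_equality inv_inv l_inv inv_closed)
      then show "x h * ind {\<one>} (inv h \<otimes> g) = (if h = g then x g else 0)"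
        using F_mult_unit fspace_apply[OF assms] g by (simp add: ind_def)
    qed
    then show ?thesis using g finite_G by simp
  qed (simp add: conv_outside fspace_outside[OF assms])
qed

lemma translate_ind:
  assumes "h \<in> carrier G" "S \<subseteq> carrier G"
  shows "translate h (ind S) = ind ((\<lambda>s. h \<otimes> s) ` S)"
proof
  fix g
  have "g \<in> (\<lambda>s. h \<otimes> s) ` S \<longleftrightarrow> g \<in> carrier G \<and> inv h \<otimes> g \<in> S"
  proof
    assume "g \<in> (\<lambda>s. h \<otimes> s) ` S"
    then obtain s where "s \<in> S" "g = h \<otimes> s" by blast
    then show "g \<in> carrier G \<and> inv h \<otimes> g \<in> S" using assms by (auto simp: m_assoc[symmetric])
  next
    assume g: "g \<in> carrier G \<and> inv h \<otimes> g \<in> S"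
    then have "g = h \<otimes> (inv h \<otimes> g)" using assms by (simp add: m_assoc[symmetric])
    then show "g \<in> (\<lambda>s. h \<otimes> s) ` S" using g by blast
  qed
  then show "translate h (ind S) g = ind ((\<lambda>s. h \<otimes> s) ` S) g"
    by (simp add: translate_def ind_def)
qed

lemma sum_conv:
  "(\<Sum>g\<in>carrier G. (x \<star> y) g) = (\<Sum>g\<in>carrier G. x g) * (\<Sum>g\<in>carrier G. y g)"
proof -
  have "(\<Sum>g\<in>carrier G. (x \<star> y) g) = (\<Sum>g\<in>carrier G. \<Sum>h\<in>carrier G. x h * y (inv h \<otimes> g))"
    by (simp add: conv_apply)
  also have "\<dots> = (\<Sum>h\<in>carrier G. \<Sum>g\<in>carrier G. x h * y (inv h \<otimes> g))"
    by (rule sum.swap)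
  also have "\<dots> = (\<Sum>h\<in>carrier G. x h * (\<Sum>g\<in>carrier G. y g))"
    by (intro sum.cong[OF refl]) (simp add: sum_distrib_left[symmetric] sum_left_mult)
  finally show ?thesis by (simp add: sum_distrib_right)
qed

lemma conv_conj:
  assumes u: "class_function u" and h: "h \<in> carrier G"
    and x: "\<And>g. g \<in> carrier G \<Longrightarrow> x (h \<otimes> g \<otimes> inv h) = x g" and g: "g \<in> carrier G"
  shows "(u \<star> x) (h \<otimes> g \<otimes> inv h) = (u \<star> x) g"
proof -
  have "(u \<star> x) (h \<otimes> g \<otimes> inv h) =
      (\<Sum>k\<in>carrier G. u (h \<otimes> k \<otimes> inv h) * x (inv (h \<otimes> k \<otimes> inv h) \<otimes> (h \<otimes> g \<otimes> inv h)))"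
    using h g by (simp add: conv_apply
      sum_conjugation[OF h, symmetric, where f = "\<lambda>k. u k * x (inv k \<otimes> (h \<otimes> g \<otimes> inv h))"])
  also have "\<dots> = (\<Sum>k\<in>carrier G. u k * x (inv k \<otimes> g))"
  proof (rule sum.cong[OF refl])
    fix k assume k: "k \<in> carrier G"
    have "inv (h \<otimes> k \<otimes> inv h) \<otimes> (h \<otimes> g \<otimes> inv h) = h \<otimes> (inv k \<otimes> g) \<otimes> inv h"
      using h g k by (simp add: inv_mult_group m_assoc mult_inv_cancel)
    then show "u (h \<otimes> k \<otimes> inv h) * x (inv (h \<otimes> k \<otimes> inv h) \<otimes> (h \<otimes> g \<otimes> inv h)) = u k * x (inv k \<otimes> g)"
      using h g k u x by (simp add: class_functionD)
  qed
  finally show ?thesis using g by (simp add: conv_apply)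
qed

lemma class_function_conv:
  assumes u: "class_function u" and v: "class_function v"
  shows "class_function (u \<star> v)"
  unfolding class_function_def
proof (intro ballI)
  fix h g assume h: "h \<in> carrier G" and g: "g \<in> carrier G"
  show "(u \<star> v) (h \<otimes> g \<otimes> inv h) = (u \<star> v) g"
    by (rule conv_conj[OF u h _ g]) (rule class_functionD[OF v h])
qed

subsection \<open>Coset representatives\<close>

text \<open>The choice depends on the coset alone, so equal cosets have equal representatives. The
  representative of \<open>M\<close> itself need not be the neutral element.\<close>

definition rep :: "'g set \<Rightarrow> 'g \<Rightarrow> 'g" where
  "rep M g = (SOME y. y \<in> M #> g)"

lemma rep_in:
  assumes "subgroup M G" "g \<in> carrier G"
  shows "rep M g \<in> M #> g"
  unfolding rep_def using rcos_self[OF assms(2,1)] by (rule someI)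

lemma rep_carrier: "subgroup M G \<Longrightarrow> g \<in> carrier G \<Longrightarrow> rep M g \<in> carrier G"
  using rep_in r_coset_subset_G subgroup.subset by blast

lemma rep_eq:
  assumes "subgroup M G" "g \<in> carrier G" "y \<in> M #> g"
  shows "rep M y = rep M g"
  using repr_independence[OF assms(3,2,1)] by (simp add: rep_def)

lemma rep_rep: "subgroup M G \<Longrightarrow> g \<in> carrier G \<Longrightarrow> rep M (rep M g) = rep M g"
  using rep_eq rep_in by blast

lemma rep_mult: "subgroup M G \<Longrightarrow> g \<in> carrier G \<Longrightarrow> h \<in> M \<Longrightarrow> rep M (h \<otimes> g) = rep M g"
  using rep_eq[of M g "h \<otimes> g"] by (auto simp: r_coset_def)

lemma rep_obtain:
  assumes "subgroup M G" "g \<in> carrier G"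
  obtains h where "h \<in> M" "rep M g = h \<otimes> g"
  using rep_in[OF assms] by (auto simp: r_coset_def)

lemma rep_obtain':
  assumes "subgroup M G" "g \<in> carrier G"
  obtains h where "h \<in> M" "g = h \<otimes> rep M g"
proof -
  interpret M: subgroup M G by fact
  obtain k where k: "k \<in> M" "rep M g = k \<otimes> g" using rep_obtain[OF assms] .
  then have "g = inv k \<otimes> rep M g" using assms by (simp add: m_assoc[symmetric])
  then show ?thesis using that k by blast
qed

lemma sum_cosets:
  assumes M: "subgroup M G"
  shows "(\<Sum>y\<in>carrier G. \<psi> y) = (\<Sum>r\<in>rep M ` carrier G. \<Sum>h\<in>M. \<psi> (h \<otimes> r))"
proof -
  interpret M: subgroup M G by fact
  have fin: "finite M" using finite_G M.subset finite_subset by blast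
  have "bij_betw (\<lambda>(r, h). h \<otimes> r) (rep M ` carrier G \<times> M) (carrier G)"
    unfolding bij_betw_def
  proof
    show "inj_on (\<lambda>(r, h). h \<otimes> r) (rep M ` carrier G \<times> M)"
    proof (rule inj_onI, clarify)
      fix g h g' h' assume a: "g \<in> carrier G" "g' \<in> carrier G" "h \<in> M" "h' \<in> M"
        "h \<otimes> rep M g = h' \<otimes> rep M g'"
      have c: "rep M g \<in> carrier G" "rep M g' \<in> carrier G" using a rep_carrier[OF M] by blast+
      have "rep M (h \<otimes> rep M g) = rep M g" "rep M (h' \<otimes> rep M g') = rep M g'"
        using a(1-4) c by (simp_all add: rep_mult[OF M] rep_rep[OF M])
      then have "rep M g = rep M g'" using a(5) by metis
      moreover from this have "h = h'" using a c right_cancel by (metis M.mem_carrier)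
      ultimately show "rep M g = rep M g' \<and> h = h'" ..
    qed
    show "(\<lambda>(r, h). h \<otimes> r) ` (rep M ` carrier G \<times> M) = carrier G"
    proof (intro equalityI subsetI)
      fix y assume "y \<in> (\<lambda>(r, h). h \<otimes> r) ` (rep M ` carrier G \<times> M)"
      then show "y \<in> carrier G" using rep_carrier[OF M] by auto
    next
      fix y assume y: "y \<in> carrier G"
      obtain h where "h \<in> M" "y = h \<otimes> rep M y" using rep_obtain'[OF M y] .
      then show "y \<in> (\<lambda>(r, h). h \<otimes> r) ` (rep M ` carrier G \<times> M)" using y by force
    qed
  qed
  from sum.reindex_bij_betw[OF this, of \<psi>]
  have "(\<Sum>y\<in>carrier G. \<psi> y) = (\<Sum>(r, h)\<in>rep M ` carrier G \<times> M. \<psi> (h \<otimes> r))"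
    by (simp add: case_prod_unfold)
  then show ?thesis by (simp add: sum.cartesian_product)
qed

text \<open>\<open>b\<close> is \<open>x\<close> cut down to the representatives. For
  \<open>J = {0}\<close> and for the maximal ideal this says that functions invariant under
  \<open>M\<close>, exactly or in reduction, are multiples of \<open>ind M\<close>.\<close>

lemma ind_conv_rep:
  assumes M: "subgroup M G" and x: "x \<in> fspace A"
    and inv: "\<And>h g. h \<in> M \<Longrightarrow> g \<in> carrier G \<Longrightarrow> x (h \<otimes> g) - x g \<in> J"
  obtains b where "b \<in> fspace A" "\<And>g. g \<in> carrier G \<Longrightarrow> (ind M \<star> b) g - x g \<in> J"
proof -
  interpret M: subgroup M G by fact
  have fin: "finite M" using finite_G M.subset finite_subset by blast
  define b where "b = (\<lambda>g. if g \<in> carrier G \<and> rep M g = g then x g else 0)"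
  have b: "b \<in> fspace A" using x A_zero by (auto simp: b_def fspace_def)
  moreover have "(ind M \<star> b) g - x g \<in> J" if g: "g \<in> carrier G" for g
  proof -
    obtain k where k: "k \<in> M" "rep M g = k \<otimes> g" using rep_obtain[OF M g] .
    have "(ind M \<star> b) g = (\<Sum>h\<in>M. b (inv h \<otimes> g))"
      using ind_conv_apply M.subset g fspace_A_F[OF b] by blast
    also have "\<dots> = (\<Sum>h\<in>M. if h = inv k then x (k \<otimes> g) else 0)"
    proof (rule sum.cong[OF refl])
      fix h assume h: "h \<in> M"
      have "rep M (inv h \<otimes> g) = k \<otimes> g" using rep_mult[OF M g, of "inv h"] h k by simp
      moreover have "k \<otimes> g = inv h \<otimes> g \<longleftrightarrow> h = inv k"
        using h k g by (metis M.mem_carrier inv_closed inv_inv right_cancel)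
      ultimately show "b (inv h \<otimes> g) = (if h = inv k then x (k \<otimes> g) else 0)"
        using h g k by (auto simp: b_def)
    qed
    also have "\<dots> = x (k \<otimes> g)" using k fin by simp
    finally show ?thesis using inv k g by simp
  qed
  ultimately show ?thesis using that by blast
qed

end

section \<open>Chains of normal subgroups of a p-group\<close>

locale p_constrained = group_functions F e A p G
  for F :: "'k :: comm_ring_1 set" and e A p and G :: "('g, 'm) monoid_scheme" (structure) +
  fixes N :: "'g set" and a :: nat
  assumes N_normal: "N \<lhd> G"
    and card_N: "card N = p ^ a"
    and centralizer_N: "x \<in> carrier G \<Longrightarrow> (\<And>n. n \<in> N \<Longrightarrow> x \<otimes> n = n \<otimes> x) \<Longrightarrow> x \<in> N"
begin

lemma N_subgroup: "subgroup N G"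
  using N_normal by (rule normal_imp_subgroup)

lemma N_carrier: "n \<in> N \<Longrightarrow> n \<in> carrier G"
  using N_subgroup by (rule subgroup.mem_carrier)

lemma N_finite: "finite N"
  by (rule finite_subset[OF subgroup.subset[OF N_subgroup] finite_G])

lemmas N_closed = subgroup.one_closed[OF N_subgroup] subgroup.m_inv_closed[OF N_subgroup]
  subgroup.m_closed[OF N_subgroup]

lemma N_conj: "g \<in> carrier G \<Longrightarrow> n \<in> N \<Longrightarrow> g \<otimes> n \<otimes> inv g \<in> N"
  by (rule normal.inv_op_closed2[OF N_normal])

lemma N_pow: "n \<in> N \<Longrightarrow> n [^] (i::nat) \<in> N"
  by (induction i) (auto simp: N_closed)

definition nsub :: "'g set \<Rightarrow> bool" where
  "nsub H \<longleftrightarrow> subgroup H G \<and> H \<subseteq> N \<and> (\<forall>n\<in>N. \<forall>h\<in>H. n \<otimes> h \<otimes> inv n \<in> H)"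

lemma nsubD:
  assumes "nsub H"
  shows "subgroup H G" "\<And>h. h \<in> H \<Longrightarrow> h \<in> N" "\<And>h. h \<in> H \<Longrightarrow> h \<in> carrier G" "\<one> \<in> H"
    "\<And>h. h \<in> H \<Longrightarrow> inv h \<in> H" "\<And>h k. h \<in> H \<Longrightarrow> k \<in> H \<Longrightarrow> h \<otimes> k \<in> H"
    "\<And>n h. n \<in> N \<Longrightarrow> h \<in> H \<Longrightarrow> n \<otimes> h \<otimes> inv n \<in> H"
    "\<And>n h. n \<in> N \<Longrightarrow> h \<in> H \<Longrightarrow> inv n \<otimes> h \<otimes> n \<in> H"
proof -
  show s: "subgroup H G" and N: "\<And>h. h \<in> H \<Longrightarrow> h \<in> N"
    and c: "\<And>n h. n \<in> N \<Longrightarrow> h \<in> H \<Longrightarrow> n \<otimes> h \<otimes> inv n \<in> H"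
    using assms unfolding nsub_def by blast+
  show "\<And>h. h \<in> H \<Longrightarrow> h \<in> carrier G" using N N_carrier by blast
  show "\<one> \<in> H" "\<And>h. h \<in> H \<Longrightarrow> inv h \<in> H" "\<And>h k. h \<in> H \<Longrightarrow> k \<in> H \<Longrightarrow> h \<otimes> k \<in> H"
    using subgroup.one_closed[OF s] subgroup.m_inv_closed[OF s] subgroup.m_closed[OF s] by simp_all
  show "inv n \<otimes> h \<otimes> n \<in> H" if n: "n \<in> N" and h: "h \<in> H" for n h
    using c[OF N_closed(2)[OF n] h] N_carrier[OF n] by simp
qed

lemma nsub_pow: "nsub H \<Longrightarrow> h \<in> H \<Longrightarrow> h [^] (i::nat) \<in> H"
  by (induction i) (auto simp: nsubD)

text \<open>The coset of \<open>m\<close> generates a central subgroup of order \<open>p\<close> in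
  \<open>N/H\<close>; commutators express this without forming the quotient.\<close>

definition central_step :: "'g set \<Rightarrow> 'g \<Rightarrow> bool" where
  "central_step H m \<longleftrightarrow> nsub H \<and> m \<in> N \<and> m \<notin> H \<and> m [^] p \<in> H \<and>
     (\<forall>n\<in>N. n \<otimes> m \<otimes> inv n \<otimes> inv m \<in> H)"

text \<open>The induction rests on the identity \<open>[n, q r] = [n, q] (q [n, r] q^-1)\<close>,
  whose factors lie in the normal subgroup \<open>H\<close> of \<open>N\<close>.\<close>

lemma conj_pow_commutator:
  assumes H: "nsub H" and r: "r \<in> N" and n: "n \<in> N" and c: "n \<otimes> r \<otimes> inv n \<otimes> inv r \<in> H"
  shows "n \<otimes> r [^] (j::nat) \<otimes> inv n \<otimes> inv (r [^] j) \<in> H"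
proof (induction j)
  case 0
  then show ?case using N_carrier[OF n] nsubD(4)[OF H] by simp
next
  case (Suc j)
  define q where "q = r [^] j"
  have q: "q \<in> N" using r by (simp add: q_def N_pow)
  note car = N_carrier[OF r] N_carrier[OF n] N_carrier[OF q]
  have "n \<otimes> (q \<otimes> r) \<otimes> inv n \<otimes> inv (q \<otimes> r) =
      (n \<otimes> q \<otimes> inv n \<otimes> inv q) \<otimes> (q \<otimes> (n \<otimes> r \<otimes> inv n \<otimes> inv r) \<otimes> inv q)"
    using car by (simp add: m_assoc inv_mult_group mult_inv_cancel)
  also have "\<dots> \<in> H"
    using Suc unfolding q_def[symmetric] by (rule nsubD(6)[OF H _ nsubD(7)[OF H q c]])
  finally show ?case by (simp add: q_def)
qed

text \<open>A nontrivial \<open>p\<close>-group has a nontrivial centre: \<open>N\<close> acts by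
  conjugation on the representatives of its \<open>H\<close>-cosets, the number of fixed ones is a
  multiple of \<open>p\<close>, and \<open>rep H \<one>\<close> is one of them. A suitable power of
  another fixed one has order \<open>p\<close> modulo \<open>H\<close>.\<close>

lemma exists_central_step:
  assumes H: "nsub H" and neq: "H \<noteq> N"
  shows "\<exists>m. central_step H m"
proof -
  note HG = nsubD(1)[OF H]
  have finH: "finite H" by (rule finite_subset[OF subgroup.subset[OF HG] finite_G])
  define S where "S = {r \<in> rep H ` carrier G. r \<in> N}"
  define act where "act = (\<lambda>n r. rep H (n \<otimes> r \<otimes> inv n))"
  have S_N: "r \<in> N" and S_rep: "rep H r = r" if "r \<in> S" for r
    using that rep_rep[OF HG] by (auto simp: S_def)
  have rep_N: "rep H r \<in> S" if r: "r \<in> N" for r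
  proof -
    obtain h where "h \<in> H" "rep H r = h \<otimes> r" using rep_obtain[OF HG N_carrier[OF r]] .
    then have "rep H r \<in> N" using r nsubD(2)[OF H] N_closed(3) by simp
    then show ?thesis unfolding S_def using N_carrier[OF r] by blast
  qed
  have rep_conj: "rep H (n \<otimes> rep H r \<otimes> inv n) = rep H (n \<otimes> r \<otimes> inv n)"
    if n: "n \<in> N" and r: "r \<in> N" for n r
  proof -
    obtain h where h: "h \<in> H" "rep H r = h \<otimes> r" using rep_obtain[OF HG N_carrier[OF r]] .
    note car = N_carrier[OF n] N_carrier[OF r] nsubD(3)[OF H h(1)]
    have "n \<otimes> rep H r \<otimes> inv n = (n \<otimes> h \<otimes> inv n) \<otimes> (n \<otimes> r \<otimes> inv n)"
      using car h by (simp add: m_assoc mult_inv_cancel)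
    then show ?thesis using car rep_mult[OF HG _ nsubD(7)[OF H n h(1)]] by simp
  qed
  have "int (card N) = (\<Sum>y\<in>carrier G. if y \<in> N then 1 else 0)"
    using finite_G N_carrier by (simp add: sum.If_cases Int_absorb1 subsetI)
  also have "\<dots> = (\<Sum>r\<in>rep H ` carrier G. \<Sum>h\<in>H. if h \<otimes> r \<in> N then 1 else 0)"
    by (rule sum_cosets[OF HG])
  also have "\<dots> = (\<Sum>r\<in>rep H ` carrier G. if r \<in> N then int (card H) else 0)"
  proof (rule sum.cong[OF refl])
    fix r assume "r \<in> rep H ` carrier G"
    then have r: "r \<in> carrier G" using rep_carrier[OF HG] by blast
    have "h \<otimes> r \<in> N \<longleftrightarrow> r \<in> N" if h: "h \<in> H" for h
    proof
      assume "h \<otimes> r \<in> N"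
      then have "inv h \<otimes> (h \<otimes> r) \<in> N" using N_closed nsubD(2)[OF H h] by blast
      then show "r \<in> N" using r nsubD(3)[OF H h] by (simp add: mult_inv_cancel)
    qed (use N_closed nsubD(2)[OF H h] in blast)
    then show "(\<Sum>h\<in>H. if h \<otimes> r \<in> N then 1 else 0) = (if r \<in> N then int (card H) else 0)"
      by simp
  qed
  also have "\<dots> = int (card S) * int (card H)"
    using finite_G by (simp add: sum.If_cases S_def Int_def)
  finally have card: "card N = card S * card H" by (metis of_nat_eq_iff of_nat_mult)
  have "card H < card N"
    using neq nsubD(2)[OF H] N_finite by (intro psubset_card_mono) blast+
  then have "card S \<noteq> 1" using card by auto
  moreover have "card S dvd p ^ a" using card card_N by (metis dvd_triv_left)
  ultimately have p_S: "p dvd card S" using prime_dvd_orbit_card[OF prime_p] by blast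
  have S_fin: "finite S" using finite_G by (simp add: S_def)
  have act_closed: "act n r \<in> S" if "n \<in> N" "r \<in> S" for n r
    unfolding act_def by (intro rep_N N_closed that S_N)
  have act_one: "act \<one> r = r" if "r \<in> S" for r
    using S_N[OF that] S_rep[OF that] N_carrier by (simp add: act_def)
  have act_mult: "act (n \<otimes> k) r = act n (act k r)" if n: "n \<in> N" and k: "k \<in> N" and r: "r \<in> S" for n k r
  proof -
    note car = N_carrier[OF n] N_carrier[OF k] N_carrier[OF S_N[OF r]]
    have "k \<otimes> r \<otimes> inv k \<in> N" using S_N[OF r] k N_closed by blast
    then have "act n (act k r) = rep H (n \<otimes> (k \<otimes> r \<otimes> inv k) \<otimes> inv n)"
      using rep_conj[OF n] by (simp add: act_def)
    then show ?thesis using car by (simp add: act_def m_assoc inv_mult_group)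
  qed
  \<comment> \<open>Counting moved points is summing the constant \<open>1\<close>, with the
    multiples of \<open>p\<close> as \<open>J\<close>.\<close>
  have "(\<Sum>r | r \<in> S \<and> (\<exists>n\<in>N. act n r \<noteq> r). 1 :: int) \<in> {i. int p dvd i}"
  proof (rule sum_moved_points[OF N_subgroup N_finite S_fin act_closed act_one act_mult], assumption+)
    fix r assume r: "r \<in> S" "\<exists>h\<in>N. act h r \<noteq> r"
    have "card ((\<lambda>h. act h r) ` N) dvd p ^ a"
      using orbit_card_dvd[OF N_subgroup N_finite, of act r] act_one act_mult r card_N by simp
    moreover have "card ((\<lambda>h. act h r) ` N) \<noteq> 1"
    proof
      assume "card ((\<lambda>h. act h r) ` N) = 1"
      then obtain z where z: "(\<lambda>h. act h r) ` N = {z}" by (auto simp: card_1_singleton_iff)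
      then have "act h r = act \<one> r" if "h \<in> N" for h
        using that N_closed(1) by (metis image_eqI singletonD)
      then show False using r act_one by auto
    qed
    ultimately show "of_nat (card ((\<lambda>h. act h r) ` N)) * (1::int) \<in> {i. int p dvd i}"
      using prime_dvd_orbit_card[OF prime_p] by simp
  qed auto
  moreover define Fix where "Fix = {r \<in> S. \<forall>n\<in>N. act n r = r}"
  moreover have "card S = card {r \<in> S. \<exists>n\<in>N. act n r \<noteq> r} + card Fix"
    unfolding Fix_def using S_fin
    by (subst card_Un_disjoint[symmetric]) (auto intro!: arg_cong[where f = card])
  ultimately have p_Fix: "p dvd card Fix"
    using p_S by (simp add: dvd_add_right_iff)
  define r0 where "r0 = rep H \<one>"
  have "rep H (n \<otimes> \<one> \<otimes> inv n) = rep H \<one>" if "n \<in> N" for n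
    using N_carrier[OF that] by simp
  then have "r0 \<in> Fix"
    using rep_N[OF N_closed(1)] rep_conj[OF _ N_closed(1)] by (simp add: Fix_def act_def r0_def)
  have "card Fix \<noteq> 1"
    using p_Fix prime_p by auto
  then have "Fix \<noteq> {r0}" by auto
  then obtain r where r: "r \<in> Fix" "r \<noteq> r0" using \<open>r0 \<in> Fix\<close> by blast
  have rS: "r \<in> S" and rN: "r \<in> N" using r S_N by (auto simp: Fix_def)
  have "r \<notin> H"
  proof
    assume "r \<in> H"
    then have "rep H (r \<otimes> \<one>) = rep H \<one>" using rep_mult[OF HG] by blast
    then show False using r S_rep[OF rS] N_carrier[OF rN] by (simp add: r0_def)
  qed
  have comm: "n \<otimes> r \<otimes> inv n \<otimes> inv r \<in> H" if n: "n \<in> N" for n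
  proof -
    have nr: "n \<otimes> r \<otimes> inv n \<in> carrier G" using N_carrier[OF rN] N_carrier[OF n] by simp
    have "rep H (n \<otimes> r \<otimes> inv n) = r" using r n by (auto simp: Fix_def act_def)
    then obtain h where h: "h \<in> H" "n \<otimes> r \<otimes> inv n = h \<otimes> r" using rep_obtain'[OF HG nr] by metis
    then show ?thesis using nsubD(3)[OF H h(1)] N_carrier[OF rN] by (simp add: m_assoc)
  qed
  have "r [^] (p ^ a) = \<one>"
  proof -
    have "group (G\<lparr>carrier := N\<rparr>)" using N_subgroup by (rule subgroup_imp_group)
    then have "r [^]\<^bsub>G\<lparr>carrier := N\<rparr>\<^esub> (p ^ a) = \<one>"
      using group.pow_order_eq_1[of "G\<lparr>carrier := N\<rparr>" r] rN card_N by (simp add: order_def)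
    then show ?thesis by (metis nat_pow_consistent)
  qed
  then have ex: "\<exists>b. r [^] (p ^ b) \<in> H" using nsubD(4)[OF H] by metis
  \<comment> \<open>\<open>p ^ b\<close> is the order of \<open>r\<close> modulo \<open>H\<close>,
    so the power of \<open>r\<close> with exponent \<open>p ^ (b - 1)\<close> has order exactly
    \<open>p\<close> there.\<close>
  define b where "b = (LEAST b. r [^] (p ^ b) \<in> H)"
  have b: "r [^] (p ^ b) \<in> H" unfolding b_def using LeastI_ex[OF ex] .
  have "b \<noteq> 0" using b \<open>r \<notin> H\<close> N_carrier[OF rN] by (cases b) auto
  then obtain b' where b': "b = Suc b'" using not0_implies_Suc by blast
  define m where "m = r [^] (p ^ b')"
  have "m \<notin> H" using not_less_Least[of b' "\<lambda>b. r [^] (p ^ b) \<in> H"] b' by (simp add: m_def b_def)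
  moreover have "m [^] p \<in> H"
    using b b' N_carrier[OF rN] by (simp add: m_def nat_pow_pow mult.commute)
  moreover have "m \<in> N" using rN by (simp add: m_def N_pow)
  moreover have "n \<otimes> m \<otimes> inv n \<otimes> inv m \<in> H" if "n \<in> N" for n
    unfolding m_def by (rule conj_pow_commutator[OF H rN that comm[OF that]])
  ultimately show ?thesis using H unfolding central_step_def by blast
qed

text \<open>The subgroup generated by \<open>H\<close> and \<open>m\<close>. Exponents below
  \<open>p\<close> suffice because \<open>m [^] p\<close> lies in \<open>H\<close>, and with this
  bound they are unique.\<close>

definition extend :: "'g set \<Rightarrow> 'g \<Rightarrow> 'g set" where
  "extend H m = {h \<otimes> m [^] l | h l. h \<in> H \<and> l < p}"

context
  fixes H m
  assumes step: "central_step H m"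
begin

lemma stepD:
  "nsub H" "m \<in> N" "m \<notin> H" "m [^] p \<in> H" "m \<in> carrier G"
  "n \<in> N \<Longrightarrow> n \<otimes> m \<otimes> inv n \<otimes> inv m \<in> H"
  using step N_carrier by (auto simp: central_step_def)

lemma pow_carrier: "m [^] (l::nat) \<in> carrier G"
  using stepD by simp

lemma step_commute:
  assumes n: "n \<in> N"
  obtains h where "h \<in> H" "n \<otimes> m [^] (l::nat) = h \<otimes> (m [^] l \<otimes> n)"
proof -
  have "n \<otimes> m [^] l \<otimes> inv n \<otimes> inv (m [^] l) \<in> H" (is "?h \<in> H")
    using conj_pow_commutator[OF stepD(1,2) n] stepD(6)[OF n] by blast
  moreover have "n \<otimes> m [^] l = ?h \<otimes> (m [^] l \<otimes> n)"
    using N_carrier[OF n] pow_carrier by (simp add: m_assoc mult_inv_cancel)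
  ultimately show ?thesis using that by blast
qed

lemma step_commute':
  assumes n: "n \<in> N"
  obtains h where "h \<in> H" "n \<otimes> m [^] (l::nat) = m [^] l \<otimes> n \<otimes> h"
proof -
  obtain h where h: "h \<in> H" "n \<otimes> m [^] l = h \<otimes> (m [^] l \<otimes> n)" using step_commute[OF n] .
  have q: "m [^] l \<otimes> n \<in> N" using stepD(2) n N_pow N_closed by blast
  have "inv (m [^] l \<otimes> n) \<otimes> h \<otimes> (m [^] l \<otimes> n) \<in> H" by (rule nsubD(8)[OF stepD(1) q h(1)])
  moreover have "n \<otimes> m [^] l = m [^] l \<otimes> n \<otimes> (inv (m [^] l \<otimes> n) \<otimes> h \<otimes> (m [^] l \<otimes> n))"
    using h N_carrier[OF q] nsubD(3)[OF stepD(1) h(1)] by (simp add: m_assoc[symmetric])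
  ultimately show ?thesis using that by blast
qed

lemma pow_in_iff: "m [^] (i::nat) \<in> H \<longleftrightarrow> p dvd i"
proof
  assume "p dvd i"
  then obtain k where "i = p * k" by (elim dvdE)
  then have "m [^] i = (m [^] p) [^] k" using stepD by (simp add: nat_pow_pow)
  then show "m [^] i \<in> H" using nsub_pow[OF stepD(1,4)] by simp
next
  assume i: "m [^] i \<in> H"
  show "p dvd i"
  proof (rule ccontr)
    assume ndvd: "\<not> p dvd i"
    then have "gcd i p = 1" using prime_p by (metis coprime_iff_gcd_eq_1 prime_imp_coprime coprime_commute)
    moreover have "i \<noteq> 0" using ndvd by (metis dvd_0_right)
    ultimately obtain x y where xy: "i * x = p * y + 1" using bezout_nat[of i p] by metis
    have "m [^] (i * x) = m [^] (p * y) \<otimes> m"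
      unfolding xy using stepD by simp
    then have "m = inv (m [^] (p * y)) \<otimes> m [^] (i * x)"
      using stepD by (simp add: m_assoc[symmetric])
    moreover have "m [^] (i * x) \<in> H" "m [^] (p * y) \<in> H"
      using nsub_pow[OF stepD(1) i, of x] nsub_pow[OF stepD(1,4), of y] stepD by (simp_all add: nat_pow_pow)
    ultimately have "m \<in> H" using nsubD(5,6)[OF stepD(1)] by metis
    then show False using stepD by simp
  qed
qed

lemma pow_mod: "\<exists>h\<in>H. m [^] (i::nat) = h \<otimes> m [^] (i mod p)"
proof -
  have "m [^] (p * (i div p)) \<otimes> m [^] (i mod p) = m [^] (p * (i div p) + i mod p)"
    using stepD by (simp add: nat_pow_mult)
  then have "m [^] i = m [^] (p * (i div p)) \<otimes> m [^] (i mod p)" by simp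
  moreover have "m [^] (p * (i div p)) \<in> H" by (simp add: pow_in_iff)
  ultimately show ?thesis by blast
qed

lemma extendI: "h \<in> H \<Longrightarrow> h \<otimes> m [^] (i::nat) \<in> extend H m"
proof -
  assume h: "h \<in> H"
  obtain k where k: "k \<in> H" "m [^] i = k \<otimes> m [^] (i mod p)" using pow_mod by blast
  then have "h \<otimes> m [^] i = (h \<otimes> k) \<otimes> m [^] (i mod p)"
    using h nsubD(3)[OF stepD(1)] pow_carrier by (simp add: m_assoc)
  moreover have "i mod p < p" using prime_p by (simp add: prime_gt_0_nat)
  moreover have "h \<otimes> k \<in> H" using h k nsubD(6)[OF stepD(1)] by blast
  ultimately show ?thesis unfolding extend_def by blast
qed

lemma extendE:
  assumes "g \<in> extend H m"
  obtains h l where "h \<in> H" "l < p" "g = h \<otimes> m [^] l"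
  using assms unfolding extend_def by blast

lemma H_subset_extend: "h \<in> H \<Longrightarrow> h \<in> extend H m"
  using extendI[of h 0] nsubD(3)[OF stepD(1)] by simp

lemma m_in_extend: "m \<in> extend H m"
  using extendI[of \<one> 1] nsubD(4)[OF stepD(1)] stepD by simp

lemma extend_N: "g \<in> extend H m \<Longrightarrow> g \<in> N"
  using nsubD(2)[OF stepD(1)] N_pow[OF stepD(2)] N_closed(3) by (elim extendE) blast

lemma extend_mult:
  assumes "g \<in> extend H m" "g' \<in> extend H m"
  shows "g \<otimes> g' \<in> extend H m"
proof -
  obtain h l where g: "h \<in> H" "l < p" "g = h \<otimes> m [^] l" by (rule extendE[OF assms(1)])
  obtain h' l' where g': "h' \<in> H" "l' < p" "g' = h' \<otimes> m [^] l'" by (rule extendE[OF assms(2)])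
  note car = nsubD(3)[OF stepD(1) g(1)] nsubD(3)[OF stepD(1) g'(1)] pow_carrier
  have "g \<otimes> g' = h \<otimes> (m [^] l \<otimes> h' \<otimes> inv (m [^] l)) \<otimes> (m [^] l \<otimes> m [^] l')"
    using car g g' by (simp add: m_assoc mult_inv_cancel)
  also have "m [^] l \<otimes> m [^] l' = m [^] (l + l')" using stepD by (simp add: nat_pow_mult)
  finally have "g \<otimes> g' = h \<otimes> (m [^] l \<otimes> h' \<otimes> inv (m [^] l)) \<otimes> m [^] (l + l')" .
  moreover have "h \<otimes> (m [^] l \<otimes> h' \<otimes> inv (m [^] l)) \<in> H"
    by (intro nsubD(6)[OF stepD(1)] nsubD(7)[OF stepD(1)] g(1) g'(1) N_pow stepD(2))
  ultimately show ?thesis using extendI by simp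
qed

lemma extend_conj:
  assumes n: "n \<in> N" and g: "g \<in> extend H m"
  shows "n \<otimes> g \<otimes> inv n \<in> extend H m"
proof -
  obtain h l where gh: "h \<in> H" "l < p" "g = h \<otimes> m [^] l" by (rule extendE[OF g])
  obtain k where k: "k \<in> H" "n \<otimes> m [^] l = k \<otimes> (m [^] l \<otimes> n)" using step_commute[OF n] .
  note car = nsubD(3)[OF stepD(1) gh(1)] nsubD(3)[OF stepD(1) k(1)] pow_carrier N_carrier[OF n]
  have "n \<otimes> g \<otimes> inv n = (n \<otimes> h \<otimes> inv n) \<otimes> ((n \<otimes> m [^] l) \<otimes> inv n)"
    using car gh by (simp add: m_assoc mult_inv_cancel)
  also have "\<dots> = (n \<otimes> h \<otimes> inv n \<otimes> k) \<otimes> m [^] l"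
    unfolding k(2) using car by (simp add: m_assoc)
  finally have "n \<otimes> g \<otimes> inv n = (n \<otimes> h \<otimes> inv n \<otimes> k) \<otimes> m [^] l" .
  moreover have "n \<otimes> h \<otimes> inv n \<otimes> k \<in> H"
    by (intro nsubD(6)[OF stepD(1)] nsubD(7)[OF stepD(1)] gh(1) k(1) n)
  ultimately show ?thesis using extendI by simp
qed

lemma nsub_extend: "nsub (extend H m)"
proof -
  have "subgroup (extend H m) G"
  proof (rule subgroupI)
    show "extend H m \<subseteq> carrier G" using extend_N N_carrier by blast
    show "extend H m \<noteq> {}" using m_in_extend by blast
    show "g \<otimes> g' \<in> extend H m" if "g \<in> extend H m" "g' \<in> extend H m" for g g'
      using extend_mult that .
    fix g assume g: "g \<in> extend H m"
    obtain h l where gh: "h \<in> H" "l < p" "g = h \<otimes> m [^] l" using extendE[OF g] .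
    note car = nsubD(3)[OF stepD(1) gh(1)] pow_carrier
    have "m [^] l \<otimes> m [^] (p - l) \<in> H" using stepD gh by (simp add: nat_pow_mult)
    then have k: "inv (m [^] l \<otimes> m [^] (p - l)) \<in> H" (is "?k \<in> H") using nsubD(5)[OF stepD(1)] by blast
    have "inv g = (m [^] (p - l) \<otimes> ?k) \<otimes> inv h"
      using car gh by (simp add: inv_mult_group m_assoc mult_inv_cancel)
    also have "m [^] (p - l) \<otimes> ?k = (m [^] (p - l) \<otimes> ?k \<otimes> inv (m [^] (p - l))) \<otimes> m [^] (p - l)"
      using car by (simp add: m_assoc)
    finally have "inv g = (m [^] (p - l) \<otimes> ?k \<otimes> inv (m [^] (p - l))) \<otimes> m [^] (p - l) \<otimes> inv h" .
    moreover have "(m [^] (p - l) \<otimes> ?k \<otimes> inv (m [^] (p - l))) \<otimes> m [^] (p - l) \<in> extend H m"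
      using extendI nsubD(7)[OF stepD(1) N_pow[OF stepD(2)] k] by blast
    moreover have "inv h \<in> extend H m" using H_subset_extend nsubD(5)[OF stepD(1) gh(1)] by blast
    ultimately show "inv g \<in> extend H m" using extend_mult by simp
  qed
  then show ?thesis unfolding nsub_def using extend_N extend_conj by blast
qed

lemma extend_unique:
  assumes "g \<in> carrier G" "inv (m [^] l) \<otimes> g \<in> H" "inv (m [^] l') \<otimes> g \<in> H" "l \<le> l'" "l' < p"
  shows "l = l'"
proof -
  have "(inv (m [^] l') \<otimes> g) \<otimes> inv (inv (m [^] l) \<otimes> g) \<in> H"
    using assms nsubD(5,6)[OF stepD(1)] by blast
  moreover have "(inv (m [^] l') \<otimes> g) \<otimes> inv (inv (m [^] l) \<otimes> g) = inv (m [^] l') \<otimes> m [^] l"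
    using assms(1) pow_carrier by (simp add: inv_mult_group m_assoc mult_inv_cancel)
  moreover have "m [^] l' = m [^] l \<otimes> m [^] (l' - l)" using stepD assms(4) by (simp add: nat_pow_mult)
  ultimately have "inv (m [^] (l' - l)) \<in> H"
    using pow_carrier by (simp add: inv_mult_group m_assoc)
  then have "inv (inv (m [^] (l' - l))) \<in> H" using nsubD(5)[OF stepD(1)] by blast
  then have "p dvd l' - l" using pow_carrier pow_in_iff by simp
  then show ?thesis using assms(4,5) by (metis dvd_imp_le diff_is_0_eq le_antisym less_imp_diff_less linorder_not_less neq0_conv)
qed

lemma ind_extend: "ind (extend H m) = (\<Sum>l<p. translate (m [^] l) (ind H))"
proof
  fix g
  have "(\<Sum>l<p. translate (m [^] l) (ind H)) g = (\<Sum>l<p. translate (m [^] l) (ind H) g)"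
    by (rule sum_fun_apply)
  moreover have "ind (extend H m) g = (\<Sum>l<p. translate (m [^] l) (ind H) g)"
  proof (cases "g \<in> extend H m")
    case True
    then have gG: "g \<in> carrier G" using extend_N N_carrier by blast
    obtain h l where gh: "h \<in> H" "l < p" "g = h \<otimes> m [^] l" using extendE[OF True] .
    have "inv (m [^] l) \<otimes> g = inv (m [^] l) \<otimes> h \<otimes> m [^] l"
      using gh nsubD(3)[OF stepD(1)] pow_carrier by (simp add: m_assoc)
    then have l: "inv (m [^] l) \<otimes> g \<in> H"
      using nsubD(8)[OF stepD(1) N_pow[OF stepD(2)] gh(1)] by simp
    have "translate (m [^] j) (ind H) g = (if j = l then e else 0)" if j: "j < p" for j
    proof (cases "j = l")
      case False
      then have "inv (m [^] j) \<otimes> g \<notin> H"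
        using extend_unique[OF gG l, of j] extend_unique[OF gG _ l, of j] j gh(2) by (cases "l \<le> j") auto
      then show ?thesis using False gG by (simp add: translate_apply ind_def)
    qed (use l gG in \<open>simp add: translate_apply ind_def\<close>)
    then have "(\<Sum>j<p. translate (m [^] j) (ind H) g) = (\<Sum>j<p. if j = l then e else 0)" by simp
    also have "\<dots> = e" using gh by simp
    finally show ?thesis using True by (simp add: ind_def)
  next
    case False
    have "translate (m [^] j) (ind H) g = 0" if j: "j < p" for j
    proof (rule ccontr)
      assume "translate (m [^] j) (ind H) g \<noteq> 0"
      then have g: "g \<in> carrier G" "inv (m [^] j) \<otimes> g \<in> H"
        by (auto simp: translate_def ind_def split: if_splits)
      have "(m [^] j \<otimes> (inv (m [^] j) \<otimes> g) \<otimes> inv (m [^] j)) \<otimes> m [^] j \<in> extend H m"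
        by (intro extendI nsubD(7)[OF stepD(1)] N_pow stepD(2) g(2))
      then show False using False g(1) pow_carrier by (simp add: m_assoc mult_inv_cancel)
    qed
    then show ?thesis using False by (simp add: ind_def)
  qed
  ultimately show "ind (extend H m) g = (\<Sum>l<p. translate (m [^] l) (ind H)) g" by simp
qed

end

text \<open>A subgroup of largest cardinality with the property must be \<open>N\<close>, since
  otherwise a central step enlarges it. A descent from \<open>N\<close> to the trivial group results
  from taking an implication for \<open>P\<close>.\<close>

lemma p_group_induct:
  assumes base: "P {\<one>}"
    and step: "\<And>H m. central_step H m \<Longrightarrow> P H \<Longrightarrow> P (extend H m)"
  shows "P N"
proof -
  define \<H> where "\<H> = {H. nsub H \<and> P H}"
  have fin: "finite \<H>"
    by (rule finite_subset[of _ "Pow N"]) (auto simp: \<H>_def nsub_def N_finite)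
  have "nsub {\<one>}"
    using triv_subgroup N_closed N_carrier by (auto simp: nsub_def)
  then have "{\<one>} \<in> \<H>" using base by (simp add: \<H>_def)
  then obtain H where H: "H \<in> \<H>" "\<And>H'. H' \<in> \<H> \<Longrightarrow> card H' \<le> card H"
  proof -
    have "Max (card ` \<H>) \<in> card ` \<H>" using fin \<open>{\<one>} \<in> \<H>\<close> by (intro Max_in) auto
    then obtain H where "H \<in> \<H>" "card H = Max (card ` \<H>)" by auto
    then show ?thesis using that fin by simp
  qed
  show ?thesis
  proof (cases "H = N")
    case True
    then show ?thesis using H by (simp add: \<H>_def)
  next
    case False
    then obtain m where m: "central_step H m" using exists_central_step H by (auto simp: \<H>_def)
    have "extend H m \<in> \<H>" using step[OF m] nsub_extend[OF m] H by (simp add: \<H>_def)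
    moreover have "finite (extend H m)"
      using nsubD(1)[OF nsub_extend[OF m]] subgroup.subset finite_G finite_subset by blast
    then have "card H < card (extend H m)"
      using H_subset_extend[OF m] m_in_extend[OF m] stepD(3)[OF m] by (intro psubset_card_mono) blast+
    ultimately show ?thesis using H(2) by fastforce
  qed
qed

end

context p_constrained
begin

section \<open>Left invariant functions\<close>

text \<open>For a subgroup \<open>H\<close> normal in \<open>N\<close> this is the right ideal
  generated by \<open>ind H\<close>. Since \<open>N\<close> normalizes \<open>H\<close>, it acts
  here by left translation, and the action factors through \<open>N/H\<close>.\<close>

definition linv :: "'g set \<Rightarrow> ('g \<Rightarrow> 'k) set" where
  "linv H = {x \<in> fspace F. \<forall>h\<in>H. translate h x = x}"

lemma linv_F: "x \<in> linv H \<Longrightarrow> x \<in> fspace F"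
  by (simp add: linv_def)

lemma linv_translate: "x \<in> linv H \<Longrightarrow> h \<in> H \<Longrightarrow> translate h x = x"
  by (simp add: linv_def)

lemma linv_add: "x \<in> linv H \<Longrightarrow> y \<in> linv H \<Longrightarrow> x + y \<in> linv H"
  by (simp add: linv_def fspace_add translate_add)

lemma linv_diff: "x \<in> linv H \<Longrightarrow> y \<in> linv H \<Longrightarrow> x - y \<in> linv H"
  by (simp add: linv_def fspace_diff translate_diff)

lemma linv_zero: "0 \<in> linv H"
  by (simp add: linv_def fspace_zero translate_zero)

lemma linv_of_nat: "x \<in> linv H \<Longrightarrow> of_nat i * x \<in> linv H"
  by (simp add: linv_def fspace_of_nat translate_of_nat)

lemma linv_scale: "c \<in> F \<Longrightarrow> x \<in> linv H \<Longrightarrow> (\<lambda>_. c) * x \<in> linv H"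
  by (simp add: linv_def fspace_scale translate_scale)

lemma linv_sum: "(\<And>i. i \<in> I \<Longrightarrow> x i \<in> linv H) \<Longrightarrow> (\<Sum>i\<in>I. x i) \<in> linv H"
  by (rule sum_in_set[OF linv_zero linv_add])

lemma linv_conv: "nsub H \<Longrightarrow> x \<in> linv H \<Longrightarrow> y \<in> fspace F \<Longrightarrow> x \<star> y \<in> linv H"
  by (auto simp: linv_def fspace_conv nsubD(3) translate_conv[symmetric])

lemma linv_class_conv:
  "nsub H \<Longrightarrow> class_function u \<Longrightarrow> u \<in> fspace F \<Longrightarrow> x \<in> linv H \<Longrightarrow> u \<star> x \<in> linv H"
  by (auto simp: linv_def fspace_conv nsubD(3) conv_translate[symmetric])

lemma linv_ind:
  assumes H: "nsub H"
  shows "ind H \<in> linv H"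
proof -
  have "(\<lambda>s. h \<otimes> s) ` H = H" if h: "h \<in> H" for h
  proof (intro equalityI subsetI)
    fix g assume "g \<in> (\<lambda>s. h \<otimes> s) ` H"
    then show "g \<in> H" using nsubD(6)[OF H h] by blast
  next
    fix g assume g: "g \<in> H"
    then have "g = h \<otimes> (inv h \<otimes> g)" using nsubD(3)[OF H] h by (simp add: mult_inv_cancel)
    moreover have "inv h \<otimes> g \<in> H" using nsubD(5,6)[OF H] h g by blast
    ultimately show "g \<in> (\<lambda>s. h \<otimes> s) ` H" by (rule image_eqI)
  qed
  moreover have "H \<subseteq> carrier G" using nsubD(3)[OF H] by blast
  ultimately show ?thesis
    unfolding linv_def using fspace_A_F[OF fspace_ind] translate_ind nsubD(3)[OF H] by simp
qed

lemma linv_N_translate: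
  assumes H: "nsub H" and x: "x \<in> linv H" and k: "k \<in> N"
  shows "translate k x \<in> linv H"
  unfolding linv_def
proof (intro CollectI conjI ballI)
  show "translate k x \<in> fspace F" using fspace_translate N_carrier k linv_F x by blast
  fix h assume h: "h \<in> H"
  note car = nsubD(3)[OF H h] N_carrier[OF k]
  have c: "inv k \<otimes> h \<otimes> k \<in> H" by (rule nsubD(8)[OF H k h])
  have "translate h (translate k x) = translate (k \<otimes> (inv k \<otimes> h \<otimes> k)) x"
    using car by (simp add: translate_translate m_assoc mult_inv_cancel)
  also have "\<dots> = translate k (translate (inv k \<otimes> h \<otimes> k) x)"
    using car by (intro translate_translate[symmetric]) simp_all
  finally show "translate h (translate k x) = translate k x"
    using linv_translate[OF x c] by simp
qed

lemma linv_apply: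
  assumes "nsub H" "x \<in> linv H" "h \<in> H" "g \<in> carrier G"
  shows "x (h \<otimes> g) = x g"
  using fun_cong[OF linv_translate[OF assms(2,3)], of "h \<otimes> g"] nsubD(3)[OF assms(1,3)] assms(4)
  by (simp add: translate_apply mult_inv_cancel)

lemma linv_ind_conv:
  assumes H: "nsub H" and x: "x \<in> linv H" "x \<in> fspace A"
  obtains b where "b \<in> fspace A" "x = ind H \<star> b"
proof -
  obtain b where b: "b \<in> fspace A" "\<And>g. g \<in> carrier G \<Longrightarrow> (ind H \<star> b) g - x g \<in> {0}"
    using ind_conv_rep[OF nsubD(1)[OF H] x(2), of "{0}"] linv_apply[OF H x(1)] by auto
  have "H \<subseteq> carrier G" using nsubD(3)[OF H] by blast
  then have "x = ind H \<star> b"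
    using fspace_conv(2)[OF fspace_ind b(1)] x(2) b(2) by (intro fspace_eqI[of x A _ A]) auto
  then show ?thesis using that b(1) by blast
qed

lemma ind_conv_mod:
  assumes H: "nsub H" and x: "x \<in> fspace A"
    and fixed: "\<And>h. h \<in> H \<Longrightarrow> translate h x - x \<in> fspace nonunits"
  obtains b where "b \<in> fspace A" "ind H \<star> b - x \<in> fspace nonunits"
proof -
  have inv: "x (h \<otimes> g) - x g \<in> nonunits" if h: "h \<in> H" and g: "g \<in> carrier G" for h g
    using fspace_apply[OF fixed[OF nsubD(5)[OF H h]] g] g nsubD(3)[OF H h]
    by (simp add: translate_apply)
  obtain b where b: "b \<in> fspace A" "\<And>g. g \<in> carrier G \<Longrightarrow> (ind H \<star> b) g - x g \<in> nonunits"
    using ind_conv_rep[OF nsubD(1)[OF H] x inv] by blast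
  have "ind H \<star> b - x \<in> fspace nonunits"
    using b(2) conv_outside fspace_outside[OF x] by (intro fspaceI) auto
  then show ?thesis using that b(1) by blast
qed

section \<open>The operators of the cyclic group generated by \<open>m\<close> modulo
  \<open>H\<close>\<close>

context
  fixes H m
  assumes step: "central_step H m"
begin

lemmas H = stepD(1)[OF step] and mG = stepD(5)[OF step] and mN = stepD(2)[OF step]

definition sigma :: "('g \<Rightarrow> 'k) \<Rightarrow> 'g \<Rightarrow> 'k" where
  "sigma x = (\<Sum>l<p. translate (m [^] l) x)"

text \<open>Up to \<open>p\<close> and the trace \<open>sigma\<close> this operator inverts
  \<open>m - 1\<close>: on \<open>linv H\<close> the identity \<open>tau (m - 1) = p - sigma\<close>
  holds. It serves wherever one would divide by \<open>m - 1\<close>.\<close>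

definition tau :: "('g \<Rightarrow> 'k) \<Rightarrow> 'g \<Rightarrow> 'k" where
  "tau x = (\<Sum>l<p. of_nat l * translate (m [^] l) x)"

lemma sigma_ind: "sigma (ind H) = ind (extend H m)"
  by (simp add: sigma_def ind_extend[OF step])

lemma translate_pow_Suc: "translate (m [^] Suc l) x = translate m (translate (m [^] l) x)"
  unfolding nat_pow_Suc2[OF mG] using mG by (simp add: translate_translate)

lemma translate_pow_m: "translate (m [^] (l::nat)) (translate m x) = translate m (translate (m [^] l) x)"
proof -
  have "translate (m [^] l) (translate m x) = translate (m [^] Suc l) x"
    using mG by (simp add: translate_translate)
  then show ?thesis by (simp only: translate_pow_Suc)
qed

lemma translate_pow_add:
  "translate (m [^] (i::nat)) (translate (m [^] (j::nat)) x) = translate (m [^] (i + j)) x"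
  using mG by (simp add: translate_translate nat_pow_mult)

lemma linv_pow: "x \<in> linv H \<Longrightarrow> translate (m [^] (l::nat)) x \<in> linv H"
  using linv_N_translate[OF H] N_pow[OF mN] by blast

lemma linv_pow_fixed: "x \<in> linv H \<Longrightarrow> p dvd l \<Longrightarrow> translate (m [^] (l::nat)) x = x"
  using linv_translate pow_in_iff[OF step] by blast

lemma linv_pow_0: "x \<in> linv H \<Longrightarrow> translate (m [^] (0::nat)) x = x"
  by (rule linv_pow_fixed) simp_all

text \<open>\<open>m\<close> is central in \<open>N\<close> modulo \<open>H\<close>, and the
  resulting element of \<open>H\<close> acts trivially on \<open>x\<close>.\<close>

lemma linv_commute:
  assumes x: "x \<in> linv H" and k: "k \<in> N"
  shows "translate k (translate (m [^] (l::nat)) x) = translate (m [^] l) (translate k x)"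
proof -
  obtain h where h: "h \<in> H" "k \<otimes> m [^] l = m [^] l \<otimes> k \<otimes> h" using step_commute'[OF step k] .
  note car = N_carrier[OF k] nsubD(3)[OF H h(1)] pow_carrier[OF step]
  have "translate k (translate (m [^] l) x) = translate (m [^] l \<otimes> k \<otimes> h) x"
    using car by (simp add: translate_translate h(2))
  also have "\<dots> = translate (m [^] l) (translate k (translate h x))"
    using car by (simp add: translate_translate m_assoc)
  finally show ?thesis using linv_translate[OF x h(1)] by simp
qed

lemma sigma_diff: "sigma (x - y) = sigma x - sigma y"
  by (simp add: sigma_def translate_diff sum_subtractf)

lemma tau_add: "tau (x + y) = tau x + tau y"
  by (simp add: tau_def translate_add sum.distrib distrib_left)

lemma tau_diff: "tau (x - y) = tau x - tau y"
  by (simp add: tau_def translate_diff sum_subtractf right_diff_distrib)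

lemma tau_of_nat: "tau (of_nat i * x) = of_nat i * tau x"
  by (simp add: tau_def translate_of_nat sum_distrib_left mult.left_commute)

lemma conv_sigma: "class_function u \<Longrightarrow> u \<star> sigma x = sigma (u \<star> x)"
  using mG by (simp add: sigma_def conv_sum conv_translate)

lemma translate_sigma: "x \<in> linv H \<Longrightarrow> k \<in> N \<Longrightarrow> translate k (sigma x) = sigma (translate k x)"
  by (simp add: sigma_def translate_sum linv_commute)

lemma translate_tau: "x \<in> linv H \<Longrightarrow> k \<in> N \<Longrightarrow> translate k (tau x) = tau (translate k x)"
  by (simp add: tau_def translate_sum translate_of_nat linv_commute)

lemma linv_sigma: "x \<in> linv H \<Longrightarrow> sigma x \<in> linv H"
  unfolding sigma_def by (intro linv_sum linv_pow)

lemma linv_tau: "x \<in> linv H \<Longrightarrow> tau x \<in> linv H"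
  unfolding tau_def by (intro linv_sum linv_of_nat linv_pow)

lemma sigma_A: "x \<in> fspace A \<Longrightarrow> sigma x \<in> fspace A"
  unfolding sigma_def using mG by (intro fspace_sum fspace_translate) simp_all

lemma tau_A: "x \<in> fspace A \<Longrightarrow> tau x \<in> fspace A"
  unfolding tau_def using mG by (intro fspace_sum fspace_of_nat fspace_translate) simp_all

lemma translate_m_sigma:
  assumes x: "x \<in> linv H"
  shows "translate m (sigma x) = sigma x"
proof -
  have "translate m (sigma x) = (\<Sum>l<p. translate (m [^] Suc l) x)"
    by (simp only: sigma_def translate_sum translate_pow_Suc)
  moreover have "(\<Sum>l<Suc p. translate (m [^] l) x) =
      translate (m [^] (0::nat)) x + (\<Sum>l<p. translate (m [^] Suc l) x)"
    by (rule sum.lessThan_Suc_shift)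
  moreover have "(\<Sum>l<Suc p. translate (m [^] l) x) = sigma x + translate (m [^] p) x"
    by (simp add: sigma_def)
  ultimately show ?thesis using linv_pow_fixed[OF x, of p] linv_pow_0[OF x] by (simp add: algebra_simps)
qed

lemma translate_pow_sigma: "x \<in> linv H \<Longrightarrow> translate (m [^] (i::nat)) (sigma x) = sigma x"
  by (induction i) (simp_all only: linv_pow_0 linv_sigma translate_pow_Suc translate_m_sigma)

lemma sigma_m_diff: "x \<in> linv H \<Longrightarrow> sigma (translate m x - x) = 0"
  using translate_m_sigma translate_sigma[OF _ mN] by (simp add: sigma_diff)

text \<open>Summation by parts. The boundary term is \<open>p x\<close> because
  \<open>m [^] p\<close> lies in \<open>H\<close> and acts trivially.\<close>

lemma tau_m_diff:
  assumes x: "x \<in> linv H"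
  shows "tau (translate m x - x) = of_nat p * x - sigma x"
proof -
  define f where "f l = translate (m [^] l) x" for l :: nat
  have f: "f p = x" "f 0 = x" using linv_pow_fixed[OF x, of p] linv_pow_0[OF x] by (simp_all add: f_def)
  have "(\<Sum>l<Suc p. of_nat l * f l) = (\<Sum>l<p. of_nat (Suc l) * f (Suc l))"
    by (subst sum.lessThan_Suc_shift) simp
  then have a: "(\<Sum>l<p. of_nat (Suc l) * f (Suc l)) = (\<Sum>l<p. of_nat l * f l) + of_nat p * x"
    using f by simp
  have "(\<Sum>l<Suc p. f l) = f 0 + (\<Sum>l<p. f (Suc l))"
    by (rule sum.lessThan_Suc_shift)
  then have b: "(\<Sum>l<p. f (Suc l)) = (\<Sum>l<p. f l)" using f by (simp add: algebra_simps)
  have "tau (translate m x) = (\<Sum>l<p. of_nat l * f (Suc l))"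
    by (simp only: tau_def f_def translate_pow_m translate_pow_Suc)
  also have "\<dots> = (\<Sum>l<p. of_nat (Suc l) * f (Suc l)) - (\<Sum>l<p. f (Suc l))"
    by (simp add: sum_subtractf[symmetric] algebra_simps)
  also have "\<dots> = tau x + of_nat p * x - sigma x"
    unfolding a b by (simp add: tau_def sigma_def f_def)
  finally show ?thesis by (simp add: tau_diff)
qed

lemma linv_m_diff: "x \<in> linv H \<Longrightarrow> translate m x - x \<in> linv H"
  using linv_N_translate[OF H _ mN] linv_diff by blast

lemma linv_extend:
  assumes x: "x \<in> linv H" and m: "translate m x = x"
  shows "x \<in> linv (extend H m)"
  unfolding linv_def
proof (intro CollectI conjI ballI)
  show "x \<in> fspace F" by (rule linv_F[OF x])
  fix g assume "g \<in> extend H m"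
  then obtain h l where g: "h \<in> H" "l < p" "g = h \<otimes> m [^] l" by (rule extendE[OF step])
  have "translate (m [^] l) x = x"
  proof (induction l)
    case 0
    then show ?case using linv_pow_0[OF x] by simp
  next
    case (Suc l)
    then show ?case using m by (simp only: translate_pow_Suc)
  qed
  then show "translate g x = x"
    using g linv_translate[OF x] translate_translate[of h "m [^] l" x] nsubD(3)[OF H] mG by simp
qed

text \<open>Integrally, the kernel of \<open>sigma\<close> is the image of \<open>m - 1\<close>: the rational preimage
  \<open>tau x / p\<close> becomes integral after subtracting its values at the coset representatives.\<close>

lemma sigma_kernel:
  assumes x: "x \<in> linv H" "x \<in> fspace A" and s: "sigma x = 0"
  obtains z where "z \<in> linv H" "z \<in> fspace A" "x = translate m z - z"
proof -
  let ?M = "extend H m"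
  note M = nsub_extend[OF step]
  obtain q where q: "q \<in> F" "(of_nat p * e) * q = e"
    using F_inverse[OF F_of_nat_mult[OF F_unit(1)] p_nonzero] by blast
  define z0 where "z0 = (\<lambda>_. q) * tau x"
  have z0: "z0 \<in> linv H" unfolding z0_def by (intro linv_scale q linv_tau x)
  have pq: "of_nat p * (q * y) = y" if "y \<in> F" for y
  proof -
    have "of_nat p * (q * y) = of_nat p * (q * (e * y))" using F_unit_mult[OF that] by simp
    also have "\<dots> = ((of_nat p * e) * q) * y" by (simp only: ac_simps)
    finally show ?thesis using q F_unit_mult[OF that] by simp
  qed
  have "translate m z0 - z0 = (\<lambda>_. q) * tau (translate m x - x)"
    using translate_tau[OF x(1) mN] by (simp add: z0_def translate_scale tau_diff right_diff_distrib)
  also have "\<dots> = (\<lambda>_. q) * (of_nat p * x)" using tau_m_diff[OF x(1)] s by simp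
  also have "\<dots> = x"
  proof
    fix g
    show "((\<lambda>_. q) * (of_nat p * x)) g = x g"
      using pq[OF fspace_apply[OF linv_F[OF x(1)]], of g] fspace_outside[OF x(2), of g]
      by (cases "g \<in> carrier G") (simp_all add: mult.left_commute)
  qed
  finally have z0x: "translate m z0 - z0 = x" .
  define w where "w = (\<lambda>g. if g \<in> carrier G then z0 (rep ?M g) else 0)"
  define z where "z = z0 - w"
  have wF: "w \<in> fspace F"
    using rep_carrier[OF nsubD(1)[OF M]] fspace_apply[OF linv_F[OF z0]] by (auto simp: w_def fspace_def)
  have w: "translate g w = w" if g: "g \<in> ?M" for g
  proof
    fix y show "translate g w y = w y"
      using rep_mult[OF nsubD(1)[OF M] _ nsubD(5)[OF M g], of y] nsubD(3)[OF M g]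
      by (cases "y \<in> carrier G") (simp_all add: translate_def w_def)
  qed
  have wH: "w \<in> linv H" using wF w H_subset_extend[OF step] by (auto simp: linv_def)
  have "z \<in> linv H" unfolding z_def by (rule linv_diff[OF z0 wH])
  moreover have "x = translate m z - z"
    using z0x w[OF m_in_extend[OF step]] by (simp add: z_def translate_diff)
  moreover have "z \<in> fspace A"
  proof (rule fspaceI)
    fix g assume g: "g \<in> carrier G"
    define r where "r = rep ?M g"
    have r: "r \<in> carrier G" using rep_carrier[OF nsubD(1)[OF M] g] by (simp add: r_def)
    obtain g' where g': "g' \<in> ?M" "g = g' \<otimes> r" using rep_obtain'[OF nsubD(1)[OF M] g] r_def by metis
    obtain h l where hl: "h \<in> H" "l < p" "g' = h \<otimes> m [^] l" by (rule extendE[OF step g'(1)])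
    \<comment> \<open>Consecutive values of \<open>z0\<close> along powers of \<open>m\<close>
      differ by a value of \<open>x\<close>, hence by an element of \<open>A\<close>.\<close>
    have "z0 (m [^] l \<otimes> r) - z0 r \<in> A"
    proof (induction l)
      case 0
      then show ?case using r A_zero by simp
    next
      case (Suc l)
      have c: "m [^] l \<otimes> r \<in> carrier G" "m [^] Suc l \<otimes> r \<in> carrier G" using r mG by simp_all
      have "m [^] Suc l \<otimes> r = m \<otimes> (m [^] l \<otimes> r)"
        unfolding nat_pow_Suc2[OF mG] using mG r by (simp add: m_assoc)
      then have "inv m \<otimes> (m [^] Suc l \<otimes> r) = m [^] l \<otimes> r"
        using mult_inv_cancel(2)[OF mG c(1)] by simp
      then have "z0 (m [^] l \<otimes> r) - z0 (m [^] Suc l \<otimes> r) = x (m [^] Suc l \<otimes> r)"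
        using fun_cong[OF z0x, of "m [^] Suc l \<otimes> r"] c(2) by (simp add: translate_apply)
      then have eq: "z0 (m [^] Suc l \<otimes> r) - z0 r = (z0 (m [^] l \<otimes> r) - z0 r) - x (m [^] Suc l \<otimes> r)"
        by (simp add: algebra_simps)
      show ?case unfolding eq by (rule A_diff[OF Suc fspace_apply[OF x(2) c(2)]])
    qed
    moreover have "z0 g = z0 (m [^] l \<otimes> r)"
      using linv_apply[OF H z0 hl(1), of "m [^] l \<otimes> r"] g' hl mG r nsubD(3)[OF H hl(1)]
      by (simp add: m_assoc)
    ultimately show "z g \<in> A" using g by (simp add: z_def w_def r_def)
  qed (use fspace_outside[OF linv_F[OF z0]] in \<open>simp add: z_def w_def\<close>)
  ultimately show ?thesis using that by blast
qed

end

section \<open>Fixed vectors modulo the maximal ideal\<close>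

text \<open>The binomial expansion of \<open>(m - 1)^r\<close>. The sign uses \<open>r + l\<close>
  in place of \<open>r - l\<close>, and the summation range stays fixed up to \<open>p\<close>
  throughout the induction, as binomial coefficients beyond \<open>r\<close> vanish.\<close>

lemma iterated_difference:
  assumes m: "m \<in> carrier G" and x: "x \<in> fspace S" and r: "r \<le> p"
  shows "((\<lambda>y. translate m y - y) ^^ r) x =
    (\<Sum>l\<le>p. of_int ((-1) ^ (r + l) * int (r choose l)) * translate (m [^] l) x)"
  using r
proof (induction r)
  case 0
  have "(\<Sum>l\<le>p. of_int ((-1) ^ (0 + l) * int (0 choose l)) * translate (m [^] l) x) =
      (\<Sum>l\<le>p. if l = 0 then translate (m [^] l) x else 0)"
    by (intro sum.cong) (auto simp: binomial_eq_0)
  also have "\<dots> = translate (m [^] (0::nat)) x" by simp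
  also have "\<dots> = x" using translate_one[OF x] by simp
  finally show ?case by (simp only: funpow_0)
next
  case (Suc r)
  define c where "c r l = (-1) ^ (r + l) * int (r choose l)" for r l
  define f where "f l = translate (m [^] l) x" for l :: nat
  have f: "translate m (f l) = f (Suc l)" for l
    using m by (simp add: f_def translate_translate nat_pow_Suc2[symmetric] del: nat_pow_Suc)
  have tr: "translate m (of_int i * y) = of_int i * translate m y" for i y
    by (cases i rule: int_cases2) (simp_all add: translate_of_nat translate_uminus)
  have c0: "c r p = 0" using Suc.prems by (simp add: c_def)
  have cS: "c (Suc r) (Suc l) = c r l - c r (Suc l)" for l
    by (simp add: c_def algebra_simps)
  have cS0: "c (Suc r) 0 = - c r 0" by (simp add: c_def)
  have "((\<lambda>y. translate m y - y) ^^ Suc r) x = (\<Sum>l\<le>p. of_int (c r l) * f (Suc l)) - (\<Sum>l\<le>p. of_int (c r l) * f l)"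
  proof -
    have IH: "((\<lambda>y. translate m y - y) ^^ r) x = (\<Sum>l\<le>p. of_int (c r l) * f l)"
      using Suc.IH Suc.prems by (simp only: c_def f_def Suc_leD)
    have "((\<lambda>y. translate m y - y) ^^ Suc r) x =
        translate m (((\<lambda>y. translate m y - y) ^^ r) x) - ((\<lambda>y. translate m y - y) ^^ r) x"
      by simp
    then show ?thesis by (simp only: IH translate_sum tr f)
  qed
  also have "(\<Sum>l\<le>p. of_int (c r l) * f (Suc l)) = (\<Sum>l<p. of_int (c r l) * f (Suc l))"
    using c0 by (simp add: lessThan_Suc_atMost[symmetric])
  also have "(\<Sum>l\<le>p. of_int (c r l) * f l) = of_int (c r 0) * f 0 + (\<Sum>l<p. of_int (c r (Suc l)) * f (Suc l))"
    by (rule sum.atMost_shift)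
  also have "(\<Sum>l<p. of_int (c r l) * f (Suc l)) - \<dots> =
      of_int (c (Suc r) 0) * f 0 + (\<Sum>l<p. of_int (c (Suc r) (Suc l)) * f (Suc l))"
    by (simp add: cS cS0 left_diff_distrib sum_subtractf)
  also have "\<dots> = (\<Sum>l\<le>p. of_int (c (Suc r) l) * f l)"
    by (rule sum.atMost_shift[symmetric])
  finally show ?case by (simp only: c_def f_def)
qed

text \<open>A \<open>p\<close>-group acting on a nonzero space in characteristic \<open>p\<close>
  fixes a nonzero vector; the space is the reduction of \<open>V\<close>. Given \<open>x\<close>
  fixed by \<open>H\<close>, the operator \<open>(m - 1)^p\<close> agrees with
  \<open>m^p - 1\<close> modulo \<open>p\<close> and kills \<open>x\<close> in reduction, so the
  last nonzero \<open>(m - 1)^r x\<close> is fixed by \<open>m\<close> as well.\<close>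

lemma exists_fixed_mod:
  assumes V_A: "V \<subseteq> fspace A"
    and V_diff: "\<And>x y. x \<in> V \<Longrightarrow> y \<in> V \<Longrightarrow> x - y \<in> V"
    and V_N: "\<And>k x. k \<in> N \<Longrightarrow> x \<in> V \<Longrightarrow> translate k x \<in> V"
    and x0: "x0 \<in> V" "x0 \<notin> fspace nonunits"
  shows "\<exists>x\<in>V. x \<notin> fspace nonunits \<and> (\<forall>k\<in>N. translate k x - x \<in> fspace nonunits)"
proof (rule p_group_induct)
  show "\<exists>x\<in>V. x \<notin> fspace nonunits \<and> (\<forall>k\<in>{\<one>}. translate k x - x \<in> fspace nonunits)"
  proof (intro bexI conjI ballI)
    fix k assume "k \<in> {\<one>}"
    moreover have "x0 \<in> fspace A" using x0 V_A by blast
    ultimately show "translate k x0 - x0 \<in> fspace nonunits"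
      using translate_one fspace_zero(3) by auto
  qed (use x0 in blast)+
next
  fix H m assume step: "central_step H m"
    and "\<exists>x\<in>V. x \<notin> fspace nonunits \<and> (\<forall>k\<in>H. translate k x - x \<in> fspace nonunits)"
  then obtain x where x: "x \<in> V" "x \<notin> fspace nonunits"
    and fix_x: "\<And>k. k \<in> H \<Longrightarrow> translate k x - x \<in> fspace nonunits" by blast
  note H = stepD(1)[OF step] and mN = stepD(2)[OF step] and mG = stepD(5)[OF step]
  define d where "d r = ((\<lambda>y. translate m y - y) ^^ r) x" for r
  have dS: "d (Suc r) = translate m (d r) - d r" for r by (simp add: d_def)
  have dV: "d r \<in> V" for r
  proof (induction r)
    case 0
    then show ?case using x(1) by (simp add: d_def)
  next
    case (Suc r)
    then show ?case unfolding dS by (intro V_diff V_N mN)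
  qed
  have d_fix: "translate k (d r) - d r \<in> fspace nonunits" if "k \<in> H" for k r
    using that
  proof (induction r arbitrary: k)
    case 0
    have "d 0 = x" by (simp add: d_def)
    then show ?case using fix_x[OF 0] by (simp only:)
  next
    case (Suc r)
    \<comment> \<open>Moving \<open>k\<close> past \<open>m\<close> replaces it by a conjugate,
      which is again in \<open>H\<close>; so the differences stay fixed by \<open>H\<close>.\<close>
    define k' where "k' = inv m \<otimes> k \<otimes> m"
    have k': "k' \<in> H" unfolding k'_def by (rule nsubD(8)[OF H mN Suc.prems])
    note car = nsubD(3)[OF H Suc.prems] nsubD(3)[OF H k']
    have "k \<otimes> m = m \<otimes> k'" using car mG by (simp add: k'_def m_assoc mult_inv_cancel)
    then have "translate k (translate m (d r)) = translate m (translate k' (d r))"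
      using car mG by (simp add: translate_translate)
    then have "translate k (d (Suc r)) - d (Suc r) =
        translate m (translate k' (d r) - d r) - (translate k (d r) - d r)"
      by (simp add: dS translate_diff)
    also have "\<dots> \<in> fspace nonunits"
      by (intro fspace_diff(3) fspace_translate mG Suc.IH k' Suc.prems)
    finally show ?case .
  qed
  have xA: "x \<in> fspace A" using x V_A by blast
  have "d p \<in> fspace nonunits"
  proof -
    define c where "c l = (-1) ^ (p + l) * int (p choose l)" for l
    define f where "f l = translate (m [^] l) x" for l :: nat
    have fA: "f l \<in> fspace A" for l unfolding f_def using mG xA by (intro fspace_translate) simp_all
    have small: "of_int i * y \<in> fspace nonunits" if i: "int p dvd i" and y: "y \<in> fspace A" for i y
    proof -
      obtain j where "i = int p * j" using i by (elim dvdE)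
      then have "of_int i * y = of_nat p * (of_int j * y)" by (simp add: mult.assoc)
      moreover have "of_int j * y \<in> fspace A"
        using y by (cases j rule: int_cases2) (auto simp: fspace_of_nat fspace_uminus)
      ultimately show ?thesis using fspace_of_nat(3) by simp
    qed
    have p0: "p > 0" using prime_p by (simp add: prime_gt_0_nat)
    have "d p = (\<Sum>l\<le>p. of_int (c l) * f l)"
      unfolding d_def c_def f_def by (rule iterated_difference[OF mG xA order_refl])
    also have "\<dots> = (\<Sum>l\<in>{0<..<p}. of_int (c l) * f l) + of_int (c 0) * f 0 + of_int (c p) * f p"
    proof -
      have "{..p} = insert 0 (insert p {0<..<p})" using p0 by auto
      then show ?thesis using p0 by simp
    qed
    also have "of_int (c p) * f p = f p" by (simp add: c_def mult_2[symmetric])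
    also have "f 0 = x" using translate_one[OF xA] by (simp add: f_def)
    also have "(\<Sum>l\<in>{0<..<p}. of_int (c l) * f l) + of_int (c 0) * x + f p =
        (\<Sum>l\<in>{0<..<p}. of_int (c l) * f l) + (of_int (c 0 + 1) * x) + (f p - x)"
      by (simp add: algebra_simps)
    finally have "d p = (\<Sum>l\<in>{0<..<p}. of_int (c l) * f l) + (of_int (c 0 + 1) * x) + (f p - x)" .
    moreover have "(\<Sum>l\<in>{0<..<p}. of_int (c l) * f l) \<in> fspace nonunits"
      using dvd_choose_prime[OF _ _ _ prime_p] by (intro fspace_sum small fA) (auto simp: c_def)
    moreover have "int p dvd c 0 + 1"
    proof (cases "p = 2")
      case False
      then have "odd p" using prime_p primes_dvd_imp_eq two_is_prime_nat by blast
      then show ?thesis by (simp add: c_def)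
    qed (simp add: c_def)
    moreover have "f p - x \<in> fspace nonunits"
      unfolding f_def using fix_x stepD(4)[OF step] by blast
    ultimately show ?thesis using small[OF _ xA] fspace_add(3) by (simp only:)
  qed
  moreover have d0: "d 0 \<notin> fspace nonunits" using x by (simp add: d_def)
  have "d r \<notin> fspace nonunits" if "\<nexists>r. d r \<notin> fspace nonunits \<and> d (Suc r) \<in> fspace nonunits" for r
    using d0 that by (induction r) blast+
  ultimately obtain r where r: "d r \<notin> fspace nonunits" "d (Suc r) \<in> fspace nonunits"
    by blast
  have m_fix: "translate (m [^] l) (d r) - d r \<in> fspace nonunits" for l :: nat
  proof (induction l)
    case 0
    have "d r \<in> fspace A" using dV V_A by blast
    then have "translate (m [^] (0::nat)) (d r) = d r" using translate_one by simp
    then show ?case using fspace_zero(3) by (simp only: diff_self)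
  next
    case (Suc l)
    have "translate (m [^] Suc l) (d r) - d r =
        translate m (translate (m [^] l) (d r) - d r) + d (Suc r)"
      unfolding translate_pow_Suc[OF step] dS translate_diff by simp
    then show ?case using fspace_add(3) fspace_translate[OF mG Suc] r(2) by (simp only:)
  qed
  have "translate g (d r) - d r \<in> fspace nonunits" if g: "g \<in> extend H m" for g
  proof -
    obtain h l where hl: "h \<in> H" "l < p" "g = h \<otimes> m [^] l" by (rule extendE[OF step g])
    have "translate g (d r) - d r = translate h (translate (m [^] l) (d r) - d r) + (translate h (d r) - d r)"
      using nsubD(3)[OF H hl(1)] mG by (simp add: hl(3) translate_translate[symmetric] translate_diff)
    then show ?thesis
      using fspace_add(3) fspace_translate[OF nsubD(3)[OF H hl(1)] m_fix] d_fix[OF hl(1)] by (simp only:)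
  qed
  then show "\<exists>x\<in>V. x \<notin> fspace nonunits \<and> (\<forall>k\<in>extend H m. translate k x - x \<in> fspace nonunits)"
    using dV r(1) by blast
qed

section \<open>Class sums outside the p-group\<close>

definition pA :: "'k set" where
  "pA = {of_nat p * x | x. x \<in> A}"

lemma pA_zero: "0 \<in> pA"
  unfolding pA_def using A_zero by (intro CollectI exI[of _ 0]) simp

lemma pA_add: "x \<in> pA \<Longrightarrow> y \<in> pA \<Longrightarrow> x + y \<in> pA"
  unfolding pA_def using A_add by (auto simp: distrib_left[symmetric])

lemma pA_nonunits: "x \<in> pA \<Longrightarrow> x \<in> nonunits"
  unfolding pA_def using p_mult_nonunit by auto

lemma pA_uminus: "x \<in> pA \<Longrightarrow> - x \<in> pA"
  unfolding pA_def using A_uminus by (auto simp: minus_mult_right simp del: mult_minus_right)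

lemma pA_of_nat: "p dvd i \<Longrightarrow> x \<in> A \<Longrightarrow> of_nat i * x \<in> pA"
  unfolding pA_def using A_of_nat_mult by (auto elim!: dvdE simp: mult.assoc)

lemma pA_sum: "(\<And>i. i \<in> I \<Longrightarrow> f i \<in> pA) \<Longrightarrow> sum f I \<in> pA"
  by (rule sum_in_set[OF pA_zero pA_add])

definition N_class :: "'g \<Rightarrow> 'g set" where
  "N_class g = (\<lambda>k. k \<otimes> g \<otimes> inv k) ` N"

lemma card_N_class_dvd:
  assumes g: "g \<in> carrier G"
  shows "card (N_class g) dvd p ^ a"
proof -
  have "card ((\<lambda>k. k \<otimes> g \<otimes> inv k) ` N) dvd card N"
    using g N_carrier by (intro orbit_card_dvd[OF N_subgroup N_finite]) (simp_all add: m_assoc inv_mult_group)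
  then show ?thesis by (simp add: N_class_def card_N)
qed

text \<open>A singleton class means that \<open>g\<close> centralizes \<open>N\<close>, which is
  impossible outside \<open>N\<close>.\<close>

lemma card_N_class_neq_1:
  assumes g: "g \<in> carrier G" "g \<notin> N"
  shows "card (N_class g) \<noteq> 1"
proof
  assume "card (N_class g) = 1"
  then obtain z where z: "N_class g = {z}" by (auto simp: card_1_singleton_iff)
  have z': "k \<otimes> g \<otimes> inv k = z" if "k \<in> N" for k
    using z that unfolding N_class_def by blast
  have "z = g" using z'[OF N_closed(1)] g by simp
  then have "g \<otimes> k = k \<otimes> g" if k: "k \<in> N" for k
    using z'[OF k] g N_carrier[OF k] by (metis inv_solve_right' m_closed)
  then show False using centralizer_N[OF g(1)] g(2) by blast
qed

text \<open>\<open>J\<close> is left general because the case \<open>p = 2\<close> applies this with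
  the multiples of \<open>4\<close> as well as with \<open>pA\<close>.\<close>

lemma class_sum_in:
  assumes S: "S \<subseteq> carrier G" "S \<inter> N = {}"
    and conj: "\<And>k g. k \<in> N \<Longrightarrow> g \<in> S \<Longrightarrow> k \<otimes> g \<otimes> inv k \<in> S"
    and u: "class_function u"
    and J: "0 \<in> J" "\<And>x y. x \<in> J \<Longrightarrow> y \<in> J \<Longrightarrow> x + y \<in> J"
    and mult: "\<And>g. g \<in> S \<Longrightarrow> of_nat (card (N_class g)) * u g \<in> J"
  shows "sum u S \<in> J"
proof -
  have moved: "\<exists>k\<in>N. k \<otimes> g \<otimes> inv k \<noteq> g" if g: "g \<in> S" for g
  proof (rule ccontr)
    assume "\<not> (\<exists>k\<in>N. k \<otimes> g \<otimes> inv k \<noteq> g)"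
    then have "N_class g = {g}" unfolding N_class_def using N_closed(1) by force
    then show False using card_N_class_neq_1[of g] g S by auto
  qed
  have "sum u {g \<in> S. \<exists>k\<in>N. k \<otimes> g \<otimes> inv k \<noteq> g} \<in> J"
  proof (rule sum_moved_points[OF N_subgroup N_finite finite_subset[OF S(1) finite_G] conj])
    show "\<one> \<otimes> g \<otimes> inv \<one> = g" if "g \<in> S" for g using that S by auto
    show "k \<otimes> l \<otimes> g \<otimes> inv (k \<otimes> l) = k \<otimes> (l \<otimes> g \<otimes> inv l) \<otimes> inv k"
      if "k \<in> N" "l \<in> N" "g \<in> S" for k l g
      using that(3) S N_carrier[OF that(1)] N_carrier[OF that(2)] by (auto simp: m_assoc inv_mult_group)
    show "u (k \<otimes> g \<otimes> inv k) - u g \<in> J" if "k \<in> N" "g \<in> S" for k g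
      using class_functionD[OF u N_carrier[OF that(1)]] that(2) S J by auto
    show "of_nat (card ((\<lambda>k. k \<otimes> g \<otimes> inv k) ` N)) * u g \<in> J" if "g \<in> S" for g
      using mult[OF that] by (simp add: N_class_def)
  qed (use J in auto)
  moreover have "{g \<in> S. \<exists>k\<in>N. k \<otimes> g \<otimes> inv k \<noteq> g} = S" using moved by blast
  ultimately show ?thesis by simp
qed

lemma class_sum_pA:
  assumes "S \<subseteq> carrier G" "S \<inter> N = {}"
    and "\<And>k g. k \<in> N \<Longrightarrow> g \<in> S \<Longrightarrow> k \<otimes> g \<otimes> inv k \<in> S"
    and "class_function u" "u \<in> fspace A"
  shows "sum u S \<in> pA"
proof (rule class_sum_in[OF assms(1-4) pA_zero pA_add])
  fix g assume "g \<in> S"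
  then have g: "g \<in> carrier G" "g \<notin> N" using assms by auto
  show "of_nat (card (N_class g)) * u g \<in> pA"
    using prime_dvd_orbit_card[OF prime_p card_N_class_dvd[OF g(1)] card_N_class_neq_1[OF g]]
      fspace_apply[OF assms(5) g(1)] by (rule pA_of_nat)
qed

end

section \<open>Descending one step of the chain\<close>

declare plus_fun_apply [simp del] minus_apply [simp del] times_fun_apply [simp del]
  uminus_apply [simp del]

text \<open>By Bezout the coprime periods \<open>p\<close> and \<open>l\<close> generate the period
  \<open>1\<close>.\<close>

lemma periodic_constant:
  fixes b :: "nat \<Rightarrow> 'x"
  assumes p: "Factorial_Ring.prime p" and per: "\<And>i. b (i + p) = b i" "\<And>i. b (i + l) = b i" and l: "\<not> p dvd l"
  shows "b i = b 0"
proof -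
  have p': "b (i + p * k) = b i" for i k
    by (induction k) (simp_all add: per(1) add.assoc[symmetric], metis add.assoc add.commute per(1))
  have l': "b (i + l * k) = b i" for i k
    by (induction k) (simp_all add: per(2) add.assoc[symmetric], metis add.assoc add.commute per(2))
  have "gcd l p = 1" using l p by (metis coprime_iff_gcd_eq_1 prime_imp_coprime coprime_commute)
  moreover have "l \<noteq> 0" using l by (metis dvd_0_right)
  ultimately obtain x y where xy: "l * x = p * y + 1" using bezout_nat[of l p] by metis
  have "b (i + 1) = b i" for i
  proof -
    have "b i = b (i + (p * y + 1))" using l'[of i x] xy by simp
    also have "\<dots> = b ((i + 1) + p * y)" by (simp add: ac_simps)
    finally show ?thesis using p'[of "i + 1" y] by simp
  qed
  then show ?thesis by (induction i) simp_all
qed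

context group_functions
begin

text \<open>Convolution with \<open>ind H\<close> on the right sums over \<open>g H\<close>; for a
  class function this equals the sum over \<open>H g\<close>, term by term.\<close>

lemma conv_ind_subgroup:
  assumes H: "subgroup H G" and u: "class_function u" "u \<in> fspace F" and g: "g \<in> carrier G"
  shows "(u \<star> ind H) g = (\<Sum>h\<in>H. u (h \<otimes> g))"
proof -
  interpret H: subgroup H G by fact
  have "(u \<star> ind H) g = (\<Sum>k\<in>carrier G. u (g \<otimes> k) * ind H (inv (g \<otimes> k) \<otimes> g))"
    unfolding conv_apply[OF g] by (rule sum_left_mult[OF g, symmetric])
  also have "\<dots> = (\<Sum>k\<in>carrier G. if k \<in> H then u (k \<otimes> g) else 0)"
  proof (rule sum.cong[OF refl])
    fix k assume k: "k \<in> carrier G"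
    have "inv (g \<otimes> k) \<otimes> g = inv k" using g k by (simp add: inv_mult_group m_assoc)
    moreover have "inv k \<in> H \<longleftrightarrow> k \<in> H" using k by (metis H.m_inv_closed inv_inv)
    moreover have "u (g \<otimes> k) = u (k \<otimes> g)"
      using class_functionD[OF u(1) k, of "g \<otimes> k"] g k by (simp add: m_assoc)
    ultimately show "u (g \<otimes> k) * ind H (inv (g \<otimes> k) \<otimes> g) = (if k \<in> H then u (k \<otimes> g) else 0)"
      using F_mult_unit fspace_apply[OF u(2)] g k by (simp add: ind_def)
  qed
  also have "\<dots> = (\<Sum>h\<in>H. u (h \<otimes> g))"
    using finite_G H.subset by (simp add: sum.If_cases Int_absorb1)
  finally show ?thesis .
qed

lemma scale_cancel:
  assumes "c \<in> F" "c \<noteq> 0" "x \<in> fspace F" "y \<in> fspace F" "(\<lambda>_. c) * x = (\<lambda>_. c) * y"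
  shows "x = y"
proof (rule fspace_eqI[OF assms(3,4)])
  fix g assume "g \<in> carrier G"
  moreover have "c * x g = c * y g" using fun_cong[OF assms(5), of g] by (simp add: times_fun_apply)
  ultimately show "x g = y g"
    using F_mult_cancel[OF assms(1) _ _ assms(2)] fspace_apply assms(3,4) by blast
qed

end

text \<open>The data of one descent: \<open>u\<close> acts as \<open>n\<close> modulo
  \<open>extend H m\<close>, and the \<open>p\<close>-th power of \<open>u\<close> is already known
  to be the group element \<open>n'\<close>.\<close>

locale lifting_step = p_constrained F e A p G N a
  for F :: "'k :: comm_ring_1 set" and e A p and G :: "('g, 'm) monoid_scheme" (structure)
    and N :: "'g set" and a +
  fixes H :: "'g set" and m :: 'g and u :: "'g \<Rightarrow> 'k" and n n' :: 'g
  assumes step: "central_step H m"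
    and u: "class_function u" "u \<in> fspace A"
    and nN: "n \<in> N" and u_extend: "u \<star> ind (extend H m) = translate n (ind (extend H m))"
    and n'N: "n' \<in> N" and u_pow: "x \<in> fspace F \<Longrightarrow> ((\<lambda>y. u \<star> y) ^^ p) x = translate n' x"
begin

lemmas H = stepD(1)[OF step] and mG = stepD(5)[OF step] and mN = stepD(2)[OF step]
  and M = nsub_extend[OF step] and uF = fspace_A_F[OF u(2)]

abbreviation "M \<equiv> extend H m"
abbreviation "\<sigma> \<equiv> sigma m"
abbreviation "\<tau> \<equiv> tau m"
abbreviation "T \<equiv> (\<lambda>l::nat. translate (m [^] l))"
abbreviation "\<delta> \<equiv> (\<lambda>x. translate m x - x)"

lemma H_carrier: "H \<subseteq> carrier G" and M_carrier: "M \<subseteq> carrier G"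
  using nsubD(3)[OF H] nsubD(3)[OF M] by blast+

lemma nG: "n \<in> carrier G"
  by (rule N_carrier[OF nN])

text \<open>Conjugation is restricted to \<open>N\<close> because \<open>H\<close> is normal in
  \<open>N\<close> but possibly not in \<open>G\<close>, so \<open>ind H\<close> need not be a class
  function.\<close>

definition conj_inv :: "('g \<Rightarrow> 'k) \<Rightarrow> bool" where
  "conj_inv x \<longleftrightarrow> (\<forall>k\<in>N. \<forall>g\<in>carrier G. x (k \<otimes> g \<otimes> inv k) = x g)"

lemma conj_invD: "conj_inv x \<Longrightarrow> k \<in> N \<Longrightarrow> g \<in> carrier G \<Longrightarrow> x (k \<otimes> g \<otimes> inv k) = x g"
  by (simp add: conj_inv_def)

lemma conj_inv_ind: assumes "nsub K" shows "conj_inv (ind K)"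
  unfolding conj_inv_def
proof (intro ballI)
  fix k g assume k: "k \<in> N" and g: "g \<in> carrier G"
  have "k \<otimes> g \<otimes> inv k \<in> K \<longleftrightarrow> g \<in> K"
  proof
    assume "k \<otimes> g \<otimes> inv k \<in> K"
    from nsubD(8)[OF assms k this] show "g \<in> K"
      using g N_carrier[OF k] by (simp add: m_assoc mult_inv_cancel)
  qed (rule nsubD(7)[OF assms k])
  then show "ind K (k \<otimes> g \<otimes> inv k) = ind K g" by (simp add: ind_def)
qed

lemma conj_inv_conv: "conj_inv x \<Longrightarrow> conj_inv (u \<star> x)"
  using conv_conj[OF u(1) N_carrier, of _ x] by (simp add: conj_inv_def)

text \<open>For \<open>x\<close> left invariant under \<open>H\<close>, the group \<open>N\<close> can only permute the \<open>H\<close>-cosets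
  \<open>m [^] j \<otimes> g\<close> cyclically.\<close>

lemma conj_shift:
  assumes x: "x \<in> linv H" "conj_inv x" and g: "g \<in> carrier G" and k: "k \<in> N" and h: "h \<in> H"
    and eq: "k \<otimes> g \<otimes> inv k = h \<otimes> m [^] l \<otimes> g"
  shows "x (m [^] (j::nat) \<otimes> g) = x (m [^] (j + l) \<otimes> g)"
proof -
  obtain h1 where h1: "h1 \<in> H" "k \<otimes> m [^] j = h1 \<otimes> (m [^] j \<otimes> k)" using step_commute[OF step k] .
  note car = g N_carrier[OF k] nsubD(3)[OF H h] nsubD(3)[OF H h1(1)] pow_carrier[OF step]
  have c: "m [^] j \<otimes> h \<otimes> inv (m [^] j) \<in> H" by (rule nsubD(7)[OF H N_pow[OF mN] h])
  have "x (m [^] j \<otimes> g) = x (k \<otimes> (m [^] j \<otimes> g) \<otimes> inv k)"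
    using conj_invD[OF x(2) k] car by simp
  also have "k \<otimes> (m [^] j \<otimes> g) \<otimes> inv k = (k \<otimes> m [^] j) \<otimes> g \<otimes> inv k"
    using car by (simp add: m_assoc)
  also have "\<dots> = h1 \<otimes> (m [^] j \<otimes> (k \<otimes> g \<otimes> inv k))"
    unfolding h1(2) using car by (simp add: m_assoc)
  also have "\<dots> = h1 \<otimes> ((m [^] j \<otimes> h \<otimes> inv (m [^] j)) \<otimes> ((m [^] j \<otimes> m [^] l) \<otimes> g))"
    unfolding eq using car by (simp add: m_assoc mult_inv_cancel)
  also have "m [^] j \<otimes> m [^] l = m [^] (j + l)" using mG by (simp add: nat_pow_mult)
  also have "x (h1 \<otimes> ((m [^] j \<otimes> h \<otimes> inv (m [^] j)) \<otimes> (m [^] (j + l) \<otimes> g))) = x (m [^] (j + l) \<otimes> g)"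
    using linv_apply[OF H x(1) h1(1)] linv_apply[OF H x(1) c] car by simp
  finally show ?thesis .
qed

lemma pow_period:
  assumes x: "x \<in> linv H" and g: "g \<in> carrier G"
  shows "x (m [^] (j + p) \<otimes> g) = x (m [^] (j::nat) \<otimes> g)"
proof -
  have "m [^] (j + p) = m [^] p \<otimes> m [^] j" using mG by (simp add: nat_pow_mult add.commute)
  then show ?thesis using linv_apply[OF H x stepD(4)[OF step], of "m [^] j \<otimes> g"] g mG by (simp add: m_assoc)
qed

lemma inv_pow_apply:
  assumes x: "x \<in> linv H" and g: "g \<in> carrier G" and l: "l \<le> p"
  shows "x (inv (m [^] (l::nat)) \<otimes> g) = x (m [^] (p - l) \<otimes> g)"
proof -
  have "m [^] p = m [^] (p - l) \<otimes> m [^] l" using mG l by (simp add: nat_pow_mult)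
  then have "m [^] (p - l) \<otimes> g = m [^] p \<otimes> (inv (m [^] l) \<otimes> g)"
    using g mG by (simp add: m_assoc mult_inv_cancel)
  then show ?thesis using linv_apply[OF H x stepD(4)[OF step], of "inv (m [^] l) \<otimes> g"] g mG by simp
qed

text \<open>The shift by \<open>l\<close> generates the cyclic group of order \<open>p\<close> that
  permutes the \<open>H\<close>-cosets in the \<open>M\<close>-coset of \<open>g\<close>.\<close>

lemma conj_shift_constant:
  assumes x: "x \<in> linv H" "conj_inv x" and g: "g \<in> carrier G" and k: "k \<in> N" and h: "h \<in> H"
    and eq: "k \<otimes> g \<otimes> inv k = h \<otimes> m [^] l \<otimes> g" and l: "\<not> p dvd l"
  shows "x (m [^] (j::nat) \<otimes> g) = x g"
proof -
  have "x (m [^] j \<otimes> g) = x (m [^] (0::nat) \<otimes> g)"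
    by (rule periodic_constant[OF prime_p _ _ l, of "\<lambda>j. x (m [^] j \<otimes> g)"])
      (simp_all only: pow_period[OF x(1) g] conj_shift[OF x g k h eq, symmetric])
  then show ?thesis using g by simp
qed

text \<open>If conjugation by \<open>k\<close> shifted the coset of \<open>n\<close> by
  \<open>m^l\<close> with \<open>l\<close> prime to \<open>p\<close>, then
  \<open>u \<star> ind H\<close> would be constant on the \<open>p\<close> cosets of
  \<open>H\<close> that make up \<open>M n\<close>. Its trace would be \<open>p\<close> times an
  element of \<open>A\<close> there, but the trace has the value \<open>e\<close>.\<close>

lemma n_central:
  assumes k: "k \<in> N"
  shows "k \<otimes> n \<otimes> inv k \<otimes> inv n \<in> H"
proof -
  define w where "w = u \<star> ind H"
  have w: "w \<in> linv H" unfolding w_def by (rule linv_class_conv[OF H u(1) uF linv_ind[OF H]])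
  have wc: "conj_inv w" unfolding w_def by (intro conj_inv_conv conj_inv_ind H)
  have wA: "w \<in> fspace A" unfolding w_def by (intro fspace_conv u fspace_ind H_carrier)
  have sw: "\<sigma> w = translate n (ind M)"
    unfolding w_def using conv_sigma[OF step u(1)] sigma_ind[OF step] u_extend by metis
  note car = nG N_carrier[OF k]
  have "translate n (ind M) (k \<otimes> n \<otimes> inv k) = translate n (ind M) n"
    unfolding u_extend[symmetric] by (intro conj_invD conj_inv_conv conj_inv_ind M k nG)
  then have "inv n \<otimes> (k \<otimes> n \<otimes> inv k) \<in> M"
    using car nsubD(4)[OF M] F_unit(2) by (simp add: translate_apply ind_def split: if_splits)
  from nsubD(7)[OF M nN this] have "k \<otimes> n \<otimes> inv k \<otimes> inv n \<in> M"
    using car by (simp add: m_assoc mult_inv_cancel)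
  then obtain h l where hl: "h \<in> H" "l < p" "k \<otimes> n \<otimes> inv k \<otimes> inv n = h \<otimes> m [^] l" by (rule extendE[OF step])
  have "k \<otimes> n \<otimes> inv k = (k \<otimes> n \<otimes> inv k \<otimes> inv n) \<otimes> n" using car by (simp add: m_assoc)
  then have eq: "k \<otimes> n \<otimes> inv k = h \<otimes> m [^] l \<otimes> n" by (simp only: hl(3))
  have "p dvd l"
  proof (rule ccontr)
    assume l: "\<not> p dvd l"
    have "\<sigma> w (m [^] p \<otimes> n) = (\<Sum>l<p. translate (m [^] l) w (m [^] p \<otimes> n))"
      by (simp only: sigma_def[OF step] sum_fun_apply)
    also have "\<dots> = (\<Sum>l<p. w n)"
    proof (rule sum.cong[OF refl])
      fix l assume l': "l \<in> {..<p}"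
      have "translate (m [^] l) w (m [^] p \<otimes> n) = w (inv (m [^] l) \<otimes> (m [^] p \<otimes> n))"
        using mG nG by (simp add: translate_apply)
      also have "\<dots> = w (m [^] (p - l) \<otimes> (m [^] p \<otimes> n))"
        using l' mG nG by (intro inv_pow_apply[OF w]) simp_all
      also have "\<dots> = w (m [^] (p - l + p) \<otimes> n)"
        using mG nG by (simp add: m_assoc[symmetric] nat_pow_mult)
      finally show "translate (m [^] l) w (m [^] p \<otimes> n) = w n"
        using conj_shift_constant[OF w wc nG k hl(1) eq l] by simp
    qed
    also have "\<dots> = of_nat p * w n" by simp
    finally have "translate n (ind M) (m [^] p \<otimes> n) = of_nat p * w n" by (simp only: sw)
    moreover have "inv n \<otimes> m [^] p \<otimes> n \<in> M"
      using nsubD(8)[OF M nN] H_subset_extend[OF step stepD(4)[OF step]] by blast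
    then have "translate n (ind M) (m [^] p \<otimes> n) = e"
      using mG nG by (simp add: translate_apply ind_def m_assoc)
    ultimately show False using p_nonunit fspace_apply[OF wA nG] by metis
  qed
  then have "m [^] l \<in> H" using pow_in_iff[OF step] by blast
  then show ?thesis using hl nsubD(6)[OF H] by simp
qed

lemma central_translate_commute:
  assumes q: "q \<in> N" "\<And>k. k \<in> N \<Longrightarrow> k \<otimes> q \<otimes> inv k \<otimes> inv q \<in> H"
    and x: "x \<in> linv H" and k: "k \<in> N"
  shows "translate q (translate k x) = translate k (translate q x)"
proof -
  note car = N_carrier[OF q(1)] N_carrier[OF k]
  define h where "h = inv q \<otimes> (inv k \<otimes> q \<otimes> inv (inv k) \<otimes> inv q) \<otimes> q"
  have h: "h \<in> H" unfolding h_def by (rule nsubD(8)[OF H q(1) q(2)[OF N_closed(2)[OF k]]])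
  have "q \<otimes> k = k \<otimes> (q \<otimes> h)" using car by (simp add: h_def m_assoc mult_inv_cancel)
  then have "translate q (translate k x) = translate k (translate q (translate h x))"
    using car nsubD(3)[OF H h] by (simp add: translate_translate)
  then show ?thesis by (simp only: linv_translate[OF x h])
qed

lemma central_conj_inv:
  assumes q: "q \<in> N" "\<And>k. k \<in> N \<Longrightarrow> k \<otimes> q \<otimes> inv k \<otimes> inv q \<in> H"
    and x: "x \<in> linv H" "conj_inv x"
  shows "conj_inv (translate q x)"
  unfolding conj_inv_def
proof (intro ballI)
  fix k g assume k: "k \<in> N" and g: "g \<in> carrier G"
  note car = N_carrier[OF q(1)] N_carrier[OF k] g
  define h where "h = inv q \<otimes> (k \<otimes> q \<otimes> inv k \<otimes> inv q) \<otimes> q"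
  have h: "h \<in> H" unfolding h_def by (rule nsubD(8)[OF H q(1) q(2)[OF k]])
  have "inv q \<otimes> (k \<otimes> g \<otimes> inv k) = h \<otimes> (k \<otimes> (inv q \<otimes> g) \<otimes> inv k)"
    using car by (simp add: h_def m_assoc mult_inv_cancel)
  then have "x (inv q \<otimes> (k \<otimes> g \<otimes> inv k)) = x (inv q \<otimes> g)"
    using linv_apply[OF H x(1) h] conj_invD[OF x(2) k] car by simp
  then show "translate q x (k \<otimes> g \<otimes> inv k) = translate q x g"
    using car by (simp add: translate_apply)
qed

lemma pow_central: "k \<in> N \<Longrightarrow> k \<otimes> m [^] (l::nat) \<otimes> inv k \<otimes> inv (m [^] l) \<in> H"
  using conj_pow_commutator[OF H mN] stepD(6)[OF step] by blast

lemma inv_n_central: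
  assumes k: "k \<in> N"
  shows "k \<otimes> inv n \<otimes> inv k \<otimes> inv (inv n) \<in> H"
proof -
  note car = nG N_carrier[OF k]
  have "inv (inv n \<otimes> (k \<otimes> n \<otimes> inv k \<otimes> inv n) \<otimes> n) \<in> H"
    by (intro nsubD(5)[OF H] nsubD(8)[OF H nN] n_central k)
  moreover have "inv (inv n \<otimes> (k \<otimes> n \<otimes> inv k \<otimes> inv n) \<otimes> n) = k \<otimes> inv n \<otimes> inv k \<otimes> inv (inv n)"
    using car by (simp add: inv_mult_group m_assoc)
  ultimately show ?thesis by simp
qed

text \<open>Kept as an operator: since \<open>n\<close> is central modulo \<open>H\<close>, it
  commutes with \<open>N\<close> on \<open>linv H\<close>, and by \<open>v_conv\<close> it is
  determined by its value at \<open>ind H\<close>.\<close>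

definition v :: "('g \<Rightarrow> 'k) \<Rightarrow> 'g \<Rightarrow> 'k" where
  "v x = translate (inv n) (u \<star> x)"

lemma v_add: "v (x + y) = v x + v y" and v_diff: "v (x - y) = v x - v y"
  and v_of_nat: "v (of_nat i * x) = of_nat i * v x"
  and v_scale: "v ((\<lambda>_. c) * x) = (\<lambda>_. c) * v x"
  by (simp_all add: v_def conv_add conv_diff conv_of_nat conv_scale
      translate_add translate_diff translate_of_nat translate_scale)

lemma v_sum: "v (\<Sum>i\<in>I. x i) = (\<Sum>i\<in>I. v (x i))"
  by (simp add: v_def conv_sum translate_sum)

lemma v_conv: "v (x \<star> y) = v x \<star> y"
  using nG by (simp add: v_def conv_assoc translate_conv)

lemma v_F: "x \<in> fspace F \<Longrightarrow> v x \<in> fspace F"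
  and v_A: "x \<in> fspace A \<Longrightarrow> v x \<in> fspace A"
  and v_nonunits: "x \<in> fspace nonunits \<Longrightarrow> v x \<in> fspace nonunits"
  unfolding v_def using nG
  by (auto intro!: fspace_translate fspace_conv(1)[OF uF] fspace_conv(2)[OF u(2)] fspace_conv(4)[OF u(2)])

lemma v_linv: "x \<in> linv H \<Longrightarrow> v x \<in> linv H"
  unfolding v_def by (intro linv_N_translate[OF H] linv_class_conv[OF H u(1) uF] N_closed(2) nN)

lemma v_translate: "x \<in> linv H \<Longrightarrow> k \<in> N \<Longrightarrow> v (translate k x) = translate k (v x)"
  unfolding v_def conv_translate[OF u(1) N_carrier]
  by (rule central_translate_commute[OF N_closed(2)[OF nN] inv_n_central linv_class_conv[OF H u(1) uF]])

lemma v_T: "x \<in> linv H \<Longrightarrow> v (T i x) = T i (v x)"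
  by (intro v_translate N_pow mN)

lemma v_sigma: "x \<in> linv H \<Longrightarrow> v (\<sigma> x) = \<sigma> (v x)"
  by (simp add: sigma_def[OF step] v_sum v_T)

lemma v_tau: "x \<in> linv H \<Longrightarrow> v (\<tau> x) = \<tau> (v x)"
  by (simp add: tau_def[OF step] v_sum v_of_nat v_T)

lemma v_delta: "x \<in> linv H \<Longrightarrow> v (\<delta> x) = \<delta> (v x)"
  by (simp add: v_diff v_translate mN)

lemma v_ind_M: "v (ind M) = ind M"
  unfolding v_def u_extend
  using nG translate_one[OF fspace_ind[OF M_carrier]] by (simp add: translate_translate)

lemma v_linv_M:
  assumes "x \<in> linv M" "x \<in> fspace A"
  shows "v x = x"
proof -
  obtain b where "x = ind M \<star> b" using linv_ind_conv[OF M assms] by blast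
  then show ?thesis by (simp only: v_conv v_ind_M)
qed

lemma v_sigma_fixed:
  assumes "x \<in> linv H" "x \<in> fspace A"
  shows "v (\<sigma> x) = \<sigma> x"
  using assms by (intro v_linv_M linv_extend[OF step] linv_sigma[OF step] translate_m_sigma[OF step] sigma_A[OF step])

text \<open>Since \<open>\<tau> \<delta> = p - \<sigma>\<close> and both \<open>v\<close> and
  \<open>m^i\<close> fix \<open>\<sigma> z\<close>, the two operators agree on
  \<open>p z\<close>.\<close>

lemma eigen_from_delta:
  assumes z: "z \<in> linv H" "z \<in> fspace A" and eq: "v (\<delta> z) = T i (\<delta> z)"
  shows "v z = T i z"
proof (rule p_cancel_fspace)
  have tz: "\<tau> (\<delta> z) = of_nat p * z - \<sigma> z" by (rule tau_m_diff[OF step z(1)])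
  have dz: "\<delta> z \<in> linv H" by (rule linv_m_diff[OF step z(1)])
  have "v (\<tau> (\<delta> z)) = T i (\<tau> (\<delta> z))"
    using v_tau[OF dz] eq translate_tau[OF step dz N_pow[OF mN]] by metis
  then have "of_nat p * v z - \<sigma> z = of_nat p * T i z - \<sigma> z"
    by (simp only: tz v_diff v_of_nat v_sigma_fixed[OF z] translate_diff translate_of_nat
        translate_pow_sigma[OF step z(1)])
  then show "of_nat p * v z = of_nat p * T i z" by (metis diff_add_cancel)
  show "v z \<in> fspace F" "T i z \<in> fspace F"
    using v_F linv_F[OF z(1)] fspace_translate mG by simp_all
qed

definition f :: "'g \<Rightarrow> 'k" where
  "f = v (ind H) - ind H"

lemma f_linv: "f \<in> linv H"
  unfolding f_def by (intro linv_diff v_linv linv_ind H)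

lemma f_A: "f \<in> fspace A"
  unfolding f_def by (intro fspace_diff v_A fspace_ind H_carrier)

lemma f_sigma: "\<sigma> f = 0"
  unfolding f_def sigma_diff[OF step] v_sigma[OF linv_ind[OF H], symmetric] sigma_ind[OF step] v_ind_M
  by simp

lemma f_conj_inv: "conj_inv f"
proof -
  have "conj_inv (v (ind H))"
    unfolding v_def
    by (intro central_conj_inv[OF N_closed(2)[OF nN] inv_n_central] linv_class_conv[OF H u(1) uF]
        linv_ind[OF H] conj_inv_conv conj_inv_ind H)
  then show ?thesis using conj_inv_ind[OF H] by (simp add: conj_inv_def f_def minus_apply)
qed

text \<open>\<open>v\<close> is the identity modulo \<open>m - 1\<close>: the kernel lemma for
  \<open>\<sigma>\<close> divides \<open>f\<close> by \<open>m - 1\<close>, and right multiplication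
  carries this from \<open>ind H\<close> to \<open>z\<close>.\<close>

lemma v_minus_one:
  assumes z: "z \<in> linv H" "z \<in> fspace A"
  obtains y where "y \<in> linv H" "y \<in> fspace A" "v z = z + \<delta> y"
proof -
  obtain y where y: "y \<in> linv H" "y \<in> fspace A" "f = \<delta> y" using sigma_kernel[OF step f_linv f_A f_sigma] .
  obtain b where b: "b \<in> fspace A" "z = ind H \<star> b" using linv_ind_conv[OF H z] .
  have "v (ind H) = ind H + \<delta> y" using y(3) by (simp add: f_def algebra_simps)
  then have "v z = (ind H + \<delta> y) \<star> b" by (simp only: b(2) v_conv)
  also have "\<dots> = z + \<delta> (y \<star> b)" by (simp only: b(2) conv_add conv_diff translate_conv[OF mG])
  finally show ?thesis
    using that[of "y \<star> b"] linv_conv[OF H y(1) fspace_A_F[OF b(1)]] fspace_conv(2)[OF y(2) b(1)] by blast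
qed

lemma v_pow: "x \<in> linv H \<Longrightarrow> (v ^^ j) x \<in> linv H"
  by (induction j) (simp_all add: v_linv)

lemma v_pow_translate:
  assumes x: "x \<in> linv H"
  shows "(v ^^ j) x = translate (inv n [^] j) (((\<lambda>y. u \<star> y) ^^ j) x) \<and> ((\<lambda>y. u \<star> y) ^^ j) x \<in> linv H"
proof (induction j)
  case 0
  then show ?case using translate_one[OF linv_F[OF x]] x by simp
next
  case (Suc j)
  define w where "w = ((\<lambda>y. u \<star> y) ^^ j) x"
  have w: "w \<in> linv H" "(v ^^ j) x = translate (inv n [^] j) w" using Suc by (simp_all add: w_def)
  have "(v ^^ Suc j) x = v (translate (inv n [^] j) w)" using w(2) by simp
  also have "\<dots> = translate (inv n [^] j) (v w)"
    by (rule v_translate[OF w(1) N_pow[OF N_closed(2)[OF nN]]])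
  also have "\<dots> = translate (inv n [^] Suc j) (u \<star> w)"
    using nG by (simp add: v_def translate_translate)
  finally show ?case using linv_class_conv[OF H u(1) uF w(1)] by (simp add: w_def)
qed

text \<open>\<open>v^p\<close> is translation by \<open>n^-p n'\<close>. It fixes
  \<open>ind M\<close>, so this element lies in \<open>M\<close>, and modulo \<open>H\<close> it is
  a power of \<open>m\<close>.\<close>

lemma v_pow_p_aux: "\<exists>i<p. \<forall>x\<in>linv H. (v ^^ p) x = T i x"
proof -
  define q where "q = inv n [^] p \<otimes> n'"
  have q: "q \<in> N" unfolding q_def by (intro N_closed N_pow nN n'N)
  have vp: "(v ^^ p) x = translate q x" if x: "x \<in> linv H" for x
    using v_pow_translate[OF x, of p] u_pow[OF linv_F[OF x]] nG N_carrier[OF n'N]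
    by (simp add: q_def translate_translate)
  have "ind M \<in> linv H"
    unfolding sigma_ind[OF step, symmetric] by (intro linv_sigma[OF step] linv_ind[OF H])
  from vp[OF this] have "(v ^^ p) (ind M) = translate q (ind M)" .
  moreover have "(v ^^ j) (ind M) = ind M" for j by (induction j) (simp_all add: v_ind_M)
  ultimately have "translate q (ind M) q = ind M q" by metis
  then have "q \<in> M"
    using N_carrier[OF q] nsubD(4)[OF M] F_unit(2) by (simp add: translate_apply ind_def split: if_splits)
  then obtain h i where hi: "h \<in> H" "i < p" "q = h \<otimes> m [^] i" by (rule extendE[OF step])
  have "(v ^^ p) x = T i x" if x: "x \<in> linv H" for x
  proof -
    have "(v ^^ p) x = translate h (T i x)"
      using vp[OF x] hi nsubD(3)[OF H hi(1)] mG by (simp add: translate_translate)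
    then show ?thesis by (simp only: linv_translate[OF linv_pow[OF step x] hi(1)])
  qed
  then show ?thesis using hi(2) by blast
qed

lemma T_minus_one:
  assumes x: "x \<in> linv H"
  shows "T i x - x = (\<Sum>l<i. T l (\<delta> x))"
proof (induction i)
  case 0
  then show ?case using linv_pow_0[OF step x] by simp
next
  case (Suc i)
  have "T (Suc i) x - x = (T i x - x) + T i (\<delta> x)"
    by (simp only: translate_pow_Suc[OF step] translate_pow_m[OF step] translate_diff) (simp add: algebra_simps)
  then show ?case by (simp only: Suc sum.lessThan_Suc)
qed

text \<open>The expansion of \<open>(1 + (v - 1))^j\<close> up to terms divisible by
  \<open>(m - 1)^2\<close>.\<close>

lemma v_pow_expansion:
  assumes y: "y \<in> linv H" "y \<in> fspace A" "v (ind H) = ind H + \<delta> y"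
  shows "\<exists>r. r \<in> linv H \<and> r \<in> fspace A \<and> (v ^^ j) (ind H) = ind H + of_nat j * \<delta> y + \<delta> (\<delta> r)"
proof (induction j)
  case 0
  have "(v ^^ 0) (ind H) = ind H + of_nat 0 * \<delta> y + \<delta> (\<delta> 0)" by (simp add: translate_zero)
  then show ?case using linv_zero fspace_zero(2) by blast
next
  case (Suc j)
  then obtain r where r: "r \<in> linv H" "r \<in> fspace A"
    "(v ^^ j) (ind H) = ind H + of_nat j * \<delta> y + \<delta> (\<delta> r)" by blast
  obtain y1 where y1: "y1 \<in> linv H" "y1 \<in> fspace A" "v y = y + \<delta> y1" using v_minus_one[OF y(1,2)] .
  define r' where "r' = of_nat j * y1 + v r"
  have "(v ^^ Suc j) (ind H) = v (ind H) + of_nat j * v (\<delta> y) + v (\<delta> (\<delta> r))"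
    by (simp only: funpow.simps comp_apply r(3) v_add v_of_nat)
  also have "v (\<delta> y) = \<delta> y + \<delta> (\<delta> y1)"
    by (simp only: v_delta[OF y(1)] y1(3) translate_add) (simp add: algebra_simps)
  also have "v (\<delta> (\<delta> r)) = \<delta> (\<delta> (v r))"
    by (simp only: v_delta[OF linv_m_diff[OF step r(1)]] v_delta[OF r(1)])
  also have "v (ind H) + of_nat j * (\<delta> y + \<delta> (\<delta> y1)) + \<delta> (\<delta> (v r)) =
      ind H + of_nat (Suc j) * \<delta> y + (of_nat j * \<delta> (\<delta> y1) + \<delta> (\<delta> (v r)))"
    unfolding y(3) by (simp add: algebra_simps)
  also have "of_nat j * \<delta> (\<delta> y1) + \<delta> (\<delta> (v r)) = \<delta> (\<delta> r')"
    unfolding r'_def translate_add translate_diff translate_of_nat by (simp add: algebra_simps)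
  finally show ?case
    using linv_add[OF linv_of_nat[OF y1(1)] v_linv[OF r(1)]]
      fspace_add(2)[OF fspace_of_nat(2)[OF y1(2)] v_A[OF r(2)]] unfolding r'_def by blast
qed

text \<open>The expansion gives \<open>(m - 1) S = p (m - 1) y + (m - 1)^2 r\<close>, where
  \<open>S\<close> is \<open>1 + ... + m^(i-1)\<close> applied to \<open>ind H\<close>. Applying
  \<open>\<tau>\<close>, in place of dividing by \<open>m - 1\<close>, shows that
  \<open>\<sigma> S = i ind M\<close> is divisible by \<open>p\<close>. Hence \<open>p\<close>
  divides \<open>i < p\<close>.\<close>

lemma v_pow_p: "x \<in> linv H \<Longrightarrow> (v ^^ p) x = x"
proof -
  obtain i where i: "i < p" "\<And>x. x \<in> linv H \<Longrightarrow> (v ^^ p) x = T i x" using v_pow_p_aux by blast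
  note iH = linv_ind[OF H] fspace_ind[OF H_carrier]
  obtain y where y: "y \<in> linv H" "y \<in> fspace A" "v (ind H) = ind H + \<delta> y" using v_minus_one[OF iH] .
  obtain r where r: "r \<in> linv H" "r \<in> fspace A"
    "(v ^^ p) (ind H) = ind H + of_nat p * \<delta> y + \<delta> (\<delta> r)" using v_pow_expansion[OF y] by blast
  define S where "S = (\<Sum>l<i. T l (ind H))"
  have S: "S \<in> linv H" "S \<in> fspace A"
    unfolding S_def using mG iH by (auto intro!: linv_sum linv_pow[OF step] fspace_sum fspace_translate)
  have dS: "\<delta> S = (\<Sum>l<i. T l (\<delta> (ind H)))"
    by (simp only: S_def translate_sum translate_diff translate_pow_m[OF step] sum_subtractf)
  have "T i (ind H) = ind H + of_nat p * \<delta> y + \<delta> (\<delta> r)" using i(2)[OF iH(1)] r(3) by simp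
  then have "T i (ind H) - ind H = of_nat p * \<delta> y + \<delta> (\<delta> r)" by (simp add: algebra_simps)
  then have "\<delta> S = of_nat p * \<delta> y + \<delta> (\<delta> r)" by (simp only: dS T_minus_one[OF iH(1)])
  then have "\<tau> (\<delta> S) = of_nat p * \<tau> (\<delta> y) + \<tau> (\<delta> (\<delta> r))"
    by (simp only: tau_add[OF step] tau_of_nat[OF step])
  then have eq: "of_nat p * S - \<sigma> S = of_nat p * \<tau> (\<delta> y) + (of_nat p * \<delta> r - 0)"
    by (simp only: tau_m_diff[OF step S(1)] tau_m_diff[OF step linv_m_diff[OF step r(1)]] sigma_m_diff[OF step r(1)])
  have "\<sigma> (T l (ind H)) = ind M" for l
    using translate_sigma[OF step iH(1) N_pow[OF mN], of l] translate_pow_sigma[OF step iH(1)] sigma_ind[OF step]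
    by metis
  then have sS: "\<sigma> S = of_nat i * ind M"
    unfolding S_def by (induction i) (simp_all add: sigma_def[OF step] translate_zero translate_add
      sum.distrib algebra_simps)
  define Q where "Q = S - \<tau> (\<delta> y) - \<delta> r"
  have Q: "Q \<in> fspace A" unfolding Q_def
    by (intro fspace_diff(2) S tau_A[OF step] fspace_translate mG y r)
  have "of_nat i * ind M = of_nat p * Q"
    using eq unfolding sS Q_def by (simp add: algebra_simps)
  from fun_cong[OF this, of \<one>] have "of_nat i * e = of_nat p * Q \<one>"
    using nsubD(4)[OF M] by (simp add: times_fun_apply ind_def)
  then have "of_nat i * e \<in> nonunits" using p_mult_nonunit fspace_apply[OF Q] by simp
  then have "p dvd i" by (rule of_nat_unit_nonunit)
  then have "i = 0" using i(1) by (auto dest: dvd_imp_le)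
  then show "(v ^^ p) x = x" if "x \<in> linv H" for x using i(2)[OF that] linv_pow_0[OF step that] by simp
qed

text \<open>Every eigenvalue of \<open>v\<close> on the kernel of \<open>\<sigma>\<close> is a power \<open>m [^] i\<close> whose exponent is, modulo the
  maximal ideal, the constant \<open>c\<close> below; \<open>\<Phi>\<close> plays the role of a logarithmic derivative of \<open>v\<close>.\<close>

definition \<Phi> :: "'g \<Rightarrow> 'k" where
  "\<Phi> = \<tau> f"

lemma \<Phi>_linv: "\<Phi> \<in> linv H" and \<Phi>_A: "\<Phi> \<in> fspace A"
  unfolding \<Phi>_def by (rule linv_tau[OF step f_linv], rule tau_A[OF step f_A])

lemma \<Phi>_conj_inv: "conj_inv \<Phi>"
proof -
  have "translate (m [^] l) f (k \<otimes> g \<otimes> inv k) = translate (m [^] l) f g" if k: "k \<in> N" and g: "g \<in> carrier G" for l :: nat and k g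
    by (rule conj_invD[OF central_conj_inv[OF N_pow[OF mN] pow_central f_linv f_conj_inv] k g])
  then show ?thesis
    by (simp add: conj_inv_def \<Phi>_def tau_def[OF step] sum_fun_apply times_fun_apply of_nat_fun_apply)
qed

lemma extend_inv_mod:
  assumes x: "x \<in> linv H" and J: "0 \<in> J" "\<And>a b. a \<in> J \<Longrightarrow> b \<in> J \<Longrightarrow> a + b \<in> J"
    and m: "\<And>y. y \<in> carrier G \<Longrightarrow> x (m \<otimes> y) - x y \<in> J"
    and g: "g \<in> M" and y: "y \<in> carrier G"
  shows "x (g \<otimes> y) - x y \<in> J"
proof -
  obtain h l where hl: "h \<in> H" "l < p" "g = h \<otimes> m [^] l" by (rule extendE[OF step g])
  have "x (m [^] l \<otimes> y) - x y \<in> J"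
  proof (induction l)
    case 0
    then show ?case using y J(1) by simp
  next
    case (Suc l)
    have c: "m [^] l \<otimes> y \<in> carrier G" using mG y by simp
    have "m [^] Suc l \<otimes> y = m \<otimes> (m [^] l \<otimes> y)"
      unfolding nat_pow_Suc2[OF mG] using mG y by (simp add: m_assoc)
    then have "x (m [^] Suc l \<otimes> y) - x y = (x (m \<otimes> (m [^] l \<otimes> y)) - x (m [^] l \<otimes> y)) + (x (m [^] l \<otimes> y) - x y)"
      by simp
    then show ?case using J(2)[OF m[OF c] Suc] by (simp only:)
  qed
  moreover have "x (g \<otimes> y) = x (m [^] l \<otimes> y)"
    using linv_apply[OF H x hl(1), of "m [^] l \<otimes> y"] hl(3) nsubD(3)[OF H hl(1)] mG y by (simp add: m_assoc)
  ultimately show ?thesis by simp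
qed

text \<open>The identities for \<open>\<tau>\<close> give
  \<open>(m - 1) \<Phi> = p f - \<sigma> f = p f\<close>.\<close>

lemma \<Phi>_left_mod:
  assumes g: "g \<in> M" and y: "y \<in> carrier G"
  shows "\<Phi> (g \<otimes> y) - \<Phi> y \<in> pA"
proof (rule extend_inv_mod[OF \<Phi>_linv pA_zero pA_add _ g y])
  fix y assume y: "y \<in> carrier G"
  have "translate m \<Phi> - \<Phi> = of_nat p * f"
    unfolding \<Phi>_def translate_tau[OF step f_linv mN] tau_diff[OF step, symmetric] tau_m_diff[OF step f_linv] f_sigma
    by simp
  from fun_cong[OF this, of "m \<otimes> y"] have eq: "\<Phi> y - \<Phi> (m \<otimes> y) = of_nat p * f (m \<otimes> y)"
    using mG y by (simp add: translate_apply times_fun_apply minus_apply of_nat_fun_apply mult_inv_cancel)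
  have "of_nat p * f (m \<otimes> y) \<in> pA" using fspace_apply[OF f_A] mG y unfolding pA_def by blast
  then have "- (\<Phi> y - \<Phi> (m \<otimes> y)) \<in> pA" unfolding eq by (rule pA_uminus)
  then show "\<Phi> (m \<otimes> y) - \<Phi> y \<in> pA" by simp
qed

lemma \<Phi>_right_mod:
  assumes g: "g \<in> M" and y: "y \<in> carrier G"
  shows "\<Phi> (y \<otimes> g) - \<Phi> y \<in> pA"
proof -
  have gG: "g \<in> carrier G" and gN: "g \<in> N" using nsubD(2,3)[OF M] g by blast+
  have "\<Phi> (g \<otimes> (y \<otimes> g) \<otimes> inv g) = \<Phi> (y \<otimes> g)"
    by (rule conj_invD[OF \<Phi>_conj_inv gN]) (use y gG in simp)
  then have "\<Phi> (y \<otimes> g) = \<Phi> (g \<otimes> y)" using y gG by (simp add: m_assoc)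
  then show ?thesis using \<Phi>_left_mod[OF g y] by simp
qed

lemma pA_of_nat_mult:
  assumes "x \<in> pA"
  shows "of_nat l * x \<in> pA"
proof -
  obtain y where "y \<in> A" "x = of_nat p * y" using assms by (auto simp: pA_def)
  then have "of_nat l * x = of_nat p * (of_nat l * y)" "of_nat l * y \<in> A"
    by (simp_all add: A_of_nat_mult mult.left_commute)
  then show ?thesis unfolding pA_def by blast
qed

text \<open>If \<open>N\<close> fixes \<open>H d\<close>, the values of \<open>f\<close> on
  \<open>M d\<close> are sums of \<open>u\<close> over sets outside \<open>N\<close> that are stable
  under \<open>N\<close>, hence multiples of \<open>p\<close>. Otherwise \<open>N\<close> moves the
  \<open>H\<close>-cosets of \<open>M d\<close> cyclically, \<open>f\<close> is constant on
  \<open>M d\<close>, and \<open>\<sigma> f = 0\<close> makes it vanish there.\<close>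

lemma \<Phi>_fixed_coset:
  assumes d: "d \<in> carrier G" "d \<notin> N" and fixed_coset: "\<And>k. k \<in> N \<Longrightarrow> \<exists>g\<in>M. k \<otimes> d \<otimes> inv k = g \<otimes> d"
  shows "\<Phi> d \<in> pA"
proof -
  have \<Phi>_d: "\<Phi> d = (\<Sum>l<p. of_nat l * f (m [^] (p - l) \<otimes> d))"
    unfolding \<Phi>_def tau_def[OF step] sum_fun_apply
    using d(1) inv_pow_apply[OF f_linv d(1)]
    by (intro sum.cong) (simp_all add: times_fun_apply of_nat_fun_apply translate_apply)
  show ?thesis
  proof (cases "\<forall>k\<in>N. \<exists>h\<in>H. k \<otimes> d \<otimes> inv k = h \<otimes> d")
    case True
    have "f (m [^] j \<otimes> d) \<in> pA" for j :: nat
    proof -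
      \<comment> \<open>The coset over which \<open>u\<close> is summed in \<open>f\<close> at
        \<open>m^j d\<close>; the factor \<open>n\<close> comes from the \<open>inv n\<close> in
        \<open>v\<close>.\<close>
      define S where "S = (\<lambda>h. h \<otimes> (n \<otimes> (m [^] j \<otimes> d))) ` H"
      have c: "m [^] j \<otimes> d \<in> carrier G" "n \<otimes> (m [^] j \<otimes> d) \<in> carrier G" using d mG nG by simp_all
      have notN: "q \<otimes> d \<notin> N" if q: "q \<in> N" for q
      proof
        assume "q \<otimes> d \<in> N"
        then have "inv q \<otimes> (q \<otimes> d) \<in> N" by (rule N_closed(3)[OF N_closed(2)[OF q]])
        then show False using d N_carrier[OF q] by (simp add: mult_inv_cancel)
      qed
      have SN: "S \<inter> N = {}"
      proof -
        have "h \<otimes> (n \<otimes> (m [^] j \<otimes> d)) \<notin> N" if h: "h \<in> H" for h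
        proof -
          have "h \<otimes> (n \<otimes> (m [^] j \<otimes> d)) = (h \<otimes> n \<otimes> m [^] j) \<otimes> d"
            using d nG mG nsubD(3)[OF H h] by (simp add: m_assoc)
          then show ?thesis using notN N_closed(3) N_pow[OF mN] nN nsubD(2)[OF H h] by simp
        qed
        then show ?thesis by (auto simp: S_def)
      qed
      have S_conj: "k \<otimes> s \<otimes> inv k \<in> S" if k: "k \<in> N" and s: "s \<in> S" for k s
      proof -
        obtain h where h: "h \<in> H" "s = h \<otimes> (n \<otimes> (m [^] j \<otimes> d))" using s by (auto simp: S_def)
        obtain h' where h': "h' \<in> H" "k \<otimes> d \<otimes> inv k = h' \<otimes> d" using True k by blast
        define h1 where "h1 = k \<otimes> h \<otimes> inv k"
        \<comment> \<open>\<open>h2\<close> and \<open>h3\<close> are the errors of moving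
          \<open>k\<close> past \<open>n\<close> and \<open>m^j\<close>; \<open>h4\<close> collects
          \<open>h3\<close> and \<open>h'\<close> on the left of \<open>n\<close>. All of them stay
          in \<open>H\<close>.\<close>
        define h2 where "h2 = k \<otimes> n \<otimes> inv k \<otimes> inv n"
        define h3 where "h3 = k \<otimes> m [^] j \<otimes> inv k \<otimes> inv (m [^] j)"
        define h4 where "h4 = n \<otimes> (h3 \<otimes> (m [^] j \<otimes> h' \<otimes> inv (m [^] j))) \<otimes> inv n"
        have hH: "h1 \<in> H" "h2 \<in> H" "h3 \<in> H"
          unfolding h1_def h2_def h3_def
          by (rule nsubD(7)[OF H k h(1)], rule n_central[OF k], rule pow_central[OF k])
        have h4: "h4 \<in> H" unfolding h4_def
          by (intro nsubD(7)[OF H nN] nsubD(6)[OF H] nsubD(7)[OF H N_pow[OF mN]] hH h')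
        note car = d(1) nG N_carrier[OF k] nsubD(3)[OF H h(1)] nsubD(3)[OF H h'(1)] pow_carrier[OF step]
        have "h1 \<otimes> h2 \<otimes> h4 \<otimes> (n \<otimes> (m [^] j \<otimes> d)) = h1 \<otimes> h2 \<otimes> n \<otimes> h3 \<otimes> m [^] j \<otimes> (h' \<otimes> d)"
          using car nsubD(3)[OF H hH(1)] nsubD(3)[OF H hH(2)] nsubD(3)[OF H hH(3)]
          by (simp add: h4_def m_assoc mult_inv_cancel)
        also have "\<dots> = h1 \<otimes> h2 \<otimes> n \<otimes> h3 \<otimes> m [^] j \<otimes> (k \<otimes> d \<otimes> inv k)" by (simp only: h'(2))
        also have "\<dots> = k \<otimes> s \<otimes> inv k"
          using car by (simp add: h1_def h2_def h3_def h(2) m_assoc mult_inv_cancel)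
        finally have "k \<otimes> s \<otimes> inv k = (h1 \<otimes> h2 \<otimes> h4) \<otimes> (n \<otimes> (m [^] j \<otimes> d))" ..
        moreover have "h1 \<otimes> h2 \<otimes> h4 \<in> H" by (intro nsubD(6)[OF H] hH h4)
        ultimately show ?thesis unfolding S_def by (rule image_eqI)
      qed
      have SG: "S \<subseteq> carrier G" using nsubD(3)[OF H] c by (auto simp: S_def)
      have "inj_on (\<lambda>h. h \<otimes> (n \<otimes> (m [^] j \<otimes> d))) H"
        using c(2) nsubD(3)[OF H] by (intro inj_onI) (meson right_cancel)
      then have "(u \<star> ind H) (n \<otimes> (m [^] j \<otimes> d)) = sum u S"
        unfolding conv_ind_subgroup[OF nsubD(1)[OF H] u(1) uF c(2)] S_def by (simp add: sum.reindex)
      moreover have "ind H (m [^] j \<otimes> d) = 0"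
        using notN[OF N_pow[OF mN]] nsubD(2)[OF H] by (auto simp: ind_def)
      ultimately have "f (m [^] j \<otimes> d) = sum u S"
        using c nG by (simp add: f_def v_def minus_apply translate_apply)
      then show ?thesis using class_sum_pA[OF SG SN S_conj u] by simp
    qed
    then have "of_nat l * f (m [^] (p - l) \<otimes> d) \<in> pA" for l
      by (rule pA_of_nat_mult)
    then show ?thesis unfolding \<Phi>_d by (intro pA_sum)
  next
    case False
    then obtain k where k: "k \<in> N" "\<And>h. h \<in> H \<Longrightarrow> k \<otimes> d \<otimes> inv k \<noteq> h \<otimes> d" by blast
    obtain g where g: "g \<in> M" "k \<otimes> d \<otimes> inv k = g \<otimes> d" using fixed_coset[OF k(1)] by blast
    obtain h l where hl: "h \<in> H" "l < p" "g = h \<otimes> m [^] l" by (rule extendE[OF step g(1)])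
    have "\<not> p dvd l"
    proof
      assume "p dvd l"
      then have "g \<in> H" using hl pow_in_iff[OF step] nsubD(6)[OF H] by blast
      then show False using k(2) g(2) by blast
    qed
    note const = conj_shift_constant[OF f_linv f_conj_inv d(1) k(1) hl(1) g(2)[unfolded hl(3)] this]
    have "\<sigma> f d = (\<Sum>l<p. f (m [^] (p - l) \<otimes> d))"
      unfolding sigma_def[OF step] sum_fun_apply
      using d(1) inv_pow_apply[OF f_linv d(1)] by (intro sum.cong) (simp_all add: translate_apply)
    then have "of_nat p * f d = 0" using f_sigma const by simp
    then have "f d = 0" using p_cancel_zero fspace_apply[OF f_A d(1)] A_F by blast
    then show ?thesis unfolding \<Phi>_d using const pA_zero by simp
  qed
qed

end

context group_functions
begin

text \<open>The scalar is a value that divides all others, so the remaining factor is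
  \<open>A\<close>-valued and does not vanish in the residue field.\<close>

lemma primitive_factor:
  assumes xF: "x \<in> fspace F" and x0: "x \<noteq> 0"
  obtains g0 y where "g0 \<in> carrier G" "x g0 \<noteq> 0" "y \<in> fspace A" "y g0 = e" "x = (\<lambda>_. x g0) * y"
proof -
  obtain g1 where g1: "g1 \<in> carrier G" "x g1 \<noteq> 0"
    using x0 fspace_outside[OF xF] by (metis ext zero_fun_apply)
  obtain g0 where g0: "g0 \<in> carrier G" "x g0 \<noteq> 0" "\<And>g. g \<in> carrier G \<Longrightarrow> \<exists>b\<in>A. x g = x g0 * b"
    using primitive_multiple[OF finite_G, of x, OF fspace_apply[OF xF] g1] by blast
  obtain b where b: "\<And>g. g \<in> carrier G \<Longrightarrow> b g \<in> A \<and> x g = x g0 * b g"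
    using bchoice[of "carrier G" "\<lambda>g b. b \<in> A \<and> x g = x g0 * b"] g0(3) by blast
  define y where "y = (\<lambda>g. if g \<in> carrier G then b g else 0)"
  have yA: "y \<in> fspace A" using b by (auto simp: y_def fspace_def)
  have x0F: "x g0 \<in> F" by (rule fspace_apply[OF xF g0(1)])
  have xy: "x = (\<lambda>_. x g0) * y"
    using b fspace_outside[OF xF] by (intro ext) (simp add: times_fun_apply y_def)
  have "x g0 * y g0 = x g0 * e"
    using fun_cong[OF xy, of g0] F_mult_unit[OF x0F] by (simp add: times_fun_apply)
  then have "y g0 = e"
    using F_mult_cancel[OF x0F A_F[OF fspace_apply[OF yA g0(1)]] F_unit(1) g0(2)] by blast
  then show ?thesis using that[OF g0(1,2) yA _ xy] by blast
qed

end

context lifting_step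
begin

section \<open>Conjugation on \<open>M\<close>-cosets and the exponent of an eigenvector\<close>

definition coset_act :: "'g \<Rightarrow> 'g \<Rightarrow> 'g" where
  "coset_act k r = rep M (k \<otimes> r \<otimes> inv k)"

text \<open>The contribution to \<open>\<Phi> \<star> t\<close> of those \<open>M\<close>-cosets
  that lie in \<open>N\<close> and are fixed by \<open>N\<close>. The sign makes the exponent of an
  eigenvector congruent to \<open>c\<close> itself.\<close>

definition c :: 'k where
  "c = - (\<Sum>r | r \<in> rep M ` carrier G \<and> r \<in> N \<and> (\<forall>k\<in>N. coset_act k r = r). \<Phi> (inv r))"

lemma c_A: "c \<in> A"
  unfolding c_def using fspace_apply[OF \<Phi>_A] N_carrier by (intro A_uminus A_sum) simp

lemma coset_act_rep:
  assumes k: "k \<in> N" and g: "g \<in> carrier G"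
  shows "coset_act k (rep M g) = rep M (k \<otimes> g \<otimes> inv k)"
proof -
  obtain h where h: "h \<in> M" "rep M g = h \<otimes> g" using rep_obtain[OF nsubD(1)[OF M] g] .
  note car = N_carrier[OF k] g nsubD(3)[OF M h(1)]
  have "k \<otimes> rep M g \<otimes> inv k = (k \<otimes> h \<otimes> inv k) \<otimes> (k \<otimes> g \<otimes> inv k)"
    using car h by (simp add: m_assoc mult_inv_cancel)
  then show ?thesis
    using car rep_mult[OF nsubD(1)[OF M] _ nsubD(7)[OF M k h(1)]] by (simp add: coset_act_def)
qed

lemma coset_act_props:
  assumes r: "r \<in> rep M ` carrier G"
  shows "r \<in> carrier G" "rep M r = r" "coset_act \<one> r = r"
    "\<And>k. k \<in> N \<Longrightarrow> coset_act k r \<in> rep M ` carrier G"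
    "\<And>k l. k \<in> N \<Longrightarrow> l \<in> N \<Longrightarrow> coset_act (k \<otimes> l) r = coset_act k (coset_act l r)"
proof -
  show rG: "r \<in> carrier G" using r rep_carrier[OF nsubD(1)[OF M]] by blast
  show rr: "rep M r = r" using r rep_rep[OF nsubD(1)[OF M]] by blast
  show "coset_act \<one> r = r" using rG rr by (simp add: coset_act_def)
  show "coset_act k r \<in> rep M ` carrier G" if "k \<in> N" for k
    unfolding coset_act_def using rG N_carrier[OF that] by (intro imageI) simp
  show "coset_act (k \<otimes> l) r = coset_act k (coset_act l r)" if k: "k \<in> N" and l: "l \<in> N" for k l
    using coset_act_rep[OF k, of "l \<otimes> r \<otimes> inv l"] rG N_carrier[OF k] N_carrier[OF l]
    by (simp add: coset_act_def m_assoc inv_mult_group)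
qed

lemma card_coset_orbit:
  assumes r: "r \<in> rep M ` carrier G" and moved: "\<exists>k\<in>N. coset_act k r \<noteq> r"
  shows "p dvd card ((\<lambda>k. coset_act k r) ` N)"
proof (rule prime_dvd_orbit_card[OF prime_p])
  show "card ((\<lambda>k. coset_act k r) ` N) dvd p ^ a"
    unfolding card_N[symmetric]
    using coset_act_props[OF r] by (intro orbit_card_dvd[OF N_subgroup N_finite]) simp_all
  show "card ((\<lambda>k. coset_act k r) ` N) \<noteq> 1"
  proof
    assume "card ((\<lambda>k. coset_act k r) ` N) = 1"
    then obtain z where z: "(\<lambda>k. coset_act k r) ` N = {z}" by (auto simp: card_1_singleton_iff)
    have "coset_act k r = z" if "k \<in> N" for k using z that by blast
    then show False using moved coset_act_props(3)[OF r] N_closed(1) by metis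
  qed
qed

lemma sum_inverse: "(\<Sum>y\<in>carrier G. \<psi> (inv y)) = (\<Sum>y\<in>carrier G. \<psi> y)"
proof -
  have "bij_betw (\<lambda>y. inv y) (carrier G) (carrier G)"
    by (rule bij_betwI[where g = "\<lambda>y. inv y"]) auto
  then show ?thesis by (rule sum.reindex_bij_betw)
qed

text \<open>Fixedness passes from \<open>M r\<close> to the coset of \<open>inv r\<close>:
  conjugating \<open>inv r\<close> by \<open>k\<close> amounts to conjugating \<open>r\<close> by
  \<open>inv r k r\<close>, which is again in \<open>N\<close>.\<close>

lemma \<Phi>_inv_rep:
  assumes r: "r \<in> rep M ` carrier G" "r \<notin> N" and fixed_r: "\<And>k. k \<in> N \<Longrightarrow> coset_act k r = r"
  shows "\<Phi> (inv r) \<in> pA"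
proof -
  note rG = coset_act_props(1)[OF r(1)]
  have ex: "k \<otimes> r \<otimes> inv k \<otimes> inv r \<in> M" if k: "k \<in> N" for k
  proof -
    have kG: "k \<otimes> r \<otimes> inv k \<in> carrier G" using rG N_carrier[OF k] by simp
    obtain h where h: "h \<in> M" "k \<otimes> r \<otimes> inv k = h \<otimes> rep M (k \<otimes> r \<otimes> inv k)"
      using rep_obtain'[OF nsubD(1)[OF M] kG] .
    then have "k \<otimes> r \<otimes> inv k = h \<otimes> r" using fixed_r[OF k] by (simp add: coset_act_def)
    then show ?thesis using h(1) rG nsubD(3)[OF M h(1)] by (simp add: m_assoc)
  qed
  show ?thesis
  proof (rule \<Phi>_fixed_coset)
    show "inv r \<in> carrier G" using rG by simp
    show "inv r \<notin> N" using r(2) rG N_closed(2)[of "inv r"] by auto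
    fix k assume k: "k \<in> N"
    note kG = N_carrier[OF k]
    define k' where "k' = inv r \<otimes> k \<otimes> r"
    have k': "k' \<in> N" unfolding k'_def using N_conj[of "inv r" k] rG k by simp
    define g where "g = k' \<otimes> r \<otimes> inv k' \<otimes> inv r"
    have g: "inv g \<in> M" unfolding g_def by (intro nsubD(5)[OF M] ex k')
    have "inv g = k \<otimes> inv r \<otimes> inv k \<otimes> r"
      using rG kG by (simp add: g_def k'_def inv_mult_group m_assoc mult_inv_cancel)
    then have "k \<otimes> inv r \<otimes> inv k = inv g \<otimes> inv r"
      using rG kG by (simp add: m_assoc)
    then show "\<exists>g\<in>M. k \<otimes> inv r \<otimes> inv k = g \<otimes> inv r" using g by blast
  qed
qed

text \<open>Up to the maximal ideal \<open>\<Phi> \<star> t\<close> at \<open>g\<close> is the sum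
  of \<open>\<Phi> (inv r) * x (r g)\<close> over the \<open>M\<close>-cosets. Cosets moved by
  \<open>N\<close> cancel in orbits, fixed cosets outside \<open>N\<close> contribute multiples of
  \<open>p\<close>, and for fixed cosets inside \<open>N\<close> the value \<open>x (r g)\<close>
  reduces to \<open>x g\<close>.\<close>

lemma \<Phi>_conv:
  assumes t: "t \<in> fspace A" and x: "x \<in> fspace A" and tx: "ind M \<star> t - x \<in> fspace nonunits"
    and x_fix: "\<And>k. k \<in> N \<Longrightarrow> translate k x - x \<in> fspace nonunits" and g: "g \<in> carrier G"
  shows "(\<Phi> \<star> t) g + c * x g \<in> nonunits"
proof -
  define R where "R = rep M ` carrier G"
  define \<theta> where "\<theta> r = \<Phi> (inv r) * x (r \<otimes> g)" for r
  note MG = nsubD(1)[OF M]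
  have R: "r \<in> carrier G" if "r \<in> R" for r using coset_act_props(1) that by (simp add: R_def)
  have finR: "finite R" using finite_G by (simp add: R_def)
  have x_N: "x (k \<otimes> y) - x y \<in> nonunits" if k: "k \<in> N" and y: "y \<in> carrier G" for k y
    using fspace_apply[OF x_fix[OF N_closed(2)[OF k]] y] y N_carrier[OF k]
    by (simp add: translate_apply minus_apply)
  have \<Phi>A: "\<Phi> y \<in> A" if "y \<in> carrier G" for y by (rule fspace_apply[OF \<Phi>_A that])
  have xA: "x y \<in> A" if "y \<in> carrier G" for y by (rule fspace_apply[OF x that])
  have "(\<Phi> \<star> t) g = (\<Sum>y\<in>carrier G. \<Phi> (inv y) * t (inv (inv y) \<otimes> g))"
    unfolding conv_apply[OF g] by (rule sum_inverse[symmetric])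
  also have "\<dots> = (\<Sum>r\<in>R. \<Sum>h\<in>M. \<Phi> (inv (h \<otimes> r)) * t (inv (inv (h \<otimes> r)) \<otimes> g))"
    unfolding R_def by (rule sum_cosets[OF MG])
  also have "\<dots> = (\<Sum>r\<in>R. \<Sum>h\<in>M. \<Phi> (inv r \<otimes> inv h) * t (h \<otimes> (r \<otimes> g)))"
    using R nsubD(3)[OF M] g by (intro sum.cong refl) (simp add: inv_mult_group m_assoc)
  finally have conv_eq: "(\<Phi> \<star> t) g = (\<Sum>r\<in>R. \<Sum>h\<in>M. \<Phi> (inv r \<otimes> inv h) * t (h \<otimes> (r \<otimes> g)))" .
  \<comment> \<open>\<open>\<Phi>\<close> is right invariant under \<open>M\<close> modulo
    \<open>p\<close> and leaves the sum over \<open>M\<close>; what remains is a value of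
    \<open>ind M \<star> t\<close>.\<close>
  have "(\<Sum>h\<in>M. \<Phi> (inv r \<otimes> inv h) * t (h \<otimes> (r \<otimes> g))) - \<theta> r \<in> nonunits" if r: "r \<in> R" for r
  proof -
    define q where "q = r \<otimes> g"
    have q: "q \<in> carrier G" using R[OF r] g by (simp add: q_def)
    have "bij_betw (\<lambda>h. inv h) M M"
      using nsubD(3,5)[OF M] by (intro bij_betwI[where g = "\<lambda>h. inv h"]) auto
    then have "(\<Sum>h\<in>M. t (h \<otimes> q)) = (\<Sum>h\<in>M. t (inv h \<otimes> q))"
      by (rule sum.reindex_bij_betw[symmetric])
    also have "\<dots> = (ind M \<star> t) q"
      by (rule ind_conv_apply[OF M_carrier q fspace_A_F[OF t], symmetric])
    finally have tq: "(\<Sum>h\<in>M. t (h \<otimes> q)) - x q \<in> nonunits"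
      using fspace_apply[OF tx q] by (simp add: minus_apply)
    have "(\<Sum>h\<in>M. \<Phi> (inv r \<otimes> inv h) * t (h \<otimes> q)) - \<theta> r =
        (\<Sum>h\<in>M. (\<Phi> (inv r \<otimes> inv h) - \<Phi> (inv r)) * t (h \<otimes> q)) + \<Phi> (inv r) * ((\<Sum>h\<in>M. t (h \<otimes> q)) - x q)"
      by (simp add: \<theta>_def q_def left_diff_distrib right_diff_distrib sum_subtractf sum_distrib_left)
    moreover have "(\<Phi> (inv r \<otimes> inv h) - \<Phi> (inv r)) * t (h \<otimes> q) \<in> nonunits" if h: "h \<in> M" for h
      using \<Phi>_right_mod[OF nsubD(5)[OF M h], of "inv r"] R[OF r] fspace_apply[OF t] q nsubD(3)[OF M h]
      by (intro nonunits_mult pA_nonunits) simp_all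
    moreover from this have "(\<Sum>h\<in>M. (\<Phi> (inv r \<otimes> inv h) - \<Phi> (inv r)) * t (h \<otimes> q)) \<in> nonunits"
      by (rule nonunits_sum)
    moreover have "\<Phi> (inv r) * ((\<Sum>h\<in>M. t (h \<otimes> q)) - x q) \<in> nonunits"
      using nonunits_mult2[OF tq \<Phi>A] R[OF r] by simp
    ultimately show ?thesis using nonunits_add by (simp only: q_def)
  qed
  then have step1: "(\<Phi> \<star> t) g - sum \<theta> R \<in> nonunits"
    unfolding conv_eq sum_subtractf[symmetric] by (rule nonunits_sum)
  have moved: "sum \<theta> {r \<in> R. \<exists>k\<in>N. coset_act k r \<noteq> r} \<in> nonunits"
  proof (rule sum_moved_points[OF N_subgroup N_finite finR _ _ _ nonunits_zero nonunits_add])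
    show "coset_act k r \<in> R" if "k \<in> N" "r \<in> R" for k r
      using coset_act_props(4) that by (simp add: R_def)
    show "coset_act \<one> r = r" if "r \<in> R" for r using coset_act_props(3) that by (simp add: R_def)
    show "coset_act (k \<otimes> l) r = coset_act k (coset_act l r)" if "k \<in> N" "l \<in> N" "r \<in> R" for k l r
      using coset_act_props(5) that by (simp add: R_def)
    show "of_nat (card ((\<lambda>k. coset_act k r) ` N)) * \<theta> r \<in> nonunits"
      if r: "r \<in> R" and "\<exists>k\<in>N. coset_act k r \<noteq> r" for r
      using card_coset_orbit[of r] that R[OF r] g unfolding \<theta>_def R_def
      by (intro pA_nonunits pA_of_nat A_mult \<Phi>A xA) simp_all
    show "\<theta> (coset_act k r) - \<theta> r \<in> nonunits" if k: "k \<in> N" and r: "r \<in> R" for k r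
    proof -
      note rG = R[OF r] and kG = N_carrier[OF k]
      have krG: "k \<otimes> r \<otimes> inv k \<in> carrier G" using rG kG by simp
      obtain h where h: "h \<in> M" "coset_act k r = h \<otimes> (k \<otimes> r \<otimes> inv k)"
        using rep_obtain[OF MG krG] unfolding coset_act_def by metis
      note hG = nsubD(3)[OF M h(1)] and hN = nsubD(2)[OF M h(1)]
      have "inv (coset_act k r) = (k \<otimes> inv r \<otimes> inv k) \<otimes> inv h"
        using rG kG hG by (simp add: h(2) inv_mult_group m_assoc)
      moreover have "\<Phi> (k \<otimes> inv r \<otimes> inv k) = \<Phi> (inv r)"
        by (rule conj_invD[OF \<Phi>_conj_inv k]) (use rG in simp)
      ultimately have a: "\<Phi> (inv (coset_act k r)) - \<Phi> (inv r) \<in> nonunits"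
        using \<Phi>_right_mod[OF nsubD(5)[OF M h(1)], of "k \<otimes> inv r \<otimes> inv k"] rG kG pA_nonunits by simp
      \<comment> \<open>As \<open>N\<close> is normal in \<open>G\<close>, conjugating
        \<open>r\<close> by \<open>k\<close> is left multiplication by an element of
        \<open>N\<close>, under which \<open>x\<close> is invariant in reduction.\<close>
      define l where "l = h \<otimes> k \<otimes> (r \<otimes> inv k \<otimes> inv r)"
      have l: "l \<in> N" unfolding l_def by (intro N_closed(3) hN k N_conj rG N_closed(2))
      have "coset_act k r \<otimes> g = l \<otimes> (r \<otimes> g)"
        using rG kG hG g by (simp add: h(2) l_def m_assoc mult_inv_cancel)
      then have b: "x (coset_act k r \<otimes> g) - x (r \<otimes> g) \<in> nonunits" using x_N[OF l] rG g by simp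
      have "\<theta> (coset_act k r) - \<theta> r = (\<Phi> (inv (coset_act k r)) - \<Phi> (inv r)) * x (coset_act k r \<otimes> g)
          + \<Phi> (inv r) * (x (coset_act k r \<otimes> g) - x (r \<otimes> g))"
        by (simp add: \<theta>_def algebra_simps)
      moreover have "coset_act k r \<otimes> g \<in> carrier G" using h(2) hG krG g by simp
      ultimately show ?thesis
        using nonunits_add[OF nonunits_mult[OF a xA] nonunits_mult2[OF b \<Phi>A]] rG by simp
    qed
  qed
  define Fix where "Fix = {r \<in> R. \<forall>k\<in>N. coset_act k r = r}"
  have finFix: "finite Fix" using finR by (simp add: Fix_def)
  have "sum \<theta> R = sum \<theta> {r \<in> R. \<exists>k\<in>N. coset_act k r \<noteq> r} + sum \<theta> Fix"
    unfolding Fix_def using finR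
    by (subst sum.union_disjoint[symmetric]) (auto intro!: sum.cong)
  then have step2: "sum \<theta> R - sum \<theta> Fix \<in> nonunits" using moved by simp
  have Fix_N: "Fix \<inter> N = {r. r \<in> rep M ` carrier G \<and> r \<in> N \<and> (\<forall>k\<in>N. coset_act k r = r)}"
    by (auto simp: Fix_def R_def)
  have "sum \<theta> Fix = sum \<theta> (Fix \<inter> N) + sum \<theta> (Fix - N)"
    using finFix by (rule sum.Int_Diff)
  moreover have "c * x g = - (\<Sum>r\<in>Fix \<inter> N. \<Phi> (inv r) * x g)"
    unfolding c_def Fix_N[symmetric] by (simp add: sum_distrib_right)
  ultimately have "sum \<theta> Fix + c * x g = (\<Sum>r\<in>Fix \<inter> N. \<theta> r - \<Phi> (inv r) * x g) + sum \<theta> (Fix - N)"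
    by (simp add: sum_subtractf)
  also have "\<dots> \<in> nonunits"
  proof (intro nonunits_add nonunits_sum)
    fix r assume "r \<in> Fix \<inter> N"
    then have r: "r \<in> R" "r \<in> N" by (auto simp: Fix_def)
    have "\<theta> r - \<Phi> (inv r) * x g = \<Phi> (inv r) * (x (r \<otimes> g) - x g)"
      by (simp add: \<theta>_def right_diff_distrib)
    then show "\<theta> r - \<Phi> (inv r) * x g \<in> nonunits"
      using nonunits_mult2[OF x_N[OF r(2) g] \<Phi>A] R[OF r(1)] by simp
  next
    fix r assume "r \<in> Fix - N"
    then have r: "r \<in> R" "r \<notin> N" "\<And>k. k \<in> N \<Longrightarrow> coset_act k r = r" by (auto simp: Fix_def)
    have "\<Phi> (inv r) \<in> pA" using r by (intro \<Phi>_inv_rep) (simp_all add: R_def)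
    then show "\<theta> r \<in> nonunits"
      unfolding \<theta>_def using R[OF r(1)] g by (intro nonunits_mult pA_nonunits xA) simp_all
  qed
  finally have step3: "sum \<theta> Fix + c * x g \<in> nonunits" .
  have "(\<Phi> \<star> t) g + c * x g = ((\<Phi> \<star> t) g - sum \<theta> R) + ((sum \<theta> R - sum \<theta> Fix) + (sum \<theta> Fix + c * x g))"
    by simp
  then show ?thesis using nonunits_add[OF step1 nonunits_add[OF step2 step3]] by simp
qed

lemma eigen_exponent_primitive:
  assumes x: "x \<in> linv H" "x \<in> fspace A" "\<sigma> x = 0" "v x = T i x" "x \<notin> fspace nonunits"
  shows "of_nat i * e - c \<in> nonunits"
proof -
  \<comment> \<open>The eigenspace is stable under \<open>N\<close>, so the given vector can be
    exchanged for one fixed by \<open>N\<close> in reduction; the exponent stays the same.\<close>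
  define V where "V = {x \<in> linv H. x \<in> fspace A \<and> \<sigma> x = 0 \<and> v x = T i x}"
  have "\<exists>x\<in>V. x \<notin> fspace nonunits \<and> (\<forall>k\<in>N. translate k x - x \<in> fspace nonunits)"
  proof (rule exists_fixed_mod)
    show "V \<subseteq> fspace A" by (auto simp: V_def)
    show "x \<in> V" "x \<notin> fspace nonunits" using x by (auto simp: V_def)
    show "y - z \<in> V" if "y \<in> V" "z \<in> V" for y z
      using that by (simp add: V_def linv_diff fspace_diff sigma_diff[OF step] v_diff translate_diff)
    show "translate k y \<in> V" if k: "k \<in> N" and y: "y \<in> V" for k y
    proof -
      have y': "y \<in> linv H" "y \<in> fspace A" "\<sigma> y = 0" "v y = T i y" using y by (auto simp: V_def)
      have "\<sigma> (translate k y) = 0"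
        using translate_sigma[OF step y'(1) k] y'(3) translate_zero by metis
      moreover have "v (translate k y) = T i (translate k y)"
        using v_translate[OF y'(1) k] y'(4) linv_commute[OF step y'(1) k] by metis
      ultimately show ?thesis
        using linv_N_translate[OF H y'(1) k] fspace_translate[OF N_carrier[OF k] y'(2)] by (simp add: V_def)
    qed
  qed
  then obtain x where x: "x \<in> linv H" "x \<in> fspace A" "\<sigma> x = 0" "v x = T i x" "x \<notin> fspace nonunits"
    and x_fix: "\<And>k. k \<in> N \<Longrightarrow> translate k x - x \<in> fspace nonunits" unfolding V_def by blast
  note iH = linv_ind[OF H] fspace_ind[OF H_carrier]
  obtain z where z: "z \<in> linv H" "z \<in> fspace A" "x = \<delta> z" using sigma_kernel[OF step x(1-3)] .
  have vz: "v z = T i z" using x(4) unfolding z(3) by (rule eigen_from_delta[OF z(1,2)])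
  have x_fix_M: "translate k x - x \<in> fspace nonunits" if "k \<in> M" for k
    using x_fix nsubD(2)[OF M that] by blast
  obtain t where t: "t \<in> fspace A" "ind M \<star> t - x \<in> fspace nonunits"
    using ind_conv_mod[OF M x(2) x_fix_M] by blast
  \<comment> \<open>Chosen so that \<open>(m - 1) s\<close> is congruent to
    \<open>- ind M \<star> t\<close>, hence to \<open>- x\<close>, which cancels
    \<open>(m - 1) z = x\<close>.\<close>
  define s where "s = \<tau> (ind H) \<star> t"
  have s: "s \<in> linv H" "s \<in> fspace A"
    unfolding s_def by (intro linv_conv[OF H] linv_tau[OF step] iH fspace_A_F[OF t(1)],
        intro fspace_conv(2) tau_A[OF step] iH t(1))
  have "\<delta> s = (\<tau> (\<delta> (ind H))) \<star> t"
    unfolding s_def tau_diff[OF step] translate_tau[OF step iH(1) mN, symmetric] conv_diff translate_conv[OF mG] ..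
  also have "\<dots> = of_nat p * (ind H \<star> t) - ind M \<star> t"
    by (simp only: tau_m_diff[OF step iH(1)] sigma_ind[OF step] conv_diff conv_of_nat)
  finally have ds: "\<delta> s = of_nat p * (ind H \<star> t) - ind M \<star> t" .
  define z1 where "z1 = z + s"
  have z1: "z1 \<in> linv H" "z1 \<in> fspace A" unfolding z1_def using linv_add fspace_add(2) z s by blast+
  have "\<delta> z1 = \<delta> z + \<delta> s" by (simp only: z1_def translate_add) (simp add: algebra_simps)
  also have "\<dots> = of_nat p * (ind H \<star> t) - (ind M \<star> t - x)"
    unfolding z(3)[symmetric] ds by (simp add: algebra_simps)
  also have "\<dots> \<in> fspace nonunits"
    by (intro fspace_diff(3) t(2) fspace_of_nat(3) fspace_conv(2) iH(2) t(1))
  finally have dz1: "\<delta> z1 \<in> fspace nonunits" .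
  have z1_m: "z1 (m \<otimes> y) - z1 y \<in> nonunits" if y: "y \<in> carrier G" for y
  proof -
    have "z1 y - z1 (m \<otimes> y) \<in> nonunits"
      using fspace_apply[OF dz1, of "m \<otimes> y"] mG y by (simp add: translate_apply minus_apply mult_inv_cancel)
    then have "- (z1 y - z1 (m \<otimes> y)) \<in> nonunits" by (rule nonunits_uminus)
    then show ?thesis by simp
  qed
  have "z1 (g \<otimes> y) - z1 y \<in> nonunits" if "g \<in> M" "y \<in> carrier G" for g y
    by (rule extend_inv_mod[OF z1(1) nonunits_zero nonunits_add z1_m that])
  then obtain b where b: "b \<in> fspace A" "\<And>g. g \<in> carrier G \<Longrightarrow> (ind M \<star> b) g - z1 g \<in> nonunits"
    using ind_conv_rep[OF nsubD(1)[OF M] z1(2)] by blast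
  have zb: "ind M \<star> b - z1 \<in> fspace nonunits"
    using b(2) conv_outside fspace_outside[OF z1(2)] by (intro fspaceI) (auto simp: minus_apply)
  \<comment> \<open>\<open>v\<close> fixes every multiple of \<open>ind M\<close>, and
    \<open>z1\<close> is such a multiple up to the maximal ideal.\<close>
  have "v z1 - z1 = (ind M \<star> b - z1) - v (ind M \<star> b - z1)"
    unfolding v_diff v_conv v_ind_M by simp
  then have vz1: "v z1 - z1 \<in> fspace nonunits"
    using fspace_diff(3)[OF zb v_nonunits[OF zb]] by (simp only:)
  have vs: "v s - s = \<Phi> \<star> t"
    unfolding s_def v_conv v_tau[OF iH(1)] conv_diff(1)[symmetric] tau_diff[OF step, symmetric]
      \<Phi>_def f_def ..
  have "v z1 - z1 = (v z - z) + (v s - s)" unfolding z1_def v_add by (simp add: algebra_simps)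
  also have "v z - z = (\<Sum>l<i. T l x)" unfolding vz z(3) by (rule T_minus_one[OF z(1)])
  finally have eq: "v z1 - z1 = (\<Sum>l<i. T l x) + \<Phi> \<star> t" unfolding vs .
  have Tx: "T l x - x \<in> fspace nonunits" for l by (rule x_fix[OF N_pow[OF mN]])
  obtain g where g: "g \<in> carrier G" "x g \<notin> nonunits"
    using x(5) fspace_outside[OF x(2)] fspaceI[of x nonunits] by blast
  have "(\<Sum>l<i. T l x g) + (\<Phi> \<star> t) g \<in> nonunits"
    using fspace_apply[OF vz1 g(1)] unfolding eq by (simp add: plus_fun_apply sum_fun_apply)
  moreover have "(\<Sum>l<i. T l x g - x g) \<in> nonunits"
    using fspace_apply[OF Tx g(1)] by (intro nonunits_sum) (simp add: minus_apply)
  moreover have "(\<Phi> \<star> t) g + c * x g \<in> nonunits" by (rule \<Phi>_conv[OF t(1) x(2) t(2) x_fix g(1)])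
  ultimately have "((\<Sum>l<i. T l x g) + (\<Phi> \<star> t) g) - (\<Sum>l<i. T l x g - x g) - ((\<Phi> \<star> t) g + c * x g) \<in> nonunits"
    by (intro nonunits_diff)
  also have "((\<Sum>l<i. T l x g) + (\<Phi> \<star> t) g) - (\<Sum>l<i. T l x g - x g) - ((\<Phi> \<star> t) g + c * x g) =
      of_nat i * x g - c * x g"
    by (simp add: sum_subtractf)
  also have "of_nat i * x g = (of_nat i * e) * x g"
    using F_unit_mult[OF A_F[OF fspace_apply[OF x(2) g(1)]]] by (simp add: mult.assoc)
  finally have "(of_nat i * e - c) * x g \<in> nonunits" by (simp add: left_diff_distrib)
  then show ?thesis
    using nonunits_prime[OF _ A_diff[OF A_of_nat_mult[OF A_unit] c_A] fspace_apply[OF x(2) g(1)]] g(2) by blast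
qed

lemma eigen_exponent:
  assumes x: "x \<in> linv H" "\<sigma> x = 0" "v x = T i x" "x \<noteq> 0"
  shows "of_nat i * e - c \<in> nonunits"
proof -
  have xF: "x \<in> fspace F" by (rule linv_F[OF x(1)])
  obtain g0 y where g0: "g0 \<in> carrier G" "x g0 \<noteq> 0" and yA: "y \<in> fspace A" and y0: "y g0 = e"
    and xy: "x = (\<lambda>_. x g0) * y" using primitive_factor[OF xF x(4)] .
  have yF: "y \<in> fspace F" by (rule fspace_A_F[OF yA])
  have x0F: "x g0 \<in> F" by (rule fspace_apply[OF xF g0(1)])
  note cancel = scale_cancel[OF x0F g0(2)]
  have yl: "y \<in> linv H"
    unfolding linv_def
  proof (intro CollectI conjI ballI yF)
    fix h assume h: "h \<in> H"
    have "(\<lambda>_. x g0) * translate h y = (\<lambda>_. x g0) * y"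
      using linv_translate[OF x(1) h] unfolding translate_scale[symmetric] xy[symmetric] .
    then show "translate h y = y" using cancel fspace_translate[OF nsubD(3)[OF H h] yF] yF by blast
  qed
  have "(\<lambda>_. x g0) * \<sigma> y = \<sigma> ((\<lambda>_. x g0) * y)"
    by (simp add: sigma_def[OF step] translate_scale sum_distrib_left)
  then have "(\<lambda>_. x g0) * \<sigma> y = (\<lambda>_. x g0) * 0" using x(2) unfolding xy[symmetric] by simp
  then have ys: "\<sigma> y = 0"
    using cancel linv_F[OF linv_sigma[OF step yl]] fspace_zero(1) by blast
  have "(\<lambda>_. x g0) * v y = (\<lambda>_. x g0) * T i y"
    using x(3) unfolding v_scale[symmetric] translate_scale[symmetric] xy[symmetric] .
  then have yv: "v y = T i y" using cancel v_F[OF yF] fspace_translate[OF pow_carrier[OF step] yF] by blast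
  have "y \<notin> fspace nonunits" using y0 unit_notin_nonunits fspace_apply[OF _ g0(1)] by metis
  from eigen_exponent_primitive[OF yl yA ys yv this] show ?thesis .
qed

text \<open>Multiplication by \<open>j\<close> permutes the residues modulo \<open>p\<close>;
  \<open>p - i\<close> stands for \<open>- i\<close> so that exponents remain natural
  numbers.\<close>

lemma sum_pow_multiples:
  assumes w: "w \<in> linv H" and j: "\<not> p dvd j"
  shows "(\<Sum>i<p. T ((p - i) * j) w) = \<sigma> w"
proof -
  have p0: "p > 0" using prime_p by (simp add: prime_gt_0_nat)
  have T_mod: "T l w = T (l mod p) w" for l
  proof -
    have "l = l mod p + p * (l div p)" by simp
    then have "T l w = T (l mod p) (T (p * (l div p)) w)" by (metis translate_pow_add[OF step])
    then show ?thesis using linv_pow_fixed[OF step w] by simp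
  qed
  define \<beta> where "\<beta> i = (p - i) * j mod p" for i
  have inj: "inj_on \<beta> {..<p}"
  proof (rule inj_onI)
    have *: "i = i'" if "i \<le> i'" "i' < p" "\<beta> i = \<beta> i'" for i i'
    proof -
      have le: "(p - i') * j \<le> (p - i) * j" by (intro mult_le_mono1 diff_le_mono2 that)
      have "p dvd (p - i) * j - (p - i') * j"
        using that(3) mod_eq_dvd_iff_nat[OF le, of p] by (simp only: \<beta>_def)
      also have "(p - i) * j - (p - i') * j = (i' - i) * j"
        using that by (simp add: diff_mult_distrib[symmetric])
      finally have "p dvd i' - i" using j prime_p prime_dvd_mult_iff by blast
      then show ?thesis using that by (metis dvd_imp_le diff_is_0_eq le_antisym less_imp_diff_less linorder_not_less neq0_conv)
    qed
    fix i i' assume "i \<in> {..<p}" "i' \<in> {..<p}" "\<beta> i = \<beta> i'"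
    then show "i = i'" using *[of i i'] *[of i' i] by (cases "i \<le> i'") auto
  qed
  have "\<beta> ` {..<p} \<subseteq> {..<p}" using p0 by (auto simp: \<beta>_def)
  then have "\<beta> ` {..<p} = {..<p}" using inj by (intro card_subset_eq) (simp_all add: card_image)
  then have "bij_betw \<beta> {..<p} {..<p}" using inj by (simp add: bij_betw_def)
  then have "(\<Sum>i<p. T (\<beta> i) w) = (\<Sum>l<p. T l w)" by (rule sum.reindex_bij_betw)
  then show ?thesis using T_mod by (simp add: \<beta>_def sigma_def[OF step])
qed

text \<open>On the kernel of \<open>\<sigma>\<close>, the operator \<open>v\<close> has order dividing \<open>p\<close> and \<open>m\<close> acts as a primitive \<open>p\<close>-th root
  of unity; \<open>w i\<close> below is \<open>p\<close> times the component of \<open>x\<close> in the \<open>m [^] i\<close>-eigenspace.\<close>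

lemma v_on_kernel: "\<exists>i0. \<forall>x. x \<in> linv H \<longrightarrow> \<sigma> x = 0 \<longrightarrow> v x = T i0 x"
proof -
  have p0: "p > 0" using prime_p by (simp add: prime_gt_0_nat)
  have unique: "i = i'" if "i < p" "i' < p" "of_nat i * e - c \<in> nonunits" "of_nat i' * e - c \<in> nonunits" for i i'
  proof -
    have "of_int (int i - int i') * e = (of_nat i * e - c) - (of_nat i' * e - c)"
      by (simp add: left_diff_distrib)
    then have "int p dvd int i - int i'" using nonunits_diff[OF that(3,4)] of_int_unit_nonunit by metis
    then show ?thesis using that(1,2) by (metis mod_eq_dvd_iff mod_less of_nat_eq_iff zmod_int)
  qed
  \<comment> \<open>If no exponent is congruent to \<open>c\<close>, every component below vanishes
    and the default \<open>0\<close> serves as well.\<close>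
  define i0 where "i0 = (if \<exists>i<p. of_nat i * e - c \<in> nonunits then SOME i. i < p \<and> of_nat i * e - c \<in> nonunits else 0)"
  have i0p: "i0 < p" unfolding i0_def using p0 someI_ex[of "\<lambda>i. i < p \<and> of_nat i * e - c \<in> nonunits"] by auto
  have i0: "i = i0" if i: "i < p" "of_nat i * e - c \<in> nonunits" for i
  proof -
    have "i0 < p \<and> of_nat i0 * e - c \<in> nonunits"
      unfolding i0_def using i someI_ex[of "\<lambda>i. i < p \<and> of_nat i * e - c \<in> nonunits"] by auto
    then show ?thesis using unique i by blast
  qed
  have "v x = T i0 x" if x: "x \<in> linv H" "\<sigma> x = 0" for x
  proof -
    \<comment> \<open>This is the sum of \<open>(m^-i v)^j x\<close> over \<open>j < p\<close>, with
      \<open>p - i\<close> in place of \<open>- i\<close>.\<close>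
    define w where "w i = (\<Sum>j<p. T ((p - i) * j) ((v ^^ j) x))" for i
    have vx: "(v ^^ j) x \<in> linv H" for j by (rule v_pow[OF x(1)])
    have v0: "v 0 = 0" using v_diff[of 0 0] by simp
    have vs: "\<sigma> ((v ^^ j) x) = 0" for j
    proof (induction j)
      case (Suc j)
      have "\<sigma> ((v ^^ Suc j) x) = v (\<sigma> ((v ^^ j) x))" using v_sigma[OF vx, of j] by simp
      then show ?case by (simp only: Suc v0)
    qed (use x in simp)
    have w_linv: "w i \<in> linv H" for i unfolding w_def by (intro linv_sum linv_pow[OF step] vx)
    have w_sigma: "\<sigma> (w i) = 0" for i
    proof -
      have "\<sigma> (T l ((v ^^ j) x)) = 0" for l j
        using translate_sigma[OF step vx N_pow[OF mN]] vs translate_zero by metis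
      then have "(\<Sum>j<p. \<sigma> (T ((p - i) * j) ((v ^^ j) x))) = 0" by simp
      moreover have "\<sigma> (\<Sum>j<p. y j) = (\<Sum>j<p. \<sigma> (y j))" for y
        unfolding sigma_def[OF step] translate_sum by (rule sum.swap)
      ultimately show ?thesis by (simp only: w_def)
    qed
    have w_v: "v (w i) = T i (w i)" if i: "i < p" for i
    proof -
      \<comment> \<open>Applying \<open>v\<close> to \<open>w i\<close> shifts the summands of
        \<open>T i (w i)\<close> by one place; \<open>v^p = 1\<close> identifies the two
        ends.\<close>
      define y where "y j = T (i + (p - i) * j) ((v ^^ j) x)" for j
      have Tw: "T i (w i) = (\<Sum>j<p. y j)"
        by (simp only: w_def translate_sum translate_pow_add[OF step] y_def)
      have vw: "v (w i) = (\<Sum>j<p. y (Suc j))"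
      proof -
        have "v (T ((p - i) * j) ((v ^^ j) x)) = y (Suc j)" for j
        proof -
          have eq: "i + (p - i) * Suc j = (p - i) * j + p" using i by simp
          have "y (Suc j) = T ((p - i) * j) (T p ((v ^^ Suc j) x))"
            unfolding y_def eq by (rule translate_pow_add[OF step, symmetric])
          also have "\<dots> = T ((p - i) * j) ((v ^^ Suc j) x)"
            using linv_pow_fixed[OF step vx, of p] by (simp only: dvd_refl)
          finally show ?thesis using v_T[OF vx] by simp
        qed
        then show ?thesis by (simp only: w_def v_sum)
      qed
      have y0: "y 0 = T i x" by (simp add: y_def)
      have "i + (p - i) * p = (p - i) * p + i" by simp
      then have "y p = T ((p - i) * p) (T i ((v ^^ p) x))"
        unfolding y_def by (simp only: translate_pow_add[OF step])
      then have yp: "y p = T i x"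
        using v_pow_p[OF x(1)] linv_pow_fixed[OF step linv_pow[OF step x(1)]] by simp
      have "(\<Sum>j<Suc p. y j) = y 0 + (\<Sum>j<p. y (Suc j))" by (rule sum.lessThan_Suc_shift)
      then have "(\<Sum>j<p. y j) = (\<Sum>j<p. y (Suc j))" using y0 yp by (simp add: add.commute)
      then show ?thesis by (simp only: Tw vw)
    qed
    have w_zero: "w i = 0" if i: "i < p" "i \<noteq> i0" for i
      using eigen_exponent[OF w_linv w_sigma w_v[OF i(1)]] i0[OF i(1)] i(2) by blast
    \<comment> \<open>For \<open>j \<noteq> 0\<close> the inner sum is the trace of
      \<open>v^j x\<close>, which is zero; the term \<open>j = 0\<close> gives
      \<open>p x\<close>.\<close>
    have "(\<Sum>i<p. w i) = (\<Sum>j<p. \<Sum>i<p. T ((p - i) * j) ((v ^^ j) x))"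
      unfolding w_def by (rule sum.swap)
    also have "\<dots> = (\<Sum>j<p. if j = 0 then of_nat p * x else 0)"
    proof (rule sum.cong[OF refl])
      fix j assume j: "j \<in> {..<p}"
      show "(\<Sum>i<p. T ((p - i) * j) ((v ^^ j) x)) = (if j = 0 then of_nat p * x else 0)"
      proof (cases "j = 0")
        case True
        then show ?thesis using linv_pow_0[OF step x(1)] by simp
      next
        case False
        then have "\<not> p dvd j" using j by (auto dest: dvd_imp_le)
        then show ?thesis using sum_pow_multiples[OF vx] vs False by simp
      qed
    qed
    also have "\<dots> = of_nat p * x" using p0 by simp
    finally have sum_w: "(\<Sum>i<p. w i) = of_nat p * x" .
    have "(\<Sum>i<p. w i) = (\<Sum>i<p. if i = i0 then w i else 0)"
      using w_zero by (intro sum.cong) auto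
    also have "\<dots> = w i0" using i0p by simp
    finally have w_i0: "w i0 = of_nat p * x" using sum_w by simp
    have "of_nat p * v x = of_nat p * T i0 x"
      using w_v[OF i0p] unfolding w_i0 v_of_nat translate_of_nat .
    then show ?thesis
      using p_cancel_fspace[OF v_F[OF linv_F[OF x(1)]] fspace_translate[OF pow_carrier[OF step] linv_F[OF x(1)]]]
      by blast
  qed
  then show ?thesis by blast
qed

text \<open>\<open>ind H\<close> is not in the kernel of \<open>\<sigma>\<close>, but
  \<open>(m - 1) ind H\<close> is, and \<open>eigen_from_delta\<close> carries the eigenvalue over
  from there.\<close>

theorem lift_step: "\<exists>k\<in>N. u \<star> ind H = translate k (ind H)"
proof -
  note iH = linv_ind[OF H] fspace_ind[OF H_carrier]
  obtain i where i: "\<And>x. x \<in> linv H \<Longrightarrow> \<sigma> x = 0 \<Longrightarrow> v x = T i x" using v_on_kernel by blast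
  have "v (\<delta> (ind H)) = T i (\<delta> (ind H))"
    by (rule i[OF linv_m_diff[OF step iH(1)] sigma_m_diff[OF step iH(1)]])
  then have vH: "v (ind H) = T i (ind H)" by (rule eigen_from_delta[OF iH])
  have uH: "u \<star> ind H \<in> fspace A" by (intro fspace_conv(2) u(2) iH(2))
  have "translate n (v (ind H)) = u \<star> ind H"
    using translate_one[OF uH] nG by (simp add: v_def translate_translate)
  then have "u \<star> ind H = translate (n \<otimes> m [^] i) (ind H)"
    using nG mG by (simp add: vH translate_translate)
  moreover have "n \<otimes> m [^] i \<in> N" by (intro N_closed(3) nN N_pow mN)
  ultimately show ?thesis by blast
qed

end

section \<open>Idempotent class functions in characteristic two\<close>

text \<open>The induction passes to the square of \<open>s\<close>: its fixed points that
  \<open>s\<close> moves come in pairs with equal values, and twice a value lies in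
  \<open>J\<close>.\<close>

lemma sum_involution_power:
  fixes \<psi> :: "'x \<Rightarrow> 'a :: comm_ring_1"
  assumes "finite S" and "\<And>x. x \<in> S \<Longrightarrow> s x \<in> S" and "\<And>x. x \<in> S \<Longrightarrow> (s ^^ (2 ^ b)) x = x"
    and inv: "\<And>x. x \<in> S \<Longrightarrow> \<psi> (s x) = \<psi> x"
    and J: "0 \<in> J" "\<And>a b. a \<in> J \<Longrightarrow> b \<in> J \<Longrightarrow> a + b \<in> J" "\<And>x. x \<in> S \<Longrightarrow> of_nat 2 * \<psi> x \<in> J"
  shows "sum \<psi> S - sum \<psi> {x \<in> S. s x = x} \<in> J"
  using assms(2-4)
proof (induction b arbitrary: s)
  case 0
  then have "{x \<in> S. s x = x} = S" by auto
  then show ?case using J by simp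
next
  case (Suc b)
  define t where "t = s ^^ 2"
  have t: "t x = s (s x)" for x by (simp add: t_def numeral_2_eq_2)
  define S' where "S' = {x \<in> S. t x = x}"
  have "sum \<psi> S - sum \<psi> S' \<in> J"
    unfolding S'_def
  proof (rule Suc.IH)
    show "(t ^^ (2 ^ b)) x = x" if "x \<in> S" for x
      using Suc.prems(2)[OF that] by (simp add: t_def funpow_mult[symmetric] mult.commute flip: funpow_mult)
  qed (use Suc.prems t in auto)
  moreover have "sum \<psi> {x \<in> S'. s x \<noteq> x} \<in> J"
  proof (rule sum_over_classes[where r = "{(x, y). x \<in> S' \<and> s x \<noteq> x \<and> (y = x \<or> y = s x)}"])
    show "finite {x \<in> S'. s x \<noteq> x}" using assms(1) by (simp add: S'_def)
    show "equiv {x \<in> S'. s x \<noteq> x} {(x, y). x \<in> S' \<and> s x \<noteq> x \<and> (y = x \<or> y = s x)}"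
    proof (rule equivI)
      show "{(x, y). x \<in> S' \<and> s x \<noteq> x \<and> (y = x \<or> y = s x)} \<subseteq> {x \<in> S'. s x \<noteq> x} \<times> {x \<in> S'. s x \<noteq> x}"
        using Suc.prems(1) by (auto simp: S'_def t)
      show "refl_on {x \<in> S'. s x \<noteq> x} {(x, y). x \<in> S' \<and> s x \<noteq> x \<and> (y = x \<or> y = s x)}"
        by (rule refl_onI) auto
      show "sym {(x, y). x \<in> S' \<and> s x \<noteq> x \<and> (y = x \<or> y = s x)}"
        by (rule symI) (use Suc.prems(1) in \<open>auto simp: S'_def t\<close>)
      show "trans {(x, y). x \<in> S' \<and> s x \<noteq> x \<and> (y = x \<or> y = s x)}"
        by (rule transI) (auto simp: S'_def t)
    qed
    show "\<psi> y - \<psi> x \<in> J" if "(x, y) \<in> {(x, y). x \<in> S' \<and> s x \<noteq> x \<and> (y = x \<or> y = s x)}" for x y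
      using that Suc.prems(3) J(1) by (auto simp: S'_def)
    fix x assume x: "x \<in> {x \<in> S'. s x \<noteq> x}"
    then have "Image {(x, y). x \<in> S' \<and> s x \<noteq> x \<and> (y = x \<or> y = s x)} {x} = {x, s x}" by auto
    moreover have "card {x, s x} = 2" using x by auto
    ultimately show "of_nat (card (Image {(x, y). x \<in> S' \<and> s x \<noteq> x \<and> (y = x \<or> y = s x)} {x})) * \<psi> x \<in> J"
      using J(3) x by (simp add: S'_def)
  qed (rule J(1), rule J(2))
  moreover have "sum \<psi> S' = sum \<psi> {x \<in> S'. s x \<noteq> x} + sum \<psi> {x \<in> S. s x = x}"
  proof -
    have fin: "finite S'" using assms(1) by (simp add: S'_def)
    have "S' \<inter> {x. s x \<noteq> x} = {x \<in> S'. s x \<noteq> x}" "S' - {x. s x \<noteq> x} = {x \<in> S. s x = x}"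
      by (auto simp: S'_def t)
    then show ?thesis using sum.Int_Diff[OF fin, of \<psi> "{x. s x \<noteq> x}"] by simp
  qed
  ultimately show ?case using J(2)[of "sum \<psi> S - sum \<psi> S'" "sum \<psi> {x \<in> S'. s x \<noteq> x}"] by simp
qed

text \<open>A special case of Osima's theorem on the support of central idempotents: the coefficient
  at \<open>g\<close> of the square of a class function is, modulo two, a sum over the square roots of \<open>g\<close>.\<close>

lemma (in group) idempotent_class_function:
  fixes \<phi> :: "'a \<Rightarrow> 'r :: comm_ring_1"
  assumes fin: "finite (carrier G)"
    and J: "0 \<in> J" "\<And>a b. a \<in> J \<Longrightarrow> b \<in> J \<Longrightarrow> a + b \<in> J"
      "\<And>x y. x \<in> carrier G \<Longrightarrow> y \<in> carrier G \<Longrightarrow> of_nat 2 * (\<phi> x * \<phi> y) \<in> J"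
      "\<And>x y. x \<in> carrier G \<Longrightarrow> y \<in> carrier G \<Longrightarrow> \<phi> x \<in> J \<Longrightarrow> \<phi> x * \<phi> y \<in> J"
    and class_fun: "\<And>h x. h \<in> carrier G \<Longrightarrow> x \<in> carrier G \<Longrightarrow> \<phi> (h \<otimes> x \<otimes> inv h) = \<phi> x"
    and idem: "\<And>g. g \<in> carrier G \<Longrightarrow> \<phi> g = (\<Sum>x\<in>carrier G. \<phi> x * \<phi> (inv x \<otimes> g))"
    and g: "g \<in> carrier G" "g \<noteq> \<one>" "g [^] (2 ^ b :: nat) = \<one>"
  shows "\<phi> g \<in> J"
proof -
  \<comment> \<open>The induction is on a \<open>j\<close> for which \<open>g\<close> has no
    \<open>2^j\<close>-th root: a square root of \<open>g\<close> then has no root of the previous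
    level.\<close>
  have main: "\<phi> g \<in> J" if "g \<in> carrier G" "g \<noteq> \<one>" "g [^] (2 ^ b :: nat) = \<one>"
    "\<And>x. x \<in> carrier G \<Longrightarrow> x [^] (2 ^ j :: nat) \<noteq> g" for j b g
    using that
  proof (induction j arbitrary: g b)
    case 0
    from 0(4)[OF 0(1)] 0(1) show ?case by simp
  next
    case (Suc j)
    note gG = Suc.prems(1)
    \<comment> \<open>\<open>s\<close> interchanges the two factors of \<open>g\<close> up to
      conjugation. Its square is conjugation by \<open>inv g\<close>, of 2-power order, and its
      fixed points are the square roots of \<open>g\<close>.\<close>
    define s where "s x = inv x \<otimes> g" for x
    have s2: "(s ^^ 2) x = inv g \<otimes> x \<otimes> g" if "x \<in> carrier G" for x
      using that gG by (simp add: s_def numeral_2_eq_2 inv_mult_group m_assoc)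
    have s2j: "((s ^^ 2) ^^ i) x = inv (g [^] i) \<otimes> x \<otimes> g [^] i" if x: "x \<in> carrier G" for i :: nat and x
    proof (induction i)
      case 0
      then show ?case using x by simp
    next
      case (Suc i)
      have "((s ^^ 2) ^^ Suc i) x = (s ^^ 2) (inv (g [^] i) \<otimes> x \<otimes> g [^] i)"
        using Suc by simp
      also have "\<dots> = inv g \<otimes> (inv (g [^] i) \<otimes> x \<otimes> g [^] i) \<otimes> g"
        using x gG by (intro s2) simp
      finally show ?case using x gG by (simp add: inv_mult_group m_assoc)
    qed
    have "sum (\<lambda>x. \<phi> x * \<phi> (s x)) (carrier G) - sum (\<lambda>x. \<phi> x * \<phi> (s x)) {x \<in> carrier G. s x = x} \<in> J"
    proof (rule sum_involution_power[OF fin _ _ _ J(1,2), where b = "Suc b"])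
      show "s x \<in> carrier G" if "x \<in> carrier G" for x using that gG by (simp add: s_def)
      show "(s ^^ (2 ^ Suc b)) x = x" if x: "x \<in> carrier G" for x
        using s2j[OF x, of "2 ^ b"] Suc.prems(3) x by (simp add: funpow_mult)
      show "of_nat 2 * (\<phi> x * \<phi> (s x)) \<in> J" if "x \<in> carrier G" for x
        using J(3) that gG by (simp add: s_def)
      show "\<phi> (s x) * \<phi> (s (s x)) = \<phi> x * \<phi> (s x)" if x: "x \<in> carrier G" for x
      proof -
        have "s (s x) = inv g \<otimes> x \<otimes> inv (inv g)"
          using x gG by (simp add: s_def inv_mult_group m_assoc)
        then show ?thesis using class_fun[of "inv g" x] x gG by (simp add: mult.commute)
      qed
    qed
    moreover have "\<phi> x * \<phi> (s x) \<in> J" if x: "x \<in> carrier G" "s x = x" for x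
    proof -
      have "x \<otimes> s x = g" using x(1) gG by (simp add: s_def m_assoc[symmetric])
      then have xx: "x \<otimes> x = g" using x(2) by simp
      then have x2: "x [^] (2::nat) = g" using x(1) by (simp add: numeral_2_eq_2)
      have "\<phi> x \<in> J"
      proof (rule Suc.IH[OF x(1), of "Suc b"])
        show "x \<noteq> \<one>" using xx Suc.prems(2) by auto
        show "x [^] (2 ^ Suc b :: nat) = \<one>"
          using Suc.prems(3) x(1) by (simp add: nat_pow_pow[symmetric] x2)
        show "y [^] (2 ^ j :: nat) \<noteq> x" if y: "y \<in> carrier G" for y
        proof
          assume "y [^] (2 ^ j :: nat) = x"
          then have "y [^] (2 ^ j * 2 :: nat) = g" using y x2 by (simp add: nat_pow_pow[symmetric])
          then show False using Suc.prems(4)[OF y] by (simp add: mult.commute)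
        qed
      qed
      then show ?thesis using J(4) x gG by simp
    qed
    then have "sum (\<lambda>x. \<phi> x * \<phi> (s x)) {x \<in> carrier G. s x = x} \<in> J"
      by (intro sum_in_set[OF J(1,2)]) auto
    ultimately have "(sum (\<lambda>x. \<phi> x * \<phi> (s x)) (carrier G) - sum (\<lambda>x. \<phi> x * \<phi> (s x)) {x \<in> carrier G. s x = x}) +
        sum (\<lambda>x. \<phi> x * \<phi> (s x)) {x \<in> carrier G. s x = x} \<in> J"
      by (rule J(2))
    then have "sum (\<lambda>x. \<phi> x * \<phi> (s x)) (carrier G) \<in> J" by simp
    then show ?case using idem[OF gG] by (simp add: s_def)
  qed
  \<comment> \<open>A \<open>2^j\<close>-th root of \<open>g\<close> would have 2-power order
    exceeding \<open>2^j\<close>, hence exceeding the group order \<open>j\<close>.\<close>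
  define j where "j = card (carrier G)"
  show ?thesis
  proof (rule main[OF g, of j])
    fix x assume x: "x \<in> carrier G"
    show "x [^] (2 ^ j :: nat) \<noteq> g"
    proof
      assume xg: "x [^] (2 ^ j :: nat) = g"
      then have "x [^] (2 ^ j * 2 ^ b :: nat) = \<one>" using g(3) x by (simp add: nat_pow_pow[symmetric])
      then have "ord x dvd 2 ^ (j + b)" using pow_eq_id[OF x] by (simp add: power_add)
      then obtain i where i: "ord x = 2 ^ i"
        using divides_primepow_nat[OF two_is_prime_nat] by blast
      have "\<not> ord x dvd 2 ^ j" using xg g(2) pow_eq_id[OF x] by metis
      then have "\<not> i \<le> j" unfolding i using le_imp_power_dvd[of i j 2] by auto
      then have "j < i" by simp
      then have "j < ord x" unfolding i by (metis less_exp less_trans power_strict_increasing_iff one_less_numeral_iff semiring_norm(76))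
      moreover have "ord x \<le> j" using ord_le_group_order[OF fin x] by (simp add: j_def order_def)
      ultimately show False by simp
    qed
  qed
qed

section \<open>The image in the group algebra of the quotient\<close>

context p_constrained
begin

lemma nsub_N: "nsub N"
  unfolding nsub_def using N_subgroup N_conj N_carrier by blast

lemma N_times_coset:
  assumes g: "g \<in> carrier G"
  shows "(\<lambda>h. h \<otimes> g) ` N \<subseteq> carrier G" "g \<notin> N \<Longrightarrow> (\<lambda>h. h \<otimes> g) ` N \<inter> N = {}"
    "k \<in> N \<Longrightarrow> s \<in> (\<lambda>h. h \<otimes> g) ` N \<Longrightarrow> k \<otimes> s \<otimes> inv k \<in> (\<lambda>h. h \<otimes> g) ` N"
    "inj_on (\<lambda>h. h \<otimes> g) N"
proof -
  show "(\<lambda>h. h \<otimes> g) ` N \<subseteq> carrier G" using N_carrier g by blast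
  show "inj_on (\<lambda>h. h \<otimes> g) N"
    using N_carrier g by (intro inj_onI) (meson right_cancel)
  show "(\<lambda>h. h \<otimes> g) ` N \<inter> N = {}" if gN: "g \<notin> N"
  proof -
    have "h \<otimes> g \<notin> N" if h: "h \<in> N" for h
    proof
      assume "h \<otimes> g \<in> N"
      then have "inv h \<otimes> (h \<otimes> g) \<in> N" using N_closed h by blast
      then show False using gN N_carrier[OF h] g by (simp add: mult_inv_cancel)
    qed
    then show ?thesis by blast
  qed
  show "k \<otimes> s \<otimes> inv k \<in> (\<lambda>h. h \<otimes> g) ` N" if k: "k \<in> N" and s: "s \<in> (\<lambda>h. h \<otimes> g) ` N"
  proof -
    obtain h where h: "h \<in> N" "s = h \<otimes> g" using s by blast
    note car = N_carrier[OF k] N_carrier[OF h(1)] g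
    have "k \<otimes> s \<otimes> inv k = (k \<otimes> h \<otimes> (g \<otimes> inv k \<otimes> inv g)) \<otimes> g"
      using car by (simp add: h(2) m_assoc mult_inv_cancel)
    moreover have "k \<otimes> h \<otimes> (g \<otimes> inv k \<otimes> inv g) \<in> N"
      by (intro N_closed(3) k h(1) N_conj g N_closed(2))
    ultimately show ?thesis by (rule image_eqI)
  qed
qed

lemma coset_sum:
  assumes u: "class_function u" "u \<in> fspace A" and g: "g \<in> carrier G"
  shows "(u \<star> ind N) g = sum u ((\<lambda>h. h \<otimes> g) ` N)"
  using N_times_coset(4)[OF g] conv_ind_subgroup[OF N_subgroup u(1) fspace_A_F[OF u(2)] g]
  by (simp add: sum.reindex)

text \<open>Outside \<open>N\<close> the coefficient is a sum of \<open>u\<close> over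
  \<open>N g\<close>. Inside \<open>N\<close> it is minus the sum over the complement of
  \<open>N\<close>, because the augmentation is \<open>e\<close>.\<close>

lemma coset_sum_mod_p:
  assumes u: "class_function u" "u \<in> fspace A" and aug: "(\<Sum>g\<in>carrier G. u g) = e" and g: "g \<in> carrier G"
  shows "(u \<star> ind N - ind N) g \<in> pA"
proof (cases "g \<in> N")
  case True
  have "(\<lambda>h. h \<otimes> g) ` N = N"
  proof (intro equalityI subsetI)
    fix y assume y: "y \<in> N"
    have "y = (y \<otimes> inv g) \<otimes> g" using N_carrier[OF y] g by (simp add: m_assoc)
    then show "y \<in> (\<lambda>h. h \<otimes> g) ` N" using N_closed True y by blast
  qed (use N_closed True in blast)
  then have "(u \<star> ind N) g = sum u N" using coset_sum[OF u g] by simp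
  moreover have "sum u (carrier G) = sum u N + sum u (carrier G - N)"
    using sum.subset_diff[of N "carrier G" u] finite_G N_carrier by (simp add: add.commute subsetI)
  moreover have "(u \<star> ind N - ind N) g = (u \<star> ind N) g - sum u (carrier G)"
    unfolding aug minus_apply using True by (simp add: ind_def[of N])
  ultimately have "(u \<star> ind N - ind N) g = - sum u (carrier G - N)" by simp
  moreover have "sum u (carrier G - N) \<in> pA"
  proof (rule class_sum_pA[OF _ _ _ u])
    show "k \<otimes> s \<otimes> inv k \<in> carrier G - N" if k: "k \<in> N" and s: "s \<in> carrier G - N" for k s
    proof -
      have "k \<otimes> s \<otimes> inv k \<notin> N"
      proof
        assume "k \<otimes> s \<otimes> inv k \<in> N"
        then have "inv k \<otimes> (k \<otimes> s \<otimes> inv k) \<otimes> k \<in> N" using N_closed k by blast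
        then show False using s N_carrier[OF k] by (simp add: m_assoc mult_inv_cancel)
      qed
      then show ?thesis using s N_carrier[OF k] by simp
    qed
  qed auto
  ultimately show ?thesis using pA_uminus by simp
next
  case False
  have "(u \<star> ind N - ind N) g = sum u ((\<lambda>h. h \<otimes> g) ` N)"
    using coset_sum[OF u g] False by (simp add: minus_apply ind_def)
  then show ?thesis
    using class_sum_pA[OF N_times_coset(1)[OF g] N_times_coset(2)[OF g False] N_times_coset(3)[OF g] u] by simp
qed

text \<open>An element with only two \<open>N\<close>-conjugates centralizes a subgroup of index two in \<open>N\<close> and
  the quotient by it, hence acts on \<open>N\<close> with order a power of two.\<close>

lemma pow_in_N_if_two_conjugates:
  assumes y: "y \<in> carrier G" and card2: "card (N_class y) = 2"
  shows "y [^] (p ^ a) \<in> N"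
proof -
  have yc: "y \<in> N_class y"
    unfolding N_class_def using N_closed(1) y by (intro image_eqI[of _ _ \<one>]) simp_all
  obtain z where z: "N_class y = {y, z}" "z \<noteq> y"
  proof -
    obtain x1 x2 where "N_class y = {x1, x2}" "x1 \<noteq> x2" using card2 by (auto simp: card_2_iff)
    then show ?thesis using yc that by (cases "y = x1") auto
  qed
  have cl: "k \<otimes> y \<otimes> inv k = y \<or> k \<otimes> y \<otimes> inv k = z" if "k \<in> N" for k
    using z(1) that unfolding N_class_def by blast
  obtain k0 where k0: "k0 \<in> N" "z = k0 \<otimes> y \<otimes> inv k0" using z(1) unfolding N_class_def by blast
  have zG: "z \<in> carrier G" using k0 N_carrier[OF k0(1)] y by simp
  have inj: "x = x'" if "k \<in> N" "x \<in> carrier G" "x' \<in> carrier G" "k \<otimes> x \<otimes> inv k = k \<otimes> x' \<otimes> inv k" for k x x'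
    using that N_carrier[OF that(1)] by simp
  have clz: "k \<otimes> z \<otimes> inv k = (if k \<otimes> y \<otimes> inv k = y then z else y)" if k: "k \<in> N" for k
  proof -
    have "k \<otimes> z \<otimes> inv k = (k \<otimes> k0) \<otimes> y \<otimes> inv (k \<otimes> k0)"
      using k0 N_carrier[OF k] N_carrier[OF k0(1)] y by (simp add: inv_mult_group m_assoc)
    then have "k \<otimes> z \<otimes> inv k = y \<or> k \<otimes> z \<otimes> inv k = z" using cl[of "k \<otimes> k0"] N_closed(3)[OF k k0(1)] by simp
    moreover have "k \<otimes> z \<otimes> inv k \<noteq> k \<otimes> y \<otimes> inv k" using inj[OF k zG y] z(2) by blast
    ultimately show ?thesis using cl[OF k] by auto
  qed
  \<comment> \<open>For \<open>k\<close> moving \<open>y\<close> the definition gives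
    \<open>y k = t k y\<close>. As \<open>t\<close> commutes with \<open>y\<close>, it follows that
    \<open>y^j k = t^j k y^j\<close>, and \<open>t\<close> has \<open>p\<close>-power order.\<close>
  define t where "t = y \<otimes> inv z"
  have tN: "t \<in> N"
  proof -
    have "t = (y \<otimes> k0 \<otimes> inv y) \<otimes> inv k0"
      using N_carrier[OF k0(1)] y by (simp add: t_def k0(2) inv_mult_group m_assoc)
    then show ?thesis using N_closed k0(1) N_conj[OF y k0(1)] by simp
  qed
  have tG: "t \<in> carrier G" by (rule N_carrier[OF tN])
  \<comment> \<open>\<open>t\<close> is the product of \<open>l\<close> and \<open>inv k0\<close>,
    both of which interchange \<open>y\<close> and \<open>z\<close> by conjugation.\<close>
  have ty: "t \<otimes> y \<otimes> inv t = y"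
  proof -
    define l where "l = y \<otimes> k0 \<otimes> inv y"
    have l: "l \<in> N" unfolding l_def by (rule N_conj[OF y k0(1)])
    have lG: "l \<in> carrier G" "k0 \<in> carrier G" using N_carrier l k0 by blast+
    have "l \<otimes> y \<otimes> inv l \<noteq> y"
    proof
      assume eq: "l \<otimes> y \<otimes> inv l = y"
      have "l \<otimes> y \<otimes> inv l = y \<otimes> z \<otimes> inv y"
        using y lG by (simp add: l_def k0(2) inv_mult_group m_assoc mult_inv_cancel)
      then have "y \<otimes> z \<otimes> inv y = y \<otimes> y \<otimes> inv y" using eq y by (simp add: m_assoc)
      then show False using z(2) y zG by simp
    qed
    moreover have k0i: "inv k0 \<otimes> y \<otimes> inv (inv k0) = z"
    proof -
      have "inv k0 \<otimes> y \<otimes> inv (inv k0) \<noteq> y"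
      proof
        assume "inv k0 \<otimes> y \<otimes> inv (inv k0) = y"
        then have "k0 \<otimes> (inv k0 \<otimes> y \<otimes> inv (inv k0)) \<otimes> inv k0 = z" using k0 by simp
        then show False using z(2) y lG by (simp add: m_assoc mult_inv_cancel)
      qed
      then show ?thesis using cl[OF N_closed(2)[OF k0(1)]] by blast
    qed
    ultimately have "l \<otimes> (inv k0 \<otimes> y \<otimes> inv (inv k0)) \<otimes> inv l = y" using clz[OF l] by simp
    moreover have "t = l \<otimes> inv k0"
      using lG y by (simp add: t_def l_def k0(2) inv_mult_group m_assoc)
    ultimately show ?thesis using lG y by (simp add: inv_mult_group m_assoc)
  qed
  have ty': "y \<otimes> t = t \<otimes> y"
  proof -
    have "t \<otimes> y = (t \<otimes> y \<otimes> inv t) \<otimes> t" using tG y by (simp add: m_assoc)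
    then show ?thesis by (simp only: ty)
  qed
  have tj: "y \<otimes> t [^] j = t [^] j \<otimes> y" for j :: nat
  proof (induction j)
    case (Suc j)
    have "y \<otimes> t [^] Suc j = (y \<otimes> t [^] j) \<otimes> t" using tG y by (simp add: m_assoc)
    also have "\<dots> = t [^] j \<otimes> (y \<otimes> t)" using Suc tG y by (simp add: m_assoc)
    finally show ?case using tG y ty' by (simp add: m_assoc)
  qed (use y in simp)
  have "t [^] (p ^ a) = \<one>"
  proof -
    have "group (G\<lparr>carrier := N\<rparr>)" using N_subgroup by (rule subgroup_imp_group)
    then have "t [^]\<^bsub>G\<lparr>carrier := N\<rparr>\<^esub> (p ^ a) = \<one>"
      using group.pow_order_eq_1[of "G\<lparr>carrier := N\<rparr>" t] tN card_N by (simp add: order_def)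
    then show ?thesis by (metis nat_pow_consistent)
  qed
  moreover have "y [^] j \<otimes> k = t [^] j \<otimes> k \<otimes> y [^] j" if k: "k \<in> N" "k \<otimes> y \<otimes> inv k \<noteq> y" for k and j :: nat
  proof (induction j)
    case 0
    then show ?case using N_carrier[OF k(1)] by simp
  next
    case (Suc j)
    note car = N_carrier[OF k(1)] y tG zG
    have kz: "z = k \<otimes> y \<otimes> inv k" using cl[OF k(1)] k(2) by simp
    have "t \<otimes> k \<otimes> y = y \<otimes> k" using car by (simp add: t_def kz inv_mult_group m_assoc mult_inv_cancel)
    then have yk: "y \<otimes> k = t \<otimes> k \<otimes> y" ..
    have "y [^] Suc j \<otimes> k = y \<otimes> (y [^] j \<otimes> k)" unfolding nat_pow_Suc2[OF y] using car by (simp add: m_assoc)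
    also have "\<dots> = (y \<otimes> t [^] j) \<otimes> k \<otimes> y [^] j" unfolding Suc using car by (simp add: m_assoc)
    also have "\<dots> = t [^] j \<otimes> (y \<otimes> k) \<otimes> y [^] j" unfolding tj using car by (simp add: m_assoc)
    also have "\<dots> = t [^] Suc j \<otimes> k \<otimes> y [^] Suc j"
      unfolding yk nat_pow_Suc2[OF y] using car by (simp add: m_assoc)
    finally show ?case .
  qed
  moreover have "y [^] j \<otimes> k = k \<otimes> y [^] j" if k: "k \<in> N" "k \<otimes> y \<otimes> inv k = y" for k and j :: nat
  proof -
    have "k \<otimes> y = y \<otimes> k" using k N_carrier[OF k(1)] y by (metis inv_solve_right' m_closed)
    show ?thesis
    proof (induction j)
      case 0
      then show ?case using N_carrier[OF k(1)] by simp
    next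
      case (Suc j)
      have "y [^] Suc j \<otimes> k = y [^] j \<otimes> (k \<otimes> y)"
        unfolding \<open>k \<otimes> y = y \<otimes> k\<close> using y N_carrier[OF k(1)] by (simp add: m_assoc)
      also have "\<dots> = (k \<otimes> y [^] j) \<otimes> y"
        unfolding Suc[symmetric] using y N_carrier[OF k(1)] by (simp add: m_assoc)
      finally show ?case using y N_carrier[OF k(1)] by (simp add: m_assoc)
    qed
  qed
  ultimately have "y [^] (p ^ a) \<otimes> k = k \<otimes> y [^] (p ^ a)" if "k \<in> N" for k
    using that N_carrier[OF that] by (metis l_one)
  then show ?thesis using y by (intro centralizer_N) simp_all
qed

text \<open>\<open>x \<star> b\<close> is the square of \<open>x\<close> in the group algebra of
  \<open>G/N\<close>; \<open>x \<star> x\<close> would carry the additional factor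
  \<open>card N\<close>.\<close>

lemma coset_idempotent:
  assumes b: "b \<in> fspace A" and x: "x = ind N \<star> b" and g: "g \<in> carrier G"
  shows "(x \<star> b) g = (\<Sum>r\<in>rep N ` carrier G. x r * x (inv r \<otimes> g))"
proof -
  have bF: "b \<in> fspace F" by (rule fspace_A_F[OF b])
  have xl: "x \<in> linv N" unfolding x by (rule linv_conv[OF nsub_N linv_ind[OF nsub_N] bF])
  have "(x \<star> b) g = (\<Sum>r\<in>rep N ` carrier G. \<Sum>h\<in>N. x (h \<otimes> r) * b (inv (h \<otimes> r) \<otimes> g))"
    unfolding conv_apply[OF g] by (rule sum_cosets[OF N_subgroup])
  also have "\<dots> = (\<Sum>r\<in>rep N ` carrier G. x r * x (inv r \<otimes> g))"
  proof (rule sum.cong[OF refl])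
    fix r assume "r \<in> rep N ` carrier G"
    then have r: "r \<in> carrier G" using rep_carrier[OF N_subgroup] by blast
    have bij: "bij_betw (\<lambda>h. inv r \<otimes> h \<otimes> r) N N"
      using r N_conj[OF r] N_conj[of "inv r"] N_carrier
      by (intro bij_betwI[where g = "\<lambda>h. r \<otimes> h \<otimes> inv r"]) (auto simp: m_assoc mult_inv_cancel)
    have "(\<Sum>h\<in>N. x (h \<otimes> r) * b (inv (h \<otimes> r) \<otimes> g)) =
        (\<Sum>h\<in>N. x r * b (inv (inv r \<otimes> h \<otimes> r) \<otimes> (inv r \<otimes> g)))"
      using linv_apply[OF nsub_N xl] N_carrier r g
      by (intro sum.cong refl) (simp add: inv_mult_group m_assoc mult_inv_cancel)
    also have "\<dots> = (\<Sum>h\<in>N. x r * b (inv h \<otimes> (inv r \<otimes> g)))"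
      by (rule sum.reindex_bij_betw[OF bij])
    also have "\<dots> = x r * x (inv r \<otimes> g)"
      using ind_conv_apply[of N "inv r \<otimes> g" b] bF r g N_carrier by (simp add: x sum_distrib_left subsetI)
    finally show "(\<Sum>h\<in>N. x (h \<otimes> r) * b (inv (h \<otimes> r) \<otimes> g)) = x r * x (inv r \<otimes> g)" .
  qed
  finally show ?thesis .
qed

text \<open>The quotient group argument for \<open>p = 2\<close>: there the difference is minus twice an idempotent.\<close>

lemma no_idempotent:
  assumes p2: "p = 2"
    and u: "class_function u" "u \<in> fspace A" and aug: "(\<Sum>g\<in>carrier G. u g) = e"
    and b: "b \<in> fspace A" and x: "x = ind N \<star> b" and idem: "x \<star> b = x"
    and ux: "u \<star> ind N = ind N - of_nat 2 * x"
  shows "x \<in> fspace nonunits"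
proof -
  interpret Nn: normal N G by (rule N_normal)
  have bF: "b \<in> fspace F" by (rule fspace_A_F[OF b])
  have NG: "N \<subseteq> carrier G" using N_carrier by blast
  have xA: "x \<in> fspace A" unfolding x by (intro fspace_conv fspace_ind NG b)
  have xl: "x \<in> linv N" unfolding x by (rule linv_conv[OF nsub_N linv_ind[OF nsub_N] bF])
  have xAp: "x g \<in> A" if "g \<in> carrier G" for g by (rule fspace_apply[OF xA that])
  have two: "of_nat 2 * y \<in> nonunits" if "y \<in> A" for y using p_mult_nonunit[OF that] p2 by simp
  have ux_apply: "(u \<star> ind N) g = ind N g - of_nat 2 * x g" for g
    unfolding ux by (simp add: minus_apply times_fun_apply)
  have ind_class: "ind N (h \<otimes> g \<otimes> inv h) = ind N g" if h: "h \<in> carrier G" and g: "g \<in> carrier G" for h g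
  proof -
    have "h \<otimes> g \<otimes> inv h \<in> N \<longleftrightarrow> g \<in> N"
    proof
      assume "h \<otimes> g \<otimes> inv h \<in> N"
      then have "inv h \<otimes> (h \<otimes> g \<otimes> inv h) \<otimes> inv (inv h) \<in> N" using N_conj h by blast
      then show "g \<in> N" using h g by (simp add: m_assoc mult_inv_cancel)
    qed (rule N_conj[OF h])
    then show ?thesis by (simp add: ind_def)
  qed
  have x_class: "x (h \<otimes> g \<otimes> inv h) = x g" if h: "h \<in> carrier G" and g: "g \<in> carrier G" for h g
  proof -
    have hg: "h \<otimes> g \<otimes> inv h \<in> carrier G" using h g by simp
    have "(u \<star> ind N) (h \<otimes> g \<otimes> inv h) = (u \<star> ind N) g"
      by (rule conv_conj[OF u(1) h _ g]) (rule ind_class[OF h])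
    then have "of_nat p * x (h \<otimes> g \<otimes> inv h) = of_nat p * x g"
      unfolding ux_apply ind_class[OF h g] p2 by simp
    then show ?thesis using p_cancel xAp[OF hg] xAp[OF g] A_F by blast
  qed
  \<comment> \<open>If \<open>N g\<close> contains an element with exactly two
    \<open>N\<close>-conjugates, its image in \<open>G/N\<close> has 2-power order and the result on
    idempotents applies. Otherwise all class sizes in \<open>N g\<close> are multiples of
    \<open>4\<close>, so \<open>2 x g\<close> is divisible by \<open>4\<close>.\<close>
  have outside: "x g \<in> nonunits" if g: "g \<in> carrier G" "g \<notin> N" for g
  proof (cases "\<exists>y\<in>(\<lambda>h. h \<otimes> g) ` N. card (N_class y) = 2")
    case True
    then obtain h0 where h0: "h0 \<in> N" "card (N_class (h0 \<otimes> g)) = 2" by blast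
    define y where "y = h0 \<otimes> g"
    have yG: "y \<in> carrier G" using h0 N_carrier g by (simp add: y_def)
    have yN: "y [^] (2 ^ a :: nat) \<in> N" using pow_in_N_if_two_conjugates[OF yG] h0 p2 by (simp add: y_def)
    define Q where "Q = G Mod N"
    have grQ: "group Q" unfolding Q_def by (rule Nn.factorgroup_is_group)
    have carQ: "carrier Q = rcosets N" and oneQ: "\<one>\<^bsub>Q\<^esub> = N" by (simp_all add: Q_def FactGroup_def)
    have inQ: "N #> z \<in> carrier Q" if "z \<in> carrier G" for z
      using that by (auto simp: carQ RCOSETS_def)
    have QE: "\<exists>z\<in>carrier G. C = N #> z" if "C \<in> carrier Q" for C
      using that by (auto simp: carQ RCOSETS_def)
    have multQ: "(N #> z) \<otimes>\<^bsub>Q\<^esub> (N #> w) = N #> (z \<otimes> w)" if "z \<in> carrier G" "w \<in> carrier G" for z w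
      using Nn.rcos_sum[OF that] by (simp add: Q_def FactGroup_def)
    have invQ: "inv\<^bsub>Q\<^esub> (N #> z) = N #> inv z" if "z \<in> carrier G" for z
      using Nn.inv_FactGroup[of "N #> z"] Nn.rcos_inv[OF that] inQ[OF that] by (simp add: Q_def)
    have powQ: "(N #> z) [^]\<^bsub>Q\<^esub> j = N #> z [^] j" if z: "z \<in> carrier G" for z and j :: nat
    proof (induction j)
      case 0
      show ?case using oneQ coset_mult_one[OF NG] by (simp add: nat_pow_def)
    next
      case (Suc j)
      have "(N #> z) [^]\<^bsub>Q\<^esub> Suc j = (N #> z) [^]\<^bsub>Q\<^esub> j \<otimes>\<^bsub>Q\<^esub> (N #> z)" by (simp add: nat_pow_def)
      then show ?case using multQ[of "z [^] j" z] z by (simp add: Suc)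
    qed
    define \<phi> where "\<phi> C = x (SOME z. z \<in> C)" for C
    have \<phi>: "\<phi> (N #> z) = x z" if z: "z \<in> carrier G" for z
    proof -
      have "(SOME z'. z' \<in> N #> z) \<in> N #> z" using rcos_self[OF z N_subgroup] by (rule someI)
      then obtain h where "h \<in> N" "(SOME z'. z' \<in> N #> z) = h \<otimes> z" unfolding r_coset_def by blast
      then show ?thesis unfolding \<phi>_def using linv_apply[OF nsub_N xl _ z] by simp
    qed
    have \<phi>A: "\<phi> C \<in> A" if C: "C \<in> carrier Q" for C using QE[OF C] \<phi> xAp by auto
    have bij: "bij_betw (\<lambda>r. N #> r) (rep N ` carrier G) (carrier Q)"
    proof (rule bij_betwI')
      fix r r' assume r: "r \<in> rep N ` carrier G" "r' \<in> rep N ` carrier G"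
      show "(N #> r = N #> r') = (r = r')"
      proof
        assume "N #> r = N #> r'"
        then have "rep N r = rep N r'" by (simp add: rep_def)
        moreover have "rep N r = r" "rep N r' = r'" using r rep_rep[OF N_subgroup] by blast+
        ultimately show "r = r'" by simp
      qed simp
    next
      fix r assume "r \<in> rep N ` carrier G"
      then show "N #> r \<in> carrier Q" using rep_carrier[OF N_subgroup] inQ by blast
    next
      fix C assume "C \<in> carrier Q"
      then obtain z where z: "z \<in> carrier G" "C = N #> z" using QE by blast
      then have "C = N #> rep N z" using repr_independence[OF rep_in[OF N_subgroup z(1)] z(1) N_subgroup] by simp
      then show "\<exists>r\<in>rep N ` carrier G. C = N #> r" using z(1) by blast
    qed
    have "\<phi> (N #> y) \<in> nonunits"
    proof (rule group.idempotent_class_function[OF grQ _ nonunits_zero nonunits_add])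
      show "finite (carrier Q)" using bij_betw_finite[OF bij] finite_G by simp
      show "of_nat 2 * (\<phi> C * \<phi> D) \<in> nonunits" if "C \<in> carrier Q" "D \<in> carrier Q" for C D
        using two A_mult \<phi>A that by blast
      show "\<phi> C * \<phi> D \<in> nonunits" if "C \<in> carrier Q" "D \<in> carrier Q" "\<phi> C \<in> nonunits" for C D
        using nonunits_mult \<phi>A that by blast
      show "\<phi> (C \<otimes>\<^bsub>Q\<^esub> D \<otimes>\<^bsub>Q\<^esub> inv\<^bsub>Q\<^esub> C) = \<phi> D" if C: "C \<in> carrier Q" and D: "D \<in> carrier Q" for C D
      proof -
        obtain z w where zw: "z \<in> carrier G" "C = N #> z" "w \<in> carrier G" "D = N #> w"
          using QE[OF C] QE[OF D] by blast
        then show ?thesis using \<phi> x_class by (simp add: multQ invQ)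
      qed
      show "\<phi> D = (\<Sum>C\<in>carrier Q. \<phi> C * \<phi> (inv\<^bsub>Q\<^esub> C \<otimes>\<^bsub>Q\<^esub> D))" if D: "D \<in> carrier Q" for D
      proof -
        obtain w where w: "w \<in> carrier G" "D = N #> w" using QE[OF D] by blast
        have "\<phi> D = (x \<star> b) w" using \<phi> w idem by simp
        also have "\<dots> = (\<Sum>r\<in>rep N ` carrier G. x r * x (inv r \<otimes> w))" by (rule coset_idempotent[OF b x w(1)])
        also have "\<dots> = (\<Sum>r\<in>rep N ` carrier G. \<phi> (N #> r) * \<phi> (inv\<^bsub>Q\<^esub> (N #> r) \<otimes>\<^bsub>Q\<^esub> D))"
        proof (rule sum.cong[OF refl])
          fix r assume "r \<in> rep N ` carrier G"
          then have "r \<in> carrier G" using rep_carrier[OF N_subgroup] by blast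
          then show "x r * x (inv r \<otimes> w) = \<phi> (N #> r) * \<phi> (inv\<^bsub>Q\<^esub> (N #> r) \<otimes>\<^bsub>Q\<^esub> D)"
            using w by (simp add: \<phi> invQ multQ)
        qed
        also have "\<dots> = (\<Sum>C\<in>carrier Q. \<phi> C * \<phi> (inv\<^bsub>Q\<^esub> C \<otimes>\<^bsub>Q\<^esub> D))"
          by (rule sum.reindex_bij_betw[OF bij])
        finally show ?thesis .
      qed
      show "N #> y \<in> carrier Q" by (rule inQ[OF yG])
      show "N #> y \<noteq> \<one>\<^bsub>Q\<^esub>"
      proof
        assume "N #> y = \<one>\<^bsub>Q\<^esub>"
        then have "y \<in> N" using rcos_self[OF yG N_subgroup] oneQ by simp
        then have "inv h0 \<otimes> y \<in> N" using N_closed h0(1) by blast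
        then show False using g N_carrier[OF h0(1)] by (simp add: y_def mult_inv_cancel)
      qed
      show "(N #> y) [^]\<^bsub>Q\<^esub> (2 ^ a :: nat) = \<one>\<^bsub>Q\<^esub>"
        using powQ[OF yG] coset_join2[OF _ N_subgroup yN] yG by (simp add: oneQ)
    qed
    then show ?thesis using \<phi>[OF yG] linv_apply[OF nsub_N xl h0(1) g(1)] by (simp add: y_def)
  next
    case False
    have "sum u ((\<lambda>h. h \<otimes> g) ` N) \<in> {of_nat 4 * y | y. y \<in> A}"
    proof (rule class_sum_in[OF N_times_coset(1)[OF g(1)] N_times_coset(2)[OF g] N_times_coset(3)[OF g(1)] u(1)])
      show "0 \<in> {of_nat 4 * y | y. y \<in> A}" using A_zero by force
      show "y + z \<in> {of_nat 4 * y | y. y \<in> A}" if "y \<in> {of_nat 4 * y | y. y \<in> A}" "z \<in> {of_nat 4 * y | y. y \<in> A}" for y z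
        using that A_add by (auto simp: distrib_left[symmetric] simp del: distrib_left_numeral)
      fix y assume y: "y \<in> (\<lambda>h. h \<otimes> g) ` N"
      have yG: "y \<in> carrier G" and yN: "y \<notin> N" using y N_times_coset(1)[OF g(1)] N_times_coset(2)[OF g] by auto
      obtain i where i: "card (N_class y) = 2 ^ i"
        using card_N_class_dvd[OF yG] p2 divides_primepow_nat[OF two_is_prime_nat] by blast
      have "i \<noteq> 0" "i \<noteq> 1" using card_N_class_neq_1[OF yG yN] False y i by auto
      then have "(2::nat) ^ 2 dvd 2 ^ i" by (intro le_imp_power_dvd) simp
      then obtain q where "card (N_class y) = 4 * q" using i by (auto elim!: dvdE)
      then have "of_nat (card (N_class y)) * u y = of_nat 4 * (of_nat q * u y)" by (simp add: mult.assoc)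
      moreover have "of_nat q * u y \<in> A" by (rule A_of_nat_mult[OF fspace_apply[OF u(2) yG]])
      ultimately show "of_nat (card (N_class y)) * u y \<in> {of_nat 4 * y | y. y \<in> A}" by blast
    qed
    then obtain y where y: "y \<in> A" "(u \<star> ind N) g = of_nat 4 * y" using coset_sum[OF u g(1)] by auto
    then have "- (of_nat 2 * x g) = of_nat 4 * y" using ux_apply[of g] g(2) by (simp add: ind_def)
    then have "of_nat 2 * x g = - (of_nat 4 * y)" by (metis minus_minus)
    then have "of_nat p * x g = of_nat p * (- (of_nat 2 * y))" unfolding p2 by simp
    then have "x g = - (of_nat 2 * y)"
      using p_cancel[OF A_F[OF xAp[OF g(1)]] F_uminus[OF F_of_nat_mult[OF A_F[OF y(1)]]]] by blast
    then show ?thesis using nonunits_uminus[OF two[OF y(1)]] by simp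
  qed
  define r0 where "r0 = rep N \<one>"
  have r0: "r0 \<in> N" using rep_in[OF N_subgroup one_closed] coset_mult_one[OF NG] by (simp add: r0_def)
  have R: "r \<in> carrier G" "r \<in> N \<longleftrightarrow> r = r0" if "r \<in> rep N ` carrier G" for r
  proof -
    show "r \<in> carrier G" using that rep_carrier[OF N_subgroup] by blast
    have "rep N r = r" using that rep_rep[OF N_subgroup] by blast
    then show "r \<in> N \<longleftrightarrow> r = r0"
      using rep_mult[OF N_subgroup one_closed, of r] r0 N_carrier by (auto simp: r0_def)
  qed
  have finR: "finite (rep N ` carrier G)" using finite_G by simp
  have r0R: "r0 \<in> rep N ` carrier G" by (simp add: r0_def)
  \<comment> \<open>The augmentation forces the values of \<open>x\<close> on the cosets to add up
    to zero, which determines the value on \<open>N\<close> from those outside.\<close>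
  have "e = (\<Sum>r\<in>rep N ` carrier G. \<Sum>h\<in>N. u (h \<otimes> r))"
    unfolding aug[symmetric] by (rule sum_cosets[OF N_subgroup])
  also have "\<dots> = (\<Sum>r\<in>rep N ` carrier G. ind N r - of_nat 2 * x r)"
    by (intro sum.cong refl)
      (simp only: conv_ind_subgroup[OF N_subgroup u(1) fspace_A_F[OF u(2)] R(1), symmetric] ux_apply)
  also have "\<dots> = (\<Sum>r\<in>rep N ` carrier G. if r = r0 then e else 0) - of_nat 2 * (\<Sum>r\<in>rep N ` carrier G. x r)"
    unfolding sum_subtractf sum_distrib_left using R(2) by (intro arg_cong2[where f = minus] sum.cong refl) (simp add: ind_def)
  also have "(\<Sum>r\<in>rep N ` carrier G. if r = r0 then e else 0) = e" using finR r0R by simp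
  finally have "of_nat p * (\<Sum>r\<in>rep N ` carrier G. x r) = 0" unfolding p2 by simp
  moreover have "(\<Sum>r\<in>rep N ` carrier G. x r) \<in> F"
    by (intro F_sum A_F xAp R(1))
  ultimately have "(\<Sum>r\<in>rep N ` carrier G. x r) = 0"
    by (rule p_cancel_zero[rotated])
  then have "x r0 + (\<Sum>r\<in>rep N ` carrier G - {r0}. x r) = 0"
    using sum.remove[OF finR r0R, of x] by simp
  then have "x r0 = - (\<Sum>r\<in>rep N ` carrier G - {r0}. x r)" by (simp add: eq_neg_iff_add_eq_0)
  also have "\<dots> \<in> nonunits"
    using outside R by (intro nonunits_uminus nonunits_sum) blast
  finally have xr0: "x r0 \<in> nonunits" .
  show ?thesis
  proof (rule fspaceI)
    fix g assume g: "g \<in> carrier G"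
    show "x g \<in> nonunits"
    proof (cases "g \<in> N")
      case True
      have "g = (g \<otimes> inv r0) \<otimes> r0" using N_carrier[OF r0] g by (simp add: m_assoc)
      moreover have "g \<otimes> inv r0 \<in> N" using N_closed True r0 by blast
      ultimately show ?thesis using linv_apply[OF nsub_N xl _ N_carrier[OF r0]] xr0 by metis
    qed (rule outside[OF g])
  qed (rule fspace_outside[OF xA])
qed

text \<open>The difference is \<open>C x\<close> with \<open>x\<close> primitive and
  \<open>C\<close> a multiple of \<open>p\<close>. Since \<open>u^p\<close> fixes
  \<open>ind N\<close>, the sum of all \<open>u^l x\<close> with \<open>l < p\<close> vanishes.
  Expanding in powers of \<open>C\<close> and dividing by \<open>p\<close> puts \<open>x\<close>
  into the maximal ideal for odd \<open>p\<close>, against primitivity.\<close>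

lemma conv_ind_N:
  assumes u: "class_function u" "u \<in> fspace A" and aug: "(\<Sum>g\<in>carrier G. u g) = e"
    and n'N: "n' \<in> N" and u_pow: "\<And>x. x \<in> fspace F \<Longrightarrow> ((\<lambda>y. u \<star> y) ^^ p) x = translate n' x"
  shows "u \<star> ind N = ind N"
proof (rule ccontr)
  assume neq: "u \<star> ind N \<noteq> ind N"
  define d where "d = u \<star> ind N - ind N"
  have NG: "N \<subseteq> carrier G" using N_carrier by blast
  have iN: "ind N \<in> linv N" "ind N \<in> fspace A" by (rule linv_ind[OF nsub_N], rule fspace_ind[OF NG])
  have uF: "u \<in> fspace F" by (rule fspace_A_F[OF u(2)])
  have dA: "d \<in> fspace A" unfolding d_def by (intro fspace_diff fspace_conv u iN)
  have dl: "d \<in> linv N" unfolding d_def by (intro linv_diff linv_class_conv[OF nsub_N u(1) uF] iN)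
  have "d \<noteq> 0" using neq by (simp add: d_def)
  then obtain g0 x where g0: "g0 \<in> carrier G" "d g0 \<noteq> 0" and xA: "x \<in> fspace A" and x0: "x g0 = e"
    and dx: "d = (\<lambda>_. d g0) * x" using primitive_factor[OF linv_F[OF dl]] by blast
  have xF: "x \<in> fspace F" by (rule fspace_A_F[OF xA])
  have dF: "d g0 \<in> F" using fspace_apply[OF linv_F[OF dl] g0(1)] .
  have xl: "x \<in> linv N"
    unfolding linv_def
  proof (intro CollectI conjI ballI xF)
    fix h assume h: "h \<in> N"
    have "(\<lambda>_. d g0) * translate h x = (\<lambda>_. d g0) * x"
      using linv_translate[OF dl h] unfolding translate_scale[symmetric] dx[symmetric] .
    then show "translate h x = x"
      using scale_cancel[OF dF g0(2)] fspace_translate[OF N_carrier[OF h] xF] xF by blast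
  qed
  obtain b where b: "b \<in> fspace A" "x = ind N \<star> b" using linv_ind_conv[OF nsub_N xl xA] .
  obtain c' where c': "c' \<in> A" "d g0 = of_nat p * c'"
    using coset_sum_mod_p[OF u aug g0(1)] unfolding d_def[symmetric] pA_def by blast
  define C where "C = (\<lambda>_::'g. d g0)"
  define C' where "C' = (\<lambda>_::'g. c')"
  have CC': "C = of_nat p * C'"
    unfolding C_def C'_def c'(2) by (intro ext) (simp add: times_fun_apply of_nat_fun_apply)
  have C_conv: "(C * y) \<star> z = C * (y \<star> z)" "z \<star> (C * y) = C * (z \<star> y)" for y z
    unfolding C_def by (rule conv_scale)+
  have C'_A: "C' * y \<in> fspace A" if "y \<in> fspace A" for y
    unfolding C'_def by (rule fspace_scale(2)[OF c'(1) that])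
  have C_cancel: "y = 0" if "C * y = 0" "y \<in> fspace F" for y
    using scale_cancel[OF dF g0(2) that(2) fspace_zero(1)] that(1) unfolding C_def by simp
  have dC: "d = C * x" unfolding C_def by (rule dx)
  have uN: "u \<star> ind N = ind N + C * x" unfolding dC[symmetric] d_def by simp
  have u_step: "u \<star> (ind N \<star> q) = ind N \<star> q + C * (x \<star> q)" for q
    unfolding conv_assoc[symmetric] uN conv_add C_conv ..
  have u_pow_x: "((\<lambda>y. u \<star> y) ^^ j) (ind N) = ind N + C * (\<Sum>l<j. ((\<lambda>y. u \<star> y) ^^ l) x)" for j
  proof (induction j)
    case (Suc j)
    have "((\<lambda>y. u \<star> y) ^^ Suc j) (ind N) = u \<star> ind N + C * (\<Sum>l<j. ((\<lambda>y. u \<star> y) ^^ Suc l) x)"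
      by (simp only: funpow.simps comp_apply Suc conv_add C_conv conv_sum)
    moreover have "(\<Sum>l<Suc j. ((\<lambda>y. u \<star> y) ^^ l) x) = x + (\<Sum>l<j. ((\<lambda>y. u \<star> y) ^^ Suc l) x)"
      by (simp only: sum.lessThan_Suc_shift funpow_0)
    ultimately show ?case by (simp only: uN distrib_left add.assoc)
  next
    case 0
    show ?case by (simp only: funpow_0 lessThan_0 sum.empty mult_zero_right add_0_right)
  qed
  \<comment> \<open>The square and the cube of \<open>x\<close> in the group algebra of
    \<open>G/N\<close>.\<close>
  define y1 where "y1 = x \<star> b"
  define y2 where "y2 = x \<star> (b \<star> b)"
  have y1A: "y1 \<in> fspace A" and y2A: "y2 \<in> fspace A"
    unfolding y1_def y2_def by (intro fspace_conv(2) xA b(1))+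
  have ux: "u \<star> x = x + C * y1" unfolding y1_def by (subst (1 2) b(2)) (rule u_step)
  have uy1: "u \<star> y1 = y1 + C * y2"
    using u_step[of "b \<star> b"] by (simp only: y1_def y2_def b(2) conv_assoc)
  have pow_A: "((\<lambda>y. u \<star> y) ^^ l) x \<in> fspace A" for l
    by (induction l) (simp_all add: xA fspace_conv(2)[OF u(2)])
  have "C * (\<Sum>l<p. ((\<lambda>y. u \<star> y) ^^ l) x) = 0"
    using u_pow_x[of p] u_pow[OF linv_F[OF iN(1)]] linv_translate[OF iN(1) n'N] by simp
  then have sum0: "(\<Sum>l<p. ((\<lambda>y. u \<star> y) ^^ l) x) = 0"
    by (rule C_cancel) (intro fspace_sum fspace_A_F pow_A)
  have expansion: "\<exists>r. r \<in> fspace A \<and> ((\<lambda>y. u \<star> y) ^^ l) x = x + of_nat l * (C * y1) + C * (C * r)" for l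
  proof (induction l)
    case 0
    have "((\<lambda>y. u \<star> y) ^^ 0) x = x + of_nat 0 * (C * y1) + C * (C * 0)" by simp
    then show ?case using fspace_zero(2) by blast
  next
    case (Suc l)
    then obtain r where r: "r \<in> fspace A" "((\<lambda>y. u \<star> y) ^^ l) x = x + of_nat l * (C * y1) + C * (C * r)" by blast
    have "((\<lambda>y. u \<star> y) ^^ Suc l) x = u \<star> x + of_nat l * (C * (u \<star> y1)) + C * (C * (u \<star> r))"
      by (simp only: funpow.simps comp_apply r(2) conv_add conv_of_nat C_conv)
    also have "\<dots> = x + of_nat (Suc l) * (C * y1) + C * (C * (of_nat l * y2 + u \<star> r))"
      unfolding ux uy1 by (simp add: algebra_simps)
    finally show ?case using fspace_add(2)[OF fspace_of_nat(2)[OF y2A] fspace_conv(2)[OF u(2) r(1)]] by blast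
  qed
  show False
  proof (cases "p = 2")
    case True
    have "x + u \<star> x = 0" using sum0 unfolding True by (simp add: numeral_2_eq_2)
    then have "x + (x + C * y1) = 0" unfolding ux .
    then have "of_nat p * x + of_nat p * (C' * y1) = 0" unfolding CC' True by (simp add: algebra_simps)
    then have "of_nat p * x = of_nat p * (- (C' * y1))" by (simp add: eq_neg_iff_add_eq_0)
    then have x_eq: "x = - (C' * y1)"
      using p_cancel_fspace[OF xF fspace_A_F[OF fspace_uminus(2)[OF C'_A[OF y1A]]]] by blast
    \<comment> \<open>The relation \<open>x = - C' y1\<close> says that \<open>- C' x\<close> is its
      own square in the group algebra of \<open>G/N\<close>; it is minus half of
      \<open>u \<star> ind N - ind N\<close>.\<close>
    define f where "f = ind N \<star> (- (C' * b))"
    have bA: "- (C' * b) \<in> fspace A" by (intro fspace_uminus C'_A b(1))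
    have C'_conv: "z \<star> (C' * y) = C' * (z \<star> y)" "(C' * y) \<star> z = C' * (y \<star> z)" for y z
      unfolding C'_def by (rule conv_scale)+
    have fx: "f = - (C' * x)" unfolding f_def conv_uminus C'_conv b(2)[symmetric] ..
    have "f \<star> (- (C' * b)) = C' * (C' * y1)"
      unfolding fx conv_uminus C'_conv y1_def by simp
    also have "C' * y1 = - x" by (subst x_eq) simp
    also have "C' * (- x) = f" unfolding fx by simp
    finally have idem: "f \<star> (- (C' * b)) = f" .
    have "u \<star> ind N = ind N - of_nat 2 * f" unfolding uN fx CC' True by (simp add: algebra_simps)
    from no_idempotent[OF True u aug bA f_def idem this] have "f g0 \<in> nonunits" using fspace_apply g0(1) by blast
    moreover have "f g0 = - c'"
      using x0 F_mult_unit[OF A_F[OF c'(1)]] by (simp add: fx C'_def uminus_apply times_fun_apply)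
    ultimately have "c' \<in> nonunits" using nonunits_uminus[of "- c'"] by simp
    moreover have "e = - (c' * y1 g0)"
      using fun_cong[OF x_eq, of g0] x0 by (simp add: C'_def uminus_apply times_fun_apply)
    ultimately show False
      using nonunits_uminus[OF nonunits_mult[OF _ fspace_apply[OF y1A g0(1)]]] unit_notin_nonunits by metis
  next
    case False
    obtain r where r: "\<And>l. r l \<in> fspace A" "\<And>l. ((\<lambda>y. u \<star> y) ^^ l) x = x + of_nat l * (C * y1) + C * (C * r l)"
      using expansion by metis
    define S where "S = (\<Sum>l<p. r l)"
    have SA: "S \<in> fspace A" unfolding S_def by (intro fspace_sum r(1))
    \<comment> \<open>The linear terms add up to \<open>p (p - 1) / 2\<close> times
      \<open>C y1\<close>, and this factor is divisible by the odd prime \<open>p\<close>.\<close>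
    have gauss: "2 * (\<Sum>l<p. l) = p * (p - 1)"
    proof -
      obtain q where "p = Suc q" using prime_p by (metis not0_implies_Suc not_prime_0)
      then show ?thesis using gauss_sum_nat[of q] by (simp add: atLeast0AtMost lessThan_Suc_atMost)
    qed
    have "p dvd 2 * (\<Sum>l<p. l)" unfolding gauss by simp
    then have "p dvd (\<Sum>l<p. l)"
      using prime_p False by (metis prime_dvd_mult_iff primes_dvd_imp_eq two_is_prime_nat)
    then obtain q where q: "(\<Sum>l<p. l) = p * q" by (elim dvdE)
    have "0 = (\<Sum>l<p. x + of_nat l * (C * y1) + C * (C * r l))"
      using sum0 unfolding r(2) by simp
    also have "\<dots> = of_nat p * x + of_nat (\<Sum>l<p. l) * (C * y1) + C * (C * S)"
      by (simp add: sum.distrib sum_distrib_left sum_distrib_right S_def)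
    also have "\<dots> = of_nat p * (x + of_nat q * (C * y1) + C' * (C * S))"
      unfolding q by (subst (2) CC') (simp add: algebra_simps)
    finally have "of_nat p * (x + of_nat q * (C * y1) + C' * (C * S)) = of_nat p * 0" by simp
    moreover have CA: "C * y \<in> fspace nonunits" if "y \<in> fspace A" for y
      unfolding CC' using fspace_of_nat(3)[OF C'_A[OF that]] by (simp add: mult.assoc)
    moreover have w: "of_nat q * (C * y1) + C' * (C * S) \<in> fspace nonunits"
    proof (rule fspace_add(3))
      have "of_nat q * (C * y1) = C * (of_nat q * y1)" by (simp add: mult.left_commute)
      then show "of_nat q * (C * y1) \<in> fspace nonunits" using CA[OF fspace_of_nat(2)[OF y1A]] by (simp only:)
      have "C' * (C * S) = C * (C' * S)" by (simp add: mult.left_commute)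
      then show "C' * (C * S) \<in> fspace nonunits" using CA[OF C'_A[OF SA]] by (simp only:)
    qed
    ultimately have "x + of_nat q * (C * y1) + C' * (C * S) = 0"
      using p_cancel_fspace[OF _ fspace_zero(1)] fspace_add(1)[OF xF fspace_A_F[OF fspace_nonunits_A[OF w]]]
      by (simp only: add.assoc)
    then have "x = - (of_nat q * (C * y1) + C' * (C * S))" by (simp only: eq_neg_iff_add_eq_0 add.assoc)
    then have "x \<in> fspace nonunits" using fspace_uminus(3)[OF w] by (simp only:)
    then show False using x0 fspace_apply g0(1) unit_notin_nonunits by metis
  qed
qed

section \<open>Central units of p-power order\<close>

lemma class_function_ind_one: "class_function (ind {\<one>})"
proof -
  have "h \<otimes> g \<otimes> inv h = \<one> \<longleftrightarrow> g = \<one>" if "h \<in> carrier G" "g \<in> carrier G" for h g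
  proof
    assume eq: "h \<otimes> g \<otimes> inv h = \<one>"
    have "g = inv h \<otimes> (h \<otimes> g \<otimes> inv h) \<otimes> h" using that by (simp add: m_assoc mult_inv_cancel)
    then show "g = \<one>" unfolding eq using that by simp
  qed (use that in simp)
  then show ?thesis by (auto simp: class_function_def ind_def)
qed

lemma conv_pow_conv: "((\<lambda>y. u \<star> y) ^^ j) x \<star> z = ((\<lambda>y. u \<star> y) ^^ j) (x \<star> z)"
  by (induction j) (simp_all add: conv_assoc)

text \<open>The order enters through convolution powers of the neutral element
  \<open>ind {\<one>}\<close>. The induction on \<open>k\<close> is applied to \<open>u^p\<close>,
  which is again a class function over \<open>A\<close> of augmentation \<open>e\<close>.\<close>

theorem torsion_class_function:
  assumes "class_function u" "u \<in> fspace A" "(\<Sum>g\<in>carrier G. u g) = e"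
    and "((\<lambda>y. u \<star> y) ^^ (p ^ k)) (ind {\<one>}) = ind {\<one>}"
  shows "\<exists>n\<in>N. u = ind {n}"
  using assms
proof (induction k arbitrary: u)
  case 0
  then have "u = ind {\<one>}" using conv_ind_one[OF fspace_A_F[OF 0(2)]] by simp
  then show ?case using N_closed(1) by blast
next
  case (Suc k)
  note u = Suc.prems(1,2) and aug = Suc.prems(3)
  define P where "P x = ((\<lambda>y. u \<star> y) ^^ p) x" for x
  define u1 where "u1 = P (ind {\<one>})"
  have one: "ind {\<one>} \<in> fspace A" by (intro fspace_ind) simp
  have good: "class_function (((\<lambda>y. u \<star> y) ^^ j) (ind {\<one>})) \<and> ((\<lambda>y. u \<star> y) ^^ j) (ind {\<one>}) \<in> fspace A \<and>
      (\<Sum>g\<in>carrier G. ((\<lambda>y. u \<star> y) ^^ j) (ind {\<one>}) g) = e" for j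
  proof (induction j)
    case 0
    have "(\<Sum>g\<in>carrier G. ind {\<one>} g) = e" using finite_G by (simp add: ind_def)
    then show ?case using class_function_ind_one one by simp
  next
    case (Suc j)
    then show ?case
      using class_function_conv[OF u(1)] fspace_conv(2)[OF u(2)] aug
        F_unit_mult[OF F_unit(1)] by (simp add: sum_conv)
  qed
  have one_conv: "ind {\<one>} \<star> x = x" if "x \<in> fspace F" for x
    using ind_singleton_conv[OF one_closed that] translate_one[OF that] by simp
  have u1_conv: "u1 \<star> x = P x" if "x \<in> fspace F" for x
    unfolding u1_def P_def conv_pow_conv one_conv[OF that] ..
  have P_F: "(P ^^ j) (ind {\<one>}) \<in> fspace F" for j
    unfolding P_def using good[of "p * j"] fspace_A_F by (simp add: funpow_mult)
  have "((\<lambda>y. u1 \<star> y) ^^ j) (ind {\<one>}) = (P ^^ j) (ind {\<one>})" for j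
    by (induction j) (simp_all add: u1_conv P_F)
  moreover have "(P ^^ (p ^ k)) (ind {\<one>}) = ind {\<one>}"
    using Suc.prems(4) unfolding P_def by (simp add: funpow_mult)
  ultimately have "\<exists>n\<in>N. u1 = ind {n}"
    using Suc.IH[of u1] good[of p] unfolding u1_def P_def by simp
  then obtain n' where n': "n' \<in> N" "u1 = ind {n'}" by blast
  have u_pow: "((\<lambda>y. u \<star> y) ^^ p) x = translate n' x" if "x \<in> fspace F" for x
    using u1_conv[OF that] ind_singleton_conv[OF N_carrier[OF n'(1)] that] n'(2) by (simp add: P_def)
  have "u \<star> ind N = ind N" by (rule conv_ind_N[OF u Suc.prems(3) n'(1) u_pow])
  then have top: "\<exists>n\<in>N. u \<star> ind N = translate n (ind N)"
    using translate_one[OF fspace_ind[OF subgroup.subset[OF N_subgroup]]] N_closed(1) by metis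
  have "(\<exists>n\<in>N. u \<star> ind N = translate n (ind N)) \<longrightarrow> (\<exists>n\<in>N. u = ind {n})"
  proof (rule p_group_induct[where P = "\<lambda>H. (\<exists>n\<in>N. u \<star> ind H = translate n (ind H)) \<longrightarrow> (\<exists>n\<in>N. u = ind {n})"])
    show "(\<exists>n\<in>N. u \<star> ind {\<one>} = translate n (ind {\<one>})) \<longrightarrow> (\<exists>n\<in>N. u = ind {n})"
      using conv_ind_one[OF fspace_A_F[OF u(2)]] translate_ind[of _ "{\<one>}"] N_carrier by auto
  next
    fix H m assume step: "central_step H m"
      and IH: "(\<exists>n\<in>N. u \<star> ind H = translate n (ind H)) \<longrightarrow> (\<exists>n\<in>N. u = ind {n})"
    show "(\<exists>n\<in>N. u \<star> ind (extend H m) = translate n (ind (extend H m))) \<longrightarrow> (\<exists>n\<in>N. u = ind {n})"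
    proof
      assume "\<exists>n\<in>N. u \<star> ind (extend H m) = translate n (ind (extend H m))"
      then obtain n where n: "n \<in> N" "u \<star> ind (extend H m) = translate n (ind (extend H m))" by blast
      interpret lifting_step F e A p G N a H m u n n'
        by unfold_locales (fact step u n n' u_pow)+
      show "\<exists>n\<in>N. u = ind {n}" using lift_step IH by blast
    qed
  qed
  then show ?case using top by blast
qed

end

section \<open>The group ring over a p-adic ring\<close>

context group_functions
begin

lemma conv_ind_right:
  assumes "h \<in> carrier G" "g \<in> carrier G" "x \<in> fspace F"
  shows "(x \<star> ind {h}) g = x (g \<otimes> inv h)"
proof -
  have "(x \<star> ind {h}) g = (\<Sum>y\<in>carrier G. if y = g \<otimes> inv h then x y else 0)"
    unfolding conv_apply[OF assms(2)]
  proof (rule sum.cong[OF refl])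
    fix y assume y: "y \<in> carrier G"
    have "inv y \<otimes> g = h \<longleftrightarrow> y = g \<otimes> inv h"
      using assms(1,2) y by (metis inv_solve_left' inv_solve_right)
    then show "x y * ind {h} (inv y \<otimes> g) = (if y = g \<otimes> inv h then x y else 0)"
      using F_mult_unit[OF fspace_apply[OF assms(3) y]] by (auto simp: ind_def)
  qed
  also have "\<dots> = x (g \<otimes> inv h)" using assms finite_G by simp
  finally show ?thesis .
qed

lemma class_functionI:
  assumes x: "x \<in> fspace F" and c: "\<And>h. h \<in> carrier G \<Longrightarrow> x \<star> ind {h} = ind {h} \<star> x"
  shows "class_function x"
  unfolding class_function_def
proof (intro ballI)
  fix h g assume h: "h \<in> carrier G" and g: "g \<in> carrier G"
  have "(x \<star> ind {h}) (h \<otimes> g) = (ind {h} \<star> x) (h \<otimes> g)" by (simp only: c[OF h])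
  then show "x (h \<otimes> g \<otimes> inv h) = x g"
    using conv_ind_right[OF h _ x] ind_singleton_conv[OF h x] h g
    by (simp add: translate_apply mult_inv_cancel)
qed

end

section \<open>The integral closure of the p-adic integers inside the embedded field\<close>

context
  fixes p :: nat and K :: "'r ring" and g :: "(nat \<Rightarrow> rat) \<Rightarrow> 'r"
  assumes p: "Factorial_Ring.prime p" and K: "field K" and g: "g \<in> ring_hom (padic_Cauchy_ring p) K"
begin

interpretation K: field K by (rule K)
interpretation U: unital_field_set "embed K ` carrier K" "embed K \<one>\<^bsub>K\<^esub>"
  by (rule field_embed[OF K])

lemmas CK = K.is_cring

lemma g_hom:
  assumes "padic_Cauchy p s" "padic_Cauchy p t"
  shows "g s \<in> carrier K" "g (\<lambda>n. s n + t n) = g s \<oplus>\<^bsub>K\<^esub> g t" "g (\<lambda>n. s n * t n) = g s \<otimes>\<^bsub>K\<^esub> g t"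
    "g (\<lambda>n. 1) = \<one>\<^bsub>K\<^esub>"
  using g assms ring_hom_memE[OF g] by (auto simp: padic_Cauchy_ring_def)

lemma g_carrier: "padic_Cauchy p s \<Longrightarrow> g s \<in> carrier K"
  using g_hom(1) by blast

lemma g_sequences_carrier: "g ` integral_sequences p \<subseteq> carrier K"
  using g_carrier by (auto simp: integral_sequences_def)

lemma embed_const: "embed K (g (\<lambda>_. of_nat i)) = of_nat i * embed K \<one>\<^bsub>K\<^esub>"
proof (induction i)
  case 0
  have "g (\<lambda>_. 0 + 0) = g (\<lambda>_. 0) \<oplus>\<^bsub>K\<^esub> g (\<lambda>_. 0)"
    by (intro g_hom padic_Cauchy_const[OF p])
  then have "g (\<lambda>_. 0) = \<zero>\<^bsub>K\<^esub>"
    using g_hom(1)[OF padic_Cauchy_const[OF p, of 0] padic_Cauchy_const[OF p, of 0]]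
    by (simp add: K.add.l_cancel_one)
  then show ?case using embed_zero[OF CK] by simp
next
  case (Suc i)
  have "g (\<lambda>_. 1 + of_nat i) = g (\<lambda>_. 1) \<oplus>\<^bsub>K\<^esub> g (\<lambda>_. of_nat i)"
    by (intro g_hom padic_Cauchy_const[OF p])
  then show ?case
    using Suc embed_add[OF CK] g_hom(1,4)[OF padic_Cauchy_const[OF p] padic_Cauchy_const[OF p]]
    by (simp add: distrib_right)
qed

lemma integral_sequences_subring: "U.is_subring (embed K ` g ` integral_sequences p)"
proof -
  have sE: "padic_Cauchy p s" "padic_abs p (s n) \<le> 1" if "s \<in> integral_sequences p" for s n
    using that by (simp_all add: integral_sequences_def)
  have const: "(\<lambda>_. c) \<in> integral_sequences p" if "padic_abs p c \<le> 1" for c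
    using that padic_Cauchy_const[OF p] by (simp add: integral_sequences_def)
  have add: "(\<lambda>n. s n + t n) \<in> integral_sequences p"
    if "s \<in> integral_sequences p" "t \<in> integral_sequences p" for s t
    unfolding integral_sequences_def
    by (intro CollectI conjI allI padic_Cauchy_add[OF p] padic_abs_add_le[OF p] sE that)
  have mult: "(\<lambda>n. s n * t n) \<in> integral_sequences p"
    if st: "s \<in> integral_sequences p" "t \<in> integral_sequences p" for s t
  proof -
    have "padic_abs p (s n * t n) \<le> 1" for n
      using mult_mono[OF sE(2)[OF st(1), of n] sE(2)[OF st(2), of n] zero_le_one padic_abs_nonneg[OF p]]
      by (simp only: padic_abs_mult[OF p] mult_1_left)
    then show ?thesis
      using padic_Cauchy_mult[OF p sE(1)[OF st(1)] sE(1)[OF st(2)]] by (simp add: integral_sequences_def)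
  qed
  have m1: "(\<lambda>_. - 1) \<in> integral_sequences p"
    by (rule const) (simp add: padic_abs_uminus[OF p] padic_abs_one[OF p])
  have one: "(\<lambda>_. 1) \<in> integral_sequences p" by (rule const) (simp add: padic_abs_one[OF p])
  have zero: "(\<lambda>_. 0) \<in> integral_sequences p" by (rule const) (simp add: padic_abs_zero[OF p])
  define \<gamma> where "\<gamma> s = embed K (g s)" for s
  have \<gamma>_add: "\<gamma> (\<lambda>n. s n + t n) = \<gamma> s + \<gamma> t" and \<gamma>_mult: "\<gamma> (\<lambda>n. s n * t n) = \<gamma> s * \<gamma> t"
    if "s \<in> integral_sequences p" "t \<in> integral_sequences p" for s t
    using g_hom(1-3)[OF sE(1) sE(1)] that embed_add[OF CK] embed_mult[OF CK] by (simp_all add: \<gamma>_def)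
  have \<gamma>0: "\<gamma> (\<lambda>_. 0) = 0" using embed_const[of 0] by (simp add: \<gamma>_def)
  have \<gamma>_minus: "\<gamma> (\<lambda>n. (- 1) * s n) = - \<gamma> s" if s: "s \<in> integral_sequences p" for s
  proof -
    have "\<gamma> (\<lambda>n. s n + (- 1) * s n) = \<gamma> s + \<gamma> (\<lambda>n. (- 1) * s n)"
      by (rule \<gamma>_add[OF s mult[OF m1 s]])
    then show ?thesis using \<gamma>0 by (simp add: eq_neg_iff_add_eq_0 add.commute)
  qed
  have img: "embed K ` g ` integral_sequences p = \<gamma> ` integral_sequences p" by (auto simp: \<gamma>_def)
  show ?thesis
    unfolding img U.is_subring_def
  proof (intro conjI ballI)
    show "\<gamma> ` integral_sequences p \<subseteq> embed K ` carrier K" using g_sequences_carrier by (auto simp: \<gamma>_def)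
    show "0 \<in> \<gamma> ` integral_sequences p" using zero \<gamma>0 by (metis imageI)
    show "embed K \<one>\<^bsub>K\<^esub> \<in> \<gamma> ` integral_sequences p"
      using one embed_const[of 1] by (intro image_eqI[of _ _ "\<lambda>_. 1"]) (simp_all add: \<gamma>_def)
    fix x assume "x \<in> \<gamma> ` integral_sequences p"
    then obtain s where s: "s \<in> integral_sequences p" "x = \<gamma> s" by blast
    show "- x \<in> \<gamma> ` integral_sequences p" using \<gamma>_minus[OF s(1)] mult[OF m1 s(1)] s(2) by (metis imageI)
    fix y assume "y \<in> \<gamma> ` integral_sequences p"
    then obtain t where t: "t \<in> integral_sequences p" "y = \<gamma> t" by blast
    show "x + y \<in> \<gamma> ` integral_sequences p" using \<gamma>_add[OF s(1) t(1)] add[OF s(1) t(1)] s(2) t(2) by (metis imageI)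
    show "x * y \<in> \<gamma> ` integral_sequences p" using \<gamma>_mult[OF s(1) t(1)] mult[OF s(1) t(1)] s(2) t(2) by (metis imageI)
  qed
qed

text \<open>The constant sequence \<open>p\<close> has an inverse among Cauchy sequences of
  rationals, and \<open>g\<close> preserves products and the unit.\<close>

lemma p_unit_nonzero: "of_nat p * embed K \<one>\<^bsub>K\<^esub> \<noteq> 0"
proof
  assume z: "of_nat p * embed K \<one>\<^bsub>K\<^esub> = 0"
  have "p \<noteq> 0" using p by (metis not_prime_0)
  have "g (\<lambda>_. of_nat p * inverse (of_nat p)) = g (\<lambda>_. of_nat p) \<otimes>\<^bsub>K\<^esub> g (\<lambda>_. inverse (of_nat p))"
    by (intro g_hom padic_Cauchy_const[OF p])
  then have "embed K (g (\<lambda>_. 1)) = embed K (g (\<lambda>_. of_nat p)) * embed K (g (\<lambda>_. inverse (of_nat p)))"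
    using \<open>p \<noteq> 0\<close> embed_mult[OF CK] g_hom(1)[OF padic_Cauchy_const[OF p] padic_Cauchy_const[OF p]] by simp
  then have "embed K \<one>\<^bsub>K\<^esub> = 0"
    using z embed_const[of p] embed_const[of 1] by simp
  then show False using U.F_unit(2) by simp
qed

text \<open>An inverse \<open>z = g s\<close> of \<open>p\<close> would make \<open>g\<close> vanish
  on \<open>1 - p s\<close>, which is an invertible Cauchy sequence.\<close>

lemma p_inverse_not_integral:
  assumes z: "z \<in> embed K ` g ` integral_sequences p"
  shows "of_nat p * z \<noteq> embed K \<one>\<^bsub>K\<^esub>"
proof
  assume eq: "of_nat p * z = embed K \<one>\<^bsub>K\<^esub>"
  obtain s where s: "s \<in> integral_sequences p" "z = embed K (g s)" using z by blast
  have sC: "padic_Cauchy p s" using s(1) by (simp add: integral_sequences_def)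
  note cc = padic_Cauchy_const[OF p]
  define w where "w n = 1 - of_nat p * s n" for n
  have w: "padic_Cauchy p w"
    using padic_Cauchy_add[OF p cc[of 1] padic_Cauchy_mult[OF p cc[of "- of_nat p"] sC]] by (simp add: w_def[abs_def])
  have wi: "padic_Cauchy p (\<lambda>n. inverse (w n))" and w0: "w n \<noteq> 0" for n
    using one_minus_p_invertible[OF p s(1)] by (simp_all add: w_def)
  have ps: "padic_Cauchy p (\<lambda>n. of_nat p * s n)" by (rule padic_Cauchy_mult[OF p cc sC])
  have "g (\<lambda>n. w n + of_nat p * s n) = g w \<oplus>\<^bsub>K\<^esub> g (\<lambda>n. of_nat p * s n)" by (rule g_hom[OF w ps])
  moreover have "g (\<lambda>n. of_nat p * s n) = g (\<lambda>_. of_nat p) \<otimes>\<^bsub>K\<^esub> g s" by (rule g_hom[OF cc sC])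
  ultimately have "embed K (g (\<lambda>n. 1)) = embed K (g w) + embed K (g (\<lambda>_. of_nat p)) * embed K (g s)"
    using embed_add[OF CK] embed_mult[OF CK] g_hom(1)[OF w w] g_hom(1)[OF cc cc] g_hom(1)[OF sC sC]
    by (simp add: w_def)
  also have "embed K (g (\<lambda>_. of_nat p)) * embed K (g s) = of_nat p * z"
    using U.F_unit_mult[of z] g_hom(1)[OF sC sC] unfolding embed_const s(2) by (simp add: mult.assoc)
  finally have gw: "embed K (g w) = 0" using eq embed_const[of 1] by simp
  have "g (\<lambda>n. w n * inverse (w n)) = g w \<otimes>\<^bsub>K\<^esub> g (\<lambda>n. inverse (w n))" by (rule g_hom[OF w wi])
  then have "embed K (g (\<lambda>n. 1)) = embed K (g w) * embed K (g (\<lambda>n. inverse (w n)))"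
    using embed_mult[OF CK] g_hom(1)[OF w w] g_hom(1)[OF wi wi] w0 by simp
  then have "embed K \<one>\<^bsub>K\<^esub> = 0" using gw embed_const[of 1] by simp
  then show False using U.F_unit(2) by simp
qed

text \<open>Polynomials are lists with the leading coefficient at the head, hence the reversal in
  the sum.\<close>

lemma embed_eval:
  assumes l: "set l \<subseteq> B" and B: "B \<subseteq> carrier K" and x: "x \<in> carrier K"
  shows "K.eval l x \<in> carrier K \<and>
    embed K (K.eval l x) = (\<Sum>i<length l. embed K (rev l ! i) * embed K x ^ i)"
  using l
proof (induction l)
  case Nil
  then show ?case using embed_zero[OF CK] by simp
next
  case (Cons a l)
  have a: "a \<in> carrier K" using Cons.prems B by auto
  have IH: "K.eval l x \<in> carrier K" "embed K (K.eval l x) = (\<Sum>i<length l. embed K (rev l ! i) * embed K x ^ i)"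
    using Cons by simp_all
  have pow: "embed K (b \<otimes>\<^bsub>K\<^esub> x [^]\<^bsub>K\<^esub> i) = embed K b * embed K x ^ i" if "b \<in> carrier K" for b and i :: nat
  proof (induction i)
    case (Suc i)
    have "embed K (b \<otimes>\<^bsub>K\<^esub> x [^]\<^bsub>K\<^esub> Suc i) = embed K ((b \<otimes>\<^bsub>K\<^esub> x [^]\<^bsub>K\<^esub> i) \<otimes>\<^bsub>K\<^esub> x)"
      using that x by (simp add: K.m_assoc)
    then show ?case using Suc embed_mult[OF CK, of "b \<otimes>\<^bsub>K\<^esub> x [^]\<^bsub>K\<^esub> i" x] that x by (simp add: ac_simps)
  qed (use that in simp)
  have "embed K (K.eval (a # l) x) = embed K a * embed K x ^ length l + embed K (K.eval l x)"
    using embed_add[OF CK, of "a \<otimes>\<^bsub>K\<^esub> x [^]\<^bsub>K\<^esub> length l" "K.eval l x"] a x IH(1) pow[OF a] by simp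
  also have "\<dots> = (\<Sum>i<length (a # l). embed K (rev (a # l) ! i) * embed K x ^ i)"
    unfolding IH(2) by (simp add: nth_append)
  finally show ?case using a x IH(1) by simp
qed

text \<open>Monic polynomials in the list representation are lists with head \<open>\<one>\<close>.\<close>

lemma integral_closure_iff:
  defines "Z \<equiv> g ` integral_sequences p"
  shows "x \<in> integral_closure K Z \<longleftrightarrow> x \<in> carrier K \<and> U.integral (embed K ` Z) (embed K x)"
proof -
  have ZK: "Z \<subseteq> carrier K" unfolding Z_def by (rule g_sequences_carrier)
  have Zr: "U.is_subring (embed K ` Z)" unfolding Z_def by (rule integral_sequences_subring)
  have inj: "a \<in> Z" if a: "a \<in> carrier K" "embed K a \<in> embed K ` Z" for a
  proof -
    obtain b where "b \<in> Z" "embed K a = embed K b" using a(2) by blast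
    then show ?thesis using embed_eq_iff[OF CK a(1), of b] ZK by auto
  qed
  have one: "\<one>\<^bsub>K\<^esub> \<in> Z" using inj[OF K.one_closed] U.is_subringD(3)[OF Zr] by blast
  have monic: "K.eval (\<one>\<^bsub>K\<^esub> # l) x = \<zero>\<^bsub>K\<^esub> \<longleftrightarrow>
      embed K \<one>\<^bsub>K\<^esub> * embed K x ^ length l = - (\<Sum>i<length l. embed K (rev l ! i) * embed K x ^ i)"
    if l: "set l \<subseteq> Z" and x: "x \<in> carrier K" for l
  proof -
    have l1: "set (\<one>\<^bsub>K\<^esub> # l) \<subseteq> Z" using l one by simp
    have "K.eval (\<one>\<^bsub>K\<^esub> # l) x = \<zero>\<^bsub>K\<^esub> \<longleftrightarrow> embed K (K.eval (\<one>\<^bsub>K\<^esub> # l) x) = 0"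
      using embed_eval[OF l1 ZK x] embed_eq_iff[OF CK _ K.zero_closed] embed_zero[OF CK] by metis
    also have "\<dots> \<longleftrightarrow> embed K \<one>\<^bsub>K\<^esub> * embed K x ^ length l + (\<Sum>i<length l. embed K (rev l ! i) * embed K x ^ i) = 0"
      using embed_eval[OF l1 ZK x] by (simp add: nth_append add.commute)
    finally show ?thesis by (simp only: eq_neg_iff_add_eq_0)
  qed
  show ?thesis
  proof
    assume "x \<in> integral_closure K Z"
    then obtain f where x: "x \<in> carrier K" and f: "f \<in> carrier (Z[X]\<^bsub>K\<^esub>)" "f \<noteq> []" "hd f = \<one>\<^bsub>K\<^esub>" "K.eval f x = \<zero>\<^bsub>K\<^esub>"
      unfolding integral_closure_def by blast
    obtain l where fl: "f = \<one>\<^bsub>K\<^esub> # l" using f(2,3) by (cases f) auto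
    have l: "set l \<subseteq> Z" using f(1) unfolding fl univ_poly_def polynomial_def by auto
    have "embed K (rev l ! i) \<in> embed K ` Z" if "i < length l" for i
      using l nth_mem[of i "rev l"] that by auto
    then have "(\<Sum>i<length l. embed K (rev l ! i) * embed K x ^ i) \<in> U.span (embed K ` Z) (embed K x) (length l)"
      using x by (intro U.span_sum[OF Zr] U.span_term[OF Zr]) simp_all
    from U.span_uminus[OF Zr _ this] x
    have "embed K \<one>\<^bsub>K\<^esub> * embed K x ^ length l \<in> U.span (embed K ` Z) (embed K x) (length l)"
      using monic[OF l x] f(4) unfolding fl by simp
    then show "x \<in> carrier K \<and> U.integral (embed K ` Z) (embed K x)" using x unfolding U.integral_def by blast
  next
    assume r: "x \<in> carrier K \<and> U.integral (embed K ` Z) (embed K x)"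
    then obtain n where "embed K \<one>\<^bsub>K\<^esub> * embed K x ^ n \<in> U.span (embed K ` Z) (embed K x) n"
      unfolding U.integral_def by blast
    then obtain b where b: "\<forall>i. b i \<in> embed K ` Z"
      "embed K \<one>\<^bsub>K\<^esub> * embed K x ^ n = (\<Sum>i<n. b i * embed K x ^ i)" unfolding U.span_def by blast
    have "\<forall>i. \<exists>c\<in>Z. - b i = embed K c" using b(1) U.is_subringD(4)[OF Zr] by blast
    then obtain c where c: "\<And>i. c i \<in> Z" "\<And>i. - b i = embed K (c i)" by metis
    define l where "l = rev (map c [0..<n])"
    have l: "set l \<subseteq> Z" "length l = n" using c(1) by (auto simp: l_def)
    have "(\<Sum>i<n. embed K (rev l ! i) * embed K x ^ i) = (\<Sum>i<n. - b i * embed K x ^ i)"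
      by (intro sum.cong refl) (simp add: l_def c(2))
    also have "\<dots> = - (\<Sum>i<n. b i * embed K x ^ i)" by (simp add: sum_negf)
    finally have "K.eval (\<one>\<^bsub>K\<^esub> # l) x = \<zero>\<^bsub>K\<^esub>" using monic[OF l(1)] r b(2) l(2) by simp
    moreover have "\<one>\<^bsub>K\<^esub> # l \<in> carrier (Z[X]\<^bsub>K\<^esub>)"
      using l(1) one K.one_not_zero by (simp add: univ_poly_def polynomial_def)
    ultimately show "x \<in> integral_closure K Z"
      using r unfolding integral_closure_def by (intro CollectI conjI bexI[of _ "\<one>\<^bsub>K\<^esub> # l"]) simp_all
  qed
qed

text \<open>Membership is tested in all valuation rings above \<open>Z\<close>, which are closed
  under the operations; no equations for sums or products are constructed.\<close>

lemma integral_closure_subring: "subring (integral_closure K (g ` integral_sequences p)) K"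
proof -
  define Z where "Z = g ` integral_sequences p"
  have Zr: "U.is_subring (embed K ` Z)" unfolding Z_def by (rule integral_sequences_subring)
  have iff: "x \<in> integral_closure K Z \<longleftrightarrow>
      x \<in> carrier K \<and> (\<forall>A. U.valuation_ring A \<longrightarrow> embed K ` Z \<subseteq> A \<longrightarrow> embed K x \<in> A)" for x
    unfolding Z_def integral_closure_iff using U.integral_iff[OF Zr, of "embed K x"] by (auto simp: Z_def)
  have sub: "U.is_subring A" if "U.valuation_ring A" for A using that by (simp add: U.valuation_ring_def)
  show ?thesis
    unfolding Z_def[symmetric]
  proof (rule K.subringI)
    show "integral_closure K Z \<subseteq> carrier K" using iff by blast
    show "\<one>\<^bsub>K\<^esub> \<in> integral_closure K Z" unfolding iff using U.is_subringD(3)[OF sub] by simp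
    fix a assume a: "a \<in> integral_closure K Z"
    then show "\<ominus>\<^bsub>K\<^esub> a \<in> integral_closure K Z"
      unfolding iff using U.is_subringD(4)[OF sub] by (simp add: embed_uminus[OF CK])
    fix b assume b: "b \<in> integral_closure K Z"
    show "a \<otimes>\<^bsub>K\<^esub> b \<in> integral_closure K Z"
      using a b unfolding iff using U.is_subringD(6)[OF sub] by (simp add: embed_mult[OF CK])
    show "a \<oplus>\<^bsub>K\<^esub> b \<in> integral_closure K Z"
      using a b unfolding iff using U.is_subringD(5)[OF sub] by (simp add: embed_add[OF CK])
  qed
qed

text \<open>Chevalley's theorem is applied to \<open>p\<close> and its inverse \<open>q\<close> in
  the field; omitting \<open>q\<close> is what makes \<open>p\<close> a nonunit.\<close>

lemma exists_padic_valuation_ring: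
  obtains A where "padic_valuation_ring (embed K ` carrier K) (embed K \<one>\<^bsub>K\<^esub>) A p"
    "\<And>x. x \<in> integral_closure K (g ` integral_sequences p) \<Longrightarrow> embed K x \<in> A"
proof -
  define Z where "Z = g ` integral_sequences p"
  have Zr: "U.is_subring (embed K ` Z)" unfolding Z_def by (rule integral_sequences_subring)
  have pK: "of_nat p * embed K \<one>\<^bsub>K\<^esub> \<in> embed K ` carrier K"
    unfolding embed_const[symmetric] using g_hom(1)[OF padic_Cauchy_const[OF p] padic_Cauchy_const[OF p]] by blast
  have pZ: "of_nat p * embed K \<one>\<^bsub>K\<^esub> \<in> embed K ` Z"
    unfolding embed_const[symmetric] Z_def
    using padic_abs_p[OF p] padic_Cauchy_const[OF p] by (intro imageI) (simp add: integral_sequences_def)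
  obtain q where q: "q \<in> embed K ` carrier K" "(of_nat p * embed K \<one>\<^bsub>K\<^esub>) * q = embed K \<one>\<^bsub>K\<^esub>"
    using U.F_inverse[OF pK p_unit_nonzero] by blast
  have pq: "of_nat p * z = (of_nat p * embed K \<one>\<^bsub>K\<^esub>) * z" if "z \<in> embed K ` carrier K" for z
    using U.F_unit_mult[OF that] by (simp add: mult.assoc)
  have "q \<notin> embed K ` Z" using p_inverse_not_integral[of q] pq[OF q(1)] q(2) unfolding Z_def by metis
  then obtain A where A: "U.valuation_ring A" "embed K ` Z \<subseteq> A" "q \<notin> A"
    using U.exists_valuation_ring[OF Zr pZ q] by blast
  have Ar: "U.is_subring A" using A(1) by (simp add: U.valuation_ring_def)
  have "padic_valuation_ring (embed K ` carrier K) (embed K \<one>\<^bsub>K\<^esub>) A p"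
  proof unfold_locales
    show "U.is_subring A" by (rule Ar)
    show "x \<in> A \<or> y \<in> A" if "x \<in> embed K ` carrier K" "y \<in> embed K ` carrier K" "x * y = embed K \<one>\<^bsub>K\<^esub>" for x y
      using A(1) that unfolding U.valuation_ring_def by blast
    show "Factorial_Ring.prime p" by (rule p)
    show "of_nat p * embed K \<one>\<^bsub>K\<^esub> \<noteq> 0" by (rule p_unit_nonzero)
    fix a assume a: "a \<in> A"
    have aF: "a \<in> embed K ` carrier K" using U.is_subringD(1)[OF Ar] a by blast
    show "of_nat p * a \<noteq> embed K \<one>\<^bsub>K\<^esub>"
    proof
      assume "of_nat p * a = embed K \<one>\<^bsub>K\<^esub>"
      then have "(of_nat p * embed K \<one>\<^bsub>K\<^esub>) * a = (of_nat p * embed K \<one>\<^bsub>K\<^esub>) * q" using pq[OF aF] q(2) by simp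
      then have "a = q" using U.F_mult_cancel[OF pK aF q(1) p_unit_nonzero] by blast
      then show False using a A(3) by simp
    qed
  qed
  moreover have "embed K x \<in> A" if "x \<in> integral_closure K Z" for x
    using that U.integral_iff[OF Zr, of "embed K x"] A(1,2) integral_closure_iff[of x] by (auto simp: Z_def)
  ultimately show ?thesis using that unfolding Z_def by blast
qed

end

section \<open>The group ring as a subring of the space of functions\<close>

locale embedded_group_ring =
  group_functions "embed K ` carrier K" "embed K \<one>\<^bsub>K\<^esub>" A p G
  for K :: "'r ring" and A p and G :: "('g, 'm) monoid_scheme" (structure) +
  fixes B :: "'r set"
  assumes cring_K: "cring K" and subring_B: "subring B K"
    and B_A: "b \<in> B \<Longrightarrow> embed K b \<in> A"
begin

abbreviation R where "R \<equiv> K\<lparr>carrier := B\<rparr>"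
abbreviation RG where "RG \<equiv> group_ring R G"
abbreviation V where "V \<equiv> normalized_units R G"

text \<open>The passage from record-based group ring elements to type class valued functions. It is
  injective and multiplicative, so the laws of the group ring are pulled back along it.\<close>

definition emb :: "('g \<Rightarrow> 'r) \<Rightarrow> 'g \<Rightarrow> 'r ring_family" where
  "emb x = (\<lambda>g. if g \<in> carrier G then embed K (x g) else 0)"

lemma B_K: "b \<in> B \<Longrightarrow> b \<in> carrier K"
  using subringE(1)[OF subring_B] by blast

lemma RG_apply: "x \<in> carrier RG \<Longrightarrow> g \<in> carrier G \<Longrightarrow> x g \<in> B"
  by (auto simp: group_ring_def)

lemma emb_fspace: "x \<in> carrier RG \<Longrightarrow> emb x \<in> fspace A"
  using RG_apply B_A by (intro fspaceI) (simp_all add: emb_def)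

lemma emb_inj:
  assumes x: "x \<in> carrier RG" and y: "y \<in> carrier RG" and eq: "emb x = emb y"
  shows "x = y"
proof (rule PiE_ext)
  show "x \<in> carrier G \<rightarrow>\<^sub>E B" "y \<in> carrier G \<rightarrow>\<^sub>E B" using x y by (simp_all add: group_ring_def)
  fix g assume g: "g \<in> carrier G"
  have "embed K (x g) = embed K (y g)" using fun_cong[OF eq, of g] g by (simp add: emb_def)
  then show "x g = y g"
    using embed_eq_iff[OF cring_K B_K B_K] RG_apply[OF x g] RG_apply[OF y g] by blast
qed

lemma conv_term:
  assumes "x \<in> carrier RG" "y \<in> carrier RG" "g \<in> carrier G" "h \<in> carrier G"
  shows "x h \<otimes>\<^bsub>K\<^esub> y (inv h \<otimes> g) \<in> B"
    "embed K (x h \<otimes>\<^bsub>K\<^esub> y (inv h \<otimes> g)) = emb x h * emb y (inv h \<otimes> g)"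
proof -
  have *: "x h \<in> B" "y (inv h \<otimes> g) \<in> B"
    by (rule RG_apply[OF assms(1,4)], rule RG_apply[OF assms(2) m_closed[OF inv_closed[OF assms(4)] assms(3)]])
  then show "x h \<otimes>\<^bsub>K\<^esub> y (inv h \<otimes> g) \<in> B" by (rule subringE(6)[OF subring_B])
  show "embed K (x h \<otimes>\<^bsub>K\<^esub> y (inv h \<otimes> g)) = emb x h * emb y (inv h \<otimes> g)"
    using embed_mult[OF cring_K B_K[OF *(1)] B_K[OF *(2)]] assms(3,4) by (simp only: emb_def m_closed inv_closed if_True)
qed

lemma RG_mult_apply:
  assumes "g \<in> carrier G"
  shows "(x \<otimes>\<^bsub>RG\<^esub> y) g = finsum R (\<lambda>h. x h \<otimes>\<^bsub>K\<^esub> y (inv h \<otimes> g)) (carrier G)"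
  using assms by (simp add: group_ring_def)

lemma RG_mult_sum:
  assumes x: "x \<in> carrier RG" and y: "y \<in> carrier RG" and g: "g \<in> carrier G"
  shows "(x \<otimes>\<^bsub>RG\<^esub> y) g \<in> B" "embed K ((x \<otimes>\<^bsub>RG\<^esub> y) g) = (emb x \<star> emb y) g"
proof -
  define f where "f h = x h \<otimes>\<^bsub>K\<^esub> y (inv h \<otimes> g)" for h
  have "f h \<in> B" if "h \<in> carrier G" for h unfolding f_def by (rule conv_term(1)[OF x y g that])
  then have "finsum R f (carrier G) \<in> B \<and> embed K (finsum R f (carrier G)) = (\<Sum>h\<in>carrier G. embed K (f h))"
    by (rule embed_sum[OF cring_K subring_B finite_G])
  then have s: "finsum R f (carrier G) \<in> B" "embed K (finsum R f (carrier G)) = (\<Sum>h\<in>carrier G. embed K (f h))"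
    by simp_all
  have m: "(x \<otimes>\<^bsub>RG\<^esub> y) g = finsum R f (carrier G)" unfolding RG_mult_apply[OF g] f_def ..
  show "(x \<otimes>\<^bsub>RG\<^esub> y) g \<in> B" unfolding m by (rule s(1))
  show "embed K ((x \<otimes>\<^bsub>RG\<^esub> y) g) = (emb x \<star> emb y) g"
    unfolding m s(2) conv_apply[OF g] f_def by (intro sum.cong refl conv_term(2)[OF x y g])
qed

lemma RG_mult_closed:
  assumes "x \<in> carrier RG" "y \<in> carrier RG"
  shows "x \<otimes>\<^bsub>RG\<^esub> y \<in> carrier RG"
proof -
  have "(x \<otimes>\<^bsub>RG\<^esub> y) g \<in> B" if "g \<in> carrier G" for g
    by (rule RG_mult_sum(1)[OF assms that])
  then show ?thesis by (auto simp: group_ring_def)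
qed

lemma emb_mult:
  assumes "x \<in> carrier RG" "y \<in> carrier RG"
  shows "emb (x \<otimes>\<^bsub>RG\<^esub> y) = emb x \<star> emb y"
proof
  fix g show "emb (x \<otimes>\<^bsub>RG\<^esub> y) g = (emb x \<star> emb y) g"
  proof (cases "g \<in> carrier G")
    case True
    then show ?thesis using RG_mult_sum(2)[OF assms True] by (simp add: emb_def)
  qed (simp add: emb_def conv_def)
qed

lemma zero_B: "\<zero>\<^bsub>K\<^esub> \<in> B" and one_B: "\<one>\<^bsub>K\<^esub> \<in> B"
  using subringE(2,3)[OF subring_B] by simp_all

lemma group_ring_of_carrier: "group_ring_of R G h \<in> carrier RG"
  using zero_B one_B by (auto simp: group_ring_def group_ring_of_def)

lemma emb_group_ring_of: "h \<in> carrier G \<Longrightarrow> emb (group_ring_of R G h) = ind {h}"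
  using embed_zero[OF cring_K] by (auto simp: emb_def group_ring_of_def ind_def fun_eq_iff)

lemma ind_mult: "h \<in> carrier G \<Longrightarrow> k \<in> carrier G \<Longrightarrow> ind {h} \<star> ind {k} = ind {h \<otimes> k}"
proof
  fix g assume h: "h \<in> carrier G" and k: "k \<in> carrier G"
  have k': "ind {k} \<in> fspace (embed K ` carrier K)" using k by (intro fspace_A_F fspace_ind) simp
  show "(ind {h} \<star> ind {k}) g = ind {h \<otimes> k} g"
  proof (cases "g \<in> carrier G")
    case True
    then have "inv h \<otimes> g = k \<longleftrightarrow> g = h \<otimes> k" using h k mult_inv_cancel by metis
    then show ?thesis unfolding ind_singleton_conv[OF h k'] by (simp add: translate_def ind_def True)
  qed (use h k in \<open>auto simp: conv_def ind_def\<close>)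
qed

lemma RG_one: "\<one>\<^bsub>RG\<^esub> = group_ring_of R G \<one>"
  by (simp add: group_ring_def)

lemma RG_one_closed: "\<one>\<^bsub>RG\<^esub> \<in> carrier RG"
  unfolding RG_one by (rule group_ring_of_carrier)

lemma emb_one: "emb \<one>\<^bsub>RG\<^esub> = ind {\<one>}"
  unfolding RG_one by (rule emb_group_ring_of) simp

lemma ind_one_conv: "x \<in> fspace A \<Longrightarrow> ind {\<one>} \<star> x = x"
  using ind_singleton_conv[OF one_closed fspace_A_F] 
  by (auto simp: translate_def fun_eq_iff fspace_def)

lemma RG_monoid: "Group.monoid RG"
proof (rule monoidI)
  show "\<one>\<^bsub>RG\<^esub> \<in> carrier RG" by (rule RG_one_closed)
  fix x assume x: "x \<in> carrier RG"
  show "\<one>\<^bsub>RG\<^esub> \<otimes>\<^bsub>RG\<^esub> x = x"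
    using emb_mult[OF RG_one_closed x] ind_one_conv[OF emb_fspace[OF x]]
    by (intro emb_inj RG_mult_closed RG_one_closed x) (simp only: emb_one)
  show "x \<otimes>\<^bsub>RG\<^esub> \<one>\<^bsub>RG\<^esub> = x"
    using emb_mult[OF x RG_one_closed] conv_ind_one[OF fspace_A_F[OF emb_fspace[OF x]]]
    by (intro emb_inj RG_mult_closed RG_one_closed x) (simp only: emb_one)
  fix y assume y: "y \<in> carrier RG"
  show "x \<otimes>\<^bsub>RG\<^esub> y \<in> carrier RG" by (rule RG_mult_closed[OF x y])
  fix z assume z: "z \<in> carrier RG"
  show "x \<otimes>\<^bsub>RG\<^esub> y \<otimes>\<^bsub>RG\<^esub> z = x \<otimes>\<^bsub>RG\<^esub> (y \<otimes>\<^bsub>RG\<^esub> z)"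
  proof (rule emb_inj)
    show "emb (x \<otimes>\<^bsub>RG\<^esub> y \<otimes>\<^bsub>RG\<^esub> z) = emb (x \<otimes>\<^bsub>RG\<^esub> (y \<otimes>\<^bsub>RG\<^esub> z))"
      by (simp only: emb_mult RG_mult_closed x y z conv_assoc)
  qed (intro RG_mult_closed x y z)+
qed

lemma augmentation_sum:
  assumes x: "x \<in> carrier RG"
  shows "augmentation R G x \<in> B" "embed K (augmentation R G x) = (\<Sum>g\<in>carrier G. emb x g)"
  using embed_sum[of K B "carrier G" x, OF cring_K subring_B finite_G RG_apply[OF x]]
  by (simp_all add: augmentation_def emb_def)

lemma augmentation_one_iff:
  assumes x: "x \<in> carrier RG"
  shows "augmentation R G x = \<one>\<^bsub>K\<^esub> \<longleftrightarrow> (\<Sum>g\<in>carrier G. emb x g) = embed K \<one>\<^bsub>K\<^esub>"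
  using embed_eq_iff[OF cring_K B_K[OF augmentation_sum(1)[OF x]] B_K[OF one_B]]
  by (simp add: augmentation_sum(2)[OF x])

lemma sum_ind_singleton: "h \<in> carrier G \<Longrightarrow> (\<Sum>g\<in>carrier G. ind {h} g) = embed K \<one>\<^bsub>K\<^esub>"
  using finite_G by (simp add: ind_def)

lemma V_carrier:
  "x \<in> carrier V \<longleftrightarrow> x \<in> Units RG \<and> (\<Sum>g\<in>carrier G. emb x g) = embed K \<one>\<^bsub>K\<^esub>"
  using augmentation_one_iff by (auto simp: normalized_units_def Units_def)

lemma V_RG: "x \<in> carrier V \<Longrightarrow> x \<in> carrier RG"
  by (auto simp: V_carrier Units_def)

lemma V_mult: "x \<otimes>\<^bsub>V\<^esub> y = x \<otimes>\<^bsub>RG\<^esub> y" and V_one: "\<one>\<^bsub>V\<^esub> = \<one>\<^bsub>RG\<^esub>"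
  by (simp_all add: normalized_units_def units_of_def)

lemma V_group: "group V"
proof -
  interpret RG: Group.monoid RG by (rule RG_monoid)
  interpret U: group "units_of RG" by (rule RG.units_group)
  have e: "embed K \<one>\<^bsub>K\<^esub> * embed K \<one>\<^bsub>K\<^esub> = embed K \<one>\<^bsub>K\<^esub>"
    using F_mult_unit F_unit(1) by blast
  have "subgroup (carrier V) (units_of RG)"
  proof (rule U.subgroupI)
    show "carrier V \<subseteq> carrier (units_of RG)" using V_carrier by (auto simp: units_of_carrier)
    have one: "\<one>\<^bsub>RG\<^esub> \<in> carrier V"
      unfolding V_carrier emb_one using sum_ind_singleton[OF one_closed] RG.Units_one_closed by blast
    then show "carrier V \<noteq> {}" by blast
    fix x assume x: "x \<in> carrier V"
    have xU: "x \<in> Units RG" "x \<in> carrier RG" and sx: "(\<Sum>g\<in>carrier G. emb x g) = embed K \<one>\<^bsub>K\<^esub>"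
      using x V_carrier V_RG by blast+
    define y where "y = inv\<^bsub>RG\<^esub> x"
    have yU: "y \<in> Units RG" "y \<in> carrier RG" using xU(1) by (simp_all add: y_def)
    have "emb y \<in> fspace (embed K ` carrier K)" by (rule fspace_A_F[OF emb_fspace[OF yU(2)]])
    then have sF: "(\<Sum>g\<in>carrier G. emb y g) \<in> embed K ` carrier K" by (intro F_sum) (rule fspace_apply)
    have "x \<otimes>\<^bsub>RG\<^esub> y = \<one>\<^bsub>RG\<^esub>" using xU(1) by (simp add: y_def)
    then have "emb x \<star> emb y = ind {\<one>}" using emb_mult[OF xU(2) yU(2)] by (simp only: emb_one)
    then have "(\<Sum>g\<in>carrier G. emb x g) * (\<Sum>g\<in>carrier G. emb y g) = embed K \<one>\<^bsub>K\<^esub>"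
      using sum_ind_singleton[OF one_closed] by (simp only: sum_conv[symmetric])
    then have "(\<Sum>g\<in>carrier G. emb y g) = embed K \<one>\<^bsub>K\<^esub>"
      using F_unit_mult[OF sF] unfolding sx by simp
    then have "y \<in> carrier V" using yU(1) V_carrier by blast
    then show "inv\<^bsub>units_of RG\<^esub> x \<in> carrier V" using RG.units_of_inv[OF xU(1)] by (simp add: y_def)
    fix z assume z: "z \<in> carrier V"
    have "(\<Sum>g\<in>carrier G. emb (x \<otimes>\<^bsub>RG\<^esub> z) g) = embed K \<one>\<^bsub>K\<^esub>"
      unfolding emb_mult[OF xU(2) V_RG[OF z]] sum_conv sx using z e by (simp add: V_carrier)
    then have "x \<otimes>\<^bsub>RG\<^esub> z \<in> carrier V" using xU(1) z V_carrier RG.Units_m_closed by blast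
    then show "x \<otimes>\<^bsub>units_of RG\<^esub> z \<in> carrier V" by (simp add: units_of_def)
  qed
  then have "group ((units_of RG)\<lparr>carrier := carrier V\<rparr>)"
    using U.group_axioms by (rule subgroup.subgroup_is_group)
  then show ?thesis by (simp add: normalized_units_def)
qed

lemma group_ring_of_V:
  assumes h: "h \<in> carrier G"
  shows "group_ring_of R G h \<in> carrier V"
proof -
  have "group_ring_of R G h \<otimes>\<^bsub>RG\<^esub> group_ring_of R G k = \<one>\<^bsub>RG\<^esub>"
    if "h \<in> carrier G" "k \<in> carrier G" "h \<otimes> k = \<one>" for h k
  proof (rule emb_inj[OF RG_mult_closed RG_one_closed])
    show "emb (group_ring_of R G h \<otimes>\<^bsub>RG\<^esub> group_ring_of R G k) = emb \<one>\<^bsub>RG\<^esub>"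
      using emb_mult[OF group_ring_of_carrier group_ring_of_carrier] emb_group_ring_of ind_mult that
      by (simp add: emb_one)
  qed (rule group_ring_of_carrier)+
  then have "group_ring_of R G h \<in> Units RG"
    using h group_ring_of_carrier unfolding Units_def
    by (intro CollectI conjI bexI[of _ "group_ring_of R G (inv h)"]) simp_all
  then show ?thesis unfolding V_carrier emb_group_ring_of[OF h] using sum_ind_singleton[OF h] by blast
qed

lemma emb_pow:
  assumes u: "u \<in> carrier V"
  shows "emb (u [^]\<^bsub>V\<^esub> (n::nat)) = ((\<lambda>y. emb u \<star> y) ^^ n) (ind {\<one>})"
proof -
  interpret V: group V by (rule V_group)
  show ?thesis
  proof (induction n)
    case 0
    show ?case using emb_one V_one by simp
  next
    case (Suc n)
    have "u [^]\<^bsub>V\<^esub> Suc n = u \<otimes>\<^bsub>RG\<^esub> u [^]\<^bsub>V\<^esub> n"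
      using V.nat_pow_Suc2[OF u] by (simp only: V_mult)
    then have "emb (u [^]\<^bsub>V\<^esub> Suc n) = emb u \<star> emb (u [^]\<^bsub>V\<^esub> n)"
      using emb_mult[OF V_RG[OF u] V_RG[OF V.nat_pow_closed[OF u]]] by simp
    then show ?case using Suc by simp
  qed
qed

text \<open>The group elements themselves belong to \<open>V\<close>, so commuting with
  \<open>V\<close> already gives invariance under conjugation.\<close>

lemma central_class_function:
  assumes u: "u \<in> center V"
  shows "class_function (emb u)"
proof (rule class_functionI)
  have uV: "u \<in> carrier V" using u by (simp add: center_def centralizer_def)
  show "emb u \<in> fspace (embed K ` carrier K)" by (rule fspace_A_F[OF emb_fspace[OF V_RG[OF uV]]])
  fix h assume h: "h \<in> carrier G"
  have "u \<otimes>\<^bsub>V\<^esub> group_ring_of R G h = group_ring_of R G h \<otimes>\<^bsub>V\<^esub> u"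
    using u group_ring_of_V[OF h] by (simp add: center_def centralizer_def)
  then have "emb (u \<otimes>\<^bsub>RG\<^esub> group_ring_of R G h) = emb (group_ring_of R G h \<otimes>\<^bsub>RG\<^esub> u)"
    by (simp only: V_mult)
  then show "emb u \<star> ind {h} = ind {h} \<star> emb u"
    by (simp only: emb_mult V_RG[OF uV] group_ring_of_carrier emb_group_ring_of[OF h])
qed

lemma class_function_ind_singleton:
  assumes n: "n \<in> carrier G" and c: "class_function (ind {n})"
  shows "n \<in> center G"
proof -
  have "h \<otimes> n = n \<otimes> h" if h: "h \<in> carrier G" for h
  proof -
    have "ind {n} (h \<otimes> n \<otimes> inv h) = embed K \<one>\<^bsub>K\<^esub>"
      using class_functionD[OF c h n] by (simp add: ind_def)
    then have "h \<otimes> n \<otimes> inv h = n" using F_unit(2) by (auto simp: ind_def split: if_splits)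
    then show ?thesis using h n by (metis inv_solve_right' m_closed)
  qed
  then show ?thesis using n by (simp add: center_def centralizer_def)
qed

end

theorem mainTheorem3:
  fixes p :: nat
    and R :: "'r ring"
    and G :: "('g, 'm) monoid_scheme"
    and N :: "'g set"
    and u :: "'g \<Rightarrow> 'r"
  assumes "Factorial_Ring.prime p"
    and "p_adic_ring p R"
    and "group G"
    and "finite (carrier G)"
    and "N \<lhd> G"
    and "\<exists>n. card N = p ^ n"
    and "centralizer G N \<subseteq> N"
    and "u \<in> center (normalized_units R G)"
    and "\<exists>k. group.ord (normalized_units R G) u = p ^ k"
  shows "u \<in> group_ring_of R G ` center G"
proof -
  obtain K :: "'r ring" and h where K: "field K" and h: "h \<in> ring_hom (padic_field p) K"
    and R: "R = K\<lparr>carrier := integral_closure K (h ` padic_integers p)\<rparr>"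
    using assms(2) unfolding p_adic_ring_def by blast
  obtain g where g: "g \<in> ring_hom (padic_Cauchy_ring p) K"
    "h ` padic_integers p = g ` integral_sequences p"
    using padic_integers_lift[OF assms(1) h] by blast
  define B where "B = integral_closure K (g ` integral_sequences p)"
  have R: "R = K\<lparr>carrier := B\<rparr>" using R g(2) by (simp add: B_def)
  have subring: "subring B K"
    unfolding B_def by (rule integral_closure_subring[OF assms(1) K g(1)])
  obtain A where A: "padic_valuation_ring (embed K ` carrier K) (embed K \<one>\<^bsub>K\<^esub>) A p"
    and BA: "\<And>x. x \<in> B \<Longrightarrow> embed K x \<in> A"
    using exists_padic_valuation_ring[OF assms(1) K g(1)] unfolding B_def by blast
  obtain a where a: "card N = p ^ a" using assms(6) by blast
  obtain k where k: "group.ord (normalized_units R G) u = p ^ k" using assms(9) by blast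
  interpret K: field K by (rule K)
  interpret A: padic_valuation_ring "embed K ` carrier K" "embed K \<one>\<^bsub>K\<^esub>" A p by (rule A)
  interpret G: group G by (rule assms(3))
  interpret N: normal N G by (rule assms(5))
  have C: "x \<in> N" if "x \<in> carrier G" "\<And>n. n \<in> N \<Longrightarrow> x \<otimes>\<^bsub>G\<^esub> n = n \<otimes>\<^bsub>G\<^esub> x" for x
    using assms(7) that by (auto simp: centralizer_def)
  interpret p_constrained "embed K ` carrier K" "embed K \<one>\<^bsub>K\<^esub>" A p G N a
    by unfold_locales (use assms(4,5) a C in auto)
  interpret E: embedded_group_ring K A p G B
    by (intro embedded_group_ring.intro embedded_group_ring_axioms.intro group_functions_axioms
        K.is_cring subring BA)
  interpret V: group E.V by (rule E.V_group)
  have u: "u \<in> center E.V" using assms(8) by (simp add: R)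
  then have uV: "u \<in> carrier E.V" by (simp add: center_def centralizer_def)
  have "u [^]\<^bsub>E.V\<^esub> (p ^ k) = \<one>\<^bsub>E.V\<^esub>" using V.pow_ord_eq_1[OF uV] k by (simp add: R)
  then have "((\<lambda>y. E.emb u \<star> y) ^^ (p ^ k)) (ind {\<one>\<^bsub>G\<^esub>}) = ind {\<one>\<^bsub>G\<^esub>}"
    using E.emb_pow[OF uV, of "p ^ k"] E.emb_one by (simp add: E.V_one)
  moreover have "(\<Sum>g\<in>carrier G. E.emb u g) = embed K \<one>\<^bsub>K\<^esub>" using uV E.V_carrier by blast
  ultimately obtain n where n: "n \<in> N" "E.emb u = ind {n}"
    using torsion_class_function[OF E.central_class_function[OF u] E.emb_fspace[OF E.V_RG[OF uV]]]
    by blast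
  have nG: "n \<in> carrier G" using n(1) by simp
  have "u = group_ring_of R G n"
    unfolding R using n(2) E.emb_group_ring_of[OF nG]
    by (intro E.emb_inj E.V_RG uV E.group_ring_of_carrier) simp
  moreover have "n \<in> center G"
    using E.class_function_ind_singleton[OF nG] E.central_class_function[OF u] unfolding n(2) by blast
  ultimately show ?thesis by blast
qed

end
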